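(* Let $\Phi:X\to Z$ be a nonconstant holomorphic map of compact connected Riemann surfaces. Let $L'_*$ be a parabolic line bundle on $Z$ of parabolic degree zero, let $L_*\cong\Phi^*L'_*$ be a parabolic line bundle on $(X,D)$, and let $\phi$ be an $L_*$-valued parabolic symplectic (respectively, parabolic orthogonal) structure on a parabolic vector bundle $E_*$ on $(X,D)$. Then the homomorphism $\Phi_*\widehat\phi:\Phi_*E_*\to\Phi_*(E_*^* )\otimes L'_*=(\Phi_*E_* )^*\otimes L'_*$ induced by $\widehat\phi:E_*\to E_*^*\otimes L_*$ gives an $L'_*$-valued parabolic symplectic (respectively, parabolic orthogonal) structure on the parabolic vector bundle $\Phi_*E_*$.
   Context: **Parabolic bundles.** $X$ is a compact connected Riemann surface, $D=\{x_1,\dots,x_\ell\}\subset X$ a finite subset. A parabolic vector bundle $E_*$ on $(X,D)$ is a holomorphic vector bundle $E$ on $X$ with, for each $i$, a filtration $E_{x_i}=E_i^1\supsetneq\cdots\supsetneq E_i^{n_i}\supsetneq E_i^{n_i+1}=0$ and weights $0\le\alpha_{i,1}<\cdots<\alpha_{i,n_i}<1$. Parabolic degree: $\deg E+\sum_{i,j}\alpha_{i,j}\dim(E_i^j/E_i^{j+1})$. Equivalently: for $x=x_i$ with local coordinate $z$ and $t\in[0,1)$, $E_{x,t}$ is the module of germs $s$ of sections of $E$ at $x$ with $s(x)\in E_i^j$, $j$ the smallest index with $\alpha_{i,j}\ge t$ ($j=n_i+1$ if none); $E_{x,t+1}=zE_{x,t}$ for all $t\in\mathbb R$; for $x\notin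 D$, $E_{x,t}=z^{\lceil t\rceil}E_{x,0}$ with $E_{x,0}$ the germs of $E$. The $t=0$ terms recover $E$ and the jumps recover the weights. Homomorphisms are bundle maps with $E_{x,t}\to E'_{x,t}$. $(E_*\otimes E'_* )_{x,t}=\sum_{a+b=t}E_{x,a}\otimes E'_{x,b}$; $(E_*^* )_{x,t}$ consists of germs of meromorphic functionals (poles only at $x$) mapping $E_{x,a}$ to $z^{\lceil a+t\rceil}\mathcal O_{X,x}$ for all $a$. **Structures.** For $L_*$ a parabolic line bundle of parabolic degree $0$, a homomorphism $\phi:E_*\otimes E_*\to L_*$ is an $L_*$-valued parabolic orthogonal (respectively, symplectic) structure on $E_*$ if $\phi|_{X\setminus D}$ is symmetric (respectively, anti-symmetric) and $\widehat\phi:E_*\to E_*^*\otimes L_*$, $u\mapsto\phi(u\otimes\cdot)$, is an isomorphism of parabolic vector bundles. An isomorphism $E_*\to E_*^*\otimes L_*$ "gives" the pairing $\phi$ for which it equals $\widehat\phi$. **Pullback of a line bundle.** $\Phi^*L'_*$ restricts to the usual pullback away from the parabolic points, and near $x$ with local coordinate $w$ and multiplicity $m_x$, $(\Phi^*L'_* )_{x,s}$ is generated by $w^k\Phi^*u$ with $u\in L'_{\Phi(x),t}$, $k\in\mathbb Z$, $t\in\mathbb R$, $m_xt+k\ge s$. **Direct image.** Let $R$ be the ramification locus of $\Phi$ (not assumed disjoint from $D$), $\Delta=\Phi(R\cup D)$, $m_x$ the multiplicity of $\Phi$ at $x$. $\Phi_*E_*$ is the parabolic bundle on $(Z,\Delta)$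 with underlying bundle $\Phi_*E$ and $(\Phi_*E_* )_{z,t}=\bigoplus_{x\in\Phi^{-1}(z)}E_{x,m_xt}$ for $z\in\Delta$. The trace pairing gives an identification $\Phi_*(E_*^* )=(\Phi_*E_* )^*$, and the projection formula gives $\Phi_*(E_*^*\otimes L_* )=\Phi_*(E_*^* )\otimes L'_*$. *)

theory Defs
  imports "HOL-Complex_Analysis.Complex_Analysis"
begin

text \<open>
  A Riemann surface is a Hausdorff space (all of the type \<open>'x\<close>) with a holomorphic atlas.
  A vector bundle is encoded by its sheaf of holomorphic sections.  Every fibre is a linear
  subspace of a function space \<open>'i \<Rightarrow> complex\<close> with \<open>'i\<close> arbitrary (no restriction: any vector
  space embeds into such a space).  Then \<open>V \<otimes> W\<close> is a subspace of \<open>'i \<times> 'j \<Rightarrow> complex\<close>, and the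
  dual of \<open>V\<close> a subspace of \<open>('i \<Rightarrow> complex) \<Rightarrow> complex\<close>.

  Germs are represented by total functions; an equality of germs is an eventual equality:
  along \<open>nhds x\<close> for holomorphic sections at a non-parabolic point, along \<open>at x\<close>
  (a punctured neighbourhood) whenever a pole at \<open>x\<close> is allowed or \<open>x\<close> is a parabolic point.
\<close>

section \<open>Riemann surfaces\<close>

type_synonym 'x atlas = "('x set \<times> ('x \<Rightarrow> complex)) set"

definition riemann_surface :: "'x::t2_space atlas \<Rightarrow> bool" where
  "riemann_surface A \<longleftrightarrow>
     connected (UNIV :: 'x set) \<and>
     (\<Union>(U, \<kappa>)\<in>A. U) = UNIV \<and>
     (\<forall>(U, \<kappa>)\<in>A. open U \<and> open (\<kappa> ` U) \<and> homeomorphism U (\<kappa> ` U) \<kappa> (inv_into U \<kappa>)) \<and>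
     (\<forall>(U, \<kappa>)\<in>A. \<forall>(V, \<mu>)\<in>A. (\<mu> \<circ> inv_into U \<kappa>) holomorphic_on \<kappa> ` (U \<inter> V))"

definition compact_riemann_surface :: "'x::t2_space atlas \<Rightarrow> bool" where
  "compact_riemann_surface A \<longleftrightarrow> riemann_surface A \<and> compact (UNIV :: 'x set)"

definition hol_map :: "'x::t2_space atlas \<Rightarrow> 'z::t2_space atlas \<Rightarrow> ('x \<Rightarrow> 'z) \<Rightarrow> bool" where
  "hol_map A B \<Phi> \<longleftrightarrow> continuous_on UNIV \<Phi> \<and>
     (\<forall>(U, \<kappa>)\<in>A. \<forall>(V, \<mu>)\<in>B. (\<mu> \<circ> \<Phi> \<circ> inv_into U \<kappa>) holomorphic_on \<kappa> ` (U \<inter> \<Phi> -` V))"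

definition hol_at :: "'x::t2_space atlas \<Rightarrow> 'x \<Rightarrow> ('x \<Rightarrow> complex) \<Rightarrow> bool" where
  "hol_at A x f \<longleftrightarrow> (\<exists>W. open W \<and> x \<in> W \<and>
     (\<forall>(U, \<kappa>)\<in>A. (f \<circ> inv_into U \<kappa>) holomorphic_on \<kappa> ` (U \<inter> W)))"

definition chart_at :: "'x atlas \<Rightarrow> 'x \<Rightarrow> 'x set \<times> ('x \<Rightarrow> complex)" where
  "chart_at A x = (SOME c. c \<in> A \<and> x \<in> fst c)"

text \<open>A local coordinate centred at \<open>x\<close>; nothing below depends on the choice of the chart.\<close>

definition coord :: "'x atlas \<Rightarrow> 'x \<Rightarrow> 'x \<Rightarrow> complex" where
  "coord A x y = snd (chart_at A x) y - snd (chart_at A x) x"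

text \<open>\<open>zO A x n\<close> is the module generated by the \<open>n\<close>-th power of the coordinate at \<open>x\<close> over
  the ring of germs of holomorphic functions, for an arbitrary integer \<open>n\<close>.\<close>

definition zO :: "'x::t2_space atlas \<Rightarrow> 'x \<Rightarrow> int \<Rightarrow> ('x \<Rightarrow> complex) set" where
  "zO A x n = {f. \<exists>g. hol_at A x g \<and> (\<forall>\<^sub>F y in at x. f y = coord A x y powi n * g y)}"

definition mult :: "'x::t2_space atlas \<Rightarrow> 'z::t2_space atlas \<Rightarrow> ('x \<Rightarrow> 'z) \<Rightarrow> 'x \<Rightarrow> nat" where
  "mult A B \<Phi> x = (case chart_at A x of (U, \<kappa>) \<Rightarrow>
     nat (zorder (\<lambda>w. coord B (\<Phi> x) (\<Phi> (inv_into U \<kappa> w))) (\<kappa> x)))"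

definition ramification :: "'x::t2_space atlas \<Rightarrow> 'z::t2_space atlas \<Rightarrow> ('x \<Rightarrow> 'z) \<Rightarrow> 'x set" where
  "ramification A B \<Phi> = {x. mult A B \<Phi> x > 1}"


section \<open>Linear algebra in function spaces\<close>

definition lincomb :: "nat \<Rightarrow> (nat \<Rightarrow> complex) \<Rightarrow> (nat \<Rightarrow> 'i \<Rightarrow> complex) \<Rightarrow> 'i \<Rightarrow> complex" where
  "lincomb n c v = (\<lambda>i. \<Sum>k<n. c k * v k i)"

definition is_basis :: "nat \<Rightarrow> (nat \<Rightarrow> 'i \<Rightarrow> complex) \<Rightarrow> ('i \<Rightarrow> complex) set \<Rightarrow> bool" where
  "is_basis r e V \<longleftrightarrow> V = range (\<lambda>c. lincomb r c e) \<and>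
     (\<forall>c. lincomb r c e = (\<lambda>_. 0) \<longrightarrow> (\<forall>k<r. c k = 0))"

definition linear_to ::
    "('i \<Rightarrow> complex) set \<Rightarrow> ('j \<Rightarrow> complex) set \<Rightarrow> (('i \<Rightarrow> complex) \<Rightarrow> 'j \<Rightarrow> complex) \<Rightarrow> bool" where
  "linear_to V W h \<longleftrightarrow> (\<forall>v\<in>V. h v \<in> W) \<and>
     (\<forall>u\<in>V. \<forall>v\<in>V. \<forall>a b. h (\<lambda>i. a * u i + b * v i) = (\<lambda>j. a * h u j + b * h v j))"

definition dual_space :: "('i \<Rightarrow> complex) set \<Rightarrow> (('i \<Rightarrow> complex) \<Rightarrow> complex) set" where
  "dual_space V = {\<xi>. (\<forall>u\<in>V. \<forall>v\<in>V. \<forall>a b. \<xi> (\<lambda>i. a * u i + b * v i) = a * \<xi> u + b * \<xi> v) \<and>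
     (\<forall>v. v \<notin> V \<longrightarrow> \<xi> v = 0)}"

definition tens :: "('i \<Rightarrow> complex) \<Rightarrow> ('j \<Rightarrow> complex) \<Rightarrow> 'i \<times> 'j \<Rightarrow> complex" where
  "tens u v = (\<lambda>(i, j). u i * v j)"


section \<open>Parabolic bundles\<close>

text \<open>
  \<open>ppts\<close> is the finite set of parabolic points.  For \<open>x\<close> outside \<open>ppts\<close>, \<open>fibre x\<close> is the fibre
  and \<open>stalk x\<close> the module of sections holomorphic at \<open>x\<close>.  For \<open>x\<close> in \<open>ppts\<close>, \<open>lattice x t\<close> is
  the module \<open>E\<^bsub>x,t\<^esub>\<close>; its elements are sections over a punctured neighbourhood of \<open>x\<close>.  The
  underlying bundle near \<open>x\<close> is given by \<open>lattice x 0\<close>.  The values of \<open>fibre\<close> and \<open>stalk\<close> at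
  parabolic points, and those of \<open>lattice\<close> at all other points, are irrelevant.
\<close>

record ('x, 'i) par_bundle =
  ppts :: "'x set"
  fibre :: "'x \<Rightarrow> ('i \<Rightarrow> complex) set"
  stalk :: "'x \<Rightarrow> ('x \<Rightarrow> 'i \<Rightarrow> complex) set"
  lattice :: "'x \<Rightarrow> real \<Rightarrow> ('x \<Rightarrow> 'i \<Rightarrow> complex) set"

definition zmul ::
    "'x::t2_space atlas \<Rightarrow> 'x \<Rightarrow> int \<Rightarrow> ('x \<Rightarrow> 'i \<Rightarrow> complex) set \<Rightarrow> ('x \<Rightarrow> 'i \<Rightarrow> complex) set" where
  "zmul A x n S = {s. \<exists>s'\<in>S. \<forall>\<^sub>F y in at x. s y = (\<lambda>i. coord A x y powi n * s' y i)}"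

text \<open>The modules \<open>E\<^bsub>x,t\<^esub>\<close> for all \<open>x\<close>; outside the parabolic points, \<open>E\<^bsub>x,t\<^esub> = z\<^sup>n E\<^bsub>x,0\<^esub>\<close>
  with \<open>n = \<lceil>t\<rceil>\<close>.\<close>

definition germs ::
    "'x::t2_space atlas \<Rightarrow> ('x, 'i) par_bundle \<Rightarrow> 'x \<Rightarrow> real \<Rightarrow> ('x \<Rightarrow> 'i \<Rightarrow> complex) set" where
  "germs A E x t = (if x \<in> ppts E then lattice E x t else zmul A x \<lceil>t\<rceil> (stalk E x))"

definition local_frame ::
    "'x::t2_space atlas \<Rightarrow> ('x, 'i) par_bundle \<Rightarrow> nat \<Rightarrow> 'x set \<Rightarrow> (nat \<Rightarrow> 'x \<Rightarrow> 'i \<Rightarrow> complex) \<Rightarrow> bool" where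
  "local_frame A E r U e \<longleftrightarrow> open U \<and>
     (\<forall>x\<in>U - ppts E. is_basis r (\<lambda>k. e k x) (fibre E x) \<and>
        stalk E x = {s. \<exists>f. (\<forall>k<r. hol_at A x (f k)) \<and>
          (\<forall>\<^sub>F y in nhds x. s y = lincomb r (\<lambda>k. f k y) (\<lambda>k. e k y))}) \<and>
     (\<forall>x\<in>U \<inter> ppts E.
        lattice E x 0 = {s. \<exists>f. (\<forall>k<r. hol_at A x (f k)) \<and>
          (\<forall>\<^sub>F y in at x. s y = lincomb r (\<lambda>k. f k y) (\<lambda>k. e k y))})"

text \<open>The value \<open>s(x)\<close>, as an element of the fibre \<open>E\<^bsub>x,0\<^esub> / z E\<^bsub>x,0\<^esub>\<close> of the underlying
  bundle at a parabolic point \<open>x\<close>.\<close>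

definition val_at ::
    "'x::t2_space atlas \<Rightarrow> ('x, 'i) par_bundle \<Rightarrow> 'x \<Rightarrow> ('x \<Rightarrow> 'i \<Rightarrow> complex) \<Rightarrow> ('x \<Rightarrow> 'i \<Rightarrow> complex) set" where
  "val_at A E x s =
     {s' \<in> lattice E x 0. (\<lambda>y i. s' y i - s y i) \<in> zmul A x 1 (lattice E x 0)}"

definition fibre_subspace ::
    "'x::t2_space atlas \<Rightarrow> ('x, 'i) par_bundle \<Rightarrow> 'x \<Rightarrow> ('x \<Rightarrow> 'i \<Rightarrow> complex) set set \<Rightarrow> bool" where
  "fibre_subspace A E x F \<longleftrightarrow>
     F \<subseteq> val_at A E x ` lattice E x 0 \<and>
     val_at A E x (\<lambda>_ _. 0) \<in> F \<and>
     (\<forall>s\<in>lattice E x 0. \<forall>s'\<in>lattice E x 0. \<forall>a b.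
        val_at A E x s \<in> F \<longrightarrow> val_at A E x s' \<in> F \<longrightarrow>
        val_at A E x (\<lambda>y i. a * s y i + b * s' y i) \<in> F)"

definition flag_weights ::
    "'x::t2_space atlas \<Rightarrow> ('x, 'i) par_bundle \<Rightarrow> 'x \<Rightarrow> nat \<Rightarrow>
       (nat \<Rightarrow> ('x \<Rightarrow> 'i \<Rightarrow> complex) set set) \<Rightarrow> (nat \<Rightarrow> real) \<Rightarrow> bool" where
  "flag_weights A E x n F \<alpha> \<longleftrightarrow>
     F 1 = val_at A E x ` lattice E x 0 \<and>
     F (n + 1) = {val_at A E x (\<lambda>_ _. 0)} \<and>
     (\<forall>j\<in>{1..n + 1}. fibre_subspace A E x (F j)) \<and>
     (\<forall>j\<in>{1..n}. F (j + 1) \<subset> F j) \<and>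
     (\<forall>j\<in>{1..n}. 0 \<le> \<alpha> j \<and> \<alpha> j < 1) \<and>
     (\<forall>j\<in>{1..<n}. \<alpha> j < \<alpha> (j + 1)) \<and>
     (\<forall>t\<in>{0..<1}. lattice E x t =
        {s \<in> lattice E x 0. val_at A E x s \<in> F (LEAST j. 1 \<le> j \<and> (j = n + 1 \<or> t \<le> \<alpha> j))}) \<and>
     (\<forall>t. lattice E x (t + 1) = zmul A x 1 (lattice E x t))"

definition par_bundle_rank :: "'x::t2_space atlas \<Rightarrow> ('x, 'i) par_bundle \<Rightarrow> nat \<Rightarrow> bool" where
  "par_bundle_rank A E r \<longleftrightarrow> finite (ppts E) \<and>
     (\<forall>x. \<exists>U e. x \<in> U \<and> local_frame A E r U e) \<and>
     (\<forall>x\<in>ppts E. \<exists>n F \<alpha>. flag_weights A E x n F \<alpha>)"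

definition par_vector_bundle :: "'x::t2_space atlas \<Rightarrow> ('x, 'i) par_bundle \<Rightarrow> bool" where
  "par_vector_bundle A E \<longleftrightarrow> (\<exists>r. par_bundle_rank A E r)"

definition par_line_bundle :: "'x::t2_space atlas \<Rightarrow> ('x, 'i) par_bundle \<Rightarrow> bool" where
  "par_line_bundle A L \<longleftrightarrow> par_bundle_rank A L 1"

text \<open>The degree of a line bundle is that of the divisor \<open>n\<close> of any nonzero meromorphic section
  \<open>s\<close>.  At each parabolic point a line bundle has exactly one weight, with multiplicity one.\<close>

definition degree_line :: "'x::t2_space atlas \<Rightarrow> ('x, 'i) par_bundle \<Rightarrow> int" where
  "degree_line A L = (THE d. \<exists>s n.
     (\<forall>x. s \<in> zmul A x (n x) (germs A L x 0) - zmul A x (n x + 1) (germs A L x 0)) \<and>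
     d = (\<Sum>x | n x \<noteq> 0. n x))"

definition weight_line :: "'x::t2_space atlas \<Rightarrow> ('x, 'i) par_bundle \<Rightarrow> 'x \<Rightarrow> real" where
  "weight_line A L x = (THE a. \<exists>F. flag_weights A L x 1 F (\<lambda>_. a))"

definition par_degree_line :: "'x::t2_space atlas \<Rightarrow> ('x, 'i) par_bundle \<Rightarrow> real" where
  "par_degree_line A L = of_int (degree_line A L) + (\<Sum>x\<in>ppts L. weight_line A L x)"

text \<open>
  A homomorphism is given on the fibres outside the parabolic points of both bundles; that it
  preserves the modules of germs at the remaining points says that it extends across them.
  (A bundle on \<open>(X,D)\<close> is one on \<open>(X,D')\<close> for every finite \<open>D'\<close> containing \<open>D\<close>, so that bundles
  with different sets of parabolic points may be compared.)
\<close>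

definition par_hom ::
    "'x::t2_space atlas \<Rightarrow> ('x, 'i) par_bundle \<Rightarrow> ('x, 'j) par_bundle \<Rightarrow>
       ('x \<Rightarrow> ('i \<Rightarrow> complex) \<Rightarrow> 'j \<Rightarrow> complex) \<Rightarrow> bool" where
  "par_hom A E E' h \<longleftrightarrow>
     (\<forall>x. x \<notin> ppts E \<union> ppts E' \<longrightarrow> linear_to (fibre E x) (fibre E' x) (h x) \<and>
        (\<forall>s\<in>stalk E x. (\<lambda>y. h y (s y)) \<in> stalk E' x)) \<and>
     (\<forall>x t. \<forall>s\<in>germs A E x t. (\<lambda>y. h y (s y)) \<in> germs A E' x t)"

definition par_iso ::
    "'x::t2_space atlas \<Rightarrow> ('x, 'i) par_bundle \<Rightarrow> ('x, 'j) par_bundle \<Rightarrow>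
       ('x \<Rightarrow> ('i \<Rightarrow> complex) \<Rightarrow> 'j \<Rightarrow> complex) \<Rightarrow> bool" where
  "par_iso A E E' h \<longleftrightarrow> par_hom A E E' h \<and>
     (\<exists>g. par_hom A E' E g \<and>
        (\<forall>x. x \<notin> ppts E \<union> ppts E' \<longrightarrow>
           (\<forall>v\<in>fibre E x. g x (h x v) = v) \<and> (\<forall>w\<in>fibre E' x. h x (g x w) = w)))"


section \<open>Tensor product and dual\<close>

definition par_tensor ::
    "'x::t2_space atlas \<Rightarrow> ('x, 'i) par_bundle \<Rightarrow> ('x, 'j) par_bundle \<Rightarrow> ('x, 'i \<times> 'j) par_bundle" where
  "par_tensor A E E' = \<lparr>
     ppts = ppts E \<union> ppts E',
     fibre = (\<lambda>x. {w. \<exists>n u v. (\<forall>k<n. u k \<in> fibre E x \<and> v k \<in> fibre E' x) \<and>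
        w = (\<lambda>p. \<Sum>k<(n::nat). tens (u k) (v k) p)}),
     stalk = (\<lambda>x. {s. \<exists>n u v. (\<forall>k<n. u k \<in> stalk E x \<and> v k \<in> stalk E' x) \<and>
        (\<forall>\<^sub>F y in nhds x. s y = (\<lambda>p. \<Sum>k<(n::nat). tens (u k y) (v k y) p))}),
     lattice = (\<lambda>x t. {s. \<exists>n u v a b.
        (\<forall>k<n. a k + b k = t \<and> u k \<in> germs A E x (a k) \<and> v k \<in> germs A E' x (b k)) \<and>
        (\<forall>\<^sub>F y in at x. s y = (\<lambda>p. \<Sum>k<(n::nat). tens (u k y) (v k y) p))}) \<rparr>"

definition dual_stalk ::
    "'x::t2_space atlas \<Rightarrow> ('x, 'i) par_bundle \<Rightarrow> 'x \<Rightarrow> ('x \<Rightarrow> ('i \<Rightarrow> complex) \<Rightarrow> complex) set" where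
  "dual_stalk A E x = {\<xi>. (\<forall>\<^sub>F y in nhds x. \<xi> y \<in> dual_space (fibre E y)) \<and>
     (\<forall>s\<in>stalk E x. hol_at A x (\<lambda>y. \<xi> y (s y)))}"

definition par_dual ::
    "'x::t2_space atlas \<Rightarrow> ('x, 'i) par_bundle \<Rightarrow> ('x, 'i \<Rightarrow> complex) par_bundle" where
  "par_dual A E = \<lparr>
     ppts = ppts E,
     fibre = (\<lambda>x. dual_space (fibre E x)),
     stalk = dual_stalk A E,
     lattice = (\<lambda>x t. {\<xi>. (\<forall>\<^sub>F y in at x. \<xi> \<in> dual_stalk A E y) \<and>
        (\<forall>a. \<forall>s\<in>germs A E x a. (\<lambda>y. \<xi> y (s y)) \<in> zO A x \<lceil>a + t\<rceil>)}) \<rparr>"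


section \<open>Orthogonal and symplectic structures\<close>

text \<open>\<open>u \<mapsto> \<phi>(u \<otimes> \<cdot>)\<close>.  An element \<open>\<xi> \<otimes> l\<close> of the tensor product of the dual with \<open>L\<close> is the
  function \<open>(v, j) \<mapsto> \<xi> v * l j\<close>, so the identification of that tensor product with the linear
  maps from \<open>E\<close> to \<open>L\<close> is currying.\<close>

definition hat ::
    "('x, 'i) par_bundle \<Rightarrow> ('x \<Rightarrow> ('i \<times> 'i \<Rightarrow> complex) \<Rightarrow> 'l \<Rightarrow> complex) \<Rightarrow>
       'x \<Rightarrow> ('i \<Rightarrow> complex) \<Rightarrow> ('i \<Rightarrow> complex) \<times> 'l \<Rightarrow> complex" where
  "hat E \<phi> x u = (\<lambda>(v, j). if v \<in> fibre E x then \<phi> x (tens u v) j else 0)"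

definition par_orthogonal ::
    "'x::t2_space atlas \<Rightarrow> ('x, 'l) par_bundle \<Rightarrow> ('x, 'i) par_bundle \<Rightarrow>
       ('x \<Rightarrow> ('i \<times> 'i \<Rightarrow> complex) \<Rightarrow> 'l \<Rightarrow> complex) \<Rightarrow> bool" where
  "par_orthogonal A L E \<phi> \<longleftrightarrow>
     par_line_bundle A L \<and> par_degree_line A L = 0 \<and> par_vector_bundle A E \<and>
     par_hom A (par_tensor A E E) L \<phi> \<and>
     (\<forall>x. x \<notin> ppts E \<union> ppts L \<longrightarrow>
        (\<forall>u\<in>fibre E x. \<forall>v\<in>fibre E x. \<phi> x (tens u v) = \<phi> x (tens v u))) \<and>
     par_iso A E (par_tensor A (par_dual A E) L) (hat E \<phi>)"

definition par_symplectic ::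
    "'x::t2_space atlas \<Rightarrow> ('x, 'l) par_bundle \<Rightarrow> ('x, 'i) par_bundle \<Rightarrow>
       ('x \<Rightarrow> ('i \<times> 'i \<Rightarrow> complex) \<Rightarrow> 'l \<Rightarrow> complex) \<Rightarrow> bool" where
  "par_symplectic A L E \<phi> \<longleftrightarrow>
     par_line_bundle A L \<and> par_degree_line A L = 0 \<and> par_vector_bundle A E \<and>
     par_hom A (par_tensor A E E) L \<phi> \<and>
     (\<forall>x. x \<notin> ppts E \<union> ppts L \<longrightarrow>
        (\<forall>u\<in>fibre E x. \<forall>v\<in>fibre E x. \<phi> x (tens u v) = (\<lambda>j. - \<phi> x (tens v u) j))) \<and>
     par_iso A E (par_tensor A (par_dual A E) L) (hat E \<phi>)"

definition gives_pairing ::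
    "('x, 'l) par_bundle \<Rightarrow> ('x, 'i) par_bundle \<Rightarrow>
       ('x \<Rightarrow> ('i \<Rightarrow> complex) \<Rightarrow> ('i \<Rightarrow> complex) \<times> 'l \<Rightarrow> complex) \<Rightarrow>
       ('x \<Rightarrow> ('i \<times> 'i \<Rightarrow> complex) \<Rightarrow> 'l \<Rightarrow> complex) \<Rightarrow> bool" where
  "gives_pairing L E h \<phi> \<longleftrightarrow>
     (\<forall>x. x \<notin> ppts E \<union> ppts L \<longrightarrow> (\<forall>u\<in>fibre E x. h x u = hat E \<phi> x u))"


section \<open>Pullback and direct image\<close>

definition par_pullback ::
    "'x::t2_space atlas \<Rightarrow> 'z::t2_space atlas \<Rightarrow> ('x \<Rightarrow> 'z) \<Rightarrow> ('z, 'j) par_bundle \<Rightarrow> ('x, 'j) par_bundle" where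
  "par_pullback A B \<Phi> L = \<lparr>
     ppts = \<Phi> -` ppts L,
     fibre = (\<lambda>x. fibre L (\<Phi> x)),
     stalk = (\<lambda>x. {s. \<exists>n f u. (\<forall>q<n. hol_at A x (f q) \<and> u q \<in> stalk L (\<Phi> x)) \<and>
        (\<forall>\<^sub>F y in nhds x. s y = lincomb n (\<lambda>q. f q y) (\<lambda>q. u q (\<Phi> y)))}),
     lattice = (\<lambda>x t. {s. \<exists>n f u k a.
        (\<forall>q<n. hol_at A x (f q) \<and> u q \<in> germs B L (\<Phi> x) (a q) \<and>
           real (mult A B \<Phi> x) * a q + real_of_int (k q) \<ge> t) \<and>
        (\<forall>\<^sub>F y in at x. s y = lincomb n (\<lambda>q. f q y * coord A x y powi k q) (\<lambda>q. u q (\<Phi> y)))}) \<rparr>"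

text \<open>A section \<open>\<sigma>\<close> of \<open>E\<close> over the preimage of an open set corresponds to the section
  \<open>s\<close> of the direct image with \<open>s z (x, i) = \<sigma> x i\<close> if \<open>\<Phi> x = z\<close>, and \<open>0\<close> otherwise.  Outside the
  parabolic points of the direct image, \<open>\<Phi>\<close> is unramified, and the fibre is the
  direct sum of the fibres of \<open>E\<close> over the preimages.\<close>

definition direct_sum_fibre ::
    "('x \<Rightarrow> 'z) \<Rightarrow> ('x, 'i) par_bundle \<Rightarrow> 'z \<Rightarrow> ('x \<times> 'i \<Rightarrow> complex) set" where
  "direct_sum_fibre \<Phi> E z = {v. \<forall>x. if \<Phi> x = z then (\<lambda>i. v (x, i)) \<in> fibre E x
                                     else (\<forall>i. v (x, i) = 0)}"

definition par_direct_image ::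
    "'x::t2_space atlas \<Rightarrow> 'z::t2_space atlas \<Rightarrow> ('x \<Rightarrow> 'z) \<Rightarrow> ('x, 'i) par_bundle \<Rightarrow>
       ('z, 'x \<times> 'i) par_bundle" where
  "par_direct_image A B \<Phi> E = \<lparr>
     ppts = \<Phi> ` (ramification A B \<Phi> \<union> ppts E),
     fibre = direct_sum_fibre \<Phi> E,
     stalk = (\<lambda>z. {s. (\<forall>\<^sub>F z' in nhds z. s z' \<in> direct_sum_fibre \<Phi> E z') \<and>
        (\<forall>x. \<Phi> x = z \<longrightarrow> (\<lambda>y i. s (\<Phi> y) (y, i)) \<in> stalk E x)}),
     lattice = (\<lambda>z t. {s. (\<forall>\<^sub>F z' in at z. s z' \<in> direct_sum_fibre \<Phi> E z') \<and>
        (\<forall>x. \<Phi> x = z \<longrightarrow>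
           (\<lambda>y i. s (\<Phi> y) (y, i)) \<in> germs A E x (real (mult A B \<Phi> x) * t))}) \<rparr>"

definition direct_image_hom ::
    "('x \<Rightarrow> 'z) \<Rightarrow> ('x \<Rightarrow> ('i \<Rightarrow> complex) \<Rightarrow> 'j \<Rightarrow> complex) \<Rightarrow>
       'z \<Rightarrow> ('x \<times> 'i \<Rightarrow> complex) \<Rightarrow> 'x \<times> 'j \<Rightarrow> complex" where
  "direct_image_hom \<Phi> h z v = (\<lambda>(x, j). if \<Phi> x = z then h x (\<lambda>i. v (x, i)) j else 0)"

text \<open>The projection formula \<open>\<Phi>\<^sub>*(F \<otimes> L) = \<Phi>\<^sub>*F \<otimes> L'\<close>, for an isomorphism \<open>\<iota>\<close> from \<open>L\<close> to
  \<open>\<Phi>\<^sup>*L'\<close>: over \<open>z\<close>, the element \<open>f \<otimes> l\<close> of the summand with index \<open>x\<close> goes to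
  \<open>f \<otimes> \<iota>\<^sub>x l\<close>, with \<open>f\<close> placed in the summand \<open>F\<^sub>x\<close> of the fibre of \<open>\<Phi>\<^sub>*F\<close>.\<close>

definition projection_formula ::
    "('x \<Rightarrow> 'z) \<Rightarrow> ('x \<Rightarrow> ('l \<Rightarrow> complex) \<Rightarrow> 'j \<Rightarrow> complex) \<Rightarrow>
       'z \<Rightarrow> ('x \<times> ('k \<times> 'l) \<Rightarrow> complex) \<Rightarrow> ('x \<times> 'k) \<times> 'j \<Rightarrow> complex" where
  "projection_formula \<Phi> \<iota> z \<tau> =
     (\<lambda>((x, k), j). if \<Phi> x = z then \<iota> x (\<lambda>l. \<tau> (x, (k, l))) j else 0)"

text \<open>The trace pairing \<open>\<Phi>\<^sub>*(E\<^sup>*) = (\<Phi>\<^sub>*E)\<^sup>*\<close>, \<open>\<xi> \<mapsto> (s \<mapsto> Tr (\<xi> s))\<close>; the trace of a function is the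
  sum of its values over the preimages.\<close>

definition trace_pairing ::
    "('x \<Rightarrow> 'z) \<Rightarrow> ('x, 'i) par_bundle \<Rightarrow>
       'z \<Rightarrow> ('x \<times> ('i \<Rightarrow> complex) \<Rightarrow> complex) \<Rightarrow> ('x \<times> 'i \<Rightarrow> complex) \<Rightarrow> complex" where
  "trace_pairing \<Phi> E z \<xi> =
     (\<lambda>v. if v \<in> direct_sum_fibre \<Phi> E z then \<Sum>x | \<Phi> x = z. \<xi> (x, \<lambda>i. v (x, i)) else 0)"

text \<open>\<open>h \<otimes> id\<close>, applied to a tensor one slice \<open>j\<close> at a time.\<close>

definition tensor_id ::
    "('z \<Rightarrow> ('i \<Rightarrow> complex) \<Rightarrow> 'k \<Rightarrow> complex) \<Rightarrow>
       'z \<Rightarrow> ('i \<times> 'j \<Rightarrow> complex) \<Rightarrow> 'k \<times> 'j \<Rightarrow> complex" where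
  "tensor_id h z \<tau> = (\<lambda>(k, j). h z (\<lambda>i. \<tau> (i, j)) k)"

text \<open>\<open>\<Phi>\<^sub>*E \<rightarrow> \<Phi>\<^sub>*(E\<^sup>* \<otimes> L) = \<Phi>\<^sub>*(E\<^sup>*) \<otimes> L' = (\<Phi>\<^sub>*E)\<^sup>* \<otimes> L'\<close>\<close>

definition induced_hom ::
    "('x \<Rightarrow> 'z) \<Rightarrow> ('x \<Rightarrow> ('l \<Rightarrow> complex) \<Rightarrow> 'j \<Rightarrow> complex) \<Rightarrow> ('x, 'i) par_bundle \<Rightarrow>
       ('x \<Rightarrow> ('i \<times> 'i \<Rightarrow> complex) \<Rightarrow> 'l \<Rightarrow> complex) \<Rightarrow>
       'z \<Rightarrow> ('x \<times> 'i \<Rightarrow> complex) \<Rightarrow> ('x \<times> 'i \<Rightarrow> complex) \<times> 'j \<Rightarrow> complex" where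
  "induced_hom \<Phi> \<iota> E \<phi> z u =
     tensor_id (trace_pairing \<Phi> E) z
       (projection_formula \<Phi> \<iota> z (direct_image_hom \<Phi> (hat E \<phi>) z u))"

end

theory Submission
  imports Defs
begin

text \<open>
  Over \<open>z\<close> the induced pairing is \<open>\<psi>(u \<otimes> v) = \<Sum> \<iota>\<^sub>y \<phi>\<^sub>y(u\<^sub>y \<otimes> v\<^sub>y)\<close>, the sum being over the preimages
  \<open>y\<close> of \<open>z\<close>.  Near a point \<open>x\<close> of multiplicity \<open>m\<close> the map is \<open>\<zeta> = \<omega>\<^sup>m\<close>, and the trace of
  \<open>\<omega>\<^sup>n\<close> vanishes unless \<open>m\<close> divides \<open>n\<close>; hence the trace of a function of order at least \<open>m t\<close> has
  order at least \<open>t\<close>, rounded up, so that \<open>\<psi>\<close> and \<open>\<psi>\<close> contracted with a section respect the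
  filtrations.  The inverse restricts a functional on the direct image to its summands, applies \<open>\<iota>\<close> and
  \<open>\<phi>\<close> backwards, and collects the results.  That the restriction \<open>f\<close> of a functional, evaluated on a
  section, has the right order follows by discrete Fourier inversion: \<open>m f = \<Sum> \<omega>\<^sup>-\<^sup>p Tr(\<omega>\<^sup>p f)\<close>
  over \<open>p < m\<close>, where \<open>f\<close> is extended by zero to the other sheets.
\<close>

section \<open>Holomorphic functions on a Riemann surface\<close>

text \<open>Rounding is the obstacle. The index t downstairs is m t upstairs, and m t rounded up is
  in general smaller than m times t rounded up. The trace survives this because only exponents
  divisible by m contribute. Fourier inversion survives it because a factor \<omega> to the power p
  raises the index downstairs by p / m and is removed again upstairs. For values in a line bundle,
  the weight \<alpha> of \<open>L'\<close> at \<open>z\<close> is the same for all preimages and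
  replaces t by t - \<alpha>, so the bounds for traces are real numbers.

  That the direct image is a parabolic bundle has to be shown as well. Its frames rest on writing a
  germ at a preimage as a combination of the powers of \<omega> below the m-th over germs
  downstairs; its flags are recovered from the filtration. The parabolic points of \<open>L'\<close>
  are unrelated to those of the direct image, so the argument works with the modules of germs at all
  points and all indices rather than with flags. One sign \<open>\<epsilon>\<close> serves both
  kinds of structure.\<close>

lemma hol_atD:
  assumes "hol_at A x f"
  shows "\<exists>W. open W \<and> x \<in> W \<and> (\<forall>U \<kappa>. (U, \<kappa>) \<in> A \<longrightarrow> (f \<circ> inv_into U \<kappa>) holomorphic_on \<kappa> ` (U \<inter> W))"
  using assms unfolding hol_at_def by fastforce

lemma hol_atI:
  assumes "open W" "x \<in> W" "\<And>U \<kappa>. (U, \<kappa>) \<in> A \<Longrightarrow> (f \<circ> inv_into U \<kappa>) holomorphic_on \<kappa> ` (U \<inter> W)"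
  shows "hol_at A x f"
  using assms unfolding hol_at_def by blast

locale riemann =
  fixes A :: "'x::t2_space atlas"
  assumes surface: "riemann_surface A"
begin

lemma atlasD:
  assumes "(U, \<kappa>) \<in> A"
  shows "open U" "open (\<kappa> ` U)" "homeomorphism U (\<kappa> ` U) \<kappa> (inv_into U \<kappa>)"
  using surface assms unfolding riemann_surface_def by auto

lemma transition_holomorphic:
  assumes "(U, \<kappa>) \<in> A" "(V, \<mu>) \<in> A"
  shows "(\<mu> \<circ> inv_into U \<kappa>) holomorphic_on \<kappa> ` (U \<inter> V)"
  using surface assms unfolding riemann_surface_def by fastforce

lemma chart_at: "chart_at A x \<in> A" "x \<in> fst (chart_at A x)"
proof -
  have "\<exists>c. c \<in> A \<and> x \<in> fst c"
    using surface unfolding riemann_surface_def by (auto simp: set_eq_iff) fastforce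
  then show "chart_at A x \<in> A" "x \<in> fst (chart_at A x)"
    unfolding chart_at_def by (metis (mono_tags, lifting) someI_ex)+
qed

end

text \<open>Any holomorphic coordinate onto a disc about 0 is allowed, not only
  \<open>coord A x\<close>, because the normal form of \<open>\<Phi>\<close> brings a coordinate of
  its own. The last conjunct replaces the atlas: near \<open>x\<close>, holomorphy can be tested in
  this single coordinate.\<close>

definition local_coord ::
    "'x::t2_space atlas \<Rightarrow> 'x \<Rightarrow> 'x set \<Rightarrow> real \<Rightarrow> ('x \<Rightarrow> complex) \<Rightarrow> (complex \<Rightarrow> 'x) \<Rightarrow> bool" where
  "local_coord A x W r \<omega> \<theta> \<longleftrightarrow> open W \<and> x \<in> W \<and> \<omega> x = 0 \<and> r > 0 \<and>
     homeomorphism W (ball 0 r) \<omega> \<theta> \<and>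
     (\<forall>y\<in>W. \<forall>f. hol_at A y f \<longleftrightarrow> (f \<circ> \<theta>) analytic_on {\<omega> y})"

text \<open>The local inverse of \<open>coord A x\<close>, shifted so that its centre is 0.\<close>

definition para :: "'x::t2_space atlas \<Rightarrow> 'x \<Rightarrow> complex \<Rightarrow> 'x" where
  "para A x u = inv_into (fst (chart_at A x)) (snd (chart_at A x)) (u + snd (chart_at A x) x)"

lemma homeomorphism_subset_open:
  assumes "homeomorphism W S f g" "open W" "T \<subseteq> S" "open T"
  shows "open {y\<in>W. f y \<in> T}" "homeomorphism {y\<in>W. f y \<in> T} T f g"
proof -
  have "open (W \<inter> f -` T)"
    using continuous_open_preimage[OF homeomorphism_cont1[OF assms(1)]] assms by simp
  moreover have eq: "W \<inter> f -` T = {y\<in>W. f y \<in> T}" by auto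
  ultimately show "open {y\<in>W. f y \<in> T}" by simp
  show "homeomorphism {y\<in>W. f y \<in> T} T f g"
  proof (rule homeomorphismI)
    show "continuous_on {y\<in>W. f y \<in> T} f"
      by (rule continuous_on_subset[OF homeomorphism_cont1[OF assms(1)]]) auto
    show "continuous_on T g"
      by (rule continuous_on_subset[OF homeomorphism_cont2[OF assms(1)] assms(3)])
    have "g u \<in> W" "f (g u) = u" if "u \<in> T" for u
      using assms(3) that homeomorphism_image2[OF assms(1)] homeomorphism_apply2[OF assms(1)] by auto
    then show "g ` T \<subseteq> {y\<in>W. f y \<in> T}" "\<And>u. u \<in> T \<Longrightarrow> f (g u) = u" by auto
    show "\<And>y. y \<in> {y\<in>W. f y \<in> T} \<Longrightarrow> g (f y) = y"
      using homeomorphism_apply1[OF assms(1)] by auto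
  qed auto
qed

lemma local_coord_restrict:
  assumes lc: "local_coord A x W r \<omega> \<theta>" and s: "0 < s" "s \<le> r"
  shows "local_coord A x {y\<in>W. \<omega> y \<in> ball 0 s} s \<omega> \<theta>"
proof -
  have h: "homeomorphism W (ball 0 r) \<omega> \<theta>" "open W"
    using lc unfolding local_coord_def by auto
  show ?thesis
    using homeomorphism_subset_open[OF h, of "ball 0 s"] s lc
    unfolding local_coord_def by (auto simp: subset_ball)
qed

text \<open>By continuity of \<open>\<theta>\<close> at 0, a small disc is mapped into
  \<open>Q\<close>. The domain is cut down to the preimage of that disc, so that its image in the
  plane remains a disc.\<close>

lemma local_coord_shrink:
  assumes lc: "local_coord A x W r \<omega> \<theta>" and Q: "open Q" "x \<in> Q"
  obtains W' s where "local_coord A x W' s \<omega> \<theta>" "W' \<subseteq> Q" "W' \<subseteq> W" "s \<le> r"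
proof -
  have h: "homeomorphism W (ball 0 r) \<omega> \<theta>" "open W" "x \<in> W" "\<omega> x = 0" "r > 0"
    using lc unfolding local_coord_def by auto
  then have "\<theta> 0 = x" using homeomorphism_apply1[OF h(1)] by metis
  have c: "continuous_on (ball 0 r) \<theta>" by (rule homeomorphism_cont2[OF h(1)])
  then have "open (ball 0 r \<inter> \<theta> -` Q)"
    using Q by (intro continuous_open_preimage) auto
  moreover have "0 \<in> ball 0 r \<inter> \<theta> -` Q" using h \<open>\<theta> 0 = x\<close> Q by auto
  ultimately obtain s where s: "s > 0" "ball 0 s \<subseteq> ball 0 r \<inter> \<theta> -` Q"
    by (meson open_contains_ball)
  have "s \<le> r" using s by (auto simp: ball_subset_ball_iff)
  have "{y\<in>W. \<omega> y \<in> ball 0 s} \<subseteq> Q"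
  proof
    fix y assume y: "y \<in> {y\<in>W. \<omega> y \<in> ball 0 s}"
    then have "\<theta> (\<omega> y) \<in> Q" using s by auto
    then show "y \<in> Q" using y homeomorphism_apply1[OF h(1)] by auto
  qed
  then show thesis
    using that[OF local_coord_restrict[OF lc s(1) \<open>s \<le> r\<close>]] \<open>s \<le> r\<close> by auto
qed

lemma eventually_nhds_homeomorphism:
  fixes f :: "'a::t2_space \<Rightarrow> 'b::t2_space"
  assumes h: "homeomorphism W S f g" "open W" "open S" and y: "y \<in> W"
  shows "(\<forall>\<^sub>F y' in nhds y. P y') \<longleftrightarrow> (\<forall>\<^sub>F u in nhds (f y). P (g u))"
proof
  have fy: "f y \<in> S" "g (f y) = y" using homeomorphism_image1[OF h(1)] homeomorphism_apply1[OF h(1)] y by auto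
  have "isCont g (f y)"
    using fy continuous_on_eq_continuous_at[OF h(3)] homeomorphism_cont2[OF h(1)] by blast
  then have "(g \<longlongrightarrow> y) (nhds (f y))"
    by (metis continuous_at tendsto_at_iff_tendsto_nhds fy(2))
  then show "\<forall>\<^sub>F u in nhds (f y). P (g u)" if "\<forall>\<^sub>F y' in nhds y. P y'"
    using that filterlim_iff by blast
  have "isCont f y"
    using y continuous_on_eq_continuous_at[OF h(2)] homeomorphism_cont1[OF h(1)] by blast
  then have *: "(f \<longlongrightarrow> f y) (nhds y)"
    by (metis continuous_at tendsto_at_iff_tendsto_nhds)
  show "\<forall>\<^sub>F y' in nhds y. P y'" if "\<forall>\<^sub>F u in nhds (f y). P (g u)"
  proof -
    have "\<forall>\<^sub>F y' in nhds y. P (g (f y'))"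
      using that * filterlim_iff by blast
    moreover have "\<forall>\<^sub>F y' in nhds y. y' \<in> W"
      using h y by (intro eventually_nhds_in_open) auto
    ultimately show ?thesis
      by eventually_elim (use homeomorphism_apply1[OF h(1)] in auto)
  qed
qed

text \<open>The puncture goes to the puncture: near \<open>f y\<close>, the equation
  \<open>g u = y\<close> holds only for \<open>u = f y\<close>.\<close>

lemma eventually_at_homeomorphism:
  fixes f :: "'a::t2_space \<Rightarrow> 'b::t2_space"
  assumes h: "homeomorphism W S f g" "open W" "open S" and y: "y \<in> W"
  shows "(\<forall>\<^sub>F y' in at y. P y') \<longleftrightarrow> (\<forall>\<^sub>F u in at (f y). P (g u))"
proof -
  have "\<forall>\<^sub>F u in nhds (f y). u \<in> S" 
    using h y homeomorphism_image1[OF h(1)] by (intro eventually_nhds_in_open) auto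
  then have *: "\<forall>\<^sub>F u in nhds (f y). (g u \<noteq> y) = (u \<noteq> f y)"
    by eventually_elim (use homeomorphism_apply1[OF h(1)] homeomorphism_apply2[OF h(1)] y in auto)
  have "(\<forall>\<^sub>F y' in at y. P y') \<longleftrightarrow> (\<forall>\<^sub>F u in nhds (f y). g u \<noteq> y \<longrightarrow> P (g u))"
    unfolding eventually_at_filter
    using eventually_nhds_homeomorphism[OF h y, of "\<lambda>y'. y' \<noteq> y \<longrightarrow> y' \<in> UNIV \<longrightarrow> P y'"] by simp
  also have "\<dots> \<longleftrightarrow> (\<forall>\<^sub>F u in at (f y). P (g u))"
    unfolding eventually_at_filter
    by (rule eventually_cong[OF *]) auto
  finally show ?thesis .
qed

lemma local_coordD:
  assumes "local_coord A x W r \<omega> \<theta>"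
  shows "open W" "x \<in> W" "\<omega> x = 0" "r > 0" "homeomorphism W (ball 0 r) \<omega> \<theta>" "\<theta> 0 = x"
    "\<And>y. y \<in> W \<Longrightarrow> \<theta> (\<omega> y) = y" "\<And>u. cmod u < r \<Longrightarrow> \<omega> (\<theta> u) = u"
    "\<And>u. cmod u < r \<Longrightarrow> \<theta> u \<in> W" "\<And>y. y \<in> W \<Longrightarrow> cmod (\<omega> y) < r" "inj_on \<omega> W"
proof -
  show 1: "open W" "x \<in> W" "\<omega> x = 0" "r > 0" "homeomorphism W (ball 0 r) \<omega> \<theta>"
    using assms unfolding local_coord_def by auto
  show 2: "\<And>y. y \<in> W \<Longrightarrow> \<theta> (\<omega> y) = y" "\<And>u. cmod u < r \<Longrightarrow> \<omega> (\<theta> u) = u"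
    "\<And>u. cmod u < r \<Longrightarrow> \<theta> u \<in> W" "\<And>y. y \<in> W \<Longrightarrow> cmod (\<omega> y) < r"
    using homeomorphism_image1[OF 1(5)] homeomorphism_image2[OF 1(5)]
      homeomorphism_apply1[OF 1(5)] homeomorphism_apply2[OF 1(5)] by auto
  show "inj_on \<omega> W" using 2(1) by (metis inj_onI)
  show "\<theta> 0 = x" using 1 2(1) by metis
qed

lemma local_coord_hol:
  assumes "local_coord A x W r \<omega> \<theta>" "y \<in> W"
  shows "hol_at A y f \<longleftrightarrow> (f \<circ> \<theta>) analytic_on {\<omega> y}"
  using assms unfolding local_coord_def by auto

lemma local_coord_eventually:
  assumes "local_coord A x W r \<omega> \<theta>" "y \<in> W"
  shows "(\<forall>\<^sub>F y' in nhds y. P y') \<longleftrightarrow> (\<forall>\<^sub>F u in nhds (\<omega> y). P (\<theta> u))"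
    "(\<forall>\<^sub>F y' in at y. P y') \<longleftrightarrow> (\<forall>\<^sub>F u in at (\<omega> y). P (\<theta> u))"
  using eventually_nhds_homeomorphism[of W "ball 0 r" \<omega> \<theta> y P]
    eventually_at_homeomorphism[of W "ball 0 r" \<omega> \<theta> y P] local_coordD[OF assms(1)] assms(2) by auto

context riemann
begin

text \<open>\<open>hol_at\<close> quantifies over all charts, whereas \<open>coord\<close> and
  \<open>para\<close> use the chosen one; the transition maps carry holomorphy from that chart to
  the others.\<close>

lemma coord_local_coord: "\<exists>W r. local_coord A x W r (coord A x) (para A x)"
proof -
  obtain U \<kappa> where c: "chart_at A x = (U, \<kappa>)" by fastforce
  have UA: "(U, \<kappa>) \<in> A" "x \<in> U" using chart_at[of x] c by auto
  note U = atlasD[OF UA(1)]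
  have coord: "coord A x = (\<lambda>y. \<kappa> y - \<kappa> x)" by (auto simp: coord_def c)
  have para: "para A x = (\<lambda>u. inv_into U \<kappa> (u + \<kappa> x))" by (auto simp: para_def c)
  obtain r where r: "r > 0" "ball (\<kappa> x) r \<subseteq> \<kappa> ` U"
    using U(2) UA(2) by (meson image_eqI open_contains_ball)
  define W where "W = {y\<in>U. \<kappa> y \<in> ball (\<kappa> x) r}"
  have W: "open W" and hW: "homeomorphism W (ball (\<kappa> x) r) \<kappa> (inv_into U \<kappa>)"
    unfolding W_def using homeomorphism_subset_open[OF U(3) U(1) r(2)] by auto
  have "homeomorphism W (ball 0 r) (coord A x) (para A x)"
  proof (rule homeomorphismI)
    show "continuous_on W (coord A x)" unfolding coord
      using homeomorphism_cont1[OF hW] by (intro continuous_intros)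
    show "continuous_on (ball 0 r) (para A x)" unfolding para
    proof (rule continuous_on_compose2[of "ball (\<kappa> x) r" "inv_into U \<kappa>"])
      show "(\<lambda>u. u + \<kappa> x) ` ball 0 r \<subseteq> ball (\<kappa> x) r"
        by (auto simp: dist_norm norm_minus_commute)
    qed (auto intro!: continuous_intros homeomorphism_cont2[OF hW])
    have 1: "inv_into U \<kappa> (u + \<kappa> x) \<in> W" "\<kappa> (inv_into U \<kappa> (u + \<kappa> x)) = u + \<kappa> x" if "u \<in> ball 0 r" for u
    proof -
      have "u + \<kappa> x \<in> ball (\<kappa> x) r" using that by (auto simp: dist_norm norm_minus_commute)
      then show "inv_into U \<kappa> (u + \<kappa> x) \<in> W" "\<kappa> (inv_into U \<kappa> (u + \<kappa> x)) = u + \<kappa> x"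
        using homeomorphism_image2[OF hW] homeomorphism_apply2[OF hW] by auto
    qed
    show "coord A x ` W \<subseteq> ball 0 r" unfolding coord W_def
      by (auto simp: dist_norm norm_minus_commute)
    show "para A x ` ball 0 r \<subseteq> W" using 1 by (auto simp: para)
    show "\<And>y. y \<in> W \<Longrightarrow> para A x (coord A x y) = y"
      using homeomorphism_apply1[OF hW] by (auto simp: para coord)
    show "\<And>u. u \<in> ball 0 r \<Longrightarrow> coord A x (para A x u) = u" using 1 by (auto simp: para coord)
  qed
  moreover have "hol_at A y f \<longleftrightarrow> (f \<circ> para A x) analytic_on {coord A x y}" if y: "y \<in> W" for y f
  proof
    assume "hol_at A y f"
    then obtain V where V: "open V" "y \<in> V" "(f \<circ> inv_into U \<kappa>) holomorphic_on \<kappa> ` (U \<inter> V)"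
      using hol_atD UA(1) by metis
    have "\<kappa> ` (U \<inter> V) = \<kappa> ` U \<inter> inv_into U \<kappa> -` V"
      using homeomorphism_image1[OF U(3)] homeomorphism_image2[OF U(3)] homeomorphism_apply1[OF U(3)]
        homeomorphism_apply2[OF U(3)] by (fastforce simp: image_iff)
    moreover have "open (\<kappa> ` U \<inter> inv_into U \<kappa> -` V)"
      using U V homeomorphism_cont2[OF U(3)] by (intro continuous_open_preimage) auto
    ultimately have o: "open (\<kappa> ` (U \<inter> V))" by simp
    have "\<kappa> y \<in> \<kappa> ` (U \<inter> V)" using V y unfolding W_def by blast
    then have an: "(f \<circ> inv_into U \<kappa>) analytic_on {\<kappa> y}"
      using V o analytic_at by blast
    have "f \<circ> para A x = (f \<circ> inv_into U \<kappa>) \<circ> (\<lambda>u. u + \<kappa> x)" by (auto simp: para)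
    then show "(f \<circ> para A x) analytic_on {coord A x y}"
      using an by (auto simp: coord intro!: analytic_on_compose analytic_intros)
  next
    assume "(f \<circ> para A x) analytic_on {coord A x y}"
    then obtain T where T: "open T" "coord A x y \<in> T" "(f \<circ> para A x) holomorphic_on T"
      by (auto simp: analytic_at)
    \<comment> \<open>The points whose coordinate lies where \<open>f \<circ> para A x\<close> is
      known to be holomorphic; on them every other chart factors through the chosen one.\<close>
    define V where "V = {y\<in>W. coord A x y \<in> T \<inter> ball 0 r}"
    have V: "open V" unfolding V_def
      using homeomorphism_subset_open[OF \<open>homeomorphism W (ball 0 r) _ _\<close> W, of "T \<inter> ball 0 r"] T
      by (auto simp: Int_commute)
    have "(f \<circ> inv_into U' \<kappa>') holomorphic_on \<kappa>' ` (U' \<inter> V)" if A': "(U', \<kappa>') \<in> A" for U' \<kappa>'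
    proof -
      have inv: "inv_into U' \<kappa>' (\<kappa>' y) = y" if "y \<in> U'" for y
        using homeomorphism_apply1[OF atlasD(3)[OF A']] that by auto
      have "(\<kappa> \<circ> inv_into U' \<kappa>') holomorphic_on \<kappa>' ` (U' \<inter> V)"
        by (rule holomorphic_on_subset[OF transition_holomorphic[OF A' UA(1)]]) (auto simp: V_def W_def)
      then have h: "(\<lambda>v. \<kappa> (inv_into U' \<kappa>' v) - \<kappa> x) holomorphic_on \<kappa>' ` (U' \<inter> V)"
        by (auto simp: o_def intro!: holomorphic_intros)
      have "((f \<circ> para A x) \<circ> (\<lambda>v. \<kappa> (inv_into U' \<kappa>' v) - \<kappa> x)) holomorphic_on \<kappa>' ` (U' \<inter> V)"
        by (rule holomorphic_on_compose_gen[OF h T(3)]) (auto simp: inv V_def coord)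
      then show ?thesis
      proof (rule holomorphic_transform)
        fix v assume "v \<in> \<kappa>' ` (U' \<inter> V)"
        then obtain y where y: "y \<in> U'" "y \<in> V" "v = \<kappa>' y" by auto
        then have "y \<in> W" by (auto simp: V_def)
        then have "inv_into U \<kappa> (\<kappa> y) = y" using homeomorphism_apply1[OF hW] by auto
        then show "(f \<circ> para A x \<circ> (\<lambda>v. \<kappa> (inv_into U' \<kappa>' v) - \<kappa> x)) v = (f \<circ> inv_into U' \<kappa>') v"
          by (simp add: y inv para)
      qed
    qed
    moreover have "y \<in> V" unfolding V_def
      using T y homeomorphism_image1[OF \<open>homeomorphism W (ball 0 r) _ _\<close>] by auto
    ultimately show "hol_at A y f" using V by (intro hol_atI[of V]) auto
  qed
  moreover have "x \<in> W" using UA r by (auto simp: W_def)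
  ultimately show ?thesis using W r
    unfolding local_coord_def coord by (intro exI[of _ W] exI[of _ r]) simp
qed

lemma obtain_coord:
  assumes "open Q" "x \<in> Q"
  obtains W r where "local_coord A x W r (coord A x) (para A x)" "W \<subseteq> Q"
  using coord_local_coord[of x] local_coord_shrink[OF _ assms] by metis

lemma hol_at_iff: "hol_at A x f \<longleftrightarrow> (f \<circ> para A x) analytic_on {0}"
  using coord_local_coord[of x] local_coord_hol[of A x _ _ "coord A x" "para A x" x f]
    local_coordD(2,3)[of A x _ _ "coord A x" "para A x"] by metis

lemma eventually_nhds_iff: "(\<forall>\<^sub>F y in nhds x. P y) \<longleftrightarrow> (\<forall>\<^sub>F u in nhds 0. P (para A x u))"
  and eventually_at_iff: "(\<forall>\<^sub>F y in at x. P y) \<longleftrightarrow> (\<forall>\<^sub>F u in at 0. P (para A x u))"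
proof -
  obtain W r where l: "local_coord A x W r (coord A x) (para A x)" using coord_local_coord by blast
  note local_coordD[OF l]
  then show "(\<forall>\<^sub>F y in nhds x. P y) \<longleftrightarrow> (\<forall>\<^sub>F u in nhds 0. P (para A x u))"
    "(\<forall>\<^sub>F y in at x. P y) \<longleftrightarrow> (\<forall>\<^sub>F u in at 0. P (para A x u))"
    using local_coord_eventually[OF l, of x P] by auto
qed

text \<open>No point is isolated, as in the plane, so limits along punctured neighbourhoods are
  unique.\<close>

lemma at_neq_bot: "at (x::'x) \<noteq> bot"
proof
  assume "at x = bot"
  then have "\<forall>\<^sub>F y in at x. False" by simp
  then have "\<forall>\<^sub>F u in at (0::complex). False" using eventually_at_iff[of "\<lambda>_. False" x] by simp
  then show False by simp
qed

lemma eventually_coord: 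
  "\<forall>\<^sub>F y in nhds x. para A x (coord A x y) = y" "\<forall>\<^sub>F u in nhds 0. coord A x (para A x u) = u"
  "coord A x x = 0" "para A x 0 = x"
proof -
  obtain W r where l: "local_coord A x W r (coord A x) (para A x)" using coord_local_coord by blast
  note D = local_coordD[OF l]
  show "coord A x x = 0" "para A x 0 = x" using D by auto
  have "\<forall>\<^sub>F y in nhds x. y \<in> W" using D by (intro eventually_nhds_in_open)
  then show "\<forall>\<^sub>F y in nhds x. para A x (coord A x y) = y" by eventually_elim (use D in auto)
  have "\<forall>\<^sub>F u in nhds 0. u \<in> ball (0::complex) r" using D by (intro eventually_nhds_in_open) auto
  then show "\<forall>\<^sub>F u in nhds 0. coord A x (para A x u) = u" by eventually_elim (use D in auto)
qed

section \<open>Germs of holomorphic functions\<close>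

lemma hol_at_cong:
  assumes "\<forall>\<^sub>F y in nhds x. f y = g y"
  shows "hol_at A x f \<longleftrightarrow> hol_at A x g"
  unfolding hol_at_iff
  using assms by (intro analytic_at_cong) (auto simp: eventually_nhds_iff)

lemma hol_at_compose:
  assumes "F analytic_on {g x}" "hol_at A x g"
  shows "hol_at A x (\<lambda>y. F (g y))"
proof -
  have "(F \<circ> (g \<circ> para A x)) analytic_on {0}"
    using assms unfolding hol_at_iff
    by (intro analytic_on_compose) (auto simp: eventually_coord)
  then show ?thesis by (simp add: hol_at_iff o_def)
qed

lemma hol_at_const [simp]: "hol_at A x (\<lambda>_. c)"
  by (simp add: hol_at_iff o_def)

lemma hol_at_coord: "hol_at A x (coord A x)"
proof -
  have "(\<lambda>u::complex. u) analytic_on {0}" by simp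
  moreover have "\<forall>\<^sub>F u in nhds 0. coord A x (para A x u) = u" by (rule eventually_coord)
  ultimately show ?thesis unfolding hol_at_iff o_def
    using analytic_at_cong[of "\<lambda>u. coord A x (para A x u)" "\<lambda>u. u" 0 0] by simp
qed

lemma hol_at_coordE:
  assumes "hol_at A x f"
  obtains F where "F analytic_on {0}" "\<forall>\<^sub>F y in nhds x. f y = F (coord A x y)"
proof
  show "(f \<circ> para A x) analytic_on {0}" using assms hol_at_iff by blast
  show "\<forall>\<^sub>F y in nhds x. f y = (f \<circ> para A x) (coord A x y)"
    using eventually_coord(1) by (rule eventually_mono) auto
qed

lemma hol_at_add: "hol_at A x f \<Longrightarrow> hol_at A x g \<Longrightarrow> hol_at A x (\<lambda>y. f y + g y)"
  and hol_at_diff: "hol_at A x f \<Longrightarrow> hol_at A x g \<Longrightarrow> hol_at A x (\<lambda>y. f y - g y)"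
  and hol_at_mult: "hol_at A x f \<Longrightarrow> hol_at A x g \<Longrightarrow> hol_at A x (\<lambda>y. f y * g y)"
  unfolding hol_at_iff o_def by (auto intro: analytic_intros)

lemma hol_at_power: "hol_at A x f \<Longrightarrow> hol_at A x (\<lambda>y. f y ^ n)"
  unfolding hol_at_iff o_def by (auto intro: analytic_intros)

lemma hol_at_sum: "(\<And>k. k \<in> I \<Longrightarrow> hol_at A x (f k)) \<Longrightarrow> hol_at A x (\<lambda>y. \<Sum>k\<in>I. f k y)"
  unfolding hol_at_iff o_def by (auto intro: analytic_intros)

lemma hol_at_inverse: "hol_at A x f \<Longrightarrow> f x \<noteq> 0 \<Longrightarrow> hol_at A x (\<lambda>y. inverse (f y))"
  unfolding hol_at_iff o_def by (auto intro!: analytic_intros simp: eventually_coord)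

lemma hol_at_powi: "hol_at A x f \<Longrightarrow> f x \<noteq> 0 \<Longrightarrow> hol_at A x (\<lambda>y. f y powi n)"
  unfolding power_int_def by (cases "n \<ge> 0") (auto intro: hol_at_power hol_at_inverse)

lemma hol_at_tendsto:
  assumes "hol_at A x f"
  shows "(f \<longlongrightarrow> f x) (at x)" "(f \<longlongrightarrow> f x) (nhds x)"
proof -
  have "isCont (f \<circ> para A x) 0"
    using assms hol_at_iff analytic_at_imp_isCont by blast
  then have "((f \<circ> para A x) \<longlongrightarrow> f x) (at 0)"
    by (simp add: isCont_def eventually_coord)
  then show *: "(f \<longlongrightarrow> f x) (at x)"
    unfolding tendsto_def by (simp add: eventually_at_iff[of _ x])
  then show "(f \<longlongrightarrow> f x) (nhds x)" by (rule tendsto_at_iff_tendsto_nhds[THEN iffD1])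
qed

lemma hol_at_eventually_nonzero:
  assumes "hol_at A x f" "f x \<noteq> 0"
  shows "\<forall>\<^sub>F y in nhds x. f y \<noteq> 0"
  using tendsto_imp_eventually_ne[OF hol_at_tendsto(2)[OF assms(1)] assms(2)] .

text \<open>Both functions are continuous at \<open>x\<close>, so the equality extends over the
  puncture. Identities obtained by dividing by the coordinate are completed in this way.\<close>

lemma hol_at_unique:
  assumes "hol_at A x f" "hol_at A x g" "\<forall>\<^sub>F y in at x. f y = g y"
  shows "\<forall>\<^sub>F y in nhds x. f y = g y" "f x = g x"
proof -
  have "(g \<longlongrightarrow> f x) (at x)"
    using hol_at_tendsto(1)[OF assms(1)] assms(3) by (rule Lim_transform_eventually)
  then show "f x = g x"
    using hol_at_tendsto(1)[OF assms(2)] at_neq_bot tendsto_unique by metis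
  then show "\<forall>\<^sub>F y in nhds x. f y = g y" using assms(3) 
    by (simp add: eventually_nhds_conv_at)
qed

lemma hol_at_factor:
  assumes "hol_at A x f" "f x = 0"
  obtains g where "hol_at A x g" "\<forall>\<^sub>F y in nhds x. f y = coord A x y * g y"
proof -
  obtain F where F: "F analytic_on {0}" "\<forall>\<^sub>F y in nhds x. f y = F (coord A x y)"
    using hol_at_coordE[OF assms(1)] by blast
  have "F 0 = 0" using eventually_nhds_x_imp_x[OF F(2)] assms(2) eventually_coord(3) by simp
  \<comment> \<open>The difference quotient has a removable singularity at 0, where it must take the
    value of the derivative.\<close>
  define G where "G = (\<lambda>u. if u = 0 then deriv F 0 else (F u - F 0) / (u - 0))"
  obtain S where S: "open S" "0 \<in> S" "F holomorphic_on S" using F(1) by (auto simp: analytic_at)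
  have "G holomorphic_on S" unfolding G_def
    using pole_lemma_open[OF S(3,1), of 0] .
  then have "G analytic_on {0}" using S by (auto simp: analytic_at)
  then have "hol_at A x (\<lambda>y. G (coord A x y))"
    using hol_at_compose[of G "coord A x" x] hol_at_coord[of x] by (simp add: eventually_coord)
  moreover have "\<forall>\<^sub>F y in nhds x. f y = coord A x y * G (coord A x y)"
    using F(2) by (rule eventually_mono) (auto simp: G_def \<open>F 0 = 0\<close>)
  ultimately show thesis using that by blast
qed

lemma eventually_nearby_nhds:
  assumes "\<forall>\<^sub>F y in nhds (x::'x). P y"
  shows "\<forall>\<^sub>F y in nhds x. \<forall>\<^sub>F y' in nhds y. P y'"
  using assms eventually_eventually by metis

text \<open>An open neighbourhood without \<open>x\<close> is still open, so each of its points has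
  a full neighbourhood inside it.\<close>

lemma eventually_nearby_at:
  assumes "\<forall>\<^sub>F y in at (x::'x). P y"
  shows "\<forall>\<^sub>F y in at x. \<forall>\<^sub>F y' in nhds y. P y'"
proof -
  obtain S where S: "open S" "x \<in> S" "\<And>y. y \<in> S \<Longrightarrow> y \<noteq> x \<Longrightarrow> P y"
    using assms unfolding eventually_at_topological by auto
  have "\<forall>\<^sub>F y in at x. y \<in> S - {x}"
    using S by (auto simp: eventually_at_topological)
  then show ?thesis
  proof eventually_elim
    case (elim y)
    have "open (S - {x})" using S(1) by (simp add: open_delete)
    then have "\<forall>\<^sub>F y' in nhds y. y' \<in> S - {x}" using elim by (rule eventually_nhds_in_open)
    then show ?case by eventually_elim (use S(3) in auto)
  qed
qed

lemma hol_at_nearby: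
  assumes "hol_at A x f"
  shows "\<forall>\<^sub>F y in nhds x. hol_at A y f"
proof -
  obtain W where W: "open W" "x \<in> W"
      "\<forall>U \<kappa>. (U, \<kappa>) \<in> A \<longrightarrow> (f \<circ> inv_into U \<kappa>) holomorphic_on \<kappa> ` (U \<inter> W)"
    using hol_atD[OF assms] by blast
  have "\<forall>\<^sub>F y in nhds x. y \<in> W" using W by (intro eventually_nhds_in_open)
  then show ?thesis by eventually_elim (use W in \<open>auto intro!: hol_atI[of W]\<close>)
qed

lemma coord_nonzero: "\<forall>\<^sub>F y in at x. coord A x y \<noteq> 0"
proof -
  have "\<forall>\<^sub>F y in at x. para A x (coord A x y) = y \<and> y \<noteq> x"
    using eventually_coord(1)[of x] by (auto simp: eventually_at_filter elim: eventually_mono)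
  then show ?thesis by eventually_elim (use eventually_coord(4) in force)
qed

lemma coord_powi_nearby: "\<forall>\<^sub>F y in at x. hol_at A y (\<lambda>y. coord A x y powi n) \<and> coord A x y \<noteq> 0"
proof -
  have "\<forall>\<^sub>F y in at x. hol_at A y (coord A x)"
    using hol_at_nearby[OF hol_at_coord, of x] by (simp add: eventually_nhds_conv_at)
  then show ?thesis using coord_nonzero[of x]
    by eventually_elim (auto intro: hol_at_powi)
qed

lemma eventually_not_mem_finite:
  "finite D \<Longrightarrow> \<forall>\<^sub>F y in at (x::'x). y \<notin> D" 
  "finite D \<Longrightarrow> x \<notin> D \<Longrightarrow> \<forall>\<^sub>F y in nhds (x::'x). y \<notin> D"
proof -
  show *: "\<forall>\<^sub>F y in nhds (x::'x). y \<notin> D" if "finite D" "x \<notin> D" for D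
    using eventually_nhds_in_open[of "- D" x] that by (auto simp: open_Compl finite_imp_closed)
  show "\<forall>\<^sub>F y in at (x::'x). y \<notin> D" if "finite D"
    using *[of "D - {x}"] that unfolding eventually_at_filter by (auto elim: eventually_mono)
qed

section \<open>Meromorphic germs of order at least a given integer\<close>

lemma zOI: "hol_at A x g \<Longrightarrow> \<forall>\<^sub>F y in at x. f y = coord A x y powi n * g y \<Longrightarrow> f \<in> zO A x n"
  unfolding zO_def by blast

lemma zOE:
  assumes "f \<in> zO A x n"
  obtains g where "hol_at A x g" "\<forall>\<^sub>F y in at x. f y = coord A x y powi n * g y"
  using assms unfolding zO_def by blast

lemma zO_cong:
  assumes "f \<in> zO A x n" "\<forall>\<^sub>F y in at x. f' y = f y"
  shows "f' \<in> zO A x n"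
proof -
  obtain g where g: "hol_at A x g" "\<forall>\<^sub>F y in at x. f y = coord A x y powi n * g y"
    using assms by (auto elim: zOE)
  have "\<forall>\<^sub>F y in at x. f' y = coord A x y powi n * g y"
    using g(2) assms(2) by eventually_elim simp
  with g(1) show ?thesis by (rule zOI)
qed

lemma zO_0: "f \<in> zO A x 0 \<longleftrightarrow> (\<exists>g. hol_at A x g \<and> (\<forall>\<^sub>F y in at x. f y = g y))"
  unfolding zO_def by simp

lemma hol_imp_zO_0: "hol_at A x f \<Longrightarrow> f \<in> zO A x 0"
  unfolding zO_0 by auto

lemma coord_powi_zO: "(\<lambda>y. coord A x y powi n) \<in> zO A x n"
  by (rule zOI[of _ "\<lambda>_. 1"]) auto

lemma zO_mult:
  assumes "f \<in> zO A x n" "g \<in> zO A x k"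
  shows "(\<lambda>y. f y * g y) \<in> zO A x (n + k)"
proof -
  obtain f' where f: "hol_at A x f'" "\<forall>\<^sub>F y in at x. f y = coord A x y powi n * f' y"
    using assms(1) by (rule zOE)
  obtain g' where g: "hol_at A x g'" "\<forall>\<^sub>F y in at x. g y = coord A x y powi k * g' y"
    using assms(2) by (rule zOE)
  have "\<forall>\<^sub>F y in at x. f y * g y = coord A x y powi (n + k) * (f' y * g' y)"
    using f(2) g(2) coord_nonzero[of x] by eventually_elim (simp add: power_int_add)
  then show ?thesis by (rule zOI[OF hol_at_mult[OF f(1) g(1)]])
qed

lemma zO_add:
  assumes "f \<in> zO A x n" "g \<in> zO A x n"
  shows "(\<lambda>y. f y + g y) \<in> zO A x n"
proof -
  obtain f' where f: "hol_at A x f'" "\<forall>\<^sub>F y in at x. f y = coord A x y powi n * f' y"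
    using assms(1) by (rule zOE)
  obtain g' where g: "hol_at A x g'" "\<forall>\<^sub>F y in at x. g y = coord A x y powi n * g' y"
    using assms(2) by (rule zOE)
  have "\<forall>\<^sub>F y in at x. f y + g y = coord A x y powi n * (f' y + g' y)"
    using f(2) g(2) by eventually_elim (simp add: algebra_simps)
  then show ?thesis by (rule zOI[OF hol_at_add[OF f(1) g(1)]])
qed

lemma zero_zO: "(\<lambda>_. 0) \<in> zO A x n"
  by (rule zOI[of _ "\<lambda>_. 0"]) auto

lemma zO_sum: "(\<And>k. k \<in> I \<Longrightarrow> f k \<in> zO A x n) \<Longrightarrow> (\<lambda>y. \<Sum>k\<in>I. f k y) \<in> zO A x n"
  by (induction I rule: infinite_finite_induct) (auto intro: zero_zO zO_add)

lemma zO_hol_mult: "hol_at A x f \<Longrightarrow> g \<in> zO A x n \<Longrightarrow> (\<lambda>y. f y * g y) \<in> zO A x n"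
  using zO_mult[OF hol_imp_zO_0] by force

lemma zO_mono: "f \<in> zO A x n \<Longrightarrow> k \<le> n \<Longrightarrow> f \<in> zO A x k"
proof -
  assume f: "f \<in> zO A x n" and "k \<le> n"
  then have "(\<lambda>y. coord A x y ^ nat (n - k)) \<in> zO A x 0"
    by (intro hol_imp_zO_0 hol_at_power hol_at_coord)
  obtain g where g: "hol_at A x g" "\<forall>\<^sub>F y in at x. f y = coord A x y powi n * g y"
    using f zOE by blast
  have "\<forall>\<^sub>F y in at x. f y = coord A x y powi k * (coord A x y ^ nat (n - k) * g y)"
    using g(2) coord_nonzero[of x]
  proof eventually_elim
    case (elim y)
    have "n = k + int (nat (n - k))" using \<open>k \<le> n\<close> by simp
    then have "coord A x y powi n = coord A x y powi k * coord A x y ^ nat (n - k)"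
      using power_int_add[of "coord A x y" k "int (nat (n - k))"] elim(2) by (metis power_int_of_nat)
    then show ?case using elim(1) by simp
  qed
  then show ?thesis by (rule zOI[OF hol_at_mult[OF hol_at_power[OF hol_at_coord] g(1)]])
qed

text \<open>Near \<open>x\<close>, the power of the coordinate has neither zeros nor poles except at
  \<open>x\<close> itself.\<close>

lemma zO_nearby:
  assumes "f \<in> zO A x n"
  shows "\<forall>\<^sub>F y in at x. hol_at A y f"
proof -
  obtain g where g: "hol_at A x g" "\<forall>\<^sub>F y in at x. f y = coord A x y powi n * g y"
    using assms by (auto elim: zOE)
  have "\<forall>\<^sub>F y in at x. hol_at A y g"
    using hol_at_nearby[OF g(1)] by (simp add: eventually_nhds_conv_at)
  then show ?thesis using eventually_nearby_at[OF g(2)] coord_powi_nearby[of x n]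
  proof eventually_elim
    case (elim y)
    then show ?case using hol_at_cong[of f] by (auto intro: hol_at_mult)
  qed
qed

end

section \<open>Powers of a complex variable\<close>

text \<open>The alternative \<open>m = 1\<close> admits \<open>\<zeta> = 0\<close>: over the centre
  of a coordinate, an unramified point is still counted correctly.\<close>

lemma nth_roots:
  fixes \<zeta> :: complex
  assumes "m > 0" "\<zeta> \<noteq> 0 \<or> m = 1"
  shows "finite {w. w ^ m = \<zeta>}" "card {w. w ^ m = \<zeta>} = m"
proof -
  consider "m = 1" | "\<zeta> \<noteq> 0" using assms by blast
  then have "finite {w. w ^ m = \<zeta>} \<and> card {w. w ^ m = \<zeta>} = m"
    using assms by cases (auto simp: finite_nth_roots card_nth_roots)
  then show "finite {w. w ^ m = \<zeta>}" "card {w. w ^ m = \<zeta>} = m" by auto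
qed

text \<open>\<open>w' / w\<close> is an \<open>m\<close>-th root of unity, so this is a finite
  geometric series. It is the orthogonality relation behind Fourier inversion along a fibre.\<close>

lemma sum_quotient_roots:
  fixes w w' :: complex
  assumes m: "m > 0" "\<zeta> \<noteq> 0 \<or> m = 1" and w: "w ^ m = \<zeta>" "w' ^ m = \<zeta>"
  shows "(\<Sum>p<m. inverse w ^ p * w' ^ p) = (if w' = w then of_nat m else 0)"
proof (cases "m = 1")
  case True
  then show ?thesis using w by simp
next
  case False
  then have "w \<noteq> 0" using m w by (auto simp: power_0_left)
  have "(\<Sum>p<m. inverse w ^ p * w' ^ p) = (\<Sum>p<m. (w' / w) ^ p)"
    by (simp add: divide_inverse power_mult_distrib mult.commute)
  also have "\<dots> = (if w' = w then of_nat m else 0)"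
  proof (cases "w' = w")
    case True
    then show ?thesis using \<open>w \<noteq> 0\<close> by simp
  next
    case False
    then have "w' / w \<noteq> 1" using \<open>w \<noteq> 0\<close> by simp
    moreover have "(w' / w) ^ m = 1"
      using w \<open>w \<noteq> 0\<close> by (metis divide_self power_divide power_eq_0_iff)
    ultimately show ?thesis using False by (simp add: geometric_sum)
  qed
  finally show ?thesis .
qed

text \<open>The companion relation, summed over the roots instead of the exponents. Multiplying
  every root by a root of unity permutes the roots and multiplies the sum by a constant; if that
  constant is not 1, the sum is 0.\<close>

lemma sum_roots_power:
  fixes \<zeta> :: complex
  assumes m: "m > 0" "\<zeta> \<noteq> 0 \<or> m = 1" and pq: "p < m" "q < m"
  shows "(\<Sum>w | w ^ m = \<zeta>. inverse w ^ p * w ^ q) = (if p = q then of_nat m else 0)"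
proof (cases "m = 1")
  case True
  then show ?thesis using pq by simp
next
  case False
  then have z: "\<zeta> \<noteq> 0" using m by auto
  have nz: "w \<noteq> 0" if "w ^ m = \<zeta>" for w using that z m by (auto simp: power_0_left)
  show ?thesis
  proof (cases "p = q")
    case True
    have "(\<Sum>w | w ^ m = \<zeta>. inverse w ^ p * w ^ q) = (\<Sum>w | w ^ m = \<zeta>. 1)"
    proof (rule sum.cong)
      fix w assume "w \<in> {w. w ^ m = \<zeta>}"
      then have "w \<noteq> 0" using nz by simp
      then show "inverse w ^ p * w ^ q = 1" using True by (simp flip: power_mult_distrib)
    qed simp
    then show ?thesis using True nth_roots[OF m] by simp
  next
    case False
    define d where "d = (if p < q then q - p else p - q)"
    have d: "0 < d" "d < m" using False pq by (auto simp: d_def)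
    \<comment> \<open>Otherwise the \<open>m\<close> solutions of \<open>\<epsilon> ^ m = 1\<close>
      would be among the solutions of \<open>\<epsilon> ^ d = 1\<close>, of which there are only
      \<open>d < m\<close>.\<close>
    have "\<exists>\<epsilon>::complex. \<epsilon> ^ m = 1 \<and> \<epsilon> ^ d \<noteq> 1"
    proof (rule ccontr)
      assume "\<not> ?thesis"
      then have "{w::complex. w ^ m = 1} \<subseteq> {w. w ^ d = 1}" by auto
      then have "m \<le> d"
        using card_mono[of "{w::complex. w ^ d = 1}" "{w. w ^ m = 1}"] m d
        by (simp add: nth_roots)
      then show False using d by simp
    qed
    then obtain \<epsilon> :: complex where e: "\<epsilon> ^ m = 1" "\<epsilon> ^ d \<noteq> 1" by blast
    then have e0: "\<epsilon> \<noteq> 0" using m by (metis power_0_left zero_neq_one less_irrefl)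
    have ei: "inverse \<epsilon> ^ m = 1" using e(1) by (simp add: power_inverse)
    define S where "S = (\<Sum>w | w ^ m = \<zeta>. inverse w ^ p * w ^ q)"
    have bij: "bij_betw ((*) \<epsilon>) {w. w ^ m = \<zeta>} {w. w ^ m = \<zeta>}"
      by (rule bij_betw_byWitness[of _ "(*) (inverse \<epsilon>)"])
        (use e(1) ei e0 in \<open>auto simp: power_mult_distrib \<close>)
    have "S = (\<Sum>w | w ^ m = \<zeta>. inverse (\<epsilon> * w) ^ p * (\<epsilon> * w) ^ q)"
      unfolding S_def by (rule sum.reindex_bij_betw[OF bij, symmetric])
    also have "\<dots> = inverse \<epsilon> ^ p * \<epsilon> ^ q * S"
      unfolding S_def sum_distrib_left by (simp add: power_mult_distrib mult_ac)
    finally have "S = 0 \<or> inverse \<epsilon> ^ p * \<epsilon> ^ q = 1" by auto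
    moreover have "inverse \<epsilon> ^ p * \<epsilon> ^ q \<noteq> 1"
    proof
      assume "inverse \<epsilon> ^ p * \<epsilon> ^ q = 1"
      then have eq: "\<epsilon> ^ q = \<epsilon> ^ p" using e0 by (simp add: power_inverse field_simps)
      show False
      proof (cases "p < q")
        case True
        then have "\<epsilon> ^ q = \<epsilon> ^ p * \<epsilon> ^ d" by (simp add: d_def flip: power_add)
        then show False using eq e0 e by simp
      next
        case F: False
        then have "\<epsilon> ^ p = \<epsilon> ^ q * \<epsilon> ^ d" by (simp add: d_def flip: power_add)
        then show False using eq e0 e by simp
      qed
    qed
    ultimately show ?thesis using False by (simp add: S_def)
  qed
qed

text \<open>The Taylor series is split by the residue of the exponent modulo \<open>m\<close>; the
  part with residue \<open>p\<close> is \<open>w ^ p\<close> times a power series in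
  \<open>w ^ m\<close>.\<close>

lemma analytic_power_decomposition:
  assumes G: "G analytic_on {0}" and m: "m > 0"
  obtains H where "\<And>p. p < m \<Longrightarrow> H p analytic_on {0::complex}"
    "\<forall>\<^sub>F w in nhds 0. G w = (\<Sum>p<m. w ^ p * H p (w ^ m))"
proof -
  obtain r where r: "r > 0" "G holomorphic_on ball 0 r"
    using G by (auto simp: analytic_on_def)
  define g where "g = (\<lambda>n. (deriv ^^ n) G 0 / fact n)"
  have sums: "(\<lambda>n. g n * w ^ n) sums G w" if "w \<in> ball 0 r" for w
    using holomorphic_power_series[OF r(2) that] by (simp add: g_def)
  \<comment> \<open>Absolute convergence is what permits passing to a subseries.\<close>
  have abs: "summable (\<lambda>n. norm (g n * w ^ n))" if "w \<in> ball 0 r" for w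
  proof -
    obtain \<rho> where \<rho>: "norm w < \<rho>" "\<rho> < r" using \<open>w \<in> ball 0 r\<close> dense by auto
    then have "\<bar>\<rho>\<bar> < r" using norm_ge_zero[of w] by linarith
    then have "summable (\<lambda>n. g n * (of_real \<rho> :: complex) ^ n)" "norm w < norm (of_real \<rho> :: complex)"
      using sums[of "of_real \<rho>"] \<rho> by (auto simp: sums_iff)
    then show ?thesis by (rule powser_insidea)
  qed
  have pw: "w ^ p * (c * (w ^ m) ^ j) = c * w ^ (j * m + p)" for w c :: complex and p j
  proof -
    have "w ^ (j * m + p) = (w ^ m) ^ j * w ^ p"
      by (metis mult.commute power_add power_mult)
    then show ?thesis by simp
  qed
  have inj: "inj (\<lambda>j. j * m + p)" for p using m by (auto simp: inj_on_def)
  have sub: "summable (\<lambda>j. g (j * m + p) * w ^ (j * m + p))" if "w \<in> ball 0 r" for w p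
    using summable_reindex[OF abs[OF that] inj, of p]
    by (intro summable_norm_cancel[of "\<lambda>j. g (j * m + p) * w ^ (j * m + p)"]) (auto simp: o_def)
  \<comment> \<open>The new variable \<open>w ^ m\<close> ranges over the disc of radius
    \<open>r ^ m\<close>: an \<open>m\<close>-th root \<open>w\<close> of \<open>\<zeta>\<close>
    lies in the original disc, and the series at \<open>\<zeta>\<close> is a subseries at
    \<open>w\<close>, divided by \<open>w ^ p\<close>.\<close>
  have sub': "summable (\<lambda>j. g (j * m + p) * \<zeta> ^ j)" if z: "\<zeta> \<in> ball 0 (r ^ m)" for \<zeta> p
  proof (cases "\<zeta> = 0")
    case True
    then show ?thesis using summable_0_powser[of "\<lambda>j. g (j * m + p)"] by simp
  next
    case False
    have "card {w. w ^ m = \<zeta>} \<noteq> 0" using nth_roots(2)[of m \<zeta>] m False by simp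
    then have "{w. w ^ m = \<zeta>} \<noteq> {}" by (metis card.empty)
    then obtain w where w: "w ^ m = \<zeta>" by blast
    then have "norm w ^ m < r ^ m" using z by (simp flip: norm_power)
    then have "w \<in> ball 0 r" using r(1) power_less_imp_less_base[of "norm w" m r] by auto
    moreover have "w \<noteq> 0" using w False m by auto
    ultimately have "summable (\<lambda>j. w ^ p * (g (j * m + p) * \<zeta> ^ j))"
      using sub[of w p] by (simp only: pw flip: w)
    then show ?thesis using \<open>w \<noteq> 0\<close> by (simp add: summable_cmult_iff)
  qed
  define H where "H = (\<lambda>p \<zeta>. \<Sum>j. g (j * m + p) * \<zeta> ^ j)"
  show thesis
  proof
    show "H p analytic_on {0}" for p
    proof -
      have "H p holomorphic_on ball 0 (r ^ m)"
        by (rule power_series_holomorphic[of 0 "r ^ m" "\<lambda>j. g (j * m + p)"])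
          (use sub' in \<open>auto simp: H_def summable_sums\<close>)
      then show ?thesis using r(1) by (auto simp: analytic_at intro!: exI[of _ "ball 0 (r ^ m)"])
    qed
    have "\<forall>\<^sub>F w in nhds (0::complex). w \<in> ball 0 r"
      using r by (intro eventually_nhds_in_open) auto
    then show "\<forall>\<^sub>F w in nhds 0. G w = (\<Sum>p<m. w ^ p * H p (w ^ m))"
    proof eventually_elim
      case (elim w)
      then have "norm w ^ m < r ^ m" using m by (intro power_strict_mono) auto
      then have z: "w ^ m \<in> ball 0 (r ^ m)" by (simp add: norm_power)
      have "(\<lambda>j. \<Sum>n = j * m..<j * m + m. g n * w ^ n) sums G w"
        using sums_group[OF sums[OF elim] m] .
      moreover have "(\<Sum>n = j * m..<j * m + m. g n * w ^ n) = (\<Sum>p<m. g (j * m + p) * w ^ (j * m + p))" for j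
        using sum.shift_bounds_nat_ivl[of "\<lambda>n. g n * w ^ n" 0 "j * m" m]
        by (simp add: lessThan_atLeast0 add.commute)
      moreover have "(\<lambda>j. \<Sum>p<m. g (j * m + p) * w ^ (j * m + p)) sums (\<Sum>p<m. w ^ p * H p (w ^ m))"
      proof (rule sums_sum)
        fix p
        have "(\<lambda>j. w ^ p * (g (j * m + p) * (w ^ m) ^ j)) sums (w ^ p * H p (w ^ m))"
          unfolding H_def by (intro sums_mult summable_sums sub' z)
        then show "(\<lambda>j. g (j * m + p) * w ^ (j * m + p)) sums (w ^ p * H p (w ^ m))"
          by (simp only: pw)
      qed
      ultimately show ?case using sums_unique2 by auto
    qed
  qed
qed

section \<open>Holomorphic maps\<close>

text \<open>An injective holomorphic function has a holomorphic inverse, so analyticity in the old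
  and in the new coordinate are equivalent. The image of the disc is only known to be open; a
  smaller disc inside it becomes the range of the new coordinate.\<close>

lemma (in riemann) local_coord_change:
  assumes lc: "local_coord A x W r \<omega> \<theta>" and g: "g holomorphic_on ball 0 s" "inj_on g (ball 0 s)" "g 0 = 0"
    and s: "0 < s" "s \<le> r"
  obtains W' r' \<theta>' where "local_coord A x W' r' (\<lambda>y. g (\<omega> y)) \<theta>'" "W' \<subseteq> W"
proof -
  let ?W = "{y\<in>W. \<omega> y \<in> ball 0 s}"
  have lc': "local_coord A x ?W s \<omega> \<theta>" by (rule local_coord_restrict[OF lc s])
  note D = local_coordD[OF lc']
  obtain h where h: "h holomorphic_on g ` ball 0 s" "\<And>u. u \<in> ball 0 s \<Longrightarrow> h (g u) = u"
    using holomorphic_has_inverse[OF g(1) open_ball g(2)] by metis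
  have o: "open (g ` ball 0 s)" using open_mapping_thm3[OF g(1) open_ball g(2)] .
  have "homeomorphism (ball 0 s) (g ` ball 0 s) g h"
    by (rule homeomorphismI) (use g h in \<open>auto intro!: holomorphic_on_imp_continuous_on\<close>)
  then have "homeomorphism ?W (g ` ball 0 s) (g \<circ> \<omega>) (\<theta> \<circ> h)"
    using homeomorphism_compose[OF D(5)] by blast
  then have hom: "homeomorphism ?W (g ` ball 0 s) (\<lambda>y. g (\<omega> y)) (\<theta> \<circ> h)" by (simp add: o_def)
  obtain r' where r': "r' > 0" "ball 0 r' \<subseteq> g ` ball 0 s"
    using o s(1) g(3) open_contains_ball[of "g ` ball 0 s"] by (metis centre_in_ball image_eqI)
  let ?W' = "{y\<in>?W. g (\<omega> y) \<in> ball 0 r'}"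
  have h1: "open ?W'" "homeomorphism ?W' (ball 0 r') (\<lambda>y. g (\<omega> y)) (\<theta> \<circ> h)"
    using homeomorphism_subset_open[OF hom D(1) r'(2)] by auto
  have iff: "hol_at A y f \<longleftrightarrow> (f \<circ> (\<theta> \<circ> h)) analytic_on {g (\<omega> y)}" if y: "y \<in> ?W'" for y f
  proof -
    have y': "y \<in> ?W" "\<omega> y \<in> ball 0 s" using y by auto
    have "hol_at A y f \<longleftrightarrow> (f \<circ> \<theta>) analytic_on {\<omega> y}" by (rule local_coord_hol[OF lc' y'(1)])
    also have "\<dots> \<longleftrightarrow> (f \<circ> (\<theta> \<circ> h)) analytic_on {g (\<omega> y)}"
    proof
      assume a: "(f \<circ> \<theta>) analytic_on {\<omega> y}"
      have "h analytic_on {g (\<omega> y)}" using h(1) o y'(2) analytic_at by blast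
      then have "((f \<circ> \<theta>) \<circ> h) analytic_on {g (\<omega> y)}"
        using a h(2) y'(2) by (intro analytic_on_compose) auto
      then show "(f \<circ> (\<theta> \<circ> h)) analytic_on {g (\<omega> y)}" by (simp add: o_assoc)
    next
      assume a: "(f \<circ> (\<theta> \<circ> h)) analytic_on {g (\<omega> y)}"
      have "g analytic_on {\<omega> y}" using g(1) y'(2) analytic_at open_ball by blast
      then have an: "((f \<circ> (\<theta> \<circ> h)) \<circ> g) analytic_on {\<omega> y}"
        using a by (intro analytic_on_compose) auto
      have "\<forall>\<^sub>F u in nhds (\<omega> y). u \<in> ball 0 s" using y'(2) by (intro eventually_nhds_in_open) auto
      then have "\<forall>\<^sub>F u in nhds (\<omega> y). ((f \<circ> (\<theta> \<circ> h)) \<circ> g) u = (f \<circ> \<theta>) u"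
        by eventually_elim (use h in auto)
      then show "(f \<circ> \<theta>) analytic_on {\<omega> y}" using an analytic_at_cong by blast
    qed
    finally show ?thesis .
  qed
  have "x \<in> ?W'" using D(2,3) g(3) r'(1) by auto
  then have "local_coord A x ?W' r' (\<lambda>y. g (\<omega> y)) (\<theta> \<circ> h)"
    using h1 r'(1) D(3) g(3) iff unfolding local_coord_def by auto
  then show thesis using that by blast
qed

text \<open>The zero germ is set apart since the factorisation by \<open>zorder\<close> does not
  apply to it. For \<open>\<Phi>\<close> it is excluded later, because \<open>\<Phi>\<close> is
  nowhere locally constant.\<close>

lemma locally_nonzero_or_zero:
  assumes "f analytic_on {0::complex}"
  shows "(\<forall>\<^sub>F u in nhds 0. f u = 0) \<or>
    zorder f 0 \<ge> 0 \<and> (\<exists>g. g analytic_on {0} \<and> g 0 \<noteq> 0 \<and> (\<forall>\<^sub>F u in nhds 0. f u = g u * u ^ nat (zorder f 0))) \<and>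
    (f 0 = 0 \<longrightarrow> zorder f 0 > 0)"
proof -
  obtain r where r: "r > 0" "f holomorphic_on ball 0 r"
    using assms by (auto simp: analytic_on_def)
  have ev: "\<forall>\<^sub>F u in nhds (0::complex). u \<in> ball 0 s" if "s > 0" for s
    using that by (intro eventually_nhds_in_open) auto
  show ?thesis
  proof (cases "\<exists>u\<in>ball 0 r. f u \<noteq> 0")
    case False
    then have "\<forall>\<^sub>F u in nhds 0. f u = 0" using ev[OF r(1)] by (auto elim: eventually_mono)
    then show ?thesis by blast
  next
    case True
    have 0: "(0::complex) \<in> ball 0 r" using r by simp
    note Z = zorder_exist_zero[OF r(2) open_ball connected_ball 0 True]
    have ord: "if f 0 = 0 then 0 < zorder f 0 else zorder f 0 = 0" by (rule conjunct1[OF Z])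
    obtain s where s: "s > 0" "zor_poly f 0 holomorphic_on cball 0 s"
        "\<And>w. w \<in> cball 0 s \<Longrightarrow> f w = zor_poly f 0 w * (w - 0) ^ nat (zorder f 0) \<and> zor_poly f 0 w \<noteq> 0"
      using conjunct2[OF Z] by blast
    have "zor_poly f 0 holomorphic_on ball 0 s"
      using s(2) by (rule holomorphic_on_subset) auto
    then have "zor_poly f 0 analytic_on {0}" using s(1) by (auto simp: analytic_at intro!: exI[of _ "ball 0 s"])
    moreover have "zor_poly f 0 0 \<noteq> 0" using s(1,3) by simp
    moreover have "\<forall>\<^sub>F u in nhds 0. f u = zor_poly f 0 u * u ^ nat (zorder f 0)"
      using ev[OF s(1)] by eventually_elim (use s(3) in auto)
    moreover have "zorder f 0 \<ge> 0 \<and> (f 0 = 0 \<longrightarrow> zorder f 0 > 0)"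
      using ord by (cases "f 0 = 0") simp_all
    ultimately show ?thesis by blast
  qed
qed

text \<open>On a disc without zeros \<open>g\<close> is of the form \<open>exp l\<close>, and
  \<open>exp (l / m)\<close> is a root.\<close>

lemma analytic_nth_root:
  assumes "g analytic_on {0::complex}" "g 0 \<noteq> 0" "m > 0"
  obtains \<gamma> where "\<gamma> analytic_on {0}" "\<gamma> 0 \<noteq> 0" "\<forall>\<^sub>F u in nhds 0. g u = \<gamma> u ^ m"
proof -
  obtain r where r: "r > 0" "g holomorphic_on ball 0 r"
    using assms by (auto simp: analytic_on_def)
  have "isCont g 0" using assms(1) analytic_at_imp_isCont by blast
  then have "\<forall>\<^sub>F u in nhds 0. g u \<noteq> 0"
    using tendsto_imp_eventually_ne[of g "g 0" "nhds 0" 0] assms(2) continuous_at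
    by (simp add: tendsto_at_iff_tendsto_nhds isCont_def)
  then obtain s where s: "s > 0" "\<And>u. u \<in> ball 0 s \<Longrightarrow> g u \<noteq> 0"
    unfolding eventually_nhds_metric by (auto simp: dist_commute)
  define t where "t = min r s"
  have "g holomorphic_on ball 0 t" using r(2) by (rule holomorphic_on_subset) (auto simp: t_def)
  moreover have "\<And>u. u \<in> ball 0 t \<Longrightarrow> g u \<noteq> 0" using s(2) by (auto simp: t_def)
  moreover have "contractible (ball (0::complex) t)" by (intro convex_imp_contractible) auto
  ultimately obtain l where l: "l holomorphic_on ball 0 t" "\<And>u. u \<in> ball 0 t \<Longrightarrow> g u = exp (l u)"
    using contractible_imp_holomorphic_log by metis
  have t: "t > 0" using r s by (simp add: t_def)
  show thesis
  proof
    have "(\<lambda>u. exp (l u / of_nat m)) holomorphic_on ball 0 t"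
      using l(1) assms(3) by (auto intro!: holomorphic_intros)
    then show "(\<lambda>u. exp (l u / of_nat m)) analytic_on {0}"
      using t by (auto simp: analytic_at intro!: exI[of _ "ball 0 t"])
    have "\<forall>\<^sub>F u in nhds (0::complex). u \<in> ball 0 t"
      using t by (intro eventually_nhds_in_open) auto
    then show "\<forall>\<^sub>F u in nhds 0. g u = exp (l u / of_nat m) ^ m"
      by eventually_elim (use l(2) assms(3) in \<open>auto simp flip: exp_of_nat_mult\<close>)
  qed auto
qed

text \<open>Each point has a neighbourhood that contains no point with \<open>P\<close> except
  possibly itself; finitely many such neighbourhoods cover the surface.\<close>

lemma (in riemann) compact_finite:
  fixes P :: "'x \<Rightarrow> bool"
  assumes "compact (UNIV :: 'x set)" "\<And>x. \<forall>\<^sub>F y in at x. \<not> P y"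
  shows "finite {y. P y}"
proof -
  have "\<exists>S. open S \<and> x \<in> S \<and> (\<forall>y\<in>S. y \<noteq> x \<longrightarrow> \<not> P y)" for x
    using assms(2)[of x] unfolding eventually_at_topological by auto
  then obtain S where S: "\<And>x. open (S x)" "\<And>x. x \<in> S x" "\<And>x y. y \<in> S x \<Longrightarrow> y \<noteq> x \<Longrightarrow> \<not> P y"
    by metis
  obtain T where T: "finite T" "UNIV \<subseteq> (\<Union>x\<in>T. S x)"
  proof (rule compactE_image[OF assms(1), of UNIV S])
    show "UNIV \<subseteq> (\<Union>x\<in>UNIV. S x)" using S(2) by blast
  qed (use S(1) in auto)
  have "{y. P y} \<subseteq> T" using S(3) T(2) by (smt (verit) UN_E UNIV_I mem_Collect_eq subsetD subsetI)
  then show ?thesis using T finite_subset by blast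
qed

locale cover = X: riemann A + Z: riemann B for A :: "'x::t2_space atlas" and B :: "'z::t2_space atlas" +
  fixes \<Phi> :: "'x \<Rightarrow> 'z"
  assumes compact_X: "compact (UNIV :: 'x set)" and compact_Z: "compact (UNIV :: 'z set)"
    and hol: "hol_map A B \<Phi>" and nonconst: "\<not> (\<exists>c. \<forall>x. \<Phi> x = c)"
begin

lemma continuous: "continuous_on UNIV \<Phi>"
  using hol unfolding hol_map_def by blast

lemma open_vimage_Phi: "open S \<Longrightarrow> open (\<Phi> -` S)"
  using continuous continuous_on_open_vimage[of UNIV \<Phi>] by auto

lemma tendsto_Phi: "filterlim \<Phi> (nhds (\<Phi> x)) (nhds x)"
  using continuous continuous_on_eq_continuous_at[of UNIV \<Phi>] 
  by (metis UNIV_I continuous_at open_UNIV tendsto_at_iff_tendsto_nhds)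

lemma eventually_nhds_Phi: "\<forall>\<^sub>F z in nhds (\<Phi> x). P z \<Longrightarrow> \<forall>\<^sub>F y in nhds x. P (\<Phi> y)"
  using tendsto_Phi by (rule eventually_compose_filterlim[rotated])

lemma hol_at_coord_Phi: "hol_at A x (\<lambda>y. coord B (\<Phi> x) (\<Phi> y))"
proof -
  obtain U \<kappa> where c: "chart_at A x = (U, \<kappa>)" by fastforce
  have UA: "(U, \<kappa>) \<in> A" "x \<in> U" using X.chart_at[of x] c by auto
  obtain V \<mu> where d: "chart_at B (\<Phi> x) = (V, \<mu>)" by fastforce
  have VB: "(V, \<mu>) \<in> B" "\<Phi> x \<in> V" using Z.chart_at[of "\<Phi> x"] d by auto
  note U = X.atlasD[OF UA(1)]
  let ?S = "\<kappa> ` (U \<inter> \<Phi> -` V)"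
  have h: "(\<mu> \<circ> \<Phi> \<circ> inv_into U \<kappa>) holomorphic_on ?S"
    using hol UA(1) VB(1) unfolding hol_map_def by fastforce
  have "?S = \<kappa> ` U \<inter> inv_into U \<kappa> -` (\<Phi> -` V)"
    using homeomorphism_image1[OF U(3)] homeomorphism_image2[OF U(3)] homeomorphism_apply1[OF U(3)]
      homeomorphism_apply2[OF U(3)] by (fastforce simp: image_iff)
  moreover have "open (\<kappa> ` U \<inter> inv_into U \<kappa> -` (\<Phi> -` V))"
    using U homeomorphism_cont2[OF U(3)] open_vimage_Phi[OF Z.atlasD(1)[OF VB(1)]]
    by (intro continuous_open_preimage) auto
  ultimately have o: "open ?S" by simp
  have "\<kappa> x \<in> ?S" using UA VB by auto
  then have "(\<mu> \<circ> \<Phi> \<circ> inv_into U \<kappa>) analytic_on {\<kappa> x}" using h o analytic_at by blast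
  then have "((\<mu> \<circ> \<Phi> \<circ> inv_into U \<kappa>) \<circ> (\<lambda>u. u + \<kappa> x)) analytic_on {0}"
    by (intro analytic_on_compose) (auto intro!: analytic_intros)
  then have "(\<lambda>u. ((\<mu> \<circ> \<Phi> \<circ> inv_into U \<kappa>) \<circ> (\<lambda>u. u + \<kappa> x)) u - \<mu> (\<Phi> x)) analytic_on {0}"
    by (intro analytic_intros)
  then show ?thesis unfolding X.hol_at_iff
    by (simp add: o_def para_def c coord_def d)
qed

lemma hol_at_Phi:
  assumes "hol_at B (\<Phi> x) a"
  shows "hol_at A x (\<lambda>y. a (\<Phi> y))"
proof -
  obtain F where F: "F analytic_on {0}" "\<forall>\<^sub>F z in nhds (\<Phi> x). a z = F (coord B (\<Phi> x) z)"
    using assms by (rule Z.hol_at_coordE)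
  have "hol_at A x (\<lambda>y. F (coord B (\<Phi> x) (\<Phi> y)))"
    by (rule X.hol_at_compose[OF _ hol_at_coord_Phi]) (simp add: F(1) Z.eventually_coord)
  moreover have "\<forall>\<^sub>F y in nhds x. a (\<Phi> y) = F (coord B (\<Phi> x) (\<Phi> y))"
    by (rule eventually_nhds_Phi[OF F(2)])
  ultimately show ?thesis using X.hol_at_cong[of "\<lambda>y. a (\<Phi> y)" "\<lambda>y. F (coord B (\<Phi> x) (\<Phi> y))" x] by simp
qed

lemma eventually_coord_zero: "\<forall>\<^sub>F y in nhds x. coord B (\<Phi> x) (\<Phi> y) = 0 \<longleftrightarrow> \<Phi> y = \<Phi> x"
  using eventually_nhds_Phi[OF Z.eventually_coord(1), of x]
  by eventually_elim (metis Z.eventually_coord(3,4))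

text \<open>The set \<open>C\<close> of points near which \<open>\<Phi>\<close> is constant is open
  and, by the identity theorem, closed. If it had a point, it would be the whole connected surface
  and \<open>\<Phi>\<close> would be constant.\<close>

lemma not_locally_constant: "\<not> (\<forall>\<^sub>F y in nhds x. \<Phi> y = \<Phi> x)"
proof
  define C where "C = {x. \<forall>\<^sub>F y in nhds x. \<Phi> y = \<Phi> x}"
  assume "\<forall>\<^sub>F y in nhds x. \<Phi> y = \<Phi> x"
  then have "x \<in> C" by (simp add: C_def)
  have openC: "open C"
  proof (subst open_subopen, intro ballI)
    fix y assume "y \<in> C"
    then have e: "\<forall>\<^sub>F y' in nhds y. \<Phi> y' = \<Phi> y" by (simp add: C_def)
    then have "\<forall>\<^sub>F y' in nhds y. \<forall>\<^sub>F y'' in nhds y'. \<Phi> y'' = \<Phi> y" by (rule X.eventually_nearby_nhds)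
    then have "\<forall>\<^sub>F y' in nhds y. y' \<in> C" using e by eventually_elim (simp add: C_def)
    then show "\<exists>T. open T \<and> y \<in> T \<and> T \<subseteq> C" unfolding eventually_nhds by auto
  qed
  moreover have "open (- C)"
  proof (subst open_subopen, intro ballI)
    fix y assume y: "y \<in> - C"
    define f where "f = (\<lambda>y'. coord B (\<Phi> y) (\<Phi> y')) \<circ> para A y"
    have "f analytic_on {0}" using hol_at_coord_Phi[of y] unfolding f_def X.hol_at_iff .
    then obtain s where s: "s > 0" "f holomorphic_on ball 0 s" by (auto simp: analytic_on_def)
    obtain V t where V: "local_coord B (\<Phi> y) V t (coord B (\<Phi> y)) (para B (\<Phi> y))"
      using Z.coord_local_coord by blast
    note DV = local_coordD[OF V]
    obtain W r where W: "local_coord A y W r (coord A y) (para A y)" "W \<subseteq> \<Phi> -` V"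
      using X.obtain_coord[of "\<Phi> -` V" y] open_vimage_Phi DV(1,2) by auto
    define q where "q = min r s"
    have q: "0 < q" "q \<le> r" using s local_coordD(4)[OF W(1)] by (auto simp: q_def)
    let ?W = "{y'\<in>W. coord A y y' \<in> ball 0 q}"
    have W': "local_coord A y ?W q (coord A y) (para A y)" by (rule local_coord_restrict[OF W(1) q])
    note D = local_coordD[OF W']
    \<comment> \<open>If a point \<open>y'\<close> of the disc were in \<open>C\<close>, then
      \<open>f\<close> would be constant near it, hence on the whole disc by analytic continuation,
      and the centre \<open>y\<close> would lie in \<open>C\<close>.\<close>
    have "?W \<subseteq> - C"
    proof
      fix y' assume y': "y' \<in> ?W"
      show "y' \<in> - C"
      proof
        assume "y' \<in> C"
        then have "\<forall>\<^sub>F u in nhds (coord A y y'). \<Phi> (para A y u) = \<Phi> y'"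
          using local_coord_eventually(1)[OF W' y', of "\<lambda>a. \<Phi> a = \<Phi> y'"] by (simp add: C_def)
        then have "\<forall>\<^sub>F u in nhds (coord A y y'). f u = f (coord A y y')"
          by eventually_elim (use D(7) y' in \<open>simp add: f_def\<close>)
        then obtain S where S: "open S" "coord A y y' \<in> S" "\<And>u. u \<in> S \<Longrightarrow> f u = f (coord A y y')"
          unfolding eventually_nhds by blast
        have cs: "coord A y y' \<in> ball 0 q" using y' by auto
        have "f holomorphic_on ball 0 q" using s(2) by (rule holomorphic_on_subset) (auto simp: q_def)
        have "f u = f (coord A y y')" if "u \<in> ball 0 q" for u
        proof (rule analytic_continuation_open[of "S \<inter> ball 0 q" "ball 0 q" f "\<lambda>_. f (coord A y y')" u])
          show "S \<inter> ball 0 q \<noteq> {}" using S(2) cs by blast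
          show "open (S \<inter> ball 0 q)" using S(1) by (intro open_Int open_ball)
        qed (use \<open>f holomorphic_on ball 0 q\<close> S(3) that in auto)
        then have "f u = f 0" if "u \<in> ball 0 q" for u using that q(1) by simp
        moreover have "f 0 = 0" by (simp add: f_def X.eventually_coord Z.eventually_coord)
        ultimately have f0: "f u = 0" if "u \<in> ball 0 q" for u using that by simp
        have "\<Phi> y'' = \<Phi> y" if y'': "y'' \<in> ?W" for y''
        proof -
          have "f (coord A y y'') = 0" using f0 y'' by simp
          then have "coord B (\<Phi> y) (\<Phi> y'') = 0" using D(7)[OF y''] by (simp add: f_def)
          moreover have "\<Phi> y'' \<in> V" using y'' W(2) by auto
          ultimately show ?thesis using DV(6,7) by metis
        qed
        moreover have "\<forall>\<^sub>F y'' in nhds y. y'' \<in> ?W" using D(1,2) by (intro eventually_nhds_in_open)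
        ultimately have "y \<in> C" unfolding C_def by (auto elim: eventually_mono)
        then show False using y by simp
      qed
    qed
    then show "\<exists>T. open T \<and> y \<in> T \<and> T \<subseteq> - C" using D(1,2) by blast
  qed
  moreover have "connected (UNIV :: 'x set)" using X.surface unfolding riemann_surface_def by blast
  ultimately have "C = UNIV" using \<open>x \<in> C\<close> connectedD[of UNIV C "- C"] by blast
  then have "\<forall>a\<in>UNIV. \<forall>\<^sub>F b in at a within UNIV. \<Phi> a = \<Phi> b"
    unfolding C_def by (auto simp: eventually_nhds_conv_at eq_commute)
  then have "\<Phi> a = \<Phi> x" for a
    using connected_local_const[of UNIV a x \<Phi>] \<open>connected UNIV\<close> by auto
  then show False using nonconst by blast
qed

text \<open>In the coordinate \<open>coord A x\<close> the map is \<open>g u * u ^ m\<close> with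
  \<open>g 0 \<noteq> 0\<close>. A root \<open>\<gamma>\<close> of \<open>g\<close> turns this into
  \<open>(u * \<gamma> u) ^ m\<close>, and \<open>u * \<gamma> u\<close> is a coordinate because its
  derivative at 0 is \<open>\<gamma> 0 \<noteq> 0\<close>.\<close>

lemma normal_form:
  assumes Q: "open Q" "x \<in> Q"
  obtains W r \<omega> \<theta> where "local_coord A x W r \<omega> \<theta>" "W \<subseteq> Q"
    "\<And>y. y \<in> W \<Longrightarrow> coord B (\<Phi> x) (\<Phi> y) = \<omega> y ^ mult A B \<Phi> x" "mult A B \<Phi> x > 0"
proof -
  define f where "f = (\<lambda>y'. coord B (\<Phi> x) (\<Phi> y')) \<circ> para A x"
  have f: "f analytic_on {0}" using hol_at_coord_Phi[of x] unfolding f_def X.hol_at_iff .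
  have f0: "f 0 = 0" by (simp add: f_def X.eventually_coord Z.eventually_coord)
  obtain U \<kappa> where c: "chart_at A x = (U, \<kappa>)" by fastforce
  have "mult A B \<Phi> x = nat (zorder (\<lambda>w. coord B (\<Phi> x) (\<Phi> (inv_into U \<kappa> w))) (\<kappa> x))"
    by (simp add: mult_def c)
  \<comment> \<open>\<open>mult\<close> takes the order in the chart itself, at
    \<open>\<kappa> x\<close>; here it is moved to the origin.\<close>
  also have "\<dots> = nat (zorder f 0)"
    by (subst zorder_shift) (simp add: f_def para_def c o_def)
  finally have m: "mult A B \<Phi> x = nat (zorder f 0)" .
  have "\<not> (\<forall>\<^sub>F u in nhds 0. f u = 0)"
  proof
    assume "\<forall>\<^sub>F u in nhds 0. f u = 0"
    then have "\<forall>\<^sub>F y in nhds x. coord B (\<Phi> x) (\<Phi> y) = 0"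
      unfolding f_def X.eventually_nhds_iff[of _ x] by simp
    then have "\<forall>\<^sub>F y in nhds x. \<Phi> y = \<Phi> x"
      using eventually_coord_zero[of x] by eventually_elim simp
    then show False using not_locally_constant by blast
  qed
  then obtain g where g: "g analytic_on {0}" "g 0 \<noteq> 0" "\<forall>\<^sub>F u in nhds 0. f u = g u * u ^ mult A B \<Phi> x"
    and mpos: "mult A B \<Phi> x > 0"
    using locally_nonzero_or_zero[OF f] f0 m by auto
  obtain \<gamma> where \<gamma>: "\<gamma> analytic_on {0}" "\<gamma> 0 \<noteq> 0" "\<forall>\<^sub>F u in nhds 0. g u = \<gamma> u ^ mult A B \<Phi> x"
    using analytic_nth_root[OF g(1,2) mpos] by blast
  define h where "h = (\<lambda>u. u * \<gamma> u)"
  have h: "h analytic_on {0}" unfolding h_def using \<gamma>(1) by (intro analytic_intros)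
  have fh: "\<forall>\<^sub>F u in nhds 0. f u = h u ^ mult A B \<Phi> x"
    using g(3) \<gamma>(3) by eventually_elim (simp add: h_def power_mult_distrib)
  have "(\<gamma> has_field_derivative deriv \<gamma> 0) (at 0)"
    using \<gamma>(1) analytic_on_imp_differentiable_at field_differentiable_derivI by blast
  then have "(h has_field_derivative (1 * \<gamma> 0 + deriv \<gamma> 0 * 0)) (at 0)"
    unfolding h_def by (rule DERIV_mult[OF DERIV_ident])
  then have dh: "deriv h 0 \<noteq> 0" using \<gamma>(2) DERIV_imp_deriv by fastforce
  obtain S where S: "open S" "0 \<in> S" "h holomorphic_on S" using h by (auto simp: analytic_at)
  obtain s where s: "s > 0" "ball 0 s \<subseteq> S" "inj_on h (ball 0 s)"
    using has_complex_derivative_locally_injective[OF S(3,2,1) dh] by blast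
  obtain t where t: "t > 0" "\<And>u. cmod u < t \<Longrightarrow> f u = h u ^ mult A B \<Phi> x"
    using fh unfolding eventually_nhds_metric by (auto simp: dist_norm)
  obtain W0 r0 where W0: "local_coord A x W0 r0 (coord A x) (para A x)" "W0 \<subseteq> Q"
    using X.obtain_coord[OF Q] by blast
  define q where "q = min s (min t r0)"
  have q: "0 < q" "q \<le> r0" "q \<le> s" "q \<le> t"
    using s(1) t(1) local_coordD(4)[OF W0(1)] by (auto simp: q_def)
  let ?W = "{y\<in>W0. coord A x y \<in> ball 0 q}"
  have W1: "local_coord A x ?W q (coord A x) (para A x)"
    by (rule local_coord_restrict[OF W0(1) q(1,2)])
  have sub: "ball 0 q \<subseteq> ball (0::complex) s" using q by auto
  obtain W r \<theta> where W: "local_coord A x W r (\<lambda>y. h (coord A x y)) \<theta>" "W \<subseteq> ?W"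
  proof (rule X.local_coord_change[OF W1, of h q])
    show "h holomorphic_on ball 0 q" using S(3) by (rule holomorphic_on_subset) (use s(2) sub in blast)
    show "inj_on h (ball 0 q)" using s(3) sub by (rule inj_on_subset)
  qed (use q in \<open>auto simp: h_def\<close>)
  show thesis
  proof (rule that[OF W(1)])
    show "W \<subseteq> Q" using W(2) W0(2) by auto
    fix y assume "y \<in> W"
    then have y: "y \<in> ?W" using W(2) by blast
    then have "f (coord A x y) = h (coord A x y) ^ mult A B \<Phi> x" using q(4) by (intro t(2)) auto
    then show "coord B (\<Phi> x) (\<Phi> y) = h (coord A x y) ^ mult A B \<Phi> x"
      using local_coordD(7)[OF W1 y] by (simp add: f_def)
  qed (rule mpos)
qed

lemma mult_pos: "mult A B \<Phi> x > 0"
  by (rule normal_form[of UNIV x]) auto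

section \<open>Fibres, multiplicities and ramification\<close>

lemma eventually_Phi_neq: "\<forall>\<^sub>F y in at x. \<Phi> y \<noteq> \<Phi> x"
proof -
  obtain W r \<omega> \<theta> where W: "local_coord A x W r \<omega> \<theta>"
    "\<And>y. y \<in> W \<Longrightarrow> coord B (\<Phi> x) (\<Phi> y) = \<omega> y ^ mult A B \<Phi> x"
    by (rule normal_form[of UNIV x]) auto
  note D = local_coordD[OF W(1)]
  have "\<forall>\<^sub>F y in at x. y \<in> W \<and> y \<noteq> x"
    using D(1,2) unfolding eventually_at_topological by blast
  then show ?thesis
  proof eventually_elim
    case (elim y)
    then have "\<omega> y \<noteq> 0" using D(6,7) by metis
    then show ?case using W(2)[of y] elim Z.eventually_coord(3)[of "\<Phi> x"] by (metis power_not_zero)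
  qed
qed

text \<open>Near \<open>x\<close> but off \<open>x\<close> the map avoids the value
  \<open>\<Phi> x\<close>, so punctured neighbourhoods pull back to punctured
  neighbourhoods.\<close>

lemma eventually_at_Phi:
  assumes "\<forall>\<^sub>F z in at (\<Phi> x). P z"
  shows "\<forall>\<^sub>F y in at x. P (\<Phi> y)"
proof -
  have "\<forall>\<^sub>F y in nhds x. \<Phi> y \<noteq> \<Phi> x \<longrightarrow> P (\<Phi> y)"
    using eventually_nhds_Phi[of "\<lambda>z. z \<noteq> \<Phi> x \<longrightarrow> P z" x] assms by (simp add: eventually_at_filter)
  then have "\<forall>\<^sub>F y in at x. \<Phi> y \<noteq> \<Phi> x \<longrightarrow> P (\<Phi> y)" by (simp add: eventually_nhds_conv_at)
  then show ?thesis using eventually_Phi_neq[of x] by eventually_elim simp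
qed

lemma finite_fibre: "finite {x. \<Phi> x = z}"
proof (rule X.compact_finite[OF compact_X])
  fix x
  show "\<forall>\<^sub>F y in at x. \<Phi> y \<noteq> z"
  proof (cases "\<Phi> x = z")
    case True
    then show ?thesis using eventually_Phi_neq[of x] by simp
  next
    case False
    then have "\<forall>\<^sub>F y in nhds x. \<Phi> y \<noteq> z"
      using Z.eventually_not_mem_finite(2)[of "{z}" "\<Phi> x"] by (intro eventually_nhds_Phi) auto
    then show ?thesis by (simp add: eventually_nhds_conv_at)
  qed
qed

text \<open>A continuous map from a compact space to a Hausdorff space is closed: the complement of
  the open set where \<open>P\<close> holds near by has a closed image, which misses
  \<open>z\<close>. Local statements at the preimages thereby become statements about whole nearby
  fibres.\<close>

lemma eventually_nhds_fibre:
  assumes "\<And>x. \<Phi> x = z \<Longrightarrow> \<forall>\<^sub>F y in nhds x. P y"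
  shows "\<forall>\<^sub>F z' in nhds z. \<forall>y. \<Phi> y = z' \<longrightarrow> P y"
proof -
  define S where "S = \<Union>{T. open T \<and> (\<forall>y\<in>T. P y)}"
  have S: "open S" "\<And>y. y \<in> S \<Longrightarrow> P y" unfolding S_def by auto
  have z: "x \<in> S" if "\<Phi> x = z" for x using assms[OF that] unfolding S_def eventually_nhds by auto
  have "closed (- S)" using S(1) by (simp add: closed_Compl)
  then have "compact (- S)" using compact_Int_closed[OF compact_X, of "- S"] by simp
  then have "compact (\<Phi> ` (- S))"
    using continuous by (intro compact_continuous_image) (auto intro: continuous_on_subset)
  then have "open (- (\<Phi> ` (- S)))" by (simp add: compact_imp_closed open_Compl)
  moreover have "z \<in> - (\<Phi> ` (- S))" using z by auto
  ultimately have "\<forall>\<^sub>F z' in nhds z. z' \<in> - (\<Phi> ` (- S))" by (rule eventually_nhds_in_open)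
  then show ?thesis by eventually_elim (use S(2) in auto)
qed

lemma eventually_at_fibre:
  assumes "\<And>x. \<Phi> x = z \<Longrightarrow> \<forall>\<^sub>F y in at x. P y"
  shows "\<forall>\<^sub>F z' in at z. \<forall>y. \<Phi> y = z' \<longrightarrow> P y"
proof -
  have "\<forall>\<^sub>F z' in nhds z. \<forall>y. \<Phi> y = z' \<longrightarrow> \<Phi> y \<noteq> z \<longrightarrow> P y"
  proof (rule eventually_nhds_fibre)
    fix x assume x: "\<Phi> x = z"
    have "\<forall>\<^sub>F y in at x. \<Phi> y \<noteq> z \<longrightarrow> P y" using assms[OF x] by eventually_elim simp
    then show "\<forall>\<^sub>F y in nhds x. \<Phi> y \<noteq> z \<longrightarrow> P y" using x by (simp add: eventually_nhds_conv_at)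
  qed
  then show ?thesis unfolding eventually_at_filter by eventually_elim auto
qed

text \<open>For an \<open>m\<close>-th root of unity \<open>e \<noteq> 1\<close>, the points with
  coordinates \<open>u\<close> and \<open>e * u\<close> have the same image.\<close>

lemma not_locally_injective:
  assumes m: "mult A B \<Phi> x > 1" and Q: "open Q" "x \<in> Q"
  shows "\<not> inj_on \<Phi> Q"
proof
  assume inj: "inj_on \<Phi> Q"
  obtain V t where V: "local_coord B (\<Phi> x) V t (coord B (\<Phi> x)) (para B (\<Phi> x))"
    using Z.coord_local_coord by blast
  note DV = local_coordD[OF V]
  have Q': "open (Q \<inter> \<Phi> -` V)" "x \<in> Q \<inter> \<Phi> -` V" using Q DV(1,2) open_vimage_Phi by auto
  obtain W r \<omega> \<theta> where W: "local_coord A x W r \<omega> \<theta>" "W \<subseteq> Q \<inter> \<Phi> -` V"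
    "\<And>y. y \<in> W \<Longrightarrow> coord B (\<Phi> x) (\<Phi> y) = \<omega> y ^ mult A B \<Phi> x"
    using normal_form[OF Q'] by metis
  note D = local_coordD[OF W(1)]
  define u where "u = complex_of_real (r / 2)"
  have u: "u \<noteq> 0" "cmod u < r" using D(4) by (auto simp: u_def)
  have "card {w. w ^ mult A B \<Phi> x = (1::complex)} = mult A B \<Phi> x" using m by (intro nth_roots) auto
  then have "\<not> {w. w ^ mult A B \<Phi> x = (1::complex)} \<subseteq> {1}"
    using m card_mono[of "{1::complex}" "{w. w ^ mult A B \<Phi> x = (1::complex)}"] by auto
  then obtain e :: complex where e: "e ^ mult A B \<Phi> x = 1" "e \<noteq> 1" by blast
  have "cmod e = 1" using e(1) m by (metis power_eq_1_iff less_nat_zero_code)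
  then have eu: "cmod (e * u) < r" using u by (simp add: norm_mult)
  have "coord B (\<Phi> x) (\<Phi> (\<theta> u)) = coord B (\<Phi> x) (\<Phi> (\<theta> (e * u)))"
    using W(3)[OF D(9)[OF u(2)]] W(3)[OF D(9)[OF eu]] D(8)[OF u(2)] D(8)[OF eu] e(1)
    by (simp add: power_mult_distrib)
  moreover have "\<Phi> (\<theta> u) \<in> V" "\<Phi> (\<theta> (e * u)) \<in> V" "\<theta> u \<in> Q" "\<theta> (e * u) \<in> Q"
    using W(2) D(9)[OF u(2)] D(9)[OF eu] by auto
  ultimately have "\<theta> u = \<theta> (e * u)" using DV(11) inj by (auto simp: inj_on_def)
  then have "u = e * u" using D(8)[OF u(2)] D(8)[OF eu] by metis
  then show False using u(1) e(2) by simp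
qed

text \<open>The order at \<open>y\<close> need not be computed in the chart at \<open>y\<close>:
  since \<open>w ^ m\<close> is injective near the nonzero value \<open>\<omega> y\<close>, the map
  is injective near \<open>y\<close>, and this forces multiplicity 1.\<close>

lemma mult_nearby: "\<forall>\<^sub>F y in at x. mult A B \<Phi> y = 1"
proof -
  obtain W r \<omega> \<theta> where W: "local_coord A x W r \<omega> \<theta>"
    "\<And>y. y \<in> W \<Longrightarrow> coord B (\<Phi> x) (\<Phi> y) = \<omega> y ^ mult A B \<Phi> x" "mult A B \<Phi> x > 0"
    by (rule normal_form[of UNIV x]) auto
  note D = local_coordD[OF W(1)]
  have "\<forall>\<^sub>F y in at x. y \<in> W \<and> y \<noteq> x"
    using D(1,2) unfolding eventually_at_topological by blast
  then show ?thesis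
  proof eventually_elim
    case (elim y)
    then have nz: "\<omega> y \<noteq> 0" using D(6,7) by metis
    let ?m = "mult A B \<Phi> x"
    have "((\<lambda>w. w ^ ?m) has_field_derivative (of_nat ?m * \<omega> y ^ (?m - 1))) (at (\<omega> y))"
      by (auto intro!: derivative_eq_intros)
    then have "deriv (\<lambda>w. w ^ ?m) (\<omega> y) \<noteq> 0" using nz W(3) by (simp add: DERIV_imp_deriv)
    then obtain s where s: "s > 0" "inj_on (\<lambda>w. w ^ ?m) (ball (\<omega> y) s)"
      using has_complex_derivative_locally_injective[of "\<lambda>w. w ^ ?m" UNIV "\<omega> y"] 
        holomorphic_on_power[OF holomorphic_on_ident, of ?m UNIV] by auto
    let ?Q = "{y'\<in>W. \<omega> y' \<in> ball (\<omega> y) s \<inter> ball 0 r}"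
    have "open ?Q" by (rule homeomorphism_subset_open[OF D(5,1)]) auto
    moreover have "y \<in> ?Q" using elim s(1) D(10) by auto
    moreover have "inj_on \<Phi> ?Q"
    proof (rule inj_onI)
      fix a b assume ab: "a \<in> ?Q" "b \<in> ?Q" "\<Phi> a = \<Phi> b"
      then have "\<omega> a ^ ?m = \<omega> b ^ ?m" using W(2) by (metis (no_types, lifting) mem_Collect_eq)
      then have "\<omega> a = \<omega> b" using s(2) ab by (auto simp: inj_on_def)
      then show "a = b" using D(7) ab by (metis (no_types, lifting) mem_Collect_eq)
    qed
    ultimately show ?case using not_locally_injective[of y ?Q] mult_pos[of y] by force
  qed
qed

lemma finite_ramification: "finite (ramification A B \<Phi>)"
  unfolding ramification_def
proof (rule X.compact_finite[OF compact_X])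
  show "\<forall>\<^sub>F y in at x. \<not> mult A B \<Phi> y > 1" for x
    using mult_nearby[of x] by eventually_elim simp
qed

text \<open>A neighbourhood of \<open>z\<close> over which \<open>\<Phi>\<close> is a disjoint union of power maps.\<close>

definition model ::
    "'z \<Rightarrow> 'z set \<Rightarrow> ('x \<Rightarrow> 'x set) \<Rightarrow> ('x \<Rightarrow> real) \<Rightarrow> ('x \<Rightarrow> 'x \<Rightarrow> complex) \<Rightarrow> ('x \<Rightarrow> complex \<Rightarrow> 'x) \<Rightarrow> bool" where
  "model z V W r \<omega> \<theta> \<longleftrightarrow> open V \<and> z \<in> V \<and> inj_on (coord B z) V \<and> \<Phi> -` V = (\<Union>x\<in>\<Phi> -` {z}. W x) \<and>
     (\<forall>x x'. \<Phi> x = z \<longrightarrow> \<Phi> x' = z \<longrightarrow> x \<noteq> x' \<longrightarrow> W x \<inter> W x' = {}) \<and>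
     (\<forall>x. \<Phi> x = z \<longrightarrow> local_coord A x (W x) (r x) (\<omega> x) (\<theta> x) \<and>
        (\<forall>y\<in>W x. coord B z (\<Phi> y) = \<omega> x y ^ mult A B \<Phi> x) \<and>
        (\<forall>z'\<in>V. bij_betw (\<omega> x) {y\<in>W x. \<Phi> y = z'} {w. w ^ mult A B \<Phi> x = coord B z z'}))"

lemma disjoint_neighbourhoods:
  assumes "finite S"
  obtains Q where "\<And>x. x \<in> S \<Longrightarrow> open (Q x) \<and> (x::'x) \<in> Q x"
    "\<And>x x'. x \<in> S \<Longrightarrow> x' \<in> S \<Longrightarrow> x \<noteq> x' \<Longrightarrow> Q x \<inter> Q x' = {}"
proof -
  have "\<forall>x x'. \<exists>U V. x \<noteq> x' \<longrightarrow> open U \<and> open V \<and> (x::'x) \<in> U \<and> x' \<in> V \<and> U \<inter> V = {}"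
    using hausdorff by metis
  then obtain U V where UV: "\<And>x x'. x \<noteq> x' \<Longrightarrow> open (U x x') \<and> open (V x x') \<and> (x::'x) \<in> U x x' \<and>
      x' \<in> V x x' \<and> U x x' \<inter> V x x' = {}"
    by metis
  \<comment> \<open>Both separating sets enter because the pair chosen for \<open>x\<close> and
    \<open>x'\<close> is unrelated to the one chosen for \<open>x'\<close> and
    \<open>x\<close>.\<close>
  define Q where "Q = (\<lambda>x. \<Inter>x'\<in>S - {x}. U x x' \<inter> V x' x)"
  show thesis
  proof (rule that[of Q])
    fix x assume "x \<in> S"
    have *: "x \<in> U x x' \<inter> V x' x" "open (U x x' \<inter> V x' x)" if "x' \<in> S - {x}" for x'
      using UV[of x x'] UV[of x' x] that by auto
    then have "open (Q x)" unfolding Q_def using assms * by (intro open_INT) auto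
    moreover have "x \<in> Q x" unfolding Q_def using * by blast
    ultimately show "open (Q x) \<and> x \<in> Q x" by simp
  next
    fix x x' assume "x \<in> S" "x' \<in> S" "x \<noteq> x'"
    then have "Q x \<subseteq> U x x'" "Q x' \<subseteq> V x x'" unfolding Q_def by auto
    then show "Q x \<inter> Q x' = {}" using UV[OF \<open>x \<noteq> x'\<close>] by blast
  qed
qed

text \<open>Closedness of the map puts the preimage of a small neighbourhood of \<open>z\<close>
  into the given discs. The radii are then matched, \<open>R\<close> downstairs and the
  \<open>m\<close>-th root of \<open>R\<close> upstairs, so that each disc upstairs contains every
  \<open>m\<close>-th root of a coordinate value taken on \<open>V\<close>.\<close>

lemma obtain_model:
  assumes O: "\<And>x. \<Phi> x = z \<Longrightarrow> open (O' x) \<and> x \<in> O' x" and P: "open P" "z \<in> P"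
  obtains V W r \<omega> \<theta> where "model z V W r \<omega> \<theta>" "\<And>x. \<Phi> x = z \<Longrightarrow> W x \<subseteq> O' x" "V \<subseteq> P"
proof -
  let ?m = "mult A B \<Phi>"
  obtain Q where "\<And>x. x \<in> {x. \<Phi> x = z} \<Longrightarrow> open (Q x) \<and> x \<in> Q x"
    "\<And>x x'. x \<in> {x. \<Phi> x = z} \<Longrightarrow> x' \<in> {x. \<Phi> x = z} \<Longrightarrow> x \<noteq> x' \<Longrightarrow> Q x \<inter> Q x' = {}"
    by (rule disjoint_neighbourhoods[OF finite_fibre[of z]]) blast
  note Q = this[unfolded mem_Collect_eq]
  obtain V1 R1 where V1: "local_coord B z V1 R1 (coord B z) (para B z)" "V1 \<subseteq> P"
    using Z.obtain_coord[OF P] by blast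
  note D1 = local_coordD[OF V1(1)]
  have "\<exists>W r \<omega> \<theta>. local_coord A x W r \<omega> \<theta> \<and> W \<subseteq> O' x \<inter> Q x \<inter> \<Phi> -` V1 \<and>
      (\<forall>y\<in>W. coord B z (\<Phi> y) = \<omega> y ^ ?m x)" if x: "\<Phi> x = z" for x
  proof -
    have "open (O' x \<inter> Q x \<inter> \<Phi> -` V1)" "x \<in> O' x \<inter> Q x \<inter> \<Phi> -` V1"
      using O[OF x] Q(1)[OF x] D1(1,2) open_vimage_Phi[of V1] x by auto
    then show ?thesis by (rule normal_form) (use x in blast)
  qed
  then obtain W0 r0 \<omega> \<theta> where W0: "\<And>x. \<Phi> x = z \<Longrightarrow> local_coord A x (W0 x) (r0 x) (\<omega> x) (\<theta> x)"
    "\<And>x. \<Phi> x = z \<Longrightarrow> W0 x \<subseteq> O' x \<inter> Q x \<inter> \<Phi> -` V1"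
    "\<And>x y. \<Phi> x = z \<Longrightarrow> y \<in> W0 x \<Longrightarrow> coord B z (\<Phi> y) = \<omega> x y ^ ?m x"
    by metis
  have "\<forall>\<^sub>F z' in nhds z. \<forall>y. \<Phi> y = z' \<longrightarrow> y \<in> (\<Union>x\<in>\<Phi> -` {z}. W0 x)"
  proof (rule eventually_nhds_fibre)
    fix x assume x: "\<Phi> x = z"
    have "\<forall>\<^sub>F y in nhds x. y \<in> W0 x"
      using local_coordD(1,2)[OF W0(1)[OF x]] by (intro eventually_nhds_in_open)
    then show "\<forall>\<^sub>F y in nhds x. y \<in> (\<Union>x\<in>\<Phi> -` {z}. W0 x)" by eventually_elim (use x in blast)
  qed
  then obtain V0 where V0: "open V0" "z \<in> V0" "\<And>y. \<Phi> y \<in> V0 \<Longrightarrow> y \<in> (\<Union>x\<in>\<Phi> -` {z}. W0 x)"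
    unfolding eventually_nhds by blast
  obtain V2 R2 where V2: "local_coord B z V2 R2 (coord B z) (para B z)" "V2 \<subseteq> V0" "V2 \<subseteq> V1"
    using local_coord_shrink[OF V1(1) V0(1,2)] by metis
  note D2 = local_coordD[OF V2(1)]
  \<comment> \<open>A coordinate value below \<open>r0 x ^ m\<close> has all its roots inside the
    original disc at \<open>x\<close>; the bound \<open>R2\<close> keeps the disc downstairs inside
    the range of its coordinate.\<close>
  define R where "R = Min (insert R2 ((\<lambda>x. r0 x ^ ?m x) ` {x. \<Phi> x = z}))"
  have R: "R \<le> R2" "\<And>x. \<Phi> x = z \<Longrightarrow> R \<le> r0 x ^ ?m x" "R > 0"
    using finite_fibre[of z] D2(4) local_coordD(4)[OF W0(1)] by (auto simp: R_def)
  define s where "s = (\<lambda>x. root (?m x) R)"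
  have s: "0 < s x" "s x \<le> r0 x" if x: "\<Phi> x = z" for x
  proof -
    show "0 < s x" unfolding s_def using R(3) mult_pos[of x] by simp
    have "s x \<le> root (?m x) (r0 x ^ ?m x)"
      unfolding s_def using R(2)[OF x] mult_pos[of x] by simp
    then show "s x \<le> r0 x"
      using local_coordD(4)[OF W0(1)[OF x]] mult_pos[of x] by (simp add: real_root_power_cancel)
  qed
  have pow: "cmod w < s x \<longleftrightarrow> cmod (w ^ ?m x) < R" for w x
  proof -
    have "cmod w < s x \<longleftrightarrow> root (?m x) (cmod w ^ ?m x) < root (?m x) R"
      unfolding s_def using mult_pos[of x] by (simp add: real_root_power_cancel del: real_root_less_iff)
    then show ?thesis using mult_pos[of x] by (simp add: norm_power)
  qed
  define V where "V = {z'\<in>V2. coord B z z' \<in> ball 0 R}"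
  define W where "W = (\<lambda>x. {y\<in>W0 x. \<omega> x y \<in> ball 0 (s x)})"
  have V: "local_coord B z V R (coord B z) (para B z)"
    unfolding V_def by (rule local_coord_restrict[OF V2(1) R(3,1)])
  note DV = local_coordD[OF V]
  have W: "local_coord A x (W x) (s x) (\<omega> x) (\<theta> x)" if x: "\<Phi> x = z" for x
    unfolding W_def by (rule local_coord_restrict[OF W0(1)[OF x] s[OF x]])
  have in_V: "\<Phi> y \<in> V \<longleftrightarrow> \<omega> x y \<in> ball 0 (s x)" if x: "\<Phi> x = z" and y: "y \<in> W0 x" for x y
  proof
    assume "\<Phi> y \<in> V"
    then show "\<omega> x y \<in> ball 0 (s x)" using W0(3)[OF x y] pow[of "\<omega> x y" x] by (simp add: V_def)
  next
    assume "\<omega> x y \<in> ball 0 (s x)"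
    then have c: "cmod (coord B z (\<Phi> y)) < R" using W0(3)[OF x y] pow[of "\<omega> x y" x] by simp
    have "\<Phi> y \<in> V1" using W0(2)[OF x] y by blast
    then have "\<Phi> y = para B z (coord B z (\<Phi> y))" using D1(7) by simp
    then show "\<Phi> y \<in> V" using DV(9)[OF c] by simp
  qed
  have vimage: "\<Phi> -` V = (\<Union>x\<in>\<Phi> -` {z}. W x)"
  proof (intro equalityI subsetI)
    fix y assume y: "y \<in> \<Phi> -` V"
    then have "\<Phi> y \<in> V0" using V2(2) by (auto simp: V_def)
    then obtain x where x: "\<Phi> x = z" "y \<in> W0 x" using V0(3) by blast
    then have "y \<in> W x" using in_V[OF x] y by (simp add: W_def)
    then show "y \<in> (\<Union>x\<in>\<Phi> -` {z}. W x)" using x(1) by blast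
  next
    fix y assume "y \<in> (\<Union>x\<in>\<Phi> -` {z}. W x)"
    then obtain x where x: "\<Phi> x = z" "y \<in> W0 x" "\<omega> x y \<in> ball 0 (s x)" unfolding W_def by blast
    then show "y \<in> \<Phi> -` V" using in_V[OF x(1,2)] by simp
  qed
  \<comment> \<open>The matched radii give surjectivity: a root of the coordinate of
    \<open>z'\<close> is the coordinate of some \<open>y\<close> in \<open>W x\<close>, and
    \<open>\<Phi> y = z'\<close> because \<open>coord B z\<close> is injective on
    \<open>V\<close>.\<close>
  have bij: "bij_betw (\<omega> x) {y\<in>W x. \<Phi> y = z'} {w. w ^ ?m x = coord B z z'}"
    if x: "\<Phi> x = z" and z': "z' \<in> V" for x z'
  proof (rule bij_betw_imageI)
    note D = local_coordD[OF W[OF x]]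
    show "inj_on (\<omega> x) {y\<in>W x. \<Phi> y = z'}" using D(11) by (rule inj_on_subset) auto
    show "\<omega> x ` {y\<in>W x. \<Phi> y = z'} = {w. w ^ ?m x = coord B z z'}"
    proof (intro equalityI subsetI)
      fix w assume "w \<in> \<omega> x ` {y\<in>W x. \<Phi> y = z'}"
      then obtain y where "y \<in> W0 x" "\<Phi> y = z'" "w = \<omega> x y" unfolding W_def by blast
      then show "w \<in> {w. w ^ ?m x = coord B z z'}" using W0(3)[OF x] by auto
    next
      fix w assume "w \<in> {w. w ^ ?m x = coord B z z'}"
      then have w: "w ^ ?m x = coord B z z'" by simp
      have "cmod (w ^ ?m x) < R" using DV(10)[OF z'] w by simp
      then have c: "cmod w < s x" using pow by blast
      define y where "y = \<theta> x w"
      have y: "y \<in> W x" "\<omega> x y = w" using D(8,9)[OF c] by (auto simp: y_def)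
      then have y0: "y \<in> W0 x" by (simp add: W_def)
      then have "coord B z (\<Phi> y) = coord B z z'" using W0(3)[OF x] y(2) w by simp
      moreover have "\<Phi> y \<in> V" using vimage y(1) x by blast
      ultimately have "\<Phi> y = z'" using DV(11) z' by (auto simp: inj_on_def)
      then show "w \<in> \<omega> x ` {y\<in>W x. \<Phi> y = z'}" using y by blast
    qed
  qed
  have "model z V W s \<omega> \<theta>"
    unfolding model_def
  proof (intro conjI allI impI ballI)
    fix x x' assume "\<Phi> x = z" "\<Phi> x' = z" "x \<noteq> x'"
    then show "W x \<inter> W x' = {}" using Q(2) W0(2) unfolding W_def by blast
  next
    fix x y assume "\<Phi> x = z" "y \<in> W x"
    then show "coord B z (\<Phi> y) = \<omega> x y ^ ?m x" using W0(3) by (simp add: W_def)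
  qed (use DV(1,2,11) vimage W bij in auto)
  moreover have "W x \<subseteq> O' x" if "\<Phi> x = z" for x using W0(2)[OF that] by (auto simp: W_def)
  moreover have "V \<subseteq> P" using V1(2) V2(3) by (auto simp: V_def)
  ultimately show thesis using that by blast
qed

end

lemma (in cover) modelD:
  assumes "model z V W r \<omega> \<theta>"
  shows "open V" "z \<in> V" "inj_on (coord B z) V"
    "\<And>y. \<Phi> y \<in> V \<Longrightarrow> \<exists>x. \<Phi> x = z \<and> y \<in> W x"
    "\<And>x y. \<Phi> x = z \<Longrightarrow> y \<in> W x \<Longrightarrow> \<Phi> y \<in> V"
    "\<And>x x' y. \<Phi> x = z \<Longrightarrow> \<Phi> x' = z \<Longrightarrow> y \<in> W x \<Longrightarrow> y \<in> W x' \<Longrightarrow> x = x'"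
    "\<And>x. \<Phi> x = z \<Longrightarrow> local_coord A x (W x) (r x) (\<omega> x) (\<theta> x)"
    "\<And>x y. \<Phi> x = z \<Longrightarrow> y \<in> W x \<Longrightarrow> coord B z (\<Phi> y) = \<omega> x y ^ mult A B \<Phi> x"
    "\<And>x z'. \<Phi> x = z \<Longrightarrow> z' \<in> V \<Longrightarrow>
       bij_betw (\<omega> x) {y\<in>W x. \<Phi> y = z'} {w. w ^ mult A B \<Phi> x = coord B z z'}"
  using assms unfolding model_def by blast+

context cover
begin

lemma model_fibre_sum:
  assumes M: "model z V W r \<omega> \<theta>" and z': "z' \<in> V"
  shows "(\<Sum>y | \<Phi> y = z'. f y) = (\<Sum>x | \<Phi> x = z. \<Sum>y | y \<in> W x \<and> \<Phi> y = z'. (f y :: 'c::comm_monoid_add))"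
proof -
  note D = modelD[OF M]
  have "{y. \<Phi> y = z'} = (\<Union>x\<in>{x. \<Phi> x = z}. {y. y \<in> W x \<and> \<Phi> y = z'})"
    using D(4) z' by blast
  moreover have "finite {y. y \<in> W x \<and> \<Phi> y = z'}" for x
    using finite_fibre[of z'] by (rule rev_finite_subset) auto
  moreover have "\<forall>x\<in>{x. \<Phi> x = z}. \<forall>x'\<in>{x. \<Phi> x = z}. x \<noteq> x' \<longrightarrow>
      {y. y \<in> W x \<and> \<Phi> y = z'} \<inter> {y. y \<in> W x' \<and> \<Phi> y = z'} = {}"
    using D(6) by blast
  ultimately show ?thesis
    using sum.UNION_disjoint[OF finite_fibre[of z], of "\<lambda>x. {y. y \<in> W x \<and> \<Phi> y = z'}" f] by simp
qed

lemma model_roots: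
  assumes M: "model z V W r \<omega> \<theta>" and "\<Phi> x = z" "z' \<in> V"
    and c: "coord B z z' \<noteq> 0 \<or> mult A B \<Phi> x = 1"
  shows "(\<Sum>y | y \<in> W x \<and> \<Phi> y = z'. f (\<omega> x y)) = (\<Sum>w | w ^ mult A B \<Phi> x = coord B z z'. f w)"
    "card {y. y \<in> W x \<and> \<Phi> y = z'} = mult A B \<Phi> x"
  using sum.reindex_bij_betw[OF modelD(9)[OF assms(1-3)], of f]
    bij_betw_same_card[OF modelD(9)[OF assms(1-3)]] nth_roots(2)[OF mult_pos c] by auto

lemma model_nonzero:
  assumes M: "model z V W r \<omega> \<theta>" and "z' \<in> V" "z' \<noteq> z"
  shows "coord B z z' \<noteq> 0"
  using modelD(2,3)[OF M] assms Z.eventually_coord(3)[of z] unfolding inj_on_def by metis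

text \<open>The degree of the map. Counting with multiplicity makes ramified fibres give the same
  number as the others.\<close>

definition sheets :: "'z \<Rightarrow> nat" where
  "sheets z = (\<Sum>x | \<Phi> x = z. mult A B \<Phi> x)"

text \<open>Each preimage of \<open>z\<close> splits over nearby points into as many unramified
  points as its multiplicity, so the count is locally constant on a connected surface. This gives
  the direct image one rank everywhere.\<close>

lemma sheets_constant: "sheets z = sheets z'"
proof -
  have "\<forall>\<^sub>F z' in at z. sheets z = sheets z'" for z
  proof -
    obtain V W r \<omega> \<theta> where M: "model z V W r \<omega> \<theta>"
      by (rule obtain_model[of z "\<lambda>_. UNIV" UNIV]) auto
    have "\<forall>\<^sub>F z' in at z. z' \<in> V \<and> z' \<noteq> z"
      using modelD(1,2)[OF M] unfolding eventually_at_topological by blast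
    moreover have "\<forall>\<^sub>F z' in at z. \<forall>y. \<Phi> y = z' \<longrightarrow> mult A B \<Phi> y = 1"
      by (rule eventually_at_fibre) (rule mult_nearby)
    ultimately show ?thesis
    proof eventually_elim
      case (elim z')
      then have "sheets z' = (\<Sum>y | \<Phi> y = z'. 1)" unfolding sheets_def by simp
      also have "\<dots> = (\<Sum>x | \<Phi> x = z. \<Sum>y | y \<in> W x \<and> \<Phi> y = z'. 1)"
        using elim by (intro model_fibre_sum[OF M]) simp
      also have "\<dots> = (\<Sum>x | \<Phi> x = z. card {y. y \<in> W x \<and> \<Phi> y = z'})" by simp
      also have "\<dots> = sheets z" unfolding sheets_def
        using elim model_nonzero[OF M] by (intro sum.cong) (auto simp: model_roots(2)[OF M])
      finally show ?case by simp
    qed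
  qed
  then show ?thesis
    using connected_local_const[of UNIV z z' sheets] Z.surface unfolding riemann_surface_def by simp
qed

text \<open>The \<open>m\<close>-th power of \<open>\<omega> x\<close> is the coordinate downstairs,
  so the parts of the power series decomposition are functions on the target. Germs at
  \<open>x\<close> are therefore combinations of the first \<open>m\<close> powers of
  \<open>\<omega> x\<close> over germs at \<open>z\<close>.\<close>

lemma hol_at_decomposition:
  assumes M: "model z V W r \<omega> \<theta>" and x: "\<Phi> x = z" and h: "hol_at A x h"
  obtains a where "\<And>p. p < mult A B \<Phi> x \<Longrightarrow> hol_at B z (a p)"
    "\<forall>\<^sub>F y in nhds x. h y = (\<Sum>p<mult A B \<Phi> x. \<omega> x y ^ p * a p (\<Phi> y))"
proof -
  let ?m = "mult A B \<Phi> x"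
  note lc = modelD(7)[OF M x]
  note D = local_coordD[OF lc]
  have an: "(h \<circ> \<theta> x) analytic_on {0}" using local_coord_hol[OF lc D(2)] h D(3) by simp
  obtain H where H: "\<And>p. p < ?m \<Longrightarrow> H p analytic_on {0}"
    "\<forall>\<^sub>F w in nhds 0. (h \<circ> \<theta> x) w = (\<Sum>p<?m. w ^ p * H p (w ^ ?m))"
    by (rule analytic_power_decomposition[OF an mult_pos[of x]]) blast
  show thesis
  proof (rule that[of "\<lambda>p z'. H p (coord B z z')"])
    show "hol_at B z (\<lambda>z'. H p (coord B z z'))" if "p < ?m" for p
      by (rule Z.hol_at_compose[OF _ Z.hol_at_coord]) (use H(1)[OF that] Z.eventually_coord(3) in simp)
    have "\<forall>\<^sub>F w in nhds 0. w \<in> ball 0 (r x)" using D(4) by (intro eventually_nhds_in_open) auto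
    with H(2) have "\<forall>\<^sub>F w in nhds (\<omega> x x). h (\<theta> x w) =
        (\<Sum>p<?m. \<omega> x (\<theta> x w) ^ p * H p (coord B z (\<Phi> (\<theta> x w))))"
      unfolding D(3) by eventually_elim (use modelD(8)[OF M x] D(8,9) in auto)
    then show "\<forall>\<^sub>F y in nhds x. h y = (\<Sum>p<?m. \<omega> x y ^ p * H p (coord B z (\<Phi> y)))"
      by (simp add: local_coord_eventually(1)[OF lc D(2)])
  qed
qed

lemma model_hol_at:
  assumes M: "model z V W r \<omega> \<theta>" and x: "\<Phi> x = z" and y: "y \<in> W x"
  shows "hol_at A y (\<omega> x)"
proof -
  note lc = modelD(7)[OF M x]
  note D = local_coordD[OF lc]
  have "\<forall>\<^sub>F w in nhds (\<omega> x y). w \<in> ball 0 (r x)"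
    using D(10)[OF y] by (intro eventually_nhds_in_open) auto
  then have "\<forall>\<^sub>F w in nhds (\<omega> x y). (\<omega> x \<circ> \<theta> x) w = w" by eventually_elim (use D(8) in auto)
  moreover have "(\<lambda>w. w) analytic_on {\<omega> x y}" by simp
  ultimately have "(\<omega> x \<circ> \<theta> x) analytic_on {\<omega> x y}" by (simp add: analytic_at_cong)
  then show ?thesis using local_coord_hol[OF lc y] by simp
qed

text \<open>Each of the two coordinates is a holomorphic multiple of the other. The two factors have
  product 1 off \<open>x\<close>, hence also at \<open>x\<close>, so they do not vanish
  there.\<close>

lemma model_coord_unit:
  assumes M: "model z V W r \<omega> \<theta>" and x: "\<Phi> x = z"
  obtains g where "hol_at A x g" "g x \<noteq> 0" "\<forall>\<^sub>F y in nhds x. \<omega> x y = coord A x y * g y"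
proof -
  note lc = modelD(7)[OF M x]
  note D = local_coordD[OF lc]
  obtain g where g: "hol_at A x g" "\<forall>\<^sub>F y in nhds x. \<omega> x y = coord A x y * g y"
    using X.hol_at_factor[OF model_hol_at[OF M x D(2)] D(3)] by blast
  have "(coord A x \<circ> \<theta> x) analytic_on {0}"
    using X.hol_at_coord[of x] local_coord_hol[OF lc D(2), of "coord A x"] D(3) by simp
  moreover have "(coord A x \<circ> \<theta> x) 0 = 0" using D(6) X.eventually_coord(3) by simp
  ultimately obtain S where S: "open S" "0 \<in> S" "(coord A x \<circ> \<theta> x) holomorphic_on S"
    by (auto simp: analytic_at)
  define G where "G = (\<lambda>w. if w = 0 then deriv (coord A x \<circ> \<theta> x) 0
      else ((coord A x \<circ> \<theta> x) w - (coord A x \<circ> \<theta> x) 0) / (w - 0))"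
  have "G holomorphic_on S" unfolding G_def using pole_lemma_open[OF S(3,1), of 0] .
  then have "G analytic_on {0}" using S by (auto simp: analytic_at)
  then have hG: "hol_at A x (\<lambda>y. G (\<omega> x y))"
    using X.hol_at_compose[of G "\<omega> x" x] model_hol_at[OF M x D(2)] D(3) by simp
  have "\<forall>\<^sub>F y in nhds x. y \<in> W x" using D(1,2) by (intro eventually_nhds_in_open)
  then have "\<forall>\<^sub>F y in nhds x. coord A x y = \<omega> x y * G (\<omega> x y)"
  proof eventually_elim
    case (elim y)
    then have "\<omega> x y = 0 \<Longrightarrow> y = x" using D(6,7) by metis
    then show ?case
      using D(3,6) D(7)[OF elim] X.eventually_coord(3)[of x] by (cases "\<omega> x y = 0") (auto simp: G_def)
  qed
  then have ev: "\<forall>\<^sub>F y in at x. coord A x y = \<omega> x y * G (\<omega> x y)"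
    by (simp add: eventually_nhds_conv_at)
  have "\<forall>\<^sub>F y in at x. \<omega> x y = coord A x y * g y" using g(2) by (simp add: eventually_nhds_conv_at)
  then have "\<forall>\<^sub>F y in at x. g y * G (\<omega> x y) = 1"
    using ev X.coord_nonzero[of x]
  proof eventually_elim
    case (elim y)
    then have "coord A x y * (g y * G (\<omega> x y)) = coord A x y * 1"
      by (metis mult.assoc mult.right_neutral)
    moreover have "coord A x y \<noteq> 0" by fact
    ultimately show ?case using mult_left_cancel by blast
  qed
  then have "g x * G (\<omega> x x) = 1"
    using X.hol_at_unique(2)[OF X.hol_at_mult[OF g(1) hG] X.hol_at_const] by simp
  then have "g x \<noteq> 0" by auto
  then show thesis using that g by blast
qed

lemma zO_model:
  assumes M: "model z V W r \<omega> \<theta>" and x: "\<Phi> x = z"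
  shows "h \<in> zO A x n \<longleftrightarrow> (\<exists>g. hol_at A x g \<and> (\<forall>\<^sub>F y in at x. h y = \<omega> x y powi n * g y))"
proof -
  obtain u where u: "hol_at A x u" "u x \<noteq> 0" "\<forall>\<^sub>F y in nhds x. \<omega> x y = coord A x y * u y"
    using model_coord_unit[OF M x] by blast
  have u3: "\<forall>\<^sub>F y in at x. \<omega> x y = coord A x y * u y \<and> u y \<noteq> 0"
    using u(3) X.hol_at_eventually_nonzero[OF u(1,2)] by (simp add: eventually_nhds_conv_at eventually_conj_iff)
  show ?thesis
  proof
    assume "h \<in> zO A x n"
    then obtain g where g: "hol_at A x g" "\<forall>\<^sub>F y in at x. h y = coord A x y powi n * g y"
      by (rule X.zOE)
    have "\<forall>\<^sub>F y in at x. h y = \<omega> x y powi n * (u y powi (- n) * g y)"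
      using g(2) u3
      by eventually_elim (simp add: power_int_mult_distrib power_int_minus)
    then show "\<exists>g. hol_at A x g \<and> (\<forall>\<^sub>F y in at x. h y = \<omega> x y powi n * g y)"
      using X.hol_at_mult[OF X.hol_at_powi[OF u(1,2)] g(1)] by blast
  next
    assume "\<exists>g. hol_at A x g \<and> (\<forall>\<^sub>F y in at x. h y = \<omega> x y powi n * g y)"
    then obtain g where g: "hol_at A x g" "\<forall>\<^sub>F y in at x. h y = \<omega> x y powi n * g y" by blast
    have "\<forall>\<^sub>F y in at x. h y = coord A x y powi n * (u y powi n * g y)"
      using g(2) u3 by eventually_elim (simp add: power_int_mult_distrib)
    then show "h \<in> zO A x n"
      using X.zOI[OF X.hol_at_mult[OF X.hol_at_powi[OF u(1,2)] g(1)]] by blast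
  qed
qed

lemma zO_Phi:
  assumes "h \<in> zO B (\<Phi> x) n"
  shows "(\<lambda>y. h (\<Phi> y)) \<in> zO A x (int (mult A B \<Phi> x) * n)"
proof -
  obtain V W r \<omega> \<theta> where M: "model (\<Phi> x) V W r \<omega> \<theta>"
    by (rule obtain_model[of "\<Phi> x" "\<lambda>_. UNIV" UNIV]) auto
  note D = local_coordD[OF modelD(7)[OF M refl]]
  obtain g where g: "hol_at B (\<Phi> x) g" "\<forall>\<^sub>F z in at (\<Phi> x). h z = coord B (\<Phi> x) z powi n * g z"
    using assms by (rule Z.zOE)
  have "\<forall>\<^sub>F y in nhds x. y \<in> W x" using D(1,2) by (intro eventually_nhds_in_open)
  then have "\<forall>\<^sub>F y in at x. y \<in> W x" by (simp add: eventually_nhds_conv_at)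
  then have "\<forall>\<^sub>F y in at x. h (\<Phi> y) = \<omega> x y powi (int (mult A B \<Phi> x) * n) * g (\<Phi> y)"
    using eventually_at_Phi[OF g(2)]
    by eventually_elim (simp add: modelD(8)[OF M refl] power_int_mult)
  then show ?thesis unfolding zO_model[OF M refl] using hol_at_Phi[OF g(1)] by blast
qed

section \<open>The trace of a function\<close>

definition trace :: "('x \<Rightarrow> complex) \<Rightarrow> 'z \<Rightarrow> complex" where
  "trace h z = (\<Sum>y | \<Phi> y = z. h y)"

text \<open>Without ramification only \<open>p = 0\<close> occurs in the decomposition: near each
  preimage \<open>x\<close> the function is the pullback of some \<open>a x\<close>, and the trace
  is the sum of the \<open>a x\<close>.\<close>

lemma hol_at_trace:
  assumes m: "\<And>x. \<Phi> x = z \<Longrightarrow> mult A B \<Phi> x = 1" and h: "\<And>x. \<Phi> x = z \<Longrightarrow> hol_at A x h"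
  shows "hol_at B z (trace h)"
proof -
  obtain V W r \<omega> \<theta> where M: "model z V W r \<omega> \<theta>"
    by (rule obtain_model[of z "\<lambda>_. UNIV" UNIV]) auto
  have "\<exists>a. hol_at B z a \<and> (\<forall>\<^sub>F y in nhds x. h y = a (\<Phi> y))" if x: "\<Phi> x = z" for x
  proof -
    obtain a where "\<And>p. p < mult A B \<Phi> x \<Longrightarrow> hol_at B z (a p)"
      "\<forall>\<^sub>F y in nhds x. h y = (\<Sum>p<mult A B \<Phi> x. \<omega> x y ^ p * a p (\<Phi> y))"
      by (rule hol_at_decomposition[OF M x h[OF x]]) blast
    then show ?thesis using m[OF x] by (intro exI[of _ "a 0"]) simp
  qed
  then obtain a where a: "\<And>x. \<Phi> x = z \<Longrightarrow> hol_at B z (a x)"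
    "\<And>x. \<Phi> x = z \<Longrightarrow> \<forall>\<^sub>F y in nhds x. h y = a x (\<Phi> y)"
    by metis
  have "\<forall>\<^sub>F z' in nhds z. \<forall>y. \<Phi> y = z' \<longrightarrow> (\<forall>x. \<Phi> x = z \<longrightarrow> y \<in> W x \<longrightarrow> h y = a x (\<Phi> y))"
  proof (rule eventually_nhds_fibre)
    fix x assume x: "\<Phi> x = z"
    have "\<forall>\<^sub>F y in nhds x. y \<in> W x"
      using local_coordD(1,2)[OF modelD(7)[OF M x]] by (intro eventually_nhds_in_open)
    then show "\<forall>\<^sub>F y in nhds x. \<forall>x. \<Phi> x = z \<longrightarrow> y \<in> W x \<longrightarrow> h y = a x (\<Phi> y)"
      using a(2)[OF x] by eventually_elim (use modelD(6)[OF M] x in metis)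
  qed
  moreover have "\<forall>\<^sub>F z' in nhds z. z' \<in> V" using modelD(1,2)[OF M] by (intro eventually_nhds_in_open)
  ultimately have "\<forall>\<^sub>F z' in nhds z. trace h z' = (\<Sum>x | \<Phi> x = z. a x z')"
  proof eventually_elim
    case (elim z')
    have "trace h z' = (\<Sum>x | \<Phi> x = z. \<Sum>y | y \<in> W x \<and> \<Phi> y = z'. h y)"
      unfolding trace_def by (rule model_fibre_sum[OF M elim(2)])
    also have "\<dots> = (\<Sum>x | \<Phi> x = z. \<Sum>y | y \<in> W x \<and> \<Phi> y = z'. a x z')"
      using elim(1) by (intro sum.cong refl) auto
    also have "\<dots> = (\<Sum>x | \<Phi> x = z. a x z')"
      using model_roots(2)[OF M _ elim(2)] m by (intro sum.cong refl) simp
    finally show ?case .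
  qed
  moreover have "hol_at B z (\<lambda>z'. \<Sum>x | \<Phi> x = z. a x z')" by (rule Z.hol_at_sum) (use a in auto)
  ultimately show ?thesis by (simp add: Z.hol_at_cong)
qed

text \<open>Applied to the exponents \<open>m * k\<close> that survive in a trace. As
  \<open>k\<close> is an integer, dividing by \<open>m\<close> and rounding up lose nothing.\<close>

lemma ceiling_le_div:
  fixes c :: real
  assumes "\<lceil>real m * c\<rceil> \<le> int m * k" "m > 0"
  shows "\<lceil>c\<rceil> \<le> k"
proof -
  have "real m * c \<le> real m * of_int k" using assms(1) by (simp add: ceiling_le_iff)
  then show ?thesis using assms(2) by (simp add: ceiling_le_iff)
qed

text \<open>Write \<open>n = m * k + q\<close> with \<open>q < m\<close>. The factor
  \<open>\<zeta> powi k\<close> is constant on the fibre, and orthogonality decides the sum of the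
  \<open>w ^ q\<close>. Negative exponents are included because poles are allowed.\<close>

lemma sum_roots_powi:
  assumes m: "m > 0" and z: "\<zeta> \<noteq> (0::complex)"
  shows "(\<Sum>w | w ^ m = \<zeta>. w powi n) = (if int m dvd n then of_nat m * \<zeta> powi (n div int m) else 0)"
proof -
  define q k where "q = nat (n mod int m)" and "k = n div int m"
  have q: "q < m" using m by (simp add: q_def nat_less_iff)
  have n: "n = int m * k + int q" using m by (simp add: q_def k_def)
  have w: "w powi n = \<zeta> powi k * w ^ q" if "w ^ m = \<zeta>" for w
  proof -
    have "w \<noteq> 0" using that z m by (auto simp: power_0_left)
    then have "w powi n = w powi (int m * k) * w ^ q" by (simp add: n power_int_add)
    then show ?thesis using that by (simp add: power_int_mult)
  qed
  have "(\<Sum>w | w ^ m = \<zeta>. w powi n) = (\<Sum>w | w ^ m = \<zeta>. \<zeta> powi k * (inverse w ^ 0 * w ^ q))"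
    by (rule sum.cong) (auto simp: w)
  also have "\<dots> = \<zeta> powi k * (if 0 = q then of_nat m else 0)"
    by (simp only: sum_roots_power[OF m disjI1[OF z] m q] flip: sum_distrib_left)
  also have "0 = q \<longleftrightarrow> int m dvd n" using n m q
    by (metis dvd_add_right_iff dvd_triv_left int_dvd_int_iff nat_dvd_not_less neq0_conv dvd_0_right)
  finally show ?thesis by (auto simp: k_def)
qed

text \<open>The bound \<open>c\<close> is real because it will be \<open>t - \<alpha>\<close> for a
  weight \<open>\<alpha>\<close> of \<open>L'\<close>. The germs are expanded in powers of
  \<open>\<omega> x\<close> with exponents from \<open>\<lceil>m * c\<rceil>\<close> on; a surviving
  exponent \<open>m * k\<close> has \<open>k \<ge> \<lceil>c\<rceil>\<close>.\<close>

lemma zO_trace: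
  assumes h: "\<And>x. \<Phi> x = z \<Longrightarrow> h \<in> zO A x \<lceil>real (mult A B \<Phi> x) * c\<rceil>"
  shows "trace h \<in> zO B z \<lceil>c\<rceil>"
proof -
  let ?m = "mult A B \<Phi>"
  obtain V W r \<omega> \<theta> where M: "model z V W r \<omega> \<theta>"
    by (rule obtain_model[of z "\<lambda>_. UNIV" UNIV]) auto
  define n where "n = (\<lambda>x. \<lceil>real (?m x) * c\<rceil>)"
  have "\<exists>a. (\<forall>p<?m x. hol_at B z (a p)) \<and>
      (\<forall>\<^sub>F y in at x. h y = (\<Sum>p<?m x. \<omega> x y powi (n x + int p) * a p (\<Phi> y)))" if x: "\<Phi> x = z" for x
  proof -
    note D = local_coordD[OF modelD(7)[OF M x]]
    obtain g where g: "hol_at A x g" "\<forall>\<^sub>F y in at x. h y = \<omega> x y powi n x * g y"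
      using h[OF x] unfolding zO_model[OF M x] n_def by blast
    obtain a where a: "\<And>p. p < ?m x \<Longrightarrow> hol_at B z (a p)"
      "\<forall>\<^sub>F y in nhds x. g y = (\<Sum>p<?m x. \<omega> x y ^ p * a p (\<Phi> y))"
      using hol_at_decomposition[OF M x g(1)] by blast
    have "\<forall>\<^sub>F y in at x. y \<in> W x \<and> y \<noteq> x"
      using D(1,2) unfolding eventually_at_topological by blast
    moreover have "\<forall>\<^sub>F y in at x. g y = (\<Sum>p<?m x. \<omega> x y ^ p * a p (\<Phi> y))"
      using a(2) by (simp add: eventually_nhds_conv_at)
    ultimately have "\<forall>\<^sub>F y in at x. h y = (\<Sum>p<?m x. \<omega> x y powi (n x + int p) * a p (\<Phi> y))"
      using g(2)
    proof eventually_elim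
      case (elim y)
      then have "\<omega> x y \<noteq> 0" using D(6,7) by metis
      then show ?case using elim by (simp add: sum_distrib_left power_int_add mult.assoc)
    qed
    then show ?thesis using a(1) by blast
  qed
  then have "\<forall>x\<in>{x. \<Phi> x = z}. \<exists>a. (\<forall>p<?m x. hol_at B z (a p)) \<and>
      (\<forall>\<^sub>F y in at x. h y = (\<Sum>p<?m x. \<omega> x y powi (n x + int p) * a p (\<Phi> y)))" by blast
  from bchoice[OF this] obtain a where a: "\<And>x p. \<Phi> x = z \<Longrightarrow> p < ?m x \<Longrightarrow> hol_at B z (a x p)"
    "\<And>x. \<Phi> x = z \<Longrightarrow> \<forall>\<^sub>F y in at x. h y = (\<Sum>p<?m x. \<omega> x y powi (n x + int p) * a x p (\<Phi> y))"
    by blast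
  have "\<forall>\<^sub>F z' in at z. \<forall>y. \<Phi> y = z' \<longrightarrow> (\<forall>x. \<Phi> x = z \<longrightarrow> y \<in> W x \<longrightarrow>
      h y = (\<Sum>p<?m x. \<omega> x y powi (n x + int p) * a x p (\<Phi> y)))"
  proof (rule eventually_at_fibre)
    fix x assume x: "\<Phi> x = z"
    have "\<forall>\<^sub>F y in nhds x. y \<in> W x"
      using local_coordD(1,2)[OF modelD(7)[OF M x]] by (intro eventually_nhds_in_open)
    then have "\<forall>\<^sub>F y in at x. y \<in> W x" by (simp add: eventually_nhds_conv_at)
    then show "\<forall>\<^sub>F y in at x. \<forall>x. \<Phi> x = z \<longrightarrow> y \<in> W x \<longrightarrow>
        h y = (\<Sum>p<?m x. \<omega> x y powi (n x + int p) * a x p (\<Phi> y))"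
      using a(2)[OF x] by eventually_elim (use modelD(6)[OF M] x in metis)
  qed
  moreover have "\<forall>\<^sub>F z' in at z. z' \<in> V \<and> z' \<noteq> z"
    using modelD(1,2)[OF M] unfolding eventually_at_topological by blast
  ultimately have ev: "\<forall>\<^sub>F z' in at z. trace h z' = (\<Sum>x | \<Phi> x = z. \<Sum>p<?m x.
      (if int (?m x) dvd n x + int p
       then of_nat (?m x) * coord B z z' powi ((n x + int p) div int (?m x)) else 0) * a x p z')"
  proof eventually_elim
    case (elim z')
    have nz: "coord B z z' \<noteq> 0" using model_nonzero[OF M] elim(2) by blast
    have "trace h z' = (\<Sum>x | \<Phi> x = z. \<Sum>y | y \<in> W x \<and> \<Phi> y = z'. h y)"
      unfolding trace_def using elim(2) by (intro model_fibre_sum[OF M]) simp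
    also have "\<dots> = (\<Sum>x | \<Phi> x = z. \<Sum>y | y \<in> W x \<and> \<Phi> y = z'.
        \<Sum>p<?m x. \<omega> x y powi (n x + int p) * a x p z')"
      using elim(1) by (intro sum.cong refl) auto
    also have "\<dots> = (\<Sum>x | \<Phi> x = z. \<Sum>p<?m x. (\<Sum>y | y \<in> W x \<and> \<Phi> y = z'.
        \<omega> x y powi (n x + int p)) * a x p z')"
      by (intro sum.cong refl, subst sum.swap) (simp add: sum_distrib_right)
    also have "\<dots> = (\<Sum>x | \<Phi> x = z. \<Sum>p<?m x. (if int (?m x) dvd n x + int p
       then of_nat (?m x) * coord B z z' powi ((n x + int p) div int (?m x)) else 0) * a x p z')"
    proof (intro sum.cong refl)
      fix x p assume x: "x \<in> {x. \<Phi> x = z}"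
      have "(\<Sum>y | y \<in> W x \<and> \<Phi> y = z'. \<omega> x y powi (n x + int p)) =
          (\<Sum>w | w ^ ?m x = coord B z z'. w powi (n x + int p))"
        using model_roots(1)[OF M _ _ disjI1[OF nz], of x "\<lambda>w. w powi (n x + int p)"] x elim(2) by simp
      then show "(\<Sum>y | y \<in> W x \<and> \<Phi> y = z'. \<omega> x y powi (n x + int p)) * a x p z' =
         (if int (?m x) dvd n x + int p
          then of_nat (?m x) * coord B z z' powi ((n x + int p) div int (?m x)) else 0) * a x p z'"
        using sum_roots_powi[OF mult_pos[of x] nz, of "n x + int p"] by simp
    qed
    finally show ?case .
  qed
  have summand: "(\<lambda>z'. (if int (?m x) dvd n x + int p
       then of_nat (?m x) * coord B z z' powi ((n x + int p) div int (?m x)) else 0) * a x p z') \<in> zO B z \<lceil>c\<rceil>"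
    if x: "\<Phi> x = z" and p: "p < ?m x" for x p
  proof (cases "int (?m x) dvd n x + int p")
    case True
    then obtain k where k: "n x + int p = int (?m x) * k" by blast
    then have "\<lceil>real (?m x) * c\<rceil> \<le> int (?m x) * k" by (simp add: n_def)
    then have "\<lceil>c\<rceil> \<le> k" using mult_pos by (rule ceiling_le_div)
    then have "(\<lambda>z'. coord B z z' powi k) \<in> zO B z \<lceil>c\<rceil>"
      by (rule Z.zO_mono[OF Z.coord_powi_zO])
    then have "(\<lambda>z'. (of_nat (?m x) * a x p z') * coord B z z' powi k) \<in> zO B z \<lceil>c\<rceil>"
      by (rule Z.zO_hol_mult[OF Z.hol_at_mult[OF Z.hol_at_const a(1)[OF x p]]])
    then show ?thesis using True k mult_pos[of x] by (simp add: mult_ac)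
  next
    case False
    then show ?thesis using Z.zero_zO by simp
  qed
  have "(\<lambda>z'. \<Sum>x | \<Phi> x = z. \<Sum>p<?m x. (if int (?m x) dvd n x + int p
       then of_nat (?m x) * coord B z z' powi ((n x + int p) div int (?m x)) else 0) * a x p z') \<in> zO B z \<lceil>c\<rceil>"
    by (rule Z.zO_sum, rule Z.zO_sum, rule summand) auto
  then show ?thesis using ev by (rule Z.zO_cong)
qed

end

section \<open>Modules of germs\<close>

text \<open>Closure under equality off \<open>x\<close> is included because germs are total
  functions whose value at \<open>x\<close> carries no information here.\<close>

definition hol_module :: "'x::t2_space atlas \<Rightarrow> 'x \<Rightarrow> ('x \<Rightarrow> 'i \<Rightarrow> complex) set \<Rightarrow> bool" where
  "hol_module A x M \<longleftrightarrow> (\<lambda>_ _. 0) \<in> M \<and> (\<forall>s\<in>M. \<forall>s'\<in>M. (\<lambda>y i. s y i + s' y i) \<in> M) \<and>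
     (\<forall>f s. hol_at A x f \<longrightarrow> s \<in> M \<longrightarrow> (\<lambda>y i. f y * s y i) \<in> M) \<and>
     (\<forall>s s'. s \<in> M \<longrightarrow> (\<forall>\<^sub>F y in at x. s' y = s y) \<longrightarrow> s' \<in> M)"

lemma hol_moduleD:
  assumes "hol_module A x M"
  shows "(\<lambda>_ _. 0) \<in> M" "\<And>s s'. s \<in> M \<Longrightarrow> s' \<in> M \<Longrightarrow> (\<lambda>y i. s y i + s' y i) \<in> M"
    "\<And>f s. hol_at A x f \<Longrightarrow> s \<in> M \<Longrightarrow> (\<lambda>y i. f y * s y i) \<in> M"
    "\<And>s s'. s \<in> M \<Longrightarrow> \<forall>\<^sub>F y in at x. s' y = s y \<Longrightarrow> s' \<in> M"
  using assms unfolding hol_module_def by blast+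

lemma zmulI: "s' \<in> S \<Longrightarrow> \<forall>\<^sub>F y in at x. s y = (\<lambda>i. coord A x y powi n * s' y i) \<Longrightarrow> s \<in> zmul A x n S"
  unfolding zmul_def by blast

lemma zmulE:
  assumes "s \<in> zmul A x n S"
  obtains s' where "s' \<in> S" "\<forall>\<^sub>F y in at x. s y = (\<lambda>i. coord A x y powi n * s' y i)"
  using assms unfolding zmul_def by blast

lemma zmul_mono: "S \<subseteq> T \<Longrightarrow> zmul A x n S \<subseteq> zmul A x n T"
  unfolding zmul_def by blast

context riemann
begin

lemma zmul_zmul: "zmul A x n (zmul A x k S) = zmul A x (n + k) S"
proof (intro equalityI subsetI)
  fix s assume "s \<in> zmul A x n (zmul A x k S)"
  then obtain s' where s': "s' \<in> zmul A x k S" "\<forall>\<^sub>F y in at x. s y = (\<lambda>i. coord A x y powi n * s' y i)"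
    by (rule zmulE)
  obtain s'' where s'': "s'' \<in> S" "\<forall>\<^sub>F y in at x. s' y = (\<lambda>i. coord A x y powi k * s'' y i)"
    using s'(1) by (rule zmulE)
  have "\<forall>\<^sub>F y in at x. s y = (\<lambda>i. coord A x y powi (n + k) * s'' y i)"
    using s'(2) s''(2) coord_nonzero[of x] by eventually_elim (simp add: power_int_add mult.assoc)
  then show "s \<in> zmul A x (n + k) S" by (rule zmulI[OF s''(1)])
next
  fix s assume "s \<in> zmul A x (n + k) S"
  then obtain s' where s': "s' \<in> S" "\<forall>\<^sub>F y in at x. s y = (\<lambda>i. coord A x y powi (n + k) * s' y i)"
    by (rule zmulE)
  have "(\<lambda>y i. coord A x y powi k * s' y i) \<in> zmul A x k S" by (rule zmulI[OF s'(1)]) simp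
  moreover have "\<forall>\<^sub>F y in at x. s y = (\<lambda>i. coord A x y powi n * (coord A x y powi k * s' y i))"
    using s'(2) coord_nonzero[of x] by eventually_elim (simp add: power_int_add mult.assoc)
  ultimately show "s \<in> zmul A x n (zmul A x k S)" by (rule zmulI)
qed

lemma zmul_0_subset: "S \<subseteq> zmul A x 0 S"
  by (auto intro!: zmulI)

text \<open>In general \<open>zmul A x 0\<close> adds all functions that agree with a member off
  \<open>x\<close>; a module is already closed under this.\<close>

lemma zmul_0_module:
  assumes "hol_module A x M"
  shows "zmul A x 0 M = M"
proof (intro equalityI subsetI)
  fix s assume "s \<in> zmul A x 0 M"
  then obtain s' where s': "s' \<in> M" "\<forall>\<^sub>F y in at x. s y = (\<lambda>i. coord A x y powi 0 * s' y i)"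
    by (rule zmulE)
  then show "s \<in> M" using hol_moduleD(4)[OF assms s'(1), of s] by simp
qed (use zmul_0_subset in blast)

lemma hol_module_zmul:
  assumes M: "hol_module A x M"
  shows "hol_module A x (zmul A x n M)"
  unfolding hol_module_def
proof (intro conjI allI ballI impI)
  note M = hol_moduleD[OF M]
  show "(\<lambda>_ _. 0) \<in> zmul A x n M" by (rule zmulI[OF M(1)]) simp
  fix s assume "s \<in> zmul A x n M"
  then obtain a where a: "a \<in> M" "\<forall>\<^sub>F y in at x. s y = (\<lambda>i. coord A x y powi n * a y i)" by (rule zmulE)
  {
    fix s' assume "s' \<in> zmul A x n M"
    then obtain b where b: "b \<in> M" "\<forall>\<^sub>F y in at x. s' y = (\<lambda>i. coord A x y powi n * b y i)" by (rule zmulE)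
    have "\<forall>\<^sub>F y in at x. (\<lambda>i. s y i + s' y i) = (\<lambda>i. coord A x y powi n * (a y i + b y i))"
      using a(2) b(2) by eventually_elim (simp add: algebra_simps)
    then show "(\<lambda>y i. s y i + s' y i) \<in> zmul A x n M" by (rule zmulI[OF M(2)[OF a(1) b(1)]])
  }
  {
    fix f assume f: "hol_at A x f"
    have "\<forall>\<^sub>F y in at x. (\<lambda>i. f y * s y i) = (\<lambda>i. coord A x y powi n * (f y * a y i))"
      using a(2) by eventually_elim (simp add: mult_ac)
    then show "(\<lambda>y i. f y * s y i) \<in> zmul A x n M" by (rule zmulI[OF M(3)[OF f a(1)]])
  }
  fix s' assume "\<forall>\<^sub>F y in at x. s' y = s y"
  then have "\<forall>\<^sub>F y in at x. s' y = (\<lambda>i. coord A x y powi n * a y i)"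
    using a(2) by eventually_elim simp
  then show "s' \<in> zmul A x n M" by (rule zmulI[OF a(1)])
qed

lemma zmul_antimono:
  assumes M: "hol_module A x M" and "k \<le> n"
  shows "zmul A x n M \<subseteq> zmul A x k M"
proof -
  have "zmul A x (n - k) M \<subseteq> M"
  proof
    fix s assume "s \<in> zmul A x (n - k) M"
    then obtain a where a: "a \<in> M" "\<forall>\<^sub>F y in at x. s y = (\<lambda>i. coord A x y powi (n - k) * a y i)"
      by (rule zmulE)
    have "\<forall>\<^sub>F y in at x. s y = (\<lambda>i. coord A x y ^ nat (n - k) * a y i)"
      using a(2) by eventually_elim (use assms(2) in \<open>simp add: power_int_def\<close>)
    then show "s \<in> M"
      by (rule hol_moduleD(4)[OF M hol_moduleD(3)[OF M hol_at_power[OF hol_at_coord] a(1)]])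
  qed
  then have "zmul A x k (zmul A x (n - k) M) \<subseteq> zmul A x k M" by (rule zmul_mono)
  then show ?thesis by (simp add: zmul_zmul)
qed

lemma zmul_zO:
  assumes "hol_module A x M" "f \<in> zO A x n" "s \<in> M"
  shows "(\<lambda>y i. f y * s y i) \<in> zmul A x n M"
proof -
  obtain g where g: "hol_at A x g" "\<forall>\<^sub>F y in at x. f y = coord A x y powi n * g y"
    using assms(2) by (rule zOE)
  have "\<forall>\<^sub>F y in at x. (\<lambda>i. f y * s y i) = (\<lambda>i. coord A x y powi n * (g y * s y i))"
    using g(2) by eventually_elim (simp add: mult.assoc)
  then show ?thesis by (rule zmulI[OF hol_moduleD(3)[OF assms(1) g(1) assms(3)]])
qed

text \<open>\<open>val_at\<close> is a coset modulo the multiples of the coordinate, so it depends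
  on the class alone.\<close>

lemma val_at_eq:
  assumes M: "hol_module A x (zmul A x 1 (lattice E x 0))"
    and d: "(\<lambda>y i. s y i - s' y i) \<in> zmul A x 1 (lattice E x 0)"
  shows "val_at A E x s = val_at A E x s'"
proof -
  have d': "(\<lambda>y i. s' y i - s y i) \<in> zmul A x 1 (lattice E x 0)"
    using hol_moduleD(3)[OF M hol_at_const[of x "-1"] d] by simp
  have "(\<lambda>y i. a y i - s y i) \<in> zmul A x 1 (lattice E x 0) \<longleftrightarrow>
      (\<lambda>y i. a y i - s' y i) \<in> zmul A x 1 (lattice E x 0)" for a
    using hol_moduleD(2)[OF M _ d, of "\<lambda>y i. a y i - s y i"]
      hol_moduleD(2)[OF M _ d', of "\<lambda>y i. a y i - s' y i"] by auto
  then show ?thesis unfolding val_at_def by simp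
qed

end

section \<open>Parabolic bundles\<close>

locale parabolic = riemann A for A :: "'x::t2_space atlas" +
  fixes E :: "('x, 'i) par_bundle" and r :: nat
  assumes rank: "par_bundle_rank A E r"
begin

lemma finite_ppts: "finite (ppts E)"
  using rank unfolding par_bundle_rank_def by blast

lemma local_frame_subset:
  "local_frame A E r U e \<Longrightarrow> open U' \<Longrightarrow> U' \<subseteq> U \<Longrightarrow> local_frame A E r U' e"
  unfolding local_frame_def by blast

lemma frame:
  assumes "open Q" "x \<in> Q"
  obtains U e where "x \<in> U" "U \<subseteq> Q" "U \<inter> ppts E \<subseteq> {x}" "local_frame A E r U e"
proof -
  obtain U e where U: "x \<in> U" "local_frame A E r U e" using rank unfolding par_bundle_rank_def by blast
  let ?U = "U \<inter> Q \<inter> - (ppts E - {x})"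
  have "open (- (ppts E - {x}))" using finite_ppts by (intro open_Compl finite_imp_closed) simp
  then have "open ?U" using U(2) assms(1) unfolding local_frame_def by (intro open_Int) blast+
  then have "local_frame A E r ?U e" using U(2) by (rule_tac local_frame_subset) auto
  then show thesis using U(1) assms by (intro that[of ?U]) auto
qed

lemma frameD:
  assumes "local_frame A E r U e"
  shows "open U"
    "\<And>x. x \<in> U \<Longrightarrow> x \<notin> ppts E \<Longrightarrow> is_basis r (\<lambda>k. e k x) (fibre E x)"
    "\<And>x s. x \<in> U \<Longrightarrow> x \<notin> ppts E \<Longrightarrow> s \<in> stalk E x \<longleftrightarrow> (\<exists>f. (\<forall>k<r. hol_at A x (f k)) \<and>
          (\<forall>\<^sub>F y in nhds x. s y = lincomb r (\<lambda>k. f k y) (\<lambda>k. e k y)))"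
  using assms unfolding local_frame_def by auto

text \<open>At an ordinary point \<open>germs\<close> arises from the stalk by forgetting the value
  at \<open>x\<close>; hence the equality along \<open>at x\<close> is the right one there
  too.\<close>

lemma germs_0:
  assumes "local_frame A E r U e" "x \<in> U"
  shows "s \<in> germs A E x 0 \<longleftrightarrow> (\<exists>f. (\<forall>k<r. hol_at A x (f k)) \<and>
          (\<forall>\<^sub>F y in at x. s y = lincomb r (\<lambda>k. f k y) (\<lambda>k. e k y)))"
proof (cases "x \<in> ppts E")
  case True
  then show ?thesis using assms unfolding local_frame_def germs_def by auto
next
  case False
  note st = frameD(3)[OF assms False]
  show ?thesis
  proof
    assume "s \<in> germs A E x 0"
    then have "s \<in> zmul A x 0 (stalk E x)" using False by (simp add: germs_def)
    then obtain s' where s': "s' \<in> stalk E x" "\<forall>\<^sub>F y in at x. s y = s' y" by (auto elim: zmulE)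
    then obtain f where f: "\<forall>k<r. hol_at A x (f k)"
        "\<forall>\<^sub>F y in nhds x. s' y = lincomb r (\<lambda>k. f k y) (\<lambda>k. e k y)" using st by blast
    then have "\<forall>\<^sub>F y in at x. s' y = lincomb r (\<lambda>k. f k y) (\<lambda>k. e k y)"
      by (simp add: eventually_nhds_conv_at)
    with s'(2) have "\<forall>\<^sub>F y in at x. s y = lincomb r (\<lambda>k. f k y) (\<lambda>k. e k y)"
      by eventually_elim simp
    then show "\<exists>f. (\<forall>k<r. hol_at A x (f k)) \<and> (\<forall>\<^sub>F y in at x. s y = lincomb r (\<lambda>k. f k y) (\<lambda>k. e k y))"
      using f(1) by blast
  next
    assume "\<exists>f. (\<forall>k<r. hol_at A x (f k)) \<and> (\<forall>\<^sub>F y in at x. s y = lincomb r (\<lambda>k. f k y) (\<lambda>k. e k y))"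
    then obtain f where f: "\<forall>k<r. hol_at A x (f k)"
        "\<forall>\<^sub>F y in at x. s y = lincomb r (\<lambda>k. f k y) (\<lambda>k. e k y)" by blast
    have "(\<lambda>y. lincomb r (\<lambda>k. f k y) (\<lambda>k. e k y)) \<in> stalk E x" using st f(1) by auto
    then have "s \<in> zmul A x 0 (stalk E x)" by (rule zmulI) (use f(2) in simp)
    then show "s \<in> germs A E x 0" using False by (simp add: germs_def)
  qed
qed

lemma module_0: "hol_module A x (germs A E x 0)"
proof -
  obtain U e where U: "x \<in> U" "local_frame A E r U e" by (rule frame[of UNIV x]) auto
  note g = germs_0[OF U(2,1)]
  show ?thesis
    unfolding hol_module_def
  proof (intro conjI allI ballI impI)
    show "(\<lambda>_ _. 0) \<in> germs A E x 0" unfolding g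
      by (rule exI[of _ "\<lambda>_ _. 0"]) (simp add: lincomb_def)
    fix s assume "s \<in> germs A E x 0"
    then obtain a where a: "\<forall>k<r. hol_at A x (a k)"
      "\<forall>\<^sub>F y in at x. s y = lincomb r (\<lambda>k. a k y) (\<lambda>k. e k y)" unfolding g by blast
    {
      fix s' assume "s' \<in> germs A E x 0"
      then obtain b where b: "\<forall>k<r. hol_at A x (b k)"
        "\<forall>\<^sub>F y in at x. s' y = lincomb r (\<lambda>k. b k y) (\<lambda>k. e k y)" unfolding g by blast
      have "\<forall>\<^sub>F y in at x. (\<lambda>i. s y i + s' y i) = lincomb r (\<lambda>k. a k y + b k y) (\<lambda>k. e k y)"
        using a(2) b(2) by eventually_elim (simp add: lincomb_def algebra_simps sum.distrib)
      moreover have "\<forall>k<r. hol_at A x (\<lambda>y. a k y + b k y)" using a(1) b(1) hol_at_add by blast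
      ultimately show "(\<lambda>y i. s y i + s' y i) \<in> germs A E x 0"
        unfolding g by (intro exI[of _ "\<lambda>k y. a k y + b k y"]) simp
    }
    {
      fix f assume f: "hol_at A x f"
      have "\<forall>\<^sub>F y in at x. (\<lambda>i. f y * s y i) = lincomb r (\<lambda>k. f y * a k y) (\<lambda>k. e k y)"
        using a(2) by eventually_elim (simp add: lincomb_def sum_distrib_left mult.assoc)
      moreover have "\<forall>k<r. hol_at A x (\<lambda>y. f y * a k y)" using a(1) f hol_at_mult by blast
      ultimately show "(\<lambda>y i. f y * s y i) \<in> germs A E x 0"
        unfolding g by (intro exI[of _ "\<lambda>k y. f y * a k y"]) simp
    }
    fix s' assume "\<forall>\<^sub>F y in at x. s' y = s y"
    with a(2) have "\<forall>\<^sub>F y in at x. s' y = lincomb r (\<lambda>k. a k y) (\<lambda>k. e k y)"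
      by eventually_elim simp
    then show "s' \<in> germs A E x 0" unfolding g using a(1) by blast
  qed
qed

lemma flags:
  assumes "x \<in> ppts E"
  obtains n F \<alpha> where "flag_weights A E x n F \<alpha>"
  using assms rank unfolding par_bundle_rank_def by blast

lemma germs_succ: "germs A E x (t + 1) = zmul A x 1 (germs A E x t)"
proof (cases "x \<in> ppts E")
  case True
  then obtain n F \<alpha> where "flag_weights A E x n F \<alpha>" by (rule flags)
  then show ?thesis using True unfolding flag_weights_def germs_def by simp
next
  case False
  then show ?thesis by (simp add: germs_def zmul_zmul add.commute[of 1 "\<lceil>t\<rceil>"])
qed

text \<open>The module at \<open>t\<close> is \<open>zmul A x 1\<close> of the one at
  \<open>t - 1\<close>, which absorbs the factor.\<close>

lemma zmul_0_germs: "zmul A x 0 (germs A E x t) = germs A E x t"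
  using germs_succ[of x "t - 1"] by (simp add: zmul_zmul)

lemma germs_shift: "germs A E x (t + of_int n) = zmul A x n (germs A E x t)"
proof -
  have nat: "germs A E x (t + real k) = zmul A x (int k) (germs A E x t)" for t k
  proof (induction k)
    case 0
    then show ?case by (simp add: zmul_0_germs)
  next
    case (Suc k)
    have "germs A E x (t + real (Suc k)) = germs A E x ((t + real k) + 1)" by (simp add: algebra_simps)
    also have "\<dots> = zmul A x 1 (zmul A x (int k) (germs A E x t))" by (simp only: germs_succ Suc)
    also have "\<dots> = zmul A x (int (Suc k)) (germs A E x t)" by (simp add: zmul_zmul)
    finally show ?case .
  qed
  show ?thesis
  proof (cases "n \<ge> 0")
    case True
    then show ?thesis using nat[of t "nat n"] by simp
  next
    case False
    have "germs A E x t = zmul A x (- n) (germs A E x (t + of_int n))"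
      using nat[of "t + of_int n" "nat (- n)"] False by simp
    then have "zmul A x n (germs A E x t) = zmul A x 0 (germs A E x (t + of_int n))"
      by (simp add: zmul_zmul)
    then show ?thesis by (simp add: zmul_0_germs)
  qed
qed

lemma germs_frac: "germs A E x t = zmul A x \<lfloor>t\<rfloor> (germs A E x (frac t))"
  using germs_shift[of x "frac t" "\<lfloor>t\<rfloor>"] by (simp add: frac_def)

text \<open>\<open>S\<close> is the set of weights. The flag index at \<open>t\<close> is the first
  one whose weight is at least \<open>t\<close>, so the module drops immediately after a weight;
  this is why the last clause excludes weights from the half-open interval
  \<open>t \<le> a < t'\<close>.\<close>

lemma parabolic_germs:
  assumes x: "x \<in> ppts E"
  obtains S where "finite S"
    "\<And>t. 0 \<le> t \<Longrightarrow> t < 1 \<Longrightarrow> hol_module A x (germs A E x t) \<and>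
       germs A E x 1 \<subseteq> germs A E x t \<and> germs A E x t \<subseteq> germs A E x 0"
    "\<And>t t'. 0 \<le> t \<Longrightarrow> t \<le> t' \<Longrightarrow> t' < 1 \<Longrightarrow> germs A E x t' \<subseteq> germs A E x t"
    "\<And>t t'. 0 \<le> t \<Longrightarrow> t \<le> t' \<Longrightarrow> t' \<le> 1 \<Longrightarrow> \<forall>a\<in>S. \<not> (t \<le> a \<and> a < t') \<Longrightarrow> germs A E x t = germs A E x t'"
proof -
  obtain n F \<alpha> where fl: "flag_weights A E x n F \<alpha>" using x by (rule flags)
  let ?L = "lattice E x" and ?N = "zmul A x 1 (lattice E x 0)"
  define j where "j = (\<lambda>t. LEAST j. 1 \<le> j \<and> (j = n + 1 \<or> t \<le> \<alpha> j))"
  note fl = fl[unfolded flag_weights_def]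
  have "F (n + 1) = {val_at A E x (\<lambda>_ _. 0)} \<and> (\<forall>j\<in>{1..n + 1}. fibre_subspace A E x (F j)) \<and>
    (\<forall>j\<in>{1..n}. F (j + 1) \<subset> F j) \<and> (\<forall>j\<in>{1..n}. 0 \<le> \<alpha> j \<and> \<alpha> j < 1) \<and>
    (\<forall>t. ?L (t + 1) = zmul A x 1 (?L t))"
    using fl by (elim conjE) (intro conjI, assumption+)
  note fl2 = this[THEN conjunct1] this[THEN conjunct2, THEN conjunct1]
    this[THEN conjunct2, THEN conjunct2, THEN conjunct1]
    this[THEN conjunct2, THEN conjunct2, THEN conjunct2, THEN conjunct1]
    this[THEN conjunct2, THEN conjunct2, THEN conjunct2, THEN conjunct2]
  have sub: "fibre_subspace A E x (F j)" if "1 \<le> j" "j \<le> n + 1" for j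
    using that by (intro bspec[OF fl2(2)]) auto
  have dec: "F (j + 1) \<subseteq> F j" if "1 \<le> j" "j \<le> n" for j
    using that by (intro psubset_imp_subset bspec[OF fl2(3)]) auto
  have a1: "\<alpha> j < 1" if "1 \<le> j" "j \<le> n" for j
    using that by (intro conjunct2[OF bspec[OF fl2(4)]]) auto
  have "\<forall>t\<in>{0..<1}. ?L t =
      {s \<in> ?L 0. val_at A E x s \<in> F (LEAST j. 1 \<le> j \<and> (j = n + 1 \<or> t \<le> \<alpha> j))}"
    using fl by (elim conjE) assumption
  then have L: "?L t = {s \<in> ?L 0. val_at A E x s \<in> F (j t)}" if "0 \<le> t" "t < 1" for t
    unfolding j_def by (rule bspec) (use that in simp)
  have L1: "?L 1 = ?N" using fl2(5) by (metis add_0)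
  have gL: "germs A E x t = ?L t" for t using x by (simp add: germs_def)
  have M0: "hol_module A x (?L 0)" using module_0[of x] by (simp add: gL)
  have MN: "hol_module A x ?N" by (rule hol_module_zmul[OF M0])
  have N0: "?N \<subseteq> ?L 0" using zmul_antimono[OF M0, of 0 1] zmul_0_module[OF M0] by simp
  have j: "1 \<le> j t" "j t \<le> n + 1" "j t = n + 1 \<or> t \<le> \<alpha> (j t)" for t
  proof -
    have "1 \<le> j t \<and> (j t = n + 1 \<or> t \<le> \<alpha> (j t))" unfolding j_def by (rule LeastI[of _ "n + 1"]) simp
    then show "1 \<le> j t" "j t = n + 1 \<or> t \<le> \<alpha> (j t)" by auto
    show "j t \<le> n + 1" unfolding j_def by (rule Least_le) simp
  qed
  have jle: "j t \<le> k" if "1 \<le> k" "k = n + 1 \<or> t \<le> \<alpha> k" for t k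
    unfolding j_def by (rule Least_le) (use that in simp)
  have antimono: "F l \<subseteq> F k" if "1 \<le> k" "k \<le> l" "l \<le> n + 1" for k l
    using that(2,3)
  proof (induction l rule: dec_induct)
    case (step l)
    then show ?case using dec[of l] that(1) by auto
  qed simp
  have zero: "val_at A E x (\<lambda>_ _. 0) \<in> F (j t)" for t
    using sub[OF j(1,2)] unfolding fibre_subspace_def by blast
  \<comment> \<open>Multiples of the coordinate have value zero, which belongs to every member of
    the flag.\<close>
  have N: "?N \<subseteq> ?L t" if t: "0 \<le> t" "t < 1" for t
  proof
    fix s assume s: "s \<in> ?N"
    then have "val_at A E x s = val_at A E x (\<lambda>_ _. 0)" using val_at_eq[OF MN, of s "\<lambda>_ _. 0"] by simp
    then show "s \<in> ?L t" unfolding L[OF t] using s N0 zero by auto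
  qed
  have Lsub: "?L t \<subseteq> ?L 0" if t: "0 \<le> t" "t < 1" for t using L[OF t] by blast
  have comb: "(\<lambda>y i. a * s y i + b * s' y i) \<in> ?L t"
    if t: "0 \<le> t" "t < 1" and s: "s \<in> ?L t" "s' \<in> ?L t" for t s s' a b
  proof -
    have s0: "s \<in> ?L 0" "s' \<in> ?L 0" "val_at A E x s \<in> F (j t)" "val_at A E x s' \<in> F (j t)"
      using s unfolding L[OF t] by auto
    have "(\<lambda>y i. a * s y i + b * s' y i) \<in> ?L 0"
      using hol_moduleD(2)[OF M0 hol_moduleD(3)[OF M0 hol_at_const[of x a] s0(1)]
          hol_moduleD(3)[OF M0 hol_at_const[of x b] s0(2)]] by simp
    moreover have "val_at A E x (\<lambda>y i. a * s y i + b * s' y i) \<in> F (j t)"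
      using sub[OF j(1,2)] s0 unfolding fibre_subspace_def by blast
    ultimately show ?thesis unfolding L[OF t] by blast
  qed
  have add: "(\<lambda>y i. s y i + s' y i) \<in> ?L t" if t: "0 \<le> t" "t < 1" and s: "s \<in> ?L t" "s' \<in> ?L t" for t s s'
    using comb[OF that, of 1 1] by simp
  have M: "hol_module A x (?L t)" if t: "0 \<le> t" "t < 1" for t
    unfolding hol_module_def
  proof (intro conjI allI ballI impI)
    show "(\<lambda>_ _. 0) \<in> ?L t" using N[OF t] hol_moduleD(1)[OF MN] by blast
    fix s assume s: "s \<in> ?L t"
    show "(\<lambda>y i. s y i + s' y i) \<in> ?L t" if "s' \<in> ?L t" for s' using add[OF t s that] .
    show "s' \<in> ?L t" if "\<forall>\<^sub>F y in at x. s' y = s y" for s'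
    proof -
      have "s' \<in> zmul A x 0 (?L t)" by (rule zmulI[OF s]) (use that in simp)
      then show ?thesis using zmul_0_germs[of x t] by (simp add: gL)
    qed
    show "(\<lambda>y i. f y * s y i) \<in> ?L t" if f: "hol_at A x f" for f
    proof -
      \<comment> \<open>Members of the flag are closed under constants only. The difference
        \<open>f - f x\<close> is a multiple of the coordinate, so its product with \<open>s\<close>
        lies in \<open>?N\<close>, which is contained in every module of the unit interval.\<close>
      obtain g where g: "hol_at A x g" "\<forall>\<^sub>F y in nhds x. f y - f x = coord A x y * g y"
        using hol_at_factor[OF hol_at_diff[OF f hol_at_const[of x "f x"]]] by auto
      have g2: "\<forall>\<^sub>F y in at x. f y - f x = coord A x y * g y" using g(2) by (simp add: eventually_nhds_conv_at)
      have "\<forall>\<^sub>F y in at x. (\<lambda>i. (f y - f x) * s y i) = (\<lambda>i. coord A x y powi 1 * (g y * s y i))"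
        using g2 by eventually_elim (simp add: mult.assoc)
      moreover have "(\<lambda>y i. g y * s y i) \<in> ?L 0" using hol_moduleD(3)[OF M0 g(1)] Lsub[OF t] s by blast
      ultimately have "(\<lambda>y i. (f y - f x) * s y i) \<in> ?N" by (rule zmulI[rotated])
      then have "(\<lambda>y i. (f y - f x) * s y i) \<in> ?L t" using N[OF t] by blast
      from comb[OF t s this, of "f x" 1] show ?thesis by (simp add: algebra_simps)
    qed
  qed
  show thesis
  proof (rule that[of "\<alpha> ` {1..n}"])
    show "finite (\<alpha> ` {1..n})" by simp
    show "hol_module A x (germs A E x t) \<and> germs A E x 1 \<subseteq> germs A E x t \<and> germs A E x t \<subseteq> germs A E x 0"
      if "0 \<le> t" "t < 1" for t using M[OF that] N[OF that] Lsub[OF that] by (simp add: gL L1)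
    show "germs A E x t' \<subseteq> germs A E x t" if t: "0 \<le> t" "t \<le> t'" "t' < 1" for t t'
    proof -
      have "j t \<le> j t'" by (rule jle) (use j[of t'] t(2) in auto)
      then have "F (j t') \<subseteq> F (j t)" using antimono j by blast
      moreover have "0 \<le> t'" "t < 1" using t by auto
      ultimately show ?thesis unfolding gL L[OF \<open>0 \<le> t'\<close> t(3)] L[OF t(1) \<open>t < 1\<close>] by blast
    qed
    show "germs A E x t = germs A E x t'"
      if t: "0 \<le> t" "t \<le> t'" "t' \<le> 1" and no: "\<forall>a\<in>\<alpha> ` {1..n}. \<not> (t \<le> a \<and> a < t')" for t t'
    proof -
      have no': "t' \<le> \<alpha> j \<longleftrightarrow> t \<le> \<alpha> j" if "1 \<le> j" "j \<le> n" for j using no that t(2) by force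
      consider "t = t'" | "t' < 1" | "t < 1" "t' = 1" using t by linarith
      then show ?thesis
      proof cases
        case 2
        have "j t = j t'"
        proof (rule antisym)
          show "j t \<le> j t'" by (rule jle) (use j[of t'] t(2) in auto)
          have "j t = n + 1 \<or> t' \<le> \<alpha> (j t)" using j[of t] no'[of "j t"] by linarith
          then show "j t' \<le> j t" using j(1)[of t] by (intro jle)
        qed
        moreover have "0 \<le> t'" "t < 1" using t 2 by auto
        ultimately show ?thesis unfolding gL L[OF \<open>0 \<le> t'\<close> 2] L[OF t(1) \<open>t < 1\<close>] by simp
      next
        case 3
        \<comment> \<open>No weight lies in \<open>[t, 1)\<close>, so the last, zero member of the
          flag is reached and only sections with value zero remain.\<close>
        have "j t = n + 1"
        proof (rule ccontr)
          assume "j t \<noteq> n + 1"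
          then have "1 \<le> j t" "j t \<le> n" "t \<le> \<alpha> (j t)" using j[of t] by auto
          then show False using a1[of "j t"] no'[of "j t"] 3 by auto
        qed
        then have Lt: "?L t = {s \<in> ?L 0. val_at A E x s = val_at A E x (\<lambda>_ _. 0)}"
          using L[OF t(1) 3(1)] fl2(1) by simp
        have "?L t \<subseteq> ?N"
        proof
          fix s assume s: "s \<in> ?L t"
          then have s0: "s \<in> ?L 0" "val_at A E x s = val_at A E x (\<lambda>_ _. 0)" unfolding Lt by auto
          have "s \<in> val_at A E x s" using s0(1) hol_moduleD(1)[OF MN] unfolding val_at_def by simp
          then have "s \<in> val_at A E x (\<lambda>_ _. 0)" using s0(2) by simp
          then show "s \<in> ?N" unfolding val_at_def by simp
        qed
        then show ?thesis using N[OF t(1) 3(1)] 3(2) by (auto simp: gL L1)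
      qed simp
    qed
  qed
qed

lemma nonparabolic_germs: "x \<notin> ppts E \<Longrightarrow> germs A E x t = zmul A x \<lceil>t\<rceil> (germs A E x 0)"
  by (simp add: germs_def zmul_zmul)

lemma germs_unit_interval:
  obtains S where "finite S"
    "\<And>t. 0 \<le> t \<Longrightarrow> t < 1 \<Longrightarrow> hol_module A x (germs A E x t) \<and>
       germs A E x 1 \<subseteq> germs A E x t \<and> germs A E x t \<subseteq> germs A E x 0"
    "\<And>t t'. 0 \<le> t \<Longrightarrow> t \<le> t' \<Longrightarrow> t' < 1 \<Longrightarrow> germs A E x t' \<subseteq> germs A E x t"
    "\<And>t t'. 0 \<le> t \<Longrightarrow> t \<le> t' \<Longrightarrow> t' \<le> 1 \<Longrightarrow> \<forall>a\<in>S. \<not> (t \<le> a \<and> a < t') \<Longrightarrow> germs A E x t = germs A E x t'"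
proof (cases "x \<in> ppts E")
  case True
  then show thesis by (rule parabolic_germs) (rule that, assumption+)
next
  case False
  have M: "hol_module A x (germs A E x t)" for t
    unfolding nonparabolic_germs[OF False, of t] by (rule hol_module_zmul[OF module_0])
  have sub: "germs A E x t' \<subseteq> germs A E x t" if "t \<le> t'" for t t'
    unfolding nonparabolic_germs[OF False, of t] nonparabolic_germs[OF False, of t']
    by (rule zmul_antimono[OF module_0 ceiling_mono[OF that]])
  show thesis
  \<comment> \<open>At an ordinary point the module changes only when
    \<open>\<lceil>t\<rceil>\<close> does, as if 0 were the only weight.\<close>
  proof (rule that[of "{0}"])
    show "germs A E x t = germs A E x t'"
      if t: "0 \<le> t" "t \<le> t'" "t' \<le> 1" "\<forall>a\<in>{0}. \<not> (t \<le> a \<and> a < t')" for t t'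
    proof -
      have "\<lceil>t\<rceil> = 1 \<and> \<lceil>t'\<rceil> = 1" if "t \<noteq> t'"
        using t that unfolding ceiling_eq_iff by force
      then have "\<lceil>t\<rceil> = \<lceil>t'\<rceil>" by fastforce
      then show ?thesis using nonparabolic_germs[OF False, of t] nonparabolic_germs[OF False, of t'] by simp
    qed
  qed (use M sub in auto)
qed

lemma hol_module_germs: "hol_module A x (germs A E x t)"
proof -
  have "hol_module A x (germs A E x (frac t))"
    by (rule germs_unit_interval[of x]) (use frac_ge_0[of t] frac_lt_1[of t] in blast)
  then show ?thesis by (subst germs_frac) (rule hol_module_zmul)
qed

text \<open>For equal integer parts this is the decreasing flag. Otherwise the module at the integer
  \<open>\<lfloor>t\<rfloor> + 1\<close> lies between the two.\<close>

lemma germs_antimono: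
  assumes "t \<le> t'"
  shows "germs A E x t' \<subseteq> germs A E x t"
proof -
  obtain S0 :: "real set" where S: "\<And>t. 0 \<le> t \<Longrightarrow> t < 1 \<Longrightarrow> hol_module A x (germs A E x t) \<and>
      germs A E x 1 \<subseteq> germs A E x t \<and> germs A E x t \<subseteq> germs A E x 0"
    "\<And>t t'. 0 \<le> t \<Longrightarrow> t \<le> t' \<Longrightarrow> t' < 1 \<Longrightarrow> germs A E x t' \<subseteq> germs A E x t"
    by (rule germs_unit_interval[of x]) (rule that, assumption+)
  have fl: "\<lfloor>t\<rfloor> \<le> \<lfloor>t'\<rfloor>" using assms by (rule floor_mono)
  show ?thesis
  proof (cases "\<lfloor>t\<rfloor> = \<lfloor>t'\<rfloor>")
    case True
    have "germs A E x (frac t') \<subseteq> germs A E x (frac t)"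
      using assms True frac_lt_1[of t'] frac_ge_0[of t] by (intro S(2)) (auto simp: frac_def)
    then show ?thesis
      using zmul_mono[of "germs A E x (frac t')" "germs A E x (frac t)" A x "\<lfloor>t\<rfloor>"]
        germs_frac[of x t] germs_frac[of x t'] True by simp
  next
    case False
    have "germs A E x t' \<subseteq> zmul A x \<lfloor>t'\<rfloor> (germs A E x 0)"
      using S(1)[of "frac t'"] frac_lt_1[of t'] frac_ge_0[of t'] by (subst germs_frac) (intro zmul_mono, blast)
    also have "\<dots> \<subseteq> zmul A x (\<lfloor>t\<rfloor> + 1) (germs A E x 0)"
      using fl False by (intro zmul_antimono[OF module_0]) linarith
    also have "\<dots> = zmul A x \<lfloor>t\<rfloor> (germs A E x 1)"
      using germs_succ[of x 0] by (simp add: zmul_zmul)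
    also have "\<dots> \<subseteq> germs A E x t"
      using S(1)[of "frac t"] frac_lt_1[of t] frac_ge_0[of t] by (subst (2) germs_frac) (intro zmul_mono, blast)
    finally show ?thesis .
  qed
qed

text \<open>By periodicity the jumps are the integer translates of those in the unit
  interval.\<close>

lemma germs_jumps:
  obtains S where "finite S"
    "\<And>t t'. t \<le> t' \<Longrightarrow> (\<And>a k. a \<in> S \<Longrightarrow> \<not> (t \<le> a + of_int k \<and> a + of_int k < t')) \<Longrightarrow>
       germs A E x t = germs A E x t'"
proof -
  obtain S where S: "finite S"
    "\<And>t t'. 0 \<le> t \<Longrightarrow> t \<le> t' \<Longrightarrow> t' \<le> 1 \<Longrightarrow> \<forall>a\<in>S. \<not> (t \<le> a \<and> a < t') \<Longrightarrow> germs A E x t = germs A E x t'"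
    by (rule germs_unit_interval[of x]) blast
  show thesis
  \<comment> \<open>Adding 0 keeps integers out of the interval from \<open>t\<close> to
    \<open>t'\<close>, so that the shift by \<open>n = \<lceil>t\<rceil> - 1\<close> brings all of
    it into the unit interval.\<close>
  proof (rule that[of "insert 0 S"])
    fix t t' :: real
    assume t: "t \<le> t'" and no: "\<And>a k. a \<in> insert 0 S \<Longrightarrow> \<not> (t \<le> a + of_int k \<and> a + of_int k < t')"
    show "germs A E x t = germs A E x t'"
    proof (cases "t = t'")
      case False
      define n where "n = \<lceil>t\<rceil> - 1"
      have "t' \<le> of_int \<lceil>t\<rceil>" using no[of 0 "\<lceil>t\<rceil>"] by (simp add: not_less)
      then have "t' - of_int n \<le> 1" by (simp add: n_def)
      moreover have "0 \<le> t - of_int n" unfolding n_def by linarith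
      moreover have "\<forall>a\<in>S. \<not> (t - of_int n \<le> a \<and> a < t' - of_int n)"
      proof
        fix a assume "a \<in> S"
        then show "\<not> (t - of_int n \<le> a \<and> a < t' - of_int n)" using no[of a n] by auto
      qed
      ultimately have "germs A E x (t - of_int n) = germs A E x (t' - of_int n)" using t by (intro S(2)) auto
      then show ?thesis
        using germs_shift[of x "t - of_int n" n] germs_shift[of x "t' - of_int n" n] by simp
    qed simp
  qed (use S(1) in simp)
qed

lemma germs_zO:
  assumes "f \<in> zO A x n" "s \<in> germs A E x t"
  shows "(\<lambda>y i. f y * s y i) \<in> germs A E x (t + of_int n)"
  unfolding germs_shift by (rule zmul_zO[OF hol_module_germs assms])

lemma germs_frame:
  assumes U: "local_frame A E r U e" "x \<in> U" and s: "s \<in> germs A E x t"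
  obtains f where "\<forall>k<r. f k \<in> zO A x \<lfloor>t\<rfloor>" "\<forall>\<^sub>F y in at x. s y = lincomb r (\<lambda>k. f k y) (\<lambda>k. e k y)"
proof -
  have "s \<in> germs A E x (0 + of_int \<lfloor>t\<rfloor>)" using s germs_antimono[of "of_int \<lfloor>t\<rfloor>" t x] by auto
  then have "s \<in> zmul A x \<lfloor>t\<rfloor> (germs A E x 0)" by (simp only: germs_shift)
  then obtain s' where s': "s' \<in> germs A E x 0" "\<forall>\<^sub>F y in at x. s y = (\<lambda>i. coord A x y powi \<lfloor>t\<rfloor> * s' y i)"
    by (rule zmulE)
  obtain f where f: "\<forall>k<r. hol_at A x (f k)" "\<forall>\<^sub>F y in at x. s' y = lincomb r (\<lambda>k. f k y) (\<lambda>k. e k y)"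
    using s'(1) unfolding germs_0[OF U] by blast
  show thesis
  proof (rule that[of "\<lambda>k y. coord A x y powi \<lfloor>t\<rfloor> * f k y"])
    show "\<forall>k<r. (\<lambda>y. coord A x y powi \<lfloor>t\<rfloor> * f k y) \<in> zO A x \<lfloor>t\<rfloor>"
      using f(1) by (auto intro!: zOI[of _ "f _"])
    show "\<forall>\<^sub>F y in at x. s y = lincomb r (\<lambda>k. coord A x y powi \<lfloor>t\<rfloor> * f k y) (\<lambda>k. e k y)"
      using s'(2) f(2) by eventually_elim (simp add: lincomb_def sum_distrib_left mult.assoc)
  qed
qed

lemma eventually_at_not_ppts: "\<forall>\<^sub>F y in at x. y \<notin> ppts E"
  and eventually_nhds_not_ppts: "x \<notin> ppts E \<Longrightarrow> \<forall>\<^sub>F y in nhds x. y \<notin> ppts E"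
  using eventually_not_mem_finite[OF finite_ppts] by auto

text \<open>The coefficients in a frame have a pole at most at \<open>x\<close>, so at each nearby
  point a germ is an ordinary holomorphic section.\<close>

lemma germs_nearby:
  assumes s: "s \<in> germs A E x t"
  shows "\<forall>\<^sub>F y in at x. y \<notin> ppts E \<and> s \<in> stalk E y"
proof -
  obtain U e where U: "x \<in> U" "local_frame A E r U e" by (rule frame[of UNIV x]) auto
  obtain f where f: "\<forall>k<r. f k \<in> zO A x \<lfloor>t\<rfloor>" "\<forall>\<^sub>F y in at x. s y = lincomb r (\<lambda>k. f k y) (\<lambda>k. e k y)"
    using germs_frame[OF U(2,1) s] by blast
  have "\<forall>k\<in>{..<r}. \<forall>\<^sub>F y in at x. hol_at A y (f k)" using f(1) zO_nearby by auto
  then have "\<forall>\<^sub>F y in at x. \<forall>k\<in>{..<r}. hol_at A y (f k)" by (intro eventually_ball_finite) auto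
  moreover have "\<forall>\<^sub>F y in nhds x. y \<in> U" using frameD(1)[OF U(2)] U(1) by (intro eventually_nhds_in_open)
  then have "\<forall>\<^sub>F y in at x. y \<in> U" by (simp add: eventually_nhds_conv_at)
  ultimately show ?thesis using eventually_nearby_at[OF f(2)] eventually_at_not_ppts[of x]
  proof eventually_elim
    case (elim y)
    then show ?case unfolding frameD(3)[OF U(2) elim(2,4)] by blast
  qed
qed

lemma fibre_closed:
  assumes "x \<notin> ppts E"
  shows "(\<lambda>_. 0) \<in> fibre E x" "v \<in> fibre E x \<Longrightarrow> (\<lambda>i. c * v i) \<in> fibre E x"
    "u \<in> fibre E x \<Longrightarrow> v \<in> fibre E x \<Longrightarrow> (\<lambda>i. a * u i + b * v i) \<in> fibre E x"
proof -
  obtain U e where U: "x \<in> U" "local_frame A E r U e" by (rule frame[of UNIV x]) auto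
  have F: "fibre E x = range (\<lambda>c. lincomb r c (\<lambda>k. e k x))"
    using frameD(2)[OF U(2,1) assms] unfolding is_basis_def by blast
  show "(\<lambda>_. 0) \<in> fibre E x" unfolding F by (rule image_eqI[of _ _ "\<lambda>_. 0"]) (auto simp: lincomb_def)
  show lin: "(\<lambda>i. a * u i + b * v i) \<in> fibre E x" if uv: "u \<in> fibre E x" "v \<in> fibre E x" for u v a b
  proof -
    obtain c d where "u = lincomb r c (\<lambda>k. e k x)" "v = lincomb r d (\<lambda>k. e k x)"
      using uv unfolding F by blast
    then have "(\<lambda>i. a * u i + b * v i) = lincomb r (\<lambda>k. a * c k + b * d k) (\<lambda>k. e k x)"
      by (simp add: lincomb_def sum_distrib_left sum.distrib algebra_simps)
    then show ?thesis unfolding F by blast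
  qed
  show "(\<lambda>i. c * v i) \<in> fibre E x" if "v \<in> fibre E x" using lin[OF that that, of c 0] by simp
qed

lemma fibre_sum:
  assumes "x \<notin> ppts E" "\<And>k. k \<in> I \<Longrightarrow> v k \<in> fibre E x"
  shows "(\<lambda>i. \<Sum>k\<in>I. v k i) \<in> fibre E x"
  using assms(2)
proof (induction I rule: infinite_finite_induct)
  case (insert a I)
  then show ?case using fibre_closed(3)[OF assms(1), of "v a" "\<lambda>i. \<Sum>k\<in>I. v k i" 1 1] by simp
qed (simp_all add: fibre_closed(1)[OF assms(1)])

lemma stalk_nearby:
  assumes x: "x \<notin> ppts E" and s: "s \<in> stalk E x"
  shows "\<forall>\<^sub>F y in nhds x. y \<notin> ppts E \<and> s \<in> stalk E y \<and> s y \<in> fibre E y"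
proof -
  obtain U e where U: "x \<in> U" "local_frame A E r U e" by (rule frame[of UNIV x]) auto
  obtain f where f: "\<forall>k<r. hol_at A x (f k)" "\<forall>\<^sub>F y in nhds x. s y = lincomb r (\<lambda>k. f k y) (\<lambda>k. e k y)"
    using s unfolding frameD(3)[OF U(2,1) x] by blast
  have "\<forall>k\<in>{..<r}. \<forall>\<^sub>F y in nhds x. hol_at A y (f k)" using f(1) hol_at_nearby by auto
  then have "\<forall>\<^sub>F y in nhds x. \<forall>k\<in>{..<r}. hol_at A y (f k)" by (intro eventually_ball_finite) auto
  moreover have "\<forall>\<^sub>F y in nhds x. y \<in> U" using frameD(1)[OF U(2)] U(1) by (intro eventually_nhds_in_open)
  ultimately show ?thesis using f(2) eventually_nearby_nhds[OF f(2)] eventually_nhds_not_ppts[OF x]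
  proof eventually_elim
    case (elim y)
    have "s \<in> stalk E y" unfolding frameD(3)[OF U(2) elim(2,5)] using elim(1,4) by blast
    moreover have "s y \<in> fibre E y"
      using frameD(2)[OF U(2) elim(2,5)] elim(3) unfolding is_basis_def by auto
    ultimately show ?case using elim(5) by simp
  qed
qed

lemma stalk_fibre:
  assumes "x \<notin> ppts E" "s \<in> stalk E x"
  shows "\<forall>\<^sub>F y in nhds x. s y \<in> fibre E y"
  using stalk_nearby[OF assms] by eventually_elim simp

lemma germs_fibre:
  assumes "s \<in> germs A E x t"
  shows "\<forall>\<^sub>F y in at x. y \<notin> ppts E \<and> s y \<in> fibre E y"
  using germs_nearby[OF assms]
proof eventually_elim
  case (elim y)
  then show ?case using eventually_nhds_x_imp_x[OF stalk_fibre[of y s]] by blast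
qed

lemma stalk_cong:
  assumes x: "x \<notin> ppts E" and "s \<in> stalk E x" "\<forall>\<^sub>F y in nhds x. s' y = s y"
  shows "s' \<in> stalk E x"
proof -
  obtain U e where U: "x \<in> U" "local_frame A E r U e" by (rule frame[of UNIV x]) auto
  obtain f where f: "\<forall>k<r. hol_at A x (f k)" "\<forall>\<^sub>F y in nhds x. s y = lincomb r (\<lambda>k. f k y) (\<lambda>k. e k y)"
    using assms(2) unfolding frameD(3)[OF U(2,1) x] by blast
  have "\<forall>\<^sub>F y in nhds x. s' y = lincomb r (\<lambda>k. f k y) (\<lambda>k. e k y)"
    using f(2) assms(3) by eventually_elim simp
  then show ?thesis using f(1) unfolding frameD(3)[OF U(2,1) x] by blast
qed

lemma stalk_mult:
  assumes x: "x \<notin> ppts E" and s: "s \<in> stalk E x" and h: "hol_at A x h"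
  shows "(\<lambda>y i. h y * s y i) \<in> stalk E x"
proof -
  obtain U e where U: "x \<in> U" "local_frame A E r U e" by (rule frame[of UNIV x]) auto
  obtain f where f: "\<forall>k<r. hol_at A x (f k)" "\<forall>\<^sub>F y in nhds x. s y = lincomb r (\<lambda>k. f k y) (\<lambda>k. e k y)"
    using s unfolding frameD(3)[OF U(2,1) x] by blast
  have "\<forall>\<^sub>F y in nhds x. (\<lambda>i. h y * s y i) = lincomb r (\<lambda>k. h y * f k y) (\<lambda>k. e k y)"
    using f(2) by eventually_elim (simp add: lincomb_def sum_distrib_left mult.assoc)
  moreover have "\<forall>k<r. hol_at A x (\<lambda>y. h y * f k y)" using f(1) h hol_at_mult by blast
  ultimately show ?thesis unfolding frameD(3)[OF U(2,1) x]
    by (intro exI[of _ "\<lambda>k y. h y * f k y"]) simp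
qed

lemma zero_stalk: "x \<notin> ppts E \<Longrightarrow> (\<lambda>_ _. 0) \<in> stalk E x"
proof -
  assume x: "x \<notin> ppts E"
  obtain U e where U: "x \<in> U" "local_frame A E r U e" by (rule frame[of UNIV x]) auto
  show ?thesis unfolding frameD(3)[OF U(2,1) x]
    by (rule exI[of _ "\<lambda>_ _. 0"]) (simp add: lincomb_def)
qed

lemma stalk_germs: "x \<notin> ppts E \<Longrightarrow> s \<in> stalk E x \<Longrightarrow> s \<in> germs A E x 0"
  using zmul_0_subset[of "stalk E x" x] by (auto simp: germs_def)

lemma frame_stalk:
  assumes U: "local_frame A E r U e" "x \<in> U" and x: "x \<notin> ppts E" and k: "k < r"
  shows "e k \<in> stalk E x"
  unfolding frameD(3)[OF U x]
  by (rule exI[of _ "\<lambda>j _. if j = k then 1 else 0"])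
    (use k in \<open>simp add: lincomb_def if_distrib[of "\<lambda>c. c * _"] cong: if_cong\<close>)

lemma frame_germs:
  assumes U: "local_frame A E r U e" "x \<in> U" and k: "k < r"
  shows "e k \<in> germs A E x 0"
  unfolding germs_0[OF U]
  by (rule exI[of _ "\<lambda>j _. if j = k then 1 else 0"])
    (use k in \<open>simp add: lincomb_def if_distrib[of "\<lambda>c. c * _"] cong: if_cong\<close>)

end

section \<open>From a filtration back to a flag with weights\<close>

context riemann
begin

text \<open>A converse to \<open>parabolic_germs\<close>. The members of the flag are the images of
  the lattices in the quotient of the lattice at 0 by that at 1.\<close>

lemma flags_of_filtration:
  fixes G :: "('x, 'i) par_bundle"
  assumes M: "\<And>t. hol_module A x (lattice G x t)"
    and anti: "\<And>t t'. t \<le> t' \<Longrightarrow> lattice G x t' \<subseteq> lattice G x t"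
    and succ: "\<And>t. lattice G x (t + 1) = zmul A x 1 (lattice G x t)"
    and J: "finite J" "\<And>t t'. 0 \<le> t \<Longrightarrow> t \<le> t' \<Longrightarrow> t' \<le> 1 \<Longrightarrow> \<forall>a\<in>J. \<not> (t \<le> a \<and> a < t') \<Longrightarrow>
      lattice G x t = lattice G x t'"
  shows "\<exists>n F \<alpha>. flag_weights A G x n F \<alpha>"
proof -
  let ?M = "lattice G x" and ?v = "val_at A G x"
  \<comment> \<open>The flag must decrease strictly, so only points of \<open>J\<close> after which
    the lattice really drops can be weights.\<close>
  define J' where "J' = {a\<in>J. 0 \<le> a \<and> a < 1 \<and> (\<forall>b. a < b \<longrightarrow> b \<le> 1 \<longrightarrow> ?M b \<noteq> ?M a)}"
  have finJ': "finite J'" using J(1) by (simp add: J'_def)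
  \<comment> \<open>The first candidate \<open>a\<close> in the interval is not a genuine jump, so
    the lattice is unchanged up to some \<open>b > a\<close>. Continuing from \<open>b\<close>
    leaves fewer candidates.\<close>
  have J': "?M t = ?M t'" if "0 \<le> t" "t \<le> t'" "t' \<le> 1" "\<forall>a\<in>J'. \<not> (t \<le> a \<and> a < t')" for t t'
    using that
  proof (induction "card {a\<in>J. t \<le> a \<and> a < t'}" arbitrary: t rule: less_induct)
    case less
    let ?S = "{a\<in>J. t \<le> a \<and> a < t'}"
    have fin: "finite ?S" using J(1) by simp
    show ?case
    proof (cases "?S = {}")
      case True
      then show ?thesis using less.prems by (intro J(2)) auto
    next
      case False
      define a where "a = Min ?S"
      have a: "a \<in> ?S" "\<And>c. c \<in> ?S \<Longrightarrow> a \<le> c"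
        unfolding a_def using Min_in[OF fin False] Min_le[OF fin] by blast+
      have a': "a \<in> J" "t \<le> a" "a < t'" using a(1) by auto
      have ta: "?M t = ?M a"
      proof (rule J(2))
        show "\<forall>c\<in>J. \<not> (t \<le> c \<and> c < a)" using a(2) a'(3) by force
      qed (use less.prems a' in auto)
      have "a \<notin> J'" using less.prems(4) a' by blast
      then obtain b where b: "a < b" "b \<le> 1" "?M b = ?M a"
        using a' less.prems unfolding J'_def by auto
      show ?thesis
      proof (cases "b \<ge> t'")
        case True
        then have "?M b \<subseteq> ?M t'" "?M t' \<subseteq> ?M a" using anti a' by auto
        then show ?thesis using ta b by auto
      next
        case F: False
        have "{c\<in>J. b \<le> c \<and> c < t'} \<subseteq> ?S" using b a' by auto
        moreover have "a \<notin> {c\<in>J. b \<le> c \<and> c < t'}" using b by simp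
        ultimately have "{c\<in>J. b \<le> c \<and> c < t'} \<subset> ?S" using a(1) by blast
        then have "card {c\<in>J. b \<le> c \<and> c < t'} < card ?S" using fin by (rule psubset_card_mono[rotated])
        then have "?M b = ?M t'" using less.hyps[of b] less.prems a' b F by auto
        then show ?thesis using ta b by simp
      qed
    qed
  qed
  define n where "n = card J'"
  define h where "h = (\<lambda>i. sorted_list_of_set J' ! i)"
  have h1: "bij_betw h {..<n} J'" unfolding h_def n_def using finJ' by (intro bij_betw_nth) auto
  have h2: "h i < h j" if "i < j" "j < n" for i j
    unfolding h_def using that finJ'
    by (intro sorted_wrt_nth_less[OF strict_sorted_list_of_set]) (auto simp: n_def)
  \<comment> \<open>The sorted list is indexed from 0, the flag from 1. Below,
    \<open>\<beta>\<close> appends the value 1 at index \<open>n + 1\<close>, because the last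
    member of the flag must be the image of the lattice at 1, which is zero.\<close>
  define \<alpha> where "\<alpha> = (\<lambda>j. h (j - 1))"
  define \<beta> where "\<beta> = (\<lambda>j. if j \<le> n then \<alpha> j else 1)"
  have \<alpha>: "\<alpha> j \<in> J'" if "1 \<le> j" "j \<le> n" for j
    using h1 that unfolding \<alpha>_def bij_betw_def by auto
  have \<alpha>_ex: "\<exists>j. 1 \<le> j \<and> j \<le> n \<and> a = \<alpha> j" if a: "a \<in> J'" for a
  proof -
    obtain i where "i < n" "a = h i" using h1 a unfolding bij_betw_def by auto
    then show ?thesis unfolding \<alpha>_def by (intro exI[of _ "Suc i"]) auto
  qed
  have \<alpha>_less: "\<alpha> i < \<alpha> j" if "1 \<le> i" "i < j" "j \<le> n" for i j
    unfolding \<alpha>_def using that by (intro h2) auto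
  have \<alpha>_bd: "0 \<le> \<alpha> j" "\<alpha> j < 1" if "1 \<le> j" "j \<le> n" for j using \<alpha>[OF that] by (auto simp: J'_def)
  have \<beta>_bd: "0 \<le> \<beta> j" "\<beta> j \<le> 1" if "1 \<le> j" for j
    using \<alpha>_bd[OF that] by (auto simp: \<beta>_def less_imp_le)
  have \<beta>_mono: "\<beta> i \<le> \<beta> j" if "1 \<le> i" "i \<le> j" for i j
    using \<alpha>_less[of i j] \<alpha>_bd(2)[of i] that by (cases "i = j") (auto simp: \<beta>_def less_imp_le)
  define F where "F = (\<lambda>j. ?v ` ?M (\<beta> j))"
  have MN: "hol_module A x (zmul A x 1 (?M 0))" by (rule hol_module_zmul[OF M])
  have M1: "?M 1 = zmul A x 1 (?M 0)" using succ[of 0] by simp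
  have sub0: "?M (\<beta> j) \<subseteq> ?M 0" "?M 1 \<subseteq> ?M (\<beta> j)" if "1 \<le> j" for j
    using anti \<beta>_bd[OF that] by auto
  \<comment> \<open>A lattice that contains the one at 1 is the full preimage of its image, so
    membership can be read off the value.\<close>
  have v_mem: "s \<in> ?M b" if s: "s \<in> ?M 0" "?v s \<in> ?v ` ?M b" and b: "?M 1 \<subseteq> ?M b" "?M b \<subseteq> ?M 0" for s b
  proof -
    obtain s' where s': "s' \<in> ?M b" "?v s = ?v s'" using s(2) by blast
    have "s \<in> ?v s" using s(1) hol_moduleD(1)[OF MN] unfolding val_at_def by simp
    then have "s \<in> ?v s'" using s'(2) by simp
    then have "(\<lambda>y i. s y i - s' y i) \<in> ?M b" using b M1 unfolding val_at_def by auto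
    from hol_moduleD(2)[OF M this s'(1)] show ?thesis by simp
  qed
  have Fsub: "fibre_subspace A G x (F j)" if j: "1 \<le> j" for j
    unfolding fibre_subspace_def
  proof (intro conjI ballI allI impI)
    show "F j \<subseteq> ?v ` ?M 0" unfolding F_def using sub0[OF j] by blast
    show "?v (\<lambda>_ _. 0) \<in> F j" unfolding F_def using hol_moduleD(1)[OF M] by blast
    fix s s' a b assume s: "s \<in> ?M 0" "s' \<in> ?M 0" "?v s \<in> F j" "?v s' \<in> F j"
    then have "s \<in> ?M (\<beta> j)" "s' \<in> ?M (\<beta> j)" using v_mem sub0[OF j] unfolding F_def by blast+
    then have "(\<lambda>y i. a * s y i + b * s' y i) \<in> ?M (\<beta> j)"
      using hol_moduleD(2)[OF M hol_moduleD(3)[OF M hol_at_const] hol_moduleD(3)[OF M hol_at_const]] by blast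
    then show "?v (\<lambda>y i. a * s y i + b * s' y i) \<in> F j" unfolding F_def by blast
  qed
  have step: "?M t = ?M (\<beta> j)"
    if t: "0 \<le> t" "t \<le> \<beta> j" and j: "1 \<le> j" and least: "\<And>i. 1 \<le> i \<Longrightarrow> i \<le> n \<Longrightarrow> t \<le> \<alpha> i \<Longrightarrow> j \<le> i" for t j
  proof (rule J'[OF t \<beta>_bd(2)[OF j]], rule ballI)
    fix a assume "a \<in> J'"
    then obtain i where i: "1 \<le> i" "i \<le> n" "a = \<alpha> i" using \<alpha>_ex by blast
    show "\<not> (t \<le> a \<and> a < \<beta> j)"
    proof
      assume a: "t \<le> a \<and> a < \<beta> j"
      then have "j \<le> i" using least[of i] i by simp
      then have "\<beta> j \<le> \<alpha> i" using \<beta>_mono[OF j, of i] i by (simp add: \<beta>_def)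
      then show False using a i by simp
    qed
  qed
  have "flag_weights A G x n F \<alpha>"
    unfolding flag_weights_def
  proof (intro conjI ballI allI)
    have "?M 0 = ?M (\<beta> 1)" using \<beta>_bd(1)[of 1] by (intro step) auto
    then show "F 1 = ?v ` ?M 0" by (simp add: F_def)
    have "?v s = ?v (\<lambda>_ _. 0)" if "s \<in> ?M 1" for s
      using that val_at_eq[OF MN, of s "\<lambda>_ _. 0"] M1 by simp
    moreover have "(\<lambda>_ _. 0) \<in> ?M 1" by (rule hol_moduleD(1)[OF M])
    ultimately have "?v ` ?M 1 = {?v (\<lambda>_ _. 0)}" by blast
    then show "F (n + 1) = {?v (\<lambda>_ _. 0)}" by (simp add: F_def \<beta>_def)
    show "fibre_subspace A G x (F j)" if "j \<in> {1..n + 1}" for j using that Fsub by simp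
    show "F (j + 1) \<subset> F j" if j: "j \<in> {1..n}" for j
    proof -
      have "\<beta> j < \<beta> (j + 1)" using j \<alpha>_less[of j "j + 1"] \<alpha>_bd[of j] by (auto simp: \<beta>_def)
      then have "?M (\<beta> (j + 1)) \<noteq> ?M (\<beta> j)" and le: "?M (\<beta> (j + 1)) \<subseteq> ?M (\<beta> j)"
        using \<alpha>[of j] j \<beta>_bd(2)[of "j + 1"] anti by (auto simp: J'_def \<beta>_def)
      then obtain s where s: "s \<in> ?M (\<beta> j)" "s \<notin> ?M (\<beta> (j + 1))" by blast
      have "s \<in> ?M 0" using s(1) sub0[of j] j by auto
      then have "?v s \<notin> F (j + 1)" using v_mem[of s "\<beta> (j + 1)"] s(2) sub0[of "j + 1"] by (auto simp: F_def)
      moreover have "?v s \<in> F j" using s(1) by (auto simp: F_def)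
      moreover have "F (j + 1) \<subseteq> F j" using le by (auto simp: F_def)
      ultimately show ?thesis by blast
    qed
    show "0 \<le> \<alpha> j" "\<alpha> j < 1" if "j \<in> {1..n}" for j using \<alpha>_bd that by auto
    show "\<alpha> j < \<alpha> (j + 1)" if "j \<in> {1..<n}" for j using \<alpha>_less that by auto
    show "?M (t + 1) = zmul A x 1 (?M t)" for t by (rule succ)
    fix t :: real assume t: "t \<in> {0..<1}"
    define j where "j = (LEAST j. 1 \<le> j \<and> (j = n + 1 \<or> t \<le> \<alpha> j))"
    have j: "1 \<le> j \<and> (j = n + 1 \<or> t \<le> \<alpha> j)" unfolding j_def by (rule LeastI[of _ "n + 1"]) simp
    have least: "j \<le> i" if "1 \<le> i" "t \<le> \<alpha> i" for i unfolding j_def by (rule Least_le) (use that in simp)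
    have "t \<le> \<beta> j" using j t by (auto simp: \<beta>_def)
    then have "?M t = ?M (\<beta> j)" using j t least by (intro step) auto
    moreover have "?M (\<beta> j) = {s \<in> ?M 0. ?v s \<in> F j}"
      using v_mem[of _ "\<beta> j"] sub0[of j] j by (auto simp: F_def)
    ultimately show "?M t = {s \<in> ?M 0. ?v s \<in> F (LEAST j. 1 \<le> j \<and> (j = n + 1 \<or> t \<le> \<alpha> j))}"
      by (simp add: j_def)
  qed
  then show ?thesis by blast
qed

end

section \<open>Line bundles\<close>

locale parabolic_line = parabolic A L 1 for A :: "'x::t2_space atlas" and L :: "('x, 'l) par_bundle"
begin

lemma line_germs_0:
  assumes "local_frame A L 1 U e" "x \<in> U"
  shows "s \<in> germs A L x 0 \<longleftrightarrow> (\<exists>f. hol_at A x f \<and> (\<forall>\<^sub>F y in at x. s y = (\<lambda>i. f y * e 0 y i)))"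
  unfolding germs_0[OF assms] lincomb_def by (auto intro: exI[of _ "\<lambda>_. _"])

lemma line_germs_int:
  assumes U: "local_frame A L 1 U e" "x \<in> U"
  shows "s \<in> germs A L x (of_int n) \<longleftrightarrow> (\<exists>f\<in>zO A x n. \<forall>\<^sub>F y in at x. s y = (\<lambda>i. f y * e 0 y i))"
proof -
  have g: "germs A L x (of_int n) = zmul A x n (germs A L x 0)" using germs_shift[of x 0 n] by simp
  show ?thesis
  proof
    assume "s \<in> germs A L x (of_int n)"
    then obtain s' where s': "s' \<in> germs A L x 0" "\<forall>\<^sub>F y in at x. s y = (\<lambda>i. coord A x y powi n * s' y i)"
      unfolding g by (rule zmulE)
    obtain f where f: "hol_at A x f" "\<forall>\<^sub>F y in at x. s' y = (\<lambda>i. f y * e 0 y i)"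
      using s'(1) unfolding line_germs_0[OF U] by blast
    have "(\<lambda>y. coord A x y powi n * f y) \<in> zO A x n" by (rule zOI[OF f(1)]) simp
    moreover have "\<forall>\<^sub>F y in at x. s y = (\<lambda>i. (coord A x y powi n * f y) * e 0 y i)"
      using s'(2) f(2) by eventually_elim (simp add: mult.assoc)
    ultimately show "\<exists>f\<in>zO A x n. \<forall>\<^sub>F y in at x. s y = (\<lambda>i. f y * e 0 y i)"
      by (intro bexI[of _ "\<lambda>y. coord A x y powi n * f y"])
  next
    assume "\<exists>f\<in>zO A x n. \<forall>\<^sub>F y in at x. s y = (\<lambda>i. f y * e 0 y i)"
    then obtain f where f: "f \<in> zO A x n" "\<forall>\<^sub>F y in at x. s y = (\<lambda>i. f y * e 0 y i)" by blast
    obtain h where h: "hol_at A x h" "\<forall>\<^sub>F y in at x. f y = coord A x y powi n * h y" using f(1) by (rule zOE)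
    have "(\<lambda>y i. h y * e 0 y i) \<in> germs A L x 0" unfolding line_germs_0[OF U] using h(1) by auto
    moreover have "\<forall>\<^sub>F y in at x. s y = (\<lambda>i. coord A x y powi n * (h y * e 0 y i))"
      using f(2) h(2) by eventually_elim (simp add: mult.assoc)
    ultimately show "s \<in> germs A L x (of_int n)" unfolding g by (rule zmulI)
  qed
qed

lemma frame_line_nonzero:
  assumes "local_frame A L 1 U e" "x \<in> U" "x \<notin> ppts L"
  shows "e 0 x \<noteq> (\<lambda>_. 0)" "fibre L x = range (\<lambda>c i. c * e 0 x i)"
proof -
  have b: "fibre L x = range (\<lambda>c. lincomb 1 c (\<lambda>k. e k x))"
    "\<forall>c. lincomb 1 c (\<lambda>k. e k x) = (\<lambda>_. 0) \<longrightarrow> (\<forall>k<1. c k = 0)"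
    using frameD(2)[OF assms] unfolding is_basis_def by auto
  show "e 0 x \<noteq> (\<lambda>_. 0)" using spec[OF b(2), of "\<lambda>_. 1"] by (auto simp: lincomb_def)
  show "fibre L x = range (\<lambda>c i. c * e 0 x i)" unfolding b(1)
  proof (intro equalityI subsetI)
    fix v assume "v \<in> range (\<lambda>c. lincomb 1 c (\<lambda>k. e k x))"
    then show "v \<in> range (\<lambda>c i. c * e 0 x i)" by (auto simp: lincomb_def)
  next
    fix v assume "v \<in> range (\<lambda>c i. c * e 0 x i)"
    then obtain c where "v = (\<lambda>i. c * e 0 x i)" by auto
    then have "v = lincomb 1 (\<lambda>_. c) (\<lambda>k. e k x)" by (simp add: lincomb_def)
    then show "v \<in> range (\<lambda>c. lincomb 1 c (\<lambda>k. e k x))" by blast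
  qed
qed

lemma eventually_frame_nonzero:
  assumes U: "local_frame A L 1 U e" "x \<in> U"
  shows "\<forall>\<^sub>F y in at x. e 0 y \<noteq> (\<lambda>_. 0)"
proof -
  have "\<forall>\<^sub>F y in nhds x. y \<in> U" using frameD(1)[OF U(1)] U(2) by (intro eventually_nhds_in_open)
  then have "\<forall>\<^sub>F y in at x. y \<in> U" by (simp add: eventually_nhds_conv_at)
  then show ?thesis using eventually_at_not_ppts[of x]
    by eventually_elim (use frame_line_nonzero(1)[OF U(1)] in blast)
qed

text \<open>The fibre is one-dimensional, so each member of the flag is zero or everything, and
  strict decrease leaves exactly one weight.\<close>

lemma parabolic_line_weight:
  assumes U: "local_frame A L 1 U e" "x \<in> U" and x: "x \<in> ppts L"
  obtains \<alpha> where "0 \<le> \<alpha>" "\<alpha> < 1"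
    "\<And>t. 0 \<le> t \<Longrightarrow> t < 1 \<Longrightarrow> germs A L x t = (if t \<le> \<alpha> then germs A L x 0 else germs A L x 1)"
proof -
  obtain n F \<alpha> where fl: "flag_weights A L x n F \<alpha>" using x by (rule flags)
  let ?M = "lattice L x" and ?v = "val_at A L x"
  have gM: "germs A L x t = ?M t" for t using x by (simp add: germs_def)
  have M1: "?M 1 = zmul A x 1 (?M 0)" using germs_succ[of x 0] by (simp add: gM)
  have MN: "hol_module A x (zmul A x 1 (?M 0))" using hol_module_germs[of x 1] by (simp add: gM M1)
  note fl = fl[unfolded flag_weights_def]
  have F1: "F 1 = ?v ` ?M 0" using fl by (elim conjE) assumption
  have Fn: "F (n + 1) = {?v (\<lambda>_ _. 0)}" using fl by (elim conjE) assumption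
  have Fs: "\<forall>j\<in>{1..n + 1}. fibre_subspace A L x (F j)" using fl by (elim conjE) assumption
  have Fd: "\<forall>j\<in>{1..n}. F (j + 1) \<subset> F j" using fl by (elim conjE) assumption
  have Fw: "\<forall>j\<in>{1..n}. 0 \<le> \<alpha> j \<and> \<alpha> j < 1" using fl by (elim conjE) assumption
  have Fl: "\<forall>t\<in>{0..<1}. ?M t =
      {s \<in> ?M 0. ?v s \<in> F (LEAST j. 1 \<le> j \<and> (j = n + 1 \<or> t \<le> \<alpha> j))}" using fl by (elim conjE) assumption
  have zero: "?v (\<lambda>_ _. 0) \<in> F j" if "j \<in> {1..n + 1}" for j
    using bspec[OF Fs that] unfolding fibre_subspace_def by (elim conjE) assumption
  have v0: "s \<in> ?M 1 \<longleftrightarrow> ?v s = ?v (\<lambda>_ _. 0)" if s: "s \<in> ?M 0" for s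
  proof
    assume "s \<in> ?M 1"
    then show "?v s = ?v (\<lambda>_ _. 0)" using val_at_eq[OF MN, of s "\<lambda>_ _. 0"] M1 by simp
  next
    assume eq: "?v s = ?v (\<lambda>_ _. 0)"
    have "s \<in> ?v s" using s hol_moduleD(1)[OF MN] unfolding val_at_def by simp
    then show "s \<in> ?M 1" unfolding eq M1 by (simp add: val_at_def)
  qed
  have e0: "e 0 \<in> ?M 0" using frame_germs[OF U, of 0] by (simp add: gM)
  \<comment> \<open>The frame does not vanish at \<open>x\<close>; otherwise 1 would be a multiple
    of the coordinate.\<close>
  have e1: "e 0 \<notin> ?M 1"
  proof
    assume "e 0 \<in> ?M 1"
    then have "e 0 \<in> germs A L x (of_int 1)" by (simp add: gM)
    then obtain f where f: "f \<in> zO A x 1" "\<forall>\<^sub>F y in at x. e 0 y = (\<lambda>i. f y * e 0 y i)"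
      unfolding line_germs_int[OF U] by blast
    obtain g where g: "hol_at A x g" "\<forall>\<^sub>F y in at x. f y = coord A x y powi 1 * g y" using f(1) by (rule zOE)
    have "\<forall>\<^sub>F y in at x. 1 = coord A x y * g y"
      using f(2) g(2) eventually_frame_nonzero[OF U]
    proof eventually_elim
      case (elim y)
      then obtain i where i: "e 0 y i \<noteq> 0" by auto
      have "1 * e 0 y i = f y * e 0 y i" using fun_cong[OF elim(1), of i] by simp
      then show ?case using i elim(2) by simp
    qed
    then have "1 = coord A x x * g x"
      using hol_at_unique(2)[OF hol_at_const hol_at_mult[OF hol_at_coord g(1)]] by blast
    then show False using eventually_coord(3)[of x] by simp
  qed
  have full: "F j = ?v ` ?M 0" if j: "j \<in> {1..n + 1}" and ne: "F j \<noteq> {?v (\<lambda>_ _. 0)}" for j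
  proof -
    have "F j \<subseteq> ?v ` ?M 0 \<and> (\<forall>s\<in>?M 0. \<forall>s'\<in>?M 0. \<forall>a b. ?v s \<in> F j \<longrightarrow> ?v s' \<in> F j \<longrightarrow>
        ?v (\<lambda>y i. a * s y i + b * s' y i) \<in> F j)"
      using bspec[OF Fs j] unfolding fibre_subspace_def by (elim conjE) (rule conjI)
    note sub = this[THEN conjunct1] this[THEN conjunct2]
    obtain s where s: "s \<in> ?M 0" "?v s \<in> F j" "s \<notin> ?M 1"
      using ne zero[OF j] sub(1) v0 by blast
    obtain g where g: "hol_at A x g" "\<forall>\<^sub>F y in at x. s y = (\<lambda>i. g y * e 0 y i)"
      using s(1) line_germs_0[OF U, of s] gM by auto
    have gx: "g x \<noteq> 0"
    proof
      assume "g x = 0"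
      then obtain g' where g': "hol_at A x g'" "\<forall>\<^sub>F y in nhds x. g y = coord A x y * g' y"
        using hol_at_factor[OF g(1)] by blast
      have "\<forall>\<^sub>F y in at x. g y = coord A x y powi 1 * g' y" using g'(2) by (simp add: eventually_nhds_conv_at)
      then have "g \<in> zO A x 1" by (rule zOI[OF g'(1)])
      then have "s \<in> germs A L x (of_int 1)" using g(2) unfolding line_germs_int[OF U] by blast
      then show False using s(3) by (simp add: gM)
    qed
    have "?v s' \<in> F j" if s': "s' \<in> ?M 0" for s'
    proof -
      obtain h where h: "hol_at A x h" "\<forall>\<^sub>F y in at x. s' y = (\<lambda>i. h y * e 0 y i)"
        using s' line_germs_0[OF U, of s'] gM by auto
      \<comment> \<open>With this constant \<open>h - c g\<close> vanishes at \<open>x\<close>, so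
        \<open>s'\<close> and \<open>c s\<close> have the same value.\<close>
      define c where "c = h x / g x"
      have hol: "hol_at A x (\<lambda>y. h y - c * g y)" by (rule hol_at_diff[OF h(1) hol_at_mult[OF hol_at_const g(1)]])
      have "h x - c * g x = 0" using gx by (simp add: c_def)
      then obtain k where k: "hol_at A x k" "\<forall>\<^sub>F y in nhds x. h y - c * g y = coord A x y * k y"
        using hol_at_factor[OF hol] by blast
      have "\<forall>\<^sub>F y in at x. h y - c * g y = coord A x y powi 1 * k y" using k(2) by (simp add: eventually_nhds_conv_at)
      then have "(\<lambda>y. h y - c * g y) \<in> zO A x 1" by (rule zOI[OF k(1)])
      moreover have "\<forall>\<^sub>F y in at x. (\<lambda>i. s' y i - (c * s y i + 0 * s y i)) = (\<lambda>i. (h y - c * g y) * e 0 y i)"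
        using g(2) h(2) by eventually_elim (simp add: algebra_simps)
      ultimately have "(\<lambda>y i. s' y i - (c * s y i + 0 * s y i)) \<in> germs A L x (of_int 1)"
        unfolding line_germs_int[OF U] by (intro bexI[of _ "\<lambda>y. h y - c * g y"])
      then have "?v s' = ?v (\<lambda>y i. c * s y i + 0 * s y i)" using val_at_eq[OF MN] by (simp add: gM M1)
      moreover have "?v (\<lambda>y i. c * s y i + 0 * s y i) \<in> F j" using sub(2) s(1,2) by blast
      ultimately show ?thesis by (rule ssubst)
    qed
    then show ?thesis using sub(1) by blast
  qed
  have ne: "?v ` ?M 0 \<noteq> {?v (\<lambda>_ _. 0)}" using v0[OF e0] e0 e1 by blast
  have n1: "n = 1"
  proof (rule ccontr)
    assume "n \<noteq> 1"
    then consider "n = 0" | "n \<ge> 2" by linarith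
    then show False
    proof cases
      case 1
      then show False using F1 Fn ne by simp
    next
      case 2
      have "F (1 + 1) \<subset> F 1" using 2 by (intro bspec[OF Fd]) auto
      then have F21: "F 2 \<subset> F 1" by (simp only: one_add_one)
      have "F 2 = {?v (\<lambda>_ _. 0)}"
      proof (rule ccontr)
        assume "F 2 \<noteq> {?v (\<lambda>_ _. 0)}"
        then have "F 2 = ?v ` ?M 0" using 2 by (intro full) auto
        then show False using F21 F1 by simp
      qed
      moreover have "F (2 + 1) \<subset> F 2" using 2 by (intro bspec[OF Fd]) auto
      ultimately have "F (2 + 1) = {}" by (metis subset_singletonD psubset_imp_subset psubset_eq)
      moreover have "?v (\<lambda>_ _. 0) \<in> F (2 + 1)" using 2 by (intro zero) auto
      ultimately show False by (metis emptyE)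
    qed
  qed
  show thesis
  proof (rule that[of "\<alpha> 1"])
    show "0 \<le> \<alpha> 1" "\<alpha> 1 < 1" using bspec[OF Fw, of 1] n1 by auto
    fix t :: real assume t: "0 \<le> t" "t < 1"
    define j where "j = (LEAST j. 1 \<le> j \<and> (j = n + 1 \<or> t \<le> \<alpha> j))"
    have Mt: "?M t = {s \<in> ?M 0. ?v s \<in> F j}" unfolding j_def by (rule bspec[OF Fl]) (use t in simp)
    show "germs A L x t = (if t \<le> \<alpha> 1 then germs A L x 0 else germs A L x 1)"
    proof (cases "t \<le> \<alpha> 1")
      case True
      then have "j = 1" unfolding j_def by (intro Least_equality) auto
      then show ?thesis using True Mt F1 by (auto simp: gM)
    next
      case False
      have "j = 2" unfolding j_def
      proof (rule Least_equality)
        fix i assume i: "1 \<le> i \<and> (i = n + 1 \<or> t \<le> \<alpha> i)"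
        then show "2 \<le> i" using False n1 by (cases "i = 1") auto
      qed (use n1 in auto)
      then have "F j = {?v (\<lambda>_ _. 0)}" using Fn n1 by (simp add: numeral_2_eq_2)
      then have "?M t = {s \<in> ?M 0. s \<in> ?M 1}" unfolding Mt using v0 by auto
      moreover have "?M 1 \<subseteq> ?M 0" using germs_antimono[of 0 1 x] by (simp add: gM)
      ultimately show ?thesis using False by (auto simp: gM)
    qed
  qed
qed

text \<open>The module at \<open>t\<close> equals the one at the integer
  \<open>\<lceil>t - \<alpha>\<rceil>\<close>, with \<open>\<alpha>\<close> the weight, or 0 at an
  ordinary point. Order estimates for sections of line bundles are reduced to functions by this
  formula.\<close>

lemma line_weight:
  obtains U e \<alpha> where "local_frame A L 1 U e" "x \<in> U" "U \<inter> ppts L \<subseteq> {x}"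
    "\<And>s t. s \<in> germs A L x t \<longleftrightarrow> (\<exists>f\<in>zO A x \<lceil>t - \<alpha>\<rceil>. \<forall>\<^sub>F y in at x. s y = (\<lambda>i. f y * e 0 y i))"
proof -
  obtain U e where U: "x \<in> U" "U \<inter> ppts L \<subseteq> {x}" "local_frame A L 1 U e" by (rule frame[of UNIV x]) auto
  have "\<exists>\<alpha>. \<forall>t. germs A L x t = germs A L x (of_int \<lceil>t - \<alpha>\<rceil>)"
  proof (cases "x \<in> ppts L")
    case True
    obtain \<alpha> where a: "0 \<le> \<alpha>" "\<alpha> < 1"
      "\<And>t. 0 \<le> t \<Longrightarrow> t < 1 \<Longrightarrow> germs A L x t = (if t \<le> \<alpha> then germs A L x 0 else germs A L x 1)"
      by (rule parabolic_line_weight[OF U(3,1) True]) blast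
    have "germs A L x t = germs A L x (of_int \<lceil>t - \<alpha>\<rceil>)" for t
    proof -
      have f: "0 \<le> frac t" "frac t < 1" using frac_ge_0 frac_lt_1 by auto
      have "germs A L x (frac t) = germs A L x (of_int \<lceil>frac t - \<alpha>\<rceil>)"
      proof (cases "frac t \<le> \<alpha>")
        case True
        moreover have "- 1 < frac t - \<alpha>" using f a(2) by linarith
        ultimately have "\<lceil>frac t - \<alpha>\<rceil> = 0" by (simp add: ceiling_eq_iff)
        then show ?thesis using a(3)[OF f] \<open>frac t \<le> \<alpha>\<close> by simp
      next
        case False
        moreover have "frac t - \<alpha> \<le> 1" using f a(1) by linarith
        ultimately have "\<lceil>frac t - \<alpha>\<rceil> = 1" by (simp add: ceiling_eq_iff)
        then show ?thesis using a(3)[OF f] \<open>\<not> frac t \<le> \<alpha>\<close> by simp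
      qed
      then have "germs A L x (frac t + of_int \<lfloor>t\<rfloor>) = germs A L x (of_int \<lceil>frac t - \<alpha>\<rceil> + of_int \<lfloor>t\<rfloor>)"
        by (simp only: germs_shift)
      moreover have "frac t + of_int \<lfloor>t\<rfloor> = t" by (simp add: frac_def)
      moreover have "\<lceil>t - \<alpha>\<rceil> = \<lceil>frac t - \<alpha>\<rceil> + \<lfloor>t\<rfloor>"
        using ceiling_add_of_int[of "frac t - \<alpha>" "\<lfloor>t\<rfloor>"] by (simp add: frac_def algebra_simps)
      ultimately show ?thesis by simp
    qed
    then show ?thesis by blast
  next
    case False
    have "germs A L x t = germs A L x (of_int \<lceil>t - 0\<rceil>)" for t
      using nonparabolic_germs[OF False, of t] germs_shift[of x 0 "\<lceil>t\<rceil>"] by simp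
    then show ?thesis by blast
  qed
  then obtain \<alpha> where a: "\<And>t. germs A L x t = germs A L x (of_int \<lceil>t - \<alpha>\<rceil>)" by blast
  show thesis
    by (rule that[OF U(3,1,2), of \<alpha>]) (subst a, rule line_germs_int[OF U(3,1)])
qed

end

section \<open>Tensor products and duals\<close>

context riemann
begin

lemma lincomb_tens:
  "(\<lambda>p. \<Sum>k<n. tens (\<lambda>i. c * u k i) (v k) p) = (\<lambda>p. c * (\<Sum>k<(n::nat). tens (u k) (v k) p))"
  by (auto simp: tens_def sum_distrib_left mult.assoc)

text \<open>Extends the description of the lattices at parabolic points to all points.\<close>

lemma tensor_germsD:
  assumes "s \<in> germs A (par_tensor A E E') x t"
  obtains n u v a b where "\<And>k. k < (n::nat) \<Longrightarrow> a k + b k = t"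
    "\<And>k. k < n \<Longrightarrow> u k \<in> germs A E x (a k)" "\<And>k. k < n \<Longrightarrow> v k \<in> germs A E' x (b k)"
    "\<forall>\<^sub>F y in at x. s y = (\<lambda>p. \<Sum>k<n. tens (u k y) (v k y) p)"
proof (cases "x \<in> ppts E \<union> ppts E'")
  case True
  then have "s \<in> lattice (par_tensor A E E') x t" using assms by (simp add: germs_def par_tensor_def)
  then obtain n u v a b where "\<forall>k<n. a k + b k = t \<and> u k \<in> germs A E x (a k) \<and> v k \<in> germs A E' x (b k)"
    "\<forall>\<^sub>F y in at x. s y = (\<lambda>p. \<Sum>k<(n::nat). tens (u k y) (v k y) p)"
    unfolding par_tensor_def by auto
  then show thesis using that[of n a b u v] by blast
next
  case False
  then have "s \<in> zmul A x \<lceil>t\<rceil> (stalk (par_tensor A E E') x)" using assms by (simp add: germs_def par_tensor_def)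
  then obtain s' where s': "s' \<in> stalk (par_tensor A E E') x"
    "\<forall>\<^sub>F y in at x. s y = (\<lambda>p. coord A x y powi \<lceil>t\<rceil> * s' y p)" by (rule zmulE)
  obtain n u v where uv: "\<forall>k<n. u k \<in> stalk E x \<and> v k \<in> stalk E' x"
    "\<forall>\<^sub>F y in nhds x. s' y = (\<lambda>p. \<Sum>k<(n::nat). tens (u k y) (v k y) p)"
    using s'(1) unfolding par_tensor_def by auto
  have ev: "\<forall>\<^sub>F y in at x. s' y = (\<lambda>p. \<Sum>k<n. tens (u k y) (v k y) p)"
    using uv(2) by (simp add: eventually_nhds_conv_at)
  show thesis
  \<comment> \<open>The power of the coordinate is put into the first factor, which thus carries the
    whole index.\<close>
  proof (rule that[of n "\<lambda>_. t" "\<lambda>_. 0" "\<lambda>k y i. coord A x y powi \<lceil>t\<rceil> * u k y i" v])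
    show "(\<lambda>y i. coord A x y powi \<lceil>t\<rceil> * u k y i) \<in> germs A E x t" if "k < n" for k
      using False uv(1) that by (auto simp: germs_def intro!: zmulI[of "u k"])
    show "v k \<in> germs A E' x 0" if "k < n" for k
      using False uv(1) that by (auto simp: germs_def intro!: zmulI[of "v k"])
    show "\<forall>\<^sub>F y in at x. s y = (\<lambda>p. \<Sum>k<n. tens (\<lambda>i. coord A x y powi \<lceil>t\<rceil> * u k y i) (v k y) p)"
      using s'(2) ev by eventually_elim (simp add: lincomb_tens)
  qed simp
qed

text \<open>At an ordinary point the indices are rounded up separately, and the surplus
  \<open>\<lceil>a\<rceil> + \<lceil>b\<rceil> - \<lceil>t\<rceil> \<ge> 0\<close> becomes a power
  of the coordinate. The first hypothesis lets the first factor absorb it.\<close>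

lemma tensor_germsI:
  assumes st: "x \<notin> ppts E \<union> ppts E' \<Longrightarrow> (\<And>h s. hol_at A x h \<Longrightarrow> s \<in> stalk E x \<Longrightarrow> (\<lambda>y i. h y * s y i) \<in> stalk E x)"
    and ab: "\<And>k. k < (n::nat) \<Longrightarrow> a k + b k = t"
    and uv: "\<And>k. k < n \<Longrightarrow> u k \<in> germs A E x (a k)" "\<And>k. k < n \<Longrightarrow> v k \<in> germs A E' x (b k)"
    and s: "\<forall>\<^sub>F y in at x. s y = (\<lambda>p. \<Sum>k<n. tens (u k y) (v k y) p)"
  shows "s \<in> germs A (par_tensor A E E') x t"
proof (cases "x \<in> ppts E \<union> ppts E'")
  case True
  have "s \<in> lattice (par_tensor A E E') x t"
    unfolding par_tensor_def using ab uv s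
    by simp (intro exI[of _ n] exI[of _ u] exI[of _ v] exI[of _ a] exI[of _ b], blast)
  then show ?thesis using True by (simp add: germs_def par_tensor_def)
next
  case False
  have "\<exists>u'. \<forall>k<n. u' k \<in> stalk E x \<and> (\<forall>\<^sub>F y in at x. u k y = (\<lambda>i. coord A x y powi \<lceil>a k\<rceil> * u' k y i))"
    using uv(1) False unfolding germs_def zmul_def by (auto intro!: choice)
  then obtain u' where u': "\<forall>k<n. u' k \<in> stalk E x \<and> (\<forall>\<^sub>F y in at x. u k y = (\<lambda>i. coord A x y powi \<lceil>a k\<rceil> * u' k y i))"
    by blast
  have "\<exists>v'. \<forall>k<n. v' k \<in> stalk E' x \<and> (\<forall>\<^sub>F y in at x. v k y = (\<lambda>i. coord A x y powi \<lceil>b k\<rceil> * v' k y i))"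
    using uv(2) False unfolding germs_def zmul_def by (auto intro!: choice)
  then obtain v' where v': "\<forall>k<n. v' k \<in> stalk E' x \<and> (\<forall>\<^sub>F y in at x. v k y = (\<lambda>i. coord A x y powi \<lceil>b k\<rceil> * v' k y i))"
    by blast
  define q where "q = (\<lambda>k. nat (\<lceil>a k\<rceil> + \<lceil>b k\<rceil> - \<lceil>t\<rceil>))"
  have q: "\<lceil>a k\<rceil> + \<lceil>b k\<rceil> = \<lceil>t\<rceil> + int (q k)" if "k < n" for k
    using ceiling_add_le[of "a k" "b k"] ab[OF that] by (simp add: q_def)
  define s' where "s' = (\<lambda>y p. \<Sum>k<n. tens (\<lambda>i. coord A x y ^ q k * u' k y i) (v' k y) p)"
  have "s' \<in> stalk (par_tensor A E E') x"
    unfolding par_tensor_def s'_def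
    using u' v' st[OF False hol_at_power[OF hol_at_coord]]
    by (auto intro!: exI[of _ n] exI[of _ "\<lambda>k y i. coord A x y ^ q k * u' k y i"] exI[of _ v'])
  moreover have "\<forall>\<^sub>F y in at x. s y = (\<lambda>p. coord A x y powi \<lceil>t\<rceil> * s' y p)"
  proof -
    have "\<forall>k\<in>{..<n}. \<forall>\<^sub>F y in at x. u k y = (\<lambda>i. coord A x y powi \<lceil>a k\<rceil> * u' k y i)" using u' by blast
    then have 1: "\<forall>\<^sub>F y in at x. \<forall>k\<in>{..<n}. u k y = (\<lambda>i. coord A x y powi \<lceil>a k\<rceil> * u' k y i)"
      by (intro eventually_ball_finite) auto
    have "\<forall>k\<in>{..<n}. \<forall>\<^sub>F y in at x. v k y = (\<lambda>i. coord A x y powi \<lceil>b k\<rceil> * v' k y i)" using v' by blast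
    then have 2: "\<forall>\<^sub>F y in at x. \<forall>k\<in>{..<n}. v k y = (\<lambda>i. coord A x y powi \<lceil>b k\<rceil> * v' k y i)"
      by (intro eventually_ball_finite) auto
    show ?thesis using s 1 2 coord_nonzero[of x]
    proof eventually_elim
      case (elim y)
      have "tens (u k y) (v k y) p = coord A x y powi \<lceil>t\<rceil> * tens (\<lambda>i. coord A x y ^ q k * u' k y i) (v' k y) p"
        if k: "k < n" for k p
      proof -
        have "coord A x y powi \<lceil>a k\<rceil> * coord A x y powi \<lceil>b k\<rceil> = coord A x y powi \<lceil>t\<rceil> * coord A x y ^ q k"
          using q[OF k] elim(4) by (metis power_int_add power_int_of_nat)
        then show ?thesis using elim(2,3) k by (simp add: tens_def split: prod.split)
      qed
      then show ?case unfolding elim(1) s'_def sum_distrib_left by (intro ext sum.cong) auto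
    qed
  qed
  ultimately have "s \<in> zmul A x \<lceil>t\<rceil> (stalk (par_tensor A E E') x)" by (rule zmulI)
  then show ?thesis using False by (simp add: germs_def par_tensor_def)
qed

end

section \<open>Functionals on a fibre\<close>

lemma dual_spaceD:
  assumes "\<xi> \<in> dual_space V"
  shows "\<And>u v a b. u \<in> V \<Longrightarrow> v \<in> V \<Longrightarrow> \<xi> (\<lambda>i. a * u i + b * v i) = a * \<xi> u + b * \<xi> v"
    "\<And>v. v \<notin> V \<Longrightarrow> \<xi> v = 0"
  using assms unfolding dual_space_def by auto

lemma dual_space_scale:
  assumes "\<xi> \<in> dual_space V"
  shows "(\<lambda>v. c * \<xi> v) \<in> dual_space V"
  using dual_spaceD[OF assms] unfolding dual_space_def by (auto simp: algebra_simps)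

lemma is_basis_mem: "is_basis r e V \<Longrightarrow> k < r \<Longrightarrow> e k \<in> V"
  unfolding is_basis_def
  by (auto intro!: image_eqI[of _ _ "\<lambda>j. if j = k then 1 else 0"]
      simp: lincomb_def if_distrib[of "\<lambda>c. c * _"] cong: if_cong)

lemma is_basis_lincomb: "is_basis r e V \<Longrightarrow> lincomb r c e \<in> V"
  unfolding is_basis_def by blast

lemma is_basis_unique:
  assumes "is_basis r e V" "lincomb r c e = lincomb r d e" "k < r"
  shows "c k = d k"
proof -
  have "lincomb r (\<lambda>k. c k - d k) e = (\<lambda>_. 0)"
    using assms(2) by (auto simp: lincomb_def fun_eq_iff algebra_simps sum_subtractf)
  then have "c k - d k = 0" using assms(1,3) unfolding is_basis_def by blast
  then show ?thesis by simp
qed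

text \<open>Functionals are additive on \<open>V\<close> only, and for two summands at a time; the
  induction therefore also carries that the partial sums lie in \<open>V\<close>.\<close>

lemma dual_space_lincomb:
  assumes b: "is_basis r e V" and xi: "\<xi> \<in> dual_space V"
  shows "\<xi> (lincomb r c e) = (\<Sum>k<r. c k * \<xi> (e k))"
proof -
  have "\<xi> (\<lambda>i. \<Sum>k<n. c k * e k i) = (\<Sum>k<n. c k * \<xi> (e k)) \<and> (\<lambda>i. \<Sum>k<n. c k * e k i) \<in> V" if "n \<le> r" for n
    using that
  proof (induction n)
    case 0
    have 0: "(\<lambda>_. 0) \<in> V" using is_basis_lincomb[OF b, of "\<lambda>_. 0"] by (simp add: lincomb_def)
    then show ?case using dual_spaceD(1)[OF xi 0 0, of 0 0] by simp
  next
    case (Suc n)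
    then have IH: "\<xi> (\<lambda>i. \<Sum>k<n. c k * e k i) = (\<Sum>k<n. c k * \<xi> (e k))" "(\<lambda>i. \<Sum>k<n. c k * e k i) \<in> V" by auto
    have e: "e n \<in> V" using is_basis_mem[OF b] Suc.prems by simp
    have "(\<lambda>i. \<Sum>k<Suc n. c k * e k i) = lincomb r (\<lambda>k. if k < Suc n then c k else 0) e"
    proof
      fix i
      have "(\<Sum>k<Suc n. c k * e k i) = (\<Sum>k<Suc n. (if k < Suc n then c k else 0) * e k i)"
        by (intro sum.cong) auto
      also have "\<dots> = (\<Sum>k<r. (if k < Suc n then c k else 0) * e k i)"
        using Suc.prems by (intro sum.mono_neutral_left) auto
      finally show "(\<Sum>k<Suc n. c k * e k i) = lincomb r (\<lambda>k. if k < Suc n then c k else 0) e i"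
        by (simp add: lincomb_def)
    qed
    then have "(\<lambda>i. \<Sum>k<Suc n. c k * e k i) \<in> V" using is_basis_lincomb[OF b] by simp
    then show ?case using dual_spaceD(1)[OF xi IH(2) e, of 1 "c n"] IH(1) by simp
  qed
  from this[of r] show ?thesis by (simp add: lincomb_def)
qed

lemma dual_basis_exists:
  assumes b: "is_basis r e V"
  obtains \<xi> where "\<xi> \<in> dual_space V" "\<And>c. \<xi> (lincomb r c e) = (\<Sum>k<r. c k * d k)"
proof -
  define \<xi> where "\<xi> = (\<lambda>v. if v \<in> V then \<Sum>k<r. (SOME c. v = lincomb r c e) k * d k else 0)"
  have *: "\<xi> (lincomb r c e) = (\<Sum>k<r. c k * d k)" for c
  proof -
    have "lincomb r c e = lincomb r (SOME c'. lincomb r c e = lincomb r c' e) e" by (rule someI[of _ c]) simp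
    from is_basis_unique[OF b this]
    have "k < r \<Longrightarrow> (SOME c'. lincomb r c e = lincomb r c' e) k = c k" for k by simp
    then show ?thesis
      unfolding \<xi>_def using is_basis_lincomb[OF b, of c] by (auto intro!: sum.cong)
  qed
  moreover have "\<xi> \<in> dual_space V"
    unfolding dual_space_def
  proof (intro CollectI conjI ballI allI impI)
    fix u v a b' assume "u \<in> V" "v \<in> V"
    then obtain c c' where c: "u = lincomb r c e" "v = lincomb r c' e" using b unfolding is_basis_def by blast
    have "(\<lambda>i. a * u i + b' * v i) = lincomb r (\<lambda>k. a * c k + b' * c' k) e"
      unfolding c by (simp add: lincomb_def sum_distrib_left sum.distrib algebra_simps)
    then show "\<xi> (\<lambda>i. a * u i + b' * v i) = a * \<xi> u + b' * \<xi> v"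
      unfolding c by (simp add: * c sum_distrib_left sum.distrib algebra_simps)
  qed (simp add: \<xi>_def)
  ultimately show thesis using that by blast
qed

context riemann
begin

lemma dual_stalk_mult:
  assumes "\<xi> \<in> dual_stalk A E x" "hol_at A x h"
  shows "(\<lambda>y v. h y * \<xi> y v) \<in> dual_stalk A E x"
proof -
  have d: "\<forall>\<^sub>F y in nhds x. \<xi> y \<in> dual_space (fibre E y)" using assms(1) unfolding dual_stalk_def by blast
  have "\<forall>\<^sub>F y in nhds x. (\<lambda>v. h y * \<xi> y v) \<in> dual_space (fibre E y)"
    using d by eventually_elim (rule dual_space_scale)
  moreover have "hol_at A x (\<lambda>y. h y * \<xi> y (s y))" if "s \<in> stalk E x" for s
    using assms(1) that unfolding dual_stalk_def by (intro hol_at_mult[OF assms(2)]) blast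
  ultimately show ?thesis unfolding dual_stalk_def by blast
qed

lemma dual_stalk_cong:
  assumes "\<xi> \<in> dual_stalk A E x" "\<forall>\<^sub>F y in nhds x. \<xi>' y = \<xi> y"
  shows "\<xi>' \<in> dual_stalk A E x"
proof -
  have d: "\<forall>\<^sub>F y in nhds x. \<xi> y \<in> dual_space (fibre E y)" using assms(1) unfolding dual_stalk_def by blast
  have "\<forall>\<^sub>F y in nhds x. \<xi>' y \<in> dual_space (fibre E y)"
    using d assms(2) by eventually_elim simp
  moreover have "hol_at A x (\<lambda>y. \<xi>' y (s y))" if "s \<in> stalk E x" for s
  proof -
    have "hol_at A x (\<lambda>y. \<xi> y (s y))" using assms(1) that unfolding dual_stalk_def by blast
    moreover have "\<forall>\<^sub>F y in nhds x. \<xi>' y (s y) = \<xi> y (s y)" using assms(2) by eventually_elim simp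
    ultimately show ?thesis using hol_at_cong[of "\<lambda>y. \<xi>' y (s y)" "\<lambda>y. \<xi> y (s y)" x] by simp
  qed
  ultimately show ?thesis unfolding dual_stalk_def by blast
qed

end

text \<open>The description of the lattices of the dual bundle, which the lemmas below extend from
  the parabolic points to all points.\<close>

definition dual_germ ::
    "'x::t2_space atlas \<Rightarrow> ('x, 'i) par_bundle \<Rightarrow> 'x \<Rightarrow> real \<Rightarrow> ('x \<Rightarrow> ('i \<Rightarrow> complex) \<Rightarrow> complex) \<Rightarrow> bool" where
  "dual_germ A E x t \<xi> \<longleftrightarrow> (\<forall>\<^sub>F y in at x. \<xi> \<in> dual_stalk A E y) \<and>
     (\<forall>a. \<forall>s\<in>germs A E x a. (\<lambda>y. \<xi> y (s y)) \<in> zO A x \<lceil>a + t\<rceil>)"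

context parabolic
begin

text \<open>Holomorphy on the finitely many sections of a frame persists at nearby points and
  implies holomorphy on all sections.\<close>

lemma dual_stalk_nearby:
  assumes x: "x \<notin> ppts E" and xi: "\<xi> \<in> dual_stalk A E x"
  shows "\<forall>\<^sub>F y in nhds x. \<xi> \<in> dual_stalk A E y"
proof -
  obtain U e where U: "x \<in> U" "local_frame A E r U e" by (rule frame[of UNIV x]) auto
  have d: "\<forall>\<^sub>F y in nhds x. \<xi> y \<in> dual_space (fibre E y)" using xi unfolding dual_stalk_def by blast
  have "\<forall>k\<in>{..<r}. \<forall>\<^sub>F y in nhds x. hol_at A y (\<lambda>y. \<xi> y (e k y))"
    using xi frame_stalk[OF U(2,1) x] hol_at_nearby unfolding dual_stalk_def by blast
  then have "\<forall>\<^sub>F y in nhds x. \<forall>k\<in>{..<r}. hol_at A y (\<lambda>y. \<xi> y (e k y))"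
    by (intro eventually_ball_finite) auto
  moreover have "\<forall>\<^sub>F y in nhds x. y \<in> U" using frameD(1)[OF U(2)] U(1) by (intro eventually_nhds_in_open)
  moreover note eventually_nearby_nhds[OF d] eventually_nhds_not_ppts[OF x]
  ultimately show ?thesis
  proof eventually_elim
    case (elim y)
    have "hol_at A y (\<lambda>y'. \<xi> y' (s y'))" if s: "s \<in> stalk E y" for s
    proof -
      obtain f where f: "\<forall>k<r. hol_at A y (f k)"
        "\<forall>\<^sub>F y' in nhds y. s y' = lincomb r (\<lambda>k. f k y') (\<lambda>k. e k y')"
        using s unfolding frameD(3)[OF U(2) elim(2,4)] by blast
      have "\<forall>\<^sub>F y' in nhds y. y' \<in> U" using frameD(1)[OF U(2)] elim(2) by (intro eventually_nhds_in_open)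
      then have "\<forall>\<^sub>F y' in nhds y. \<xi> y' (s y') = (\<Sum>k<r. f k y' * \<xi> y' (e k y'))"
        using f(2) elim(3) eventually_nhds_not_ppts[OF elim(4)]
      proof eventually_elim
        case E: (elim y')
        show ?case unfolding E(2) by (rule dual_space_lincomb[OF frameD(2)[OF U(2) E(1,4)] E(3)])
      qed
      moreover have "hol_at A y (\<lambda>y'. \<Sum>k<r. f k y' * \<xi> y' (e k y'))"
        by (rule hol_at_sum, rule hol_at_mult) (use f(1) elim(1) in auto)
      ultimately show ?thesis
        using hol_at_cong[of "\<lambda>y'. \<xi> y' (s y')" "\<lambda>y'. \<Sum>k<r. f k y' * \<xi> y' (e k y')" y] by simp
    qed
    then show ?case unfolding dual_stalk_def using elim(3) by blast
  qed
qed

lemma dual_germsD: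
  assumes "\<xi> \<in> germs A (par_dual A E) x t"
  shows "dual_germ A E x t \<xi>"
proof (cases "x \<in> ppts E")
  case True
  then show ?thesis using assms by (simp add: germs_def par_dual_def dual_germ_def)
next
  case False
  then have "\<xi> \<in> zmul A x \<lceil>t\<rceil> (dual_stalk A E x)" using assms by (simp add: germs_def par_dual_def)
  then obtain \<xi>' where xi': "\<xi>' \<in> dual_stalk A E x" "\<forall>\<^sub>F y in at x. \<xi> y = (\<lambda>v. coord A x y powi \<lceil>t\<rceil> * \<xi>' y v)"
    by (rule zmulE)
  have d: "\<forall>\<^sub>F y in nhds x. \<xi>' y \<in> dual_space (fibre E y)" using xi'(1) unfolding dual_stalk_def by blast
  have "\<forall>\<^sub>F y in at x. \<xi>' \<in> dual_stalk A E y"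
    using dual_stalk_nearby[OF False xi'(1)] by (simp add: eventually_nhds_conv_at)
  then have "\<forall>\<^sub>F y in at x. \<xi> \<in> dual_stalk A E y"
    using eventually_nearby_at[OF xi'(2)] coord_powi_nearby[of x "\<lceil>t\<rceil>"]
  proof eventually_elim
    case (elim y)
    show ?case by (rule dual_stalk_cong[OF dual_stalk_mult[OF elim(1) conjunct1[OF elim(3)]] elim(2)])
  qed
  moreover have "(\<lambda>y. \<xi> y (s y)) \<in> zO A x \<lceil>a + t\<rceil>" if s: "s \<in> germs A E x a" for s a
  proof -
    have "s \<in> zmul A x \<lceil>a\<rceil> (stalk E x)" using s False by (simp add: germs_def)
    then obtain s' where s': "s' \<in> stalk E x" "\<forall>\<^sub>F y in at x. s y = (\<lambda>i. coord A x y powi \<lceil>a\<rceil> * s' y i)"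
      by (rule zmulE)
    have "hol_at A x (\<lambda>y. \<xi>' y (s' y))" using xi'(1) s'(1) unfolding dual_stalk_def by blast
    moreover have "\<forall>\<^sub>F y in at x. s' y \<in> fibre E y \<and> \<xi>' y \<in> dual_space (fibre E y)"
      using stalk_fibre[OF False s'(1)] d by (simp add: eventually_nhds_conv_at eventually_conj_iff)
    then have "\<forall>\<^sub>F y in at x. \<xi> y (s y) = coord A x y powi (\<lceil>t\<rceil> + \<lceil>a\<rceil>) * \<xi>' y (s' y)"
      using xi'(2) s'(2) coord_nonzero[of x]
    proof eventually_elim
      case (elim y)
      have "\<xi>' y (\<lambda>i. coord A x y powi \<lceil>a\<rceil> * s' y i) = coord A x y powi \<lceil>a\<rceil> * \<xi>' y (s' y)"
        using dual_spaceD(1)[OF conjunct2[OF elim(1)] conjunct1[OF elim(1)] conjunct1[OF elim(1)],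
            of "coord A x y powi \<lceil>a\<rceil>" 0] by simp
      then show ?case using elim(2,3,4) by (simp add: power_int_add)
    qed
    ultimately have "(\<lambda>y. \<xi> y (s y)) \<in> zO A x (\<lceil>t\<rceil> + \<lceil>a\<rceil>)" by (rule zOI)
    then show ?thesis using ceiling_add_le[of a t] by (elim zO_mono) simp
  qed
  ultimately show ?thesis unfolding dual_germ_def by blast
qed

text \<open>At an ordinary point, division by the power \<open>\<lceil>t\<rceil>\<close> of the
  coordinate gives a functional that must still be defined at \<open>x\<close>, where the value of
  \<open>\<xi>\<close> says nothing.\<close>

lemma dual_germsI:
  assumes "dual_germ A E x t \<xi>"
  shows "\<xi> \<in> germs A (par_dual A E) x t"
proof (cases "x \<in> ppts E")
  case True
  then show ?thesis using assms by (simp add: germs_def par_dual_def dual_germ_def)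
next
  case x: False
  obtain U e where U: "x \<in> U" "local_frame A E r U e" by (rule frame[of UNIV x]) auto
  have "\<forall>k<r. \<exists>g. hol_at A x g \<and> (\<forall>\<^sub>F y in at x. \<xi> y (e k y) = coord A x y powi \<lceil>t\<rceil> * g y)"
    using assms frame_germs[OF U(2,1)] unfolding dual_germ_def zO_def by fastforce
  then obtain g where g: "\<And>k. k < r \<Longrightarrow> hol_at A x (g k)"
    "\<And>k. k < r \<Longrightarrow> \<forall>\<^sub>F y in at x. \<xi> y (e k y) = coord A x y powi \<lceil>t\<rceil> * g k y" by metis
  note bx = frameD(2)[OF U(2,1) x]
  \<comment> \<open>The value at \<open>x\<close> is the functional that takes the limits
    \<open>g k x\<close> on the frame.\<close>
  obtain \<xi>0 where xi0: "\<xi>0 \<in> dual_space (fibre E x)"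
    "\<And>c. \<xi>0 (lincomb r c (\<lambda>k. e k x)) = (\<Sum>k<r. c k * g k x)"
    by (rule dual_basis_exists[OF bx, of "\<lambda>k. g k x"]) blast
  define \<xi>' where "\<xi>' = (\<lambda>y. if y = x then \<xi>0 else (\<lambda>v. coord A x y powi (- \<lceil>t\<rceil>) * \<xi> y v))"
  have "\<forall>\<^sub>F y in at x. \<xi> \<in> dual_stalk A E y" using assms unfolding dual_germ_def by blast
  then have dx: "\<forall>\<^sub>F y in at x. \<xi> y \<in> dual_space (fibre E y)"
  proof eventually_elim
    case (elim y)
    then have "\<forall>\<^sub>F y in nhds y. \<xi> y \<in> dual_space (fibre E y)" unfolding dual_stalk_def by blast
    then show ?case by (rule eventually_nhds_x_imp_x)
  qed
  have "\<forall>\<^sub>F y in at x. y \<noteq> x" by (simp add: eventually_at_filter)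
  with dx have "\<forall>\<^sub>F y in at x. \<xi>' y \<in> dual_space (fibre E y)"
    by eventually_elim (simp add: \<xi>'_def dual_space_scale)
  then have d': "\<forall>\<^sub>F y in nhds x. \<xi>' y \<in> dual_space (fibre E y)"
    using xi0(1) by (simp add: eventually_nhds_conv_at \<xi>'_def)
  have "hol_at A x (\<lambda>y. \<xi>' y (s y))" if s: "s \<in> stalk E x" for s
  proof -
    obtain f where f: "\<forall>k<r. hol_at A x (f k)"
      "\<forall>\<^sub>F y in nhds x. s y = lincomb r (\<lambda>k. f k y) (\<lambda>k. e k y)"
      using s unfolding frameD(3)[OF U(2,1) x] by blast
    have "\<forall>\<^sub>F y in nhds x. y \<in> U" using frameD(1)[OF U(2)] U(1) by (intro eventually_nhds_in_open)
    then have eU: "\<forall>\<^sub>F y in at x. y \<in> U" by (simp add: eventually_nhds_conv_at)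
    have fx: "\<forall>\<^sub>F y in at x. s y = lincomb r (\<lambda>k. f k y) (\<lambda>k. e k y)"
      using f(2) by (simp add: eventually_nhds_conv_at)
    have "\<forall>k\<in>{..<r}. \<forall>\<^sub>F y in at x. \<xi> y (e k y) = coord A x y powi \<lceil>t\<rceil> * g k y" using g(2) by blast
    then have gx: "\<forall>\<^sub>F y in at x. \<forall>k\<in>{..<r}. \<xi> y (e k y) = coord A x y powi \<lceil>t\<rceil> * g k y"
      by (intro eventually_ball_finite) auto
    have "\<forall>\<^sub>F y in at x. \<xi>' y (s y) = (\<Sum>k<r. f k y * g k y)"
      using fx eU gx dx eventually_at_not_ppts[of x] coord_nonzero[of x] \<open>\<forall>\<^sub>F y in at x. y \<noteq> x\<close>
    proof eventually_elim
      case (elim y)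
      have "\<xi> y (s y) = (\<Sum>k<r. f k y * \<xi> y (e k y))"
        unfolding elim(1) by (rule dual_space_lincomb[OF frameD(2)[OF U(2) elim(2,5)] elim(4)])
      also have "\<dots> = coord A x y powi \<lceil>t\<rceil> * (\<Sum>k<r. f k y * g k y)"
        unfolding sum_distrib_left using elim(3) by (intro sum.cong) auto
      finally show ?case using elim(6,7) by (simp add: \<xi>'_def power_int_minus)
    qed
    moreover have "\<xi>' x (s x) = (\<Sum>k<r. f k x * g k x)"
      using eventually_nhds_x_imp_x[OF f(2)] xi0(2) by (simp add: \<xi>'_def)
    ultimately have "\<forall>\<^sub>F y in nhds x. \<xi>' y (s y) = (\<Sum>k<r. f k y * g k y)"
      by (simp add: eventually_nhds_conv_at)
    moreover have "hol_at A x (\<lambda>y. \<Sum>k<r. f k y * g k y)"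
      by (rule hol_at_sum, rule hol_at_mult) (use f(1) g(1) in auto)
    ultimately show ?thesis
      using hol_at_cong[of "\<lambda>y. \<xi>' y (s y)" "\<lambda>y. \<Sum>k<r. f k y * g k y" x] by simp
  qed
  then have "\<xi>' \<in> dual_stalk A E x" unfolding dual_stalk_def using d' by blast
  moreover have "\<forall>\<^sub>F y in at x. \<xi> y = (\<lambda>v. coord A x y powi \<lceil>t\<rceil> * \<xi>' y v)"
    using coord_nonzero[of x] \<open>\<forall>\<^sub>F y in at x. y \<noteq> x\<close>
    by eventually_elim (simp add: \<xi>'_def power_int_minus flip: mult.assoc)
  ultimately have "\<xi> \<in> zmul A x \<lceil>t\<rceil> (dual_stalk A E x)" by (rule zmulI)
  then show ?thesis using x by (simp add: germs_def par_dual_def)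
qed

end

section \<open>The direct image\<close>

lemma (in cover) coord_Phi_unit:
  obtains u where "hol_at A x u" "u x \<noteq> 0"
    "\<forall>\<^sub>F y in nhds x. coord B (\<Phi> x) (\<Phi> y) = coord A x y ^ mult A B \<Phi> x * u y"
proof -
  obtain V W r \<omega> \<theta> where M: "model (\<Phi> x) V W r \<omega> \<theta>"
    by (rule obtain_model[of "\<Phi> x" "\<lambda>_. UNIV" UNIV]) auto
  note D = local_coordD[OF modelD(7)[OF M refl]]
  obtain g where g: "hol_at A x g" "g x \<noteq> 0" "\<forall>\<^sub>F y in nhds x. \<omega> x y = coord A x y * g y"
    by (rule model_coord_unit[OF M refl])
  have "\<forall>\<^sub>F y in nhds x. y \<in> W x" using D(1,2) by (intro eventually_nhds_in_open)
  then have "\<forall>\<^sub>F y in nhds x. coord B (\<Phi> x) (\<Phi> y) = coord A x y ^ mult A B \<Phi> x * g y ^ mult A B \<Phi> x"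
    using g(3) by eventually_elim (simp add: modelD(8)[OF M refl] power_mult_distrib)
  then show thesis using that[OF X.hol_at_power[OF g(1)]] g(2) by simp
qed

locale cover_bundle = cover A B \<Phi> + E: parabolic A E r
  for A :: "'x::t2_space atlas" and B :: "'z::t2_space atlas" and \<Phi> :: "'x \<Rightarrow> 'z"
    and E :: "('x, 'i) par_bundle" and r :: nat
begin

abbreviation DI :: "('z, 'x \<times> 'i) par_bundle" where
  "DI \<equiv> par_direct_image A B \<Phi> E"

abbreviation slice :: "('z \<Rightarrow> 'x \<times> 'i \<Rightarrow> complex) \<Rightarrow> 'x \<Rightarrow> 'i \<Rightarrow> complex" where
  "slice s \<equiv> (\<lambda>y i. s (\<Phi> y) (y, i))"

lemma finite_ppts_DI: "finite (ppts DI)"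
  using finite_ramification E.finite_ppts by (simp add: par_direct_image_def)

lemma not_ppts_DI:
  assumes "\<Phi> x \<notin> ppts DI"
  shows "mult A B \<Phi> x = 1" "x \<notin> ppts E"
  using assms mult_pos[of x] by (auto simp: par_direct_image_def ramification_def)

lemma stalk_DI: "s \<in> stalk DI z \<longleftrightarrow> (\<forall>\<^sub>F z' in nhds z. s z' \<in> direct_sum_fibre \<Phi> E z') \<and>
    (\<forall>x. \<Phi> x = z \<longrightarrow> slice s \<in> stalk E x)"
  by (simp add: par_direct_image_def)

lemma fibre_DI: "fibre DI z = direct_sum_fibre \<Phi> E z"
  by (simp add: par_direct_image_def)

lemma direct_sum_fibreD:
  assumes "v \<in> direct_sum_fibre \<Phi> E z"
  shows "\<Phi> x = z \<Longrightarrow> (\<lambda>i. v (x, i)) \<in> fibre E x" "\<Phi> x \<noteq> z \<Longrightarrow> v (x, i) = 0"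
  using assms unfolding direct_sum_fibre_def by (auto dest: spec[of _ x])

lemma direct_sum_fibreI:
  assumes "\<And>x. \<Phi> x = z \<Longrightarrow> (\<lambda>i. v (x, i)) \<in> fibre E x" "\<And>x i. \<Phi> x \<noteq> z \<Longrightarrow> v (x, i) = 0"
  shows "v \<in> direct_sum_fibre \<Phi> E z"
  using assms unfolding direct_sum_fibre_def by auto

lemma eventually_fibre_good: "\<forall>\<^sub>F z' in at z. z' \<notin> ppts DI"
  using Z.eventually_not_mem_finite(1)[OF finite_ppts_DI] .

lemma dsf_lin:
  assumes "z \<notin> ppts DI" "u \<in> direct_sum_fibre \<Phi> E z" "v \<in> direct_sum_fibre \<Phi> E z"
  shows "(\<lambda>p. a * u p + b * v p) \<in> direct_sum_fibre \<Phi> E z"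
proof (rule direct_sum_fibreI)
  fix x assume x: "\<Phi> x = z"
  have nx: "x \<notin> ppts E" using not_ppts_DI(2)[of x] assms(1) x by simp
  show "(\<lambda>i. a * u (x, i) + b * v (x, i)) \<in> fibre E x"
    by (rule E.fibre_closed(3)[OF nx direct_sum_fibreD(1)[OF assms(2) x] direct_sum_fibreD(1)[OF assms(3) x]])
qed (simp add: direct_sum_fibreD(2)[OF assms(2)] direct_sum_fibreD(2)[OF assms(3)])

lemma dsf_scale:
  assumes "z \<notin> ppts DI" "v \<in> direct_sum_fibre \<Phi> E z"
  shows "(\<lambda>p. a * v p) \<in> direct_sum_fibre \<Phi> E z"
  using dsf_lin[OF assms(1,2,2), of a 0] by simp

text \<open>The formula for the lattices, used at every point and not only at parabolic ones;
  \<open>germs_DI\<close> shows that it gives the modules of germs everywhere.\<close>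

definition di_germ :: "'z \<Rightarrow> real \<Rightarrow> ('z \<Rightarrow> 'x \<times> 'i \<Rightarrow> complex) set" where
  "di_germ z t = {s. (\<forall>\<^sub>F z' in at z. s z' \<in> direct_sum_fibre \<Phi> E z') \<and>
     (\<forall>x. \<Phi> x = z \<longrightarrow> slice s \<in> germs A E x (real (mult A B \<Phi> x) * t))}"

lemma di_germD:
  assumes "s \<in> di_germ z t"
  shows "\<forall>\<^sub>F z' in at z. s z' \<in> direct_sum_fibre \<Phi> E z'"
    "\<And>x. \<Phi> x = z \<Longrightarrow> slice s \<in> germs A E x (real (mult A B \<Phi> x) * t)"
  using assms unfolding di_germ_def by blast+

lemma di_germI:
  assumes "\<forall>\<^sub>F z' in at z. s z' \<in> direct_sum_fibre \<Phi> E z'"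
    "\<And>x. \<Phi> x = z \<Longrightarrow> slice s \<in> germs A E x (real (mult A B \<Phi> x) * t)"
  shows "s \<in> di_germ z t"
  using assms unfolding di_germ_def by blast

lemma di_germ_cong:
  assumes "s \<in> di_germ z t" "\<forall>\<^sub>F z' in at z. s' z' = s z'"
  shows "s' \<in> di_germ z t"
proof (rule di_germI)
  show "\<forall>\<^sub>F z' in at z. s' z' \<in> direct_sum_fibre \<Phi> E z'"
    using assms(2) di_germD(1)[OF assms(1)] by eventually_elim simp
  fix x assume x: "\<Phi> x = z"
  have "\<forall>\<^sub>F y in at x. s' (\<Phi> y) = s (\<Phi> y)"
    by (rule eventually_at_Phi) (use assms(2) x in simp)
  then have "\<forall>\<^sub>F y in at x. slice s' y = slice s y" by eventually_elim simp
  then show "slice s' \<in> germs A E x (real (mult A B \<Phi> x) * t)"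
    by (rule hol_moduleD(4)[OF E.hol_module_germs di_germD(2)[OF assms(1) x]])
qed

lemma di_germ_powi:
  assumes s: "s \<in> di_germ z t"
  shows "(\<lambda>z' p. coord B z z' powi n * s z' p) \<in> di_germ z (t + of_int n)"
proof (rule di_germI)
  show "\<forall>\<^sub>F z' in at z. (\<lambda>p. coord B z z' powi n * s z' p) \<in> direct_sum_fibre \<Phi> E z'"
    using di_germD(1)[OF s] eventually_fibre_good[of z] by eventually_elim (rule dsf_scale)
  fix x assume x: "\<Phi> x = z"
  have "(\<lambda>y. coord B z (\<Phi> y) powi n) \<in> zO A x (int (mult A B \<Phi> x) * n)"
    using zO_Phi[of "\<lambda>z'. coord B z z' powi n" x n] Z.coord_powi_zO[of z n] x by simp
  from E.germs_zO[OF this di_germD(2)[OF s x]]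
  show "(\<lambda>y i. coord B z (\<Phi> y) powi n * s (\<Phi> y) (y, i)) \<in> germs A E x (real (mult A B \<Phi> x) * (t + of_int n))"
    by (simp add: distrib_left)
qed

lemma di_germ_shift: "di_germ z (t + of_int n) = zmul B z n (di_germ z t)"
proof (intro equalityI subsetI)
  fix s assume s: "s \<in> di_germ z (t + of_int n)"
  have "(\<lambda>z' p. coord B z z' powi (- n) * s z' p) \<in> di_germ z t"
    using di_germ_powi[OF s, of "- n"] by simp
  moreover have "\<forall>\<^sub>F z' in at z. s z' = (\<lambda>p. coord B z z' powi n * (coord B z z' powi (- n) * s z' p))"
    using Z.coord_nonzero[of z] by eventually_elim (simp add: power_int_minus flip: mult.assoc)
  ultimately show "s \<in> zmul B z n (di_germ z t)" by (rule zmulI)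
next
  fix s assume "s \<in> zmul B z n (di_germ z t)"
  then obtain s' where s': "s' \<in> di_germ z t" "\<forall>\<^sub>F z' in at z. s z' = (\<lambda>p. coord B z z' powi n * s' z' p)"
    by (rule zmulE)
  show "s \<in> di_germ z (t + of_int n)" by (rule di_germ_cong[OF di_germ_powi[OF s'(1)] s'(2)])
qed

lemma di_germ_antimono:
  assumes "t \<le> t'"
  shows "di_germ z t' \<subseteq> di_germ z t"
proof
  fix s assume s: "s \<in> di_germ z t'"
  show "s \<in> di_germ z t"
  proof (rule di_germI[OF di_germD(1)[OF s]])
    fix x assume x: "\<Phi> x = z"
    have "real (mult A B \<Phi> x) * t \<le> real (mult A B \<Phi> x) * t'" using assms by (simp add: mult_left_mono)
    then show "slice s \<in> germs A E x (real (mult A B \<Phi> x) * t)"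
      using di_germD(2)[OF s x] E.germs_antimono by blast
  qed
qed

lemma hol_module_di_germ: "hol_module B z (di_germ z t)"
  unfolding hol_module_def
proof (intro conjI ballI allI impI)
  have "\<forall>\<^sub>F z' in at z. (\<lambda>_. 0) \<in> direct_sum_fibre \<Phi> E z'"
    using eventually_fibre_good[of z]
  proof eventually_elim
    case (elim z')
    show ?case by (rule direct_sum_fibreI) (use not_ppts_DI(2) elim E.fibre_closed(1) in auto)
  qed
  then show "(\<lambda>_ _. 0) \<in> di_germ z t" by (rule di_germI) (rule hol_moduleD(1)[OF E.hol_module_germs])
  fix s assume s: "s \<in> di_germ z t"
  show "(\<lambda>y i. s y i + s' y i) \<in> di_germ z t" if s': "s' \<in> di_germ z t" for s'
  proof (rule di_germI)
    show "\<forall>\<^sub>F z' in at z. (\<lambda>p. s z' p + s' z' p) \<in> direct_sum_fibre \<Phi> E z'"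
      using di_germD(1)[OF s] di_germD(1)[OF s'] eventually_fibre_good[of z]
      by eventually_elim (use dsf_lin[of _ _ _ 1 1] in simp)
  qed (rule hol_moduleD(2)[OF E.hol_module_germs di_germD(2)[OF s] di_germD(2)[OF s']])
  show "(\<lambda>y i. f y * s y i) \<in> di_germ z t" if f: "hol_at B z f" for f
  proof (rule di_germI)
    show "\<forall>\<^sub>F z' in at z. (\<lambda>p. f z' * s z' p) \<in> direct_sum_fibre \<Phi> E z'"
      using di_germD(1)[OF s] eventually_fibre_good[of z] by eventually_elim (rule dsf_scale)
    fix x assume x: "\<Phi> x = z"
    show "(\<lambda>y i. f (\<Phi> y) * s (\<Phi> y) (y, i)) \<in> germs A E x (real (mult A B \<Phi> x) * t)"
      by (rule hol_moduleD(3)[OF E.hol_module_germs hol_at_Phi di_germD(2)[OF s x]]) (use f x in simp)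
  qed
  show "s' \<in> di_germ z t" if "\<forall>\<^sub>F y in at z. s' y = s y" for s' by (rule di_germ_cong[OF s that])
qed

lemma stalk_DI_di_germ:
  assumes z: "z \<notin> ppts DI" and s: "s \<in> stalk DI z"
  shows "s \<in> di_germ z 0"
proof (rule di_germI)
  show "\<forall>\<^sub>F z' in at z. s z' \<in> direct_sum_fibre \<Phi> E z'"
    using s unfolding stalk_DI by (simp add: eventually_nhds_conv_at)
  fix x assume x: "\<Phi> x = z"
  then have "x \<notin> ppts E" using not_ppts_DI(2) z by blast
  then show "slice s \<in> germs A E x (real (mult A B \<Phi> x) * 0)"
    using E.stalk_germs s x unfolding stalk_DI by simp
qed

text \<open>A germ leaves the value over \<open>z\<close> undetermined. The representative
  \<open>s'\<close> takes it from holomorphic sections of \<open>E\<close> at the preimages.\<close>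

lemma di_germ_0_stalk:
  assumes z: "z \<notin> ppts DI" and s: "s \<in> di_germ z 0"
  shows "\<exists>s'\<in>stalk DI z. \<forall>\<^sub>F z' in at z. s z' = s' z'"
proof -
  have "\<exists>a. a \<in> stalk E x \<and> (\<forall>\<^sub>F y in at x. slice s y = a y)" if x: "\<Phi> x = z" for x
  proof -
    have nx: "x \<notin> ppts E" using not_ppts_DI(2) z x by blast
    have "slice s \<in> germs A E x 0" using di_germD(2)[OF s x] by simp
    then have "slice s \<in> zmul A x 0 (stalk E x)" using nx by (simp add: germs_def)
    then obtain a where "a \<in> stalk E x" "\<forall>\<^sub>F y in at x. slice s y = (\<lambda>i. coord A x y powi 0 * a y i)"
      by (rule zmulE)
    then show ?thesis by (intro exI[of _ a]) simp
  qed
  then have "\<forall>x\<in>{x. \<Phi> x = z}. \<exists>a. a \<in> stalk E x \<and> (\<forall>\<^sub>F y in at x. slice s y = a y)" by blast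
  from bchoice[OF this] obtain a where a: "\<And>x. \<Phi> x = z \<Longrightarrow> a x \<in> stalk E x"
    "\<And>x. \<Phi> x = z \<Longrightarrow> \<forall>\<^sub>F y in at x. slice s y = a x y" by blast
  define s' where "s' = (\<lambda>z' (y, i). if z' = z then (if \<Phi> y = z then a y y i else 0) else s z' (y, i))"
  have ev: "\<forall>\<^sub>F z' in at z. z' \<noteq> z" by (simp add: eventually_at_filter)
  have eq: "\<forall>\<^sub>F z' in at z. s z' = s' z'"
    using ev by eventually_elim (auto simp: s'_def)
  have dz: "s' z \<in> direct_sum_fibre \<Phi> E z"
  proof (rule direct_sum_fibreI)
    fix x assume x: "\<Phi> x = z"
    then have "x \<notin> ppts E" using not_ppts_DI(2) z by blast
    then have "a x x \<in> fibre E x" using eventually_nhds_x_imp_x[OF E.stalk_fibre[OF _ a(1)[OF x]]] by blast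
    then show "(\<lambda>i. s' z (x, i)) \<in> fibre E x" using x by (simp add: s'_def)
  qed (simp add: s'_def)
  have "\<forall>\<^sub>F z' in at z. s' z' \<in> direct_sum_fibre \<Phi> E z'"
    using di_germD(1)[OF s] eq by eventually_elim simp
  then have "\<forall>\<^sub>F z' in nhds z. s' z' \<in> direct_sum_fibre \<Phi> E z'" using dz by (simp add: eventually_nhds_conv_at)
  moreover have "slice s' \<in> stalk E x" if x: "\<Phi> x = z" for x
  proof -
    have nx: "x \<notin> ppts E" using not_ppts_DI(2) z x by blast
    have "\<forall>\<^sub>F y in at x. slice s' y = a x y"
      using a(2)[OF x] eventually_Phi_neq[of x] by eventually_elim (simp add: s'_def x)
    moreover have "slice s' x = a x x" using x by (simp add: s'_def)
    ultimately have "\<forall>\<^sub>F y in nhds x. slice s' y = a x y" by (simp add: eventually_nhds_conv_at)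
    then show ?thesis by (rule E.stalk_cong[OF nx a(1)[OF x]])
  qed
  ultimately have "s' \<in> stalk DI z" unfolding stalk_DI by blast
  then show ?thesis using eq by blast
qed

text \<open>Over an ordinary point all multiplicities are 1 and all preimages are ordinary, so
  upstairs, too, only \<open>\<lceil>t\<rceil>\<close> matters.\<close>

lemma germs_DI: "germs B DI z t = di_germ z t"
proof (cases "z \<in> ppts DI")
  case True
  have "lattice DI z t = di_germ z t" by (simp add: par_direct_image_def di_germ_def)
  then show ?thesis using True by (simp add: germs_def)
next
  case False
  have "di_germ z 0 = zmul B z 0 (stalk DI z)"
  proof (intro equalityI subsetI)
    fix s assume "s \<in> di_germ z 0"
    then obtain s' where "s' \<in> stalk DI z" "\<forall>\<^sub>F z' in at z. s z' = s' z'"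
      using di_germ_0_stalk[OF False] by blast
    then show "s \<in> zmul B z 0 (stalk DI z)" by (intro zmulI[of s']) auto
  next
    fix s assume "s \<in> zmul B z 0 (stalk DI z)"
    then obtain s' where s': "s' \<in> stalk DI z" "\<forall>\<^sub>F z' in at z. s z' = (\<lambda>p. coord B z z' powi 0 * s' z' p)"
      by (rule zmulE)
    then show "s \<in> di_germ z 0" using di_germ_cong[OF stalk_DI_di_germ[OF False s'(1)]] by simp
  qed
  then have 1: "germs B DI z t = di_germ z (of_int \<lceil>t\<rceil>)"
    using False di_germ_shift[of z 0 "\<lceil>t\<rceil>"] by (simp add: germs_def Z.zmul_zmul)
  have "germs A E x (real (mult A B \<Phi> x) * of_int \<lceil>t\<rceil>) = germs A E x (real (mult A B \<Phi> x) * t)"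
    if x: "\<Phi> x = z" for x
    using not_ppts_DI[of x] False x E.nonparabolic_germs[of x t] E.nonparabolic_germs[of x "of_int \<lceil>t\<rceil>"]
    by simp
  then have "di_germ z (of_int \<lceil>t\<rceil>) = di_germ z t" unfolding di_germ_def by auto
  then show ?thesis using 1 by simp
qed

text \<open>The modules of \<open>E\<close> are taken at the multiplicity times \<open>t\<close>, so
  a jump \<open>a + k\<close> upstairs appears downstairs divided by the multiplicity. Finitely many
  such values suffice for the unit interval.\<close>

lemma di_germ_jumps:
  obtains J where "finite J"
    "\<And>t t'. 0 \<le> t \<Longrightarrow> t \<le> t' \<Longrightarrow> t' \<le> 1 \<Longrightarrow> \<forall>a\<in>J. \<not> (t \<le> a \<and> a < t') \<Longrightarrow> di_germ z t = di_germ z t'"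
proof -
  have "\<forall>x\<in>{x. \<Phi> x = z}. \<exists>S. finite S \<and> (\<forall>t t'. t \<le> t' \<longrightarrow>
      (\<forall>a\<in>S. \<forall>k. \<not> (t \<le> a + of_int k \<and> a + of_int k < t')) \<longrightarrow> germs A E x t = germs A E x t')"
  proof
    fix x
    obtain S where "finite S" "\<And>t t'. t \<le> t' \<Longrightarrow>
      (\<And>a k. a \<in> S \<Longrightarrow> \<not> (t \<le> a + of_int k \<and> a + of_int k < t')) \<Longrightarrow> germs A E x t = germs A E x t'"
      by (rule E.germs_jumps[of x]) blast
    then show "\<exists>S. finite S \<and> (\<forall>t t'. t \<le> t' \<longrightarrow>
      (\<forall>a\<in>S. \<forall>k. \<not> (t \<le> a + of_int k \<and> a + of_int k < t')) \<longrightarrow> germs A E x t = germs A E x t')"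
      by (intro exI[of _ S]) simp
  qed
  from bchoice[OF this] obtain S where SS: "\<forall>x\<in>{x. \<Phi> x = z}. finite (S x) \<and> (\<forall>t t'. t \<le> t' \<longrightarrow>
      (\<forall>a\<in>S x. \<forall>k. \<not> (t \<le> a + of_int k \<and> a + of_int k < t')) \<longrightarrow> germs A E x t = germs A E x t')"
    by (rule exE)
  have S: "finite (S x)" "\<And>t t'. t \<le> t' \<Longrightarrow> \<forall>a\<in>S x. \<forall>k. \<not> (t \<le> a + of_int k \<and> a + of_int k < t') \<Longrightarrow>
      germs A E x t = germs A E x t'" if x: "\<Phi> x = z" for x
    using bspec[OF SS, of x] x by simp_all
  let ?m = "\<lambda>x. real (mult A B \<Phi> x)"
  have mp: "?m x > 0" for x using mult_pos[of x] by simp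
  \<comment> \<open>The range of \<open>k\<close> is a generous form of
    \<open>0 \<le> a + k \<le> ?m x\<close>.\<close>
  define J where "J = (\<Union>x\<in>{x. \<Phi> x = z}. \<Union>a\<in>S x.
      (\<lambda>k. (a + of_int k) / ?m x) ` {k. \<lfloor>- a\<rfloor> \<le> k \<and> k \<le> \<lceil>?m x - a\<rceil>})"
  show thesis
  proof (rule that[of J])
    have "finite {k::int. \<lfloor>- a\<rfloor> \<le> k \<and> k \<le> \<lceil>?m x - a\<rceil>}" for a x
      using finite_atLeastAtMost_int[of "\<lfloor>- a\<rfloor>" "\<lceil>?m x - a\<rceil>"] by (simp add: atLeastAtMost_def atLeast_def atMost_def Int_def)
    then show "finite J" unfolding J_def using finite_fibre[of z] S(1) by auto
    fix t t' :: real assume t: "0 \<le> t" "t \<le> t'" "t' \<le> 1" and no: "\<forall>a\<in>J. \<not> (t \<le> a \<and> a < t')"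
    have "germs A E x (?m x * t) = germs A E x (?m x * t')" if x: "\<Phi> x = z" for x
    proof (rule S(2)[OF x])
      show "?m x * t \<le> ?m x * t'" using t(2) by (simp add: mult_left_mono)
      show "\<forall>a\<in>S x. \<forall>k. \<not> (?m x * t \<le> a + of_int k \<and> a + of_int k < ?m x * t')"
      proof (intro ballI allI notI)
        fix a k assume a: "a \<in> S x" and k: "?m x * t \<le> a + of_int k \<and> a + of_int k < ?m x * t'"
        have "0 \<le> ?m x * t" "?m x * t' \<le> ?m x" using t mp[of x] by (auto simp: mult_le_cancel_left1)
        then have "- a \<le> of_int k" "of_int k \<le> ?m x - a" using k by auto
        then have "k \<in> {k. \<lfloor>- a\<rfloor> \<le> k \<and> k \<le> \<lceil>?m x - a\<rceil>}" by (simp add: floor_le_iff le_ceiling_iff)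
        then have "(a + of_int k) / ?m x \<in> J" unfolding J_def using a x by blast
        then have "\<not> (t \<le> (a + of_int k) / ?m x \<and> (a + of_int k) / ?m x < t')" using no by blast
        then show False using k mp[of x] by (simp add: pos_le_divide_eq pos_divide_less_eq mult.commute)
      qed
    qed
    then show "di_germ z t = di_germ z t'" unfolding di_germ_def by auto
  qed
qed

lemma flags_DI:
  assumes "z \<in> ppts DI"
  shows "\<exists>n F \<alpha>. flag_weights B DI z n F \<alpha>"
proof -
  have L: "lattice DI z t = di_germ z t" for t using germs_DI[of z t] assms by (simp add: germs_def)
  obtain J where J: "finite J"
    "\<And>t t'. 0 \<le> t \<Longrightarrow> t \<le> t' \<Longrightarrow> t' \<le> 1 \<Longrightarrow> \<forall>a\<in>J. \<not> (t \<le> a \<and> a < t') \<Longrightarrow> di_germ z t = di_germ z t'"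
    by (rule di_germ_jumps[of z]) blast
  show ?thesis
  proof (rule Z.flags_of_filtration)
    show "lattice DI z (t + 1) = zmul B z 1 (lattice DI z t)" for t
      using di_germ_shift[of z t 1] by (simp add: L)
  qed (use J hol_module_di_germ di_germ_antimono in \<open>auto simp: L\<close>)
qed

end

text \<open>Over a model neighbourhood, a frame of the direct image consists of the products of the
  powers of \<open>\<omega> x\<close> below the multiplicity with a frame of \<open>E\<close> near \<open>x\<close>; the coefficients of a
  section are recovered by discrete Fourier inversion along the fibres.\<close>

locale model_frame = cover_bundle A B \<Phi> E r
  for A :: "'x::t2_space atlas" and B :: "'z::t2_space atlas" and \<Phi> :: "'x \<Rightarrow> 'z"
    and E :: "('x, 'i) par_bundle" and r :: nat +
  fixes z :: 'z and V W \<rho> \<omega> \<theta> and U :: "'x \<Rightarrow> 'x set" and e :: "'x \<Rightarrow> nat \<Rightarrow> 'x \<Rightarrow> 'i \<Rightarrow> complex"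
  assumes M: "model z V W \<rho> \<omega> \<theta>"
    and U: "\<And>x. \<Phi> x = z \<Longrightarrow> W x \<subseteq> U x" "\<And>x. \<Phi> x = z \<Longrightarrow> local_frame A E r (U x) (e x)"
    and V: "V \<inter> ppts DI \<subseteq> {z}"
begin

abbreviation m where "m \<equiv> mult A B \<Phi>"

definition idx :: "('x \<times> nat \<times> nat) set" where
  "idx = Sigma {x. \<Phi> x = z} (\<lambda>x. {..<m x} \<times> {..<r})"

definition sect :: "'x \<times> nat \<times> nat \<Rightarrow> 'z \<Rightarrow> 'x \<times> 'i \<Rightarrow> complex" where
  "sect = (\<lambda>(x, p, k) z' (y, i). if y \<in> W x \<and> \<Phi> y = z' then \<omega> x y ^ p * e x k y i else 0)"

definition comb :: "('x \<times> nat \<times> nat \<Rightarrow> complex) \<Rightarrow> 'z \<Rightarrow> 'x \<times> 'i \<Rightarrow> complex" where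
  "comb C z' = (\<lambda>q. \<Sum>j\<in>idx. C j * sect j z' q)"

lemma finite_idx: "finite idx" and card_idx: "card idx = sheets z * r"
  using finite_fibre[of z] by (auto simp: idx_def sheets_def sum_distrib_right)

lemma sheet:
  assumes "\<Phi> y \<in> V"
  obtains x where "\<Phi> x = z" "y \<in> W x"
  using modelD(4)[OF M assms] by blast

text \<open>The discs over \<open>z\<close> are disjoint, so on \<open>W x\<close> only the block of
  \<open>x\<close> contributes.\<close>

lemma comb_eq:
  assumes x: "\<Phi> x = z" and y: "y \<in> W x"
  shows "comb C (\<Phi> y) (y, i) = (\<Sum>k<r. (\<Sum>p<m x. C (x, p, k) * \<omega> x y ^ p) * e x k y i)"
proof -
  have "comb C (\<Phi> y) (y, i) = (\<Sum>j\<in>{x} \<times> {..<m x} \<times> {..<r}. C j * sect j (\<Phi> y) (y, i))"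
    unfolding comb_def
  proof (rule sum.mono_neutral_right[OF finite_idx])
    show "{x} \<times> {..<m x} \<times> {..<r} \<subseteq> idx" using x by (auto simp: idx_def)
    show "\<forall>j\<in>idx - {x} \<times> {..<m x} \<times> {..<r}. C j * sect j (\<Phi> y) (y, i) = 0"
    proof
      fix j assume j: "j \<in> idx - {x} \<times> {..<m x} \<times> {..<r}"
      obtain x' p k where [simp]: "j = (x', p, k)" by (cases j)
      have "y \<notin> W x'" using j modelD(6)[OF M _ x _ y, of x'] by (auto simp: idx_def)
      then show "C j * sect j (\<Phi> y) (y, i) = 0" by (simp add: sect_def)
    qed
  qed
  also have "\<dots> = (\<Sum>p<m x. \<Sum>k<r. C (x, p, k) * sect (x, p, k) (\<Phi> y) (y, i))"
    by (simp add: sum.cartesian_product')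
  also have "\<dots> = (\<Sum>k<r. \<Sum>p<m x. C (x, p, k) * sect (x, p, k) (\<Phi> y) (y, i))" by (rule sum.swap)
  also have "\<dots> = (\<Sum>k<r. (\<Sum>p<m x. C (x, p, k) * \<omega> x y ^ p) * e x k y i)"
    using y by (simp add: sect_def sum_distrib_right mult.assoc)
  finally show ?thesis .
qed

lemma comb_eq_0: "\<Phi> y \<noteq> z' \<Longrightarrow> comb C z' (y, i) = 0"
  unfolding comb_def by (rule sum.neutral) (simp add: sect_def split: prod.split)

text \<open>The centre \<open>z\<close> can be an ordinary point only if it is unramified, and
  elsewhere the coordinate does not vanish. This is the hypothesis of the root lemmas.\<close>

lemma good:
  assumes "z' \<in> V" "z' \<notin> ppts DI" "\<Phi> x = z"
  shows "coord B z z' \<noteq> 0 \<or> m x = 1"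
  using model_nonzero[OF M assms(1)] not_ppts_DI(1)[of x] assms by auto

lemma basis_fibre:
  assumes "\<Phi> x = z" "y \<in> W x" "y \<notin> ppts E"
  shows "is_basis r (\<lambda>k. e x k y) (fibre E y)"
  using E.frameD(2)[OF U(2)[OF assms(1)]] U(1)[OF assms(1)] assms by blast

lemma comb_mem:
  assumes z': "z' \<in> V" "z' \<notin> ppts DI"
  shows "comb C z' \<in> direct_sum_fibre \<Phi> E z'"
proof (rule direct_sum_fibreI)
  fix y assume y: "\<Phi> y = z'"
  obtain x where x: "\<Phi> x = z" "y \<in> W x" using sheet[of y] y z' by blast
  have ny: "y \<notin> ppts E" using not_ppts_DI(2)[of y] y z' by simp
  have "(\<lambda>i. comb C z' (y, i)) = lincomb r (\<lambda>k. \<Sum>p<m x. C (x, p, k) * \<omega> x y ^ p) (\<lambda>k. e x k y)"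
    using comb_eq[OF x] y by (simp add: lincomb_def)
  then show "(\<lambda>i. comb C z' (y, i)) \<in> fibre E y" using is_basis_lincomb[OF basis_fibre[OF x ny]] by simp
qed (rule comb_eq_0)

text \<open>Discrete Fourier coefficients along the sheets in \<open>W x\<close>. For
  \<open>p = 0\<close> the factor is 1 even where \<open>\<omega> x\<close> vanishes, which covers
  an unramified centre.\<close>

definition fourier :: "(nat \<Rightarrow> 'x \<Rightarrow> complex) \<Rightarrow> 'z \<Rightarrow> 'x \<times> nat \<times> nat \<Rightarrow> complex" where
  "fourier \<gamma> z' = (\<lambda>(x, p, k). trace (\<lambda>y. if y \<in> W x then inverse (\<omega> x y) ^ p * \<gamma> k y else 0) z' / of_nat (m x))"

lemma fourier_inversion:
  assumes z': "z' \<in> V" "z' \<notin> ppts DI" and x: "\<Phi> x = z" and y: "y \<in> W x" "\<Phi> y = z'"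
  shows "(\<Sum>p<m x. fourier \<gamma> z' (x, p, k) * \<omega> x y ^ p) = \<gamma> k y"
proof -
  have fin: "finite {y. y \<in> W x \<and> \<Phi> y = z'}" using finite_fibre[of z'] by (rule rev_finite_subset) auto
  have "trace (\<lambda>y. if y \<in> W x then h y else 0) z' = (\<Sum>y' | y' \<in> W x \<and> \<Phi> y' = z'. h y')" for h
    unfolding trace_def by (intro sum.mono_neutral_cong_right[OF finite_fibre]) auto
  then have "(\<Sum>p<m x. fourier \<gamma> z' (x, p, k) * \<omega> x y ^ p) =
      (\<Sum>p<m x. \<Sum>y' | y' \<in> W x \<and> \<Phi> y' = z'. inverse (\<omega> x y') ^ p * \<gamma> k y' * \<omega> x y ^ p) / of_nat (m x)"
    by (simp add: fourier_def sum_distrib_right sum_divide_distrib)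
  also have "\<dots> = (\<Sum>y' | y' \<in> W x \<and> \<Phi> y' = z'. \<gamma> k y' * (\<Sum>p<m x. inverse (\<omega> x y') ^ p * \<omega> x y ^ p)) / of_nat (m x)"
    by (subst sum.swap) (simp add: sum_distrib_left mult_ac)
  also have "\<dots> = (\<Sum>y' | y' \<in> W x \<and> \<Phi> y' = z'. if y' = y then \<gamma> k y' * of_nat (m x) else 0) / of_nat (m x)"
  proof (intro arg_cong2[where f = "(/)"] sum.cong refl)
    fix y' assume y': "y' \<in> {y'. y' \<in> W x \<and> \<Phi> y' = z'}"
    have "\<omega> x y' ^ m x = coord B z z'" "\<omega> x y ^ m x = coord B z z'"
      using modelD(8)[OF M x, of y'] modelD(8)[OF M x, of y] y y' by simp_all
    from sum_quotient_roots[OF mult_pos good[OF z' x] this]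
    have "(\<Sum>p<m x. inverse (\<omega> x y') ^ p * \<omega> x y ^ p) = (if \<omega> x y = \<omega> x y' then of_nat (m x) else 0)" .
    moreover have "\<omega> x y = \<omega> x y' \<longleftrightarrow> y' = y"
      using local_coordD(11)[OF modelD(7)[OF M x]] y y' by (auto simp: inj_on_def)
    ultimately show "\<gamma> k y' * (\<Sum>p<m x. inverse (\<omega> x y') ^ p * \<omega> x y ^ p) = (if y' = y then \<gamma> k y' * of_nat (m x) else 0)"
      by simp
  qed
  also have "\<dots> = \<gamma> k y" using fin y mult_pos[of x] by simp
  finally show ?thesis .
qed

lemma comb_fourier:
  assumes z': "z' \<in> V" "z' \<notin> ppts DI" and v: "v \<in> direct_sum_fibre \<Phi> E z'"
    and g: "\<And>x y. \<Phi> x = z \<Longrightarrow> y \<in> W x \<Longrightarrow> \<Phi> y = z' \<Longrightarrow> (\<lambda>i. v (y, i)) = lincomb r (\<lambda>k. \<gamma> k y) (\<lambda>k. e x k y)"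
  shows "v = comb (fourier \<gamma> z') z'"
proof (rule ext, clarify)
  fix y i
  show "v (y, i) = comb (fourier \<gamma> z') z' (y, i)"
  proof (cases "\<Phi> y = z'")
    case True
    obtain x where x: "\<Phi> x = z" "y \<in> W x" using sheet[of y] True z' by blast
    have "comb (fourier \<gamma> z') z' (y, i) = (\<Sum>k<r. \<gamma> k y * e x k y i)"
      using comb_eq[OF x, of "fourier \<gamma> z'" i] fourier_inversion[OF z' x True] True by simp
    then show ?thesis using fun_cong[OF g[OF x True], of i] by (simp add: lincomb_def)
  qed (simp add: comb_eq_0 direct_sum_fibreD(2)[OF v])
qed

text \<open>By orthogonality, summing against the powers \<open>inverse (\<omega> x y) ^ q\<close>
  over the sheets in \<open>W x\<close> isolates the coefficient with exponent
  \<open>q\<close>.\<close>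

lemma comb_injective:
  assumes z': "z' \<in> V" "z' \<notin> ppts DI" and 0: "comb C z' = (\<lambda>_. 0)" and j: "j \<in> idx"
  shows "C j = 0"
proof -
  obtain x q k where q: "j = (x, q, k)" "\<Phi> x = z" "q < m x" "k < r" using j by (auto simp: idx_def)
  have s0: "(\<Sum>p<m x. C (x, p, k) * \<omega> x y ^ p) = 0" if y: "y \<in> W x" "\<Phi> y = z'" for y
  proof -
    have "lincomb r (\<lambda>k. \<Sum>p<m x. C (x, p, k) * \<omega> x y ^ p) (\<lambda>k. e x k y) = (\<lambda>_. 0)"
      using comb_eq[OF q(2) y(1), of C] y(2) 0 by (auto simp: lincomb_def fun_eq_iff)
    moreover have "y \<notin> ppts E" using not_ppts_DI(2)[of y] y z' by simp
    ultimately show ?thesis using basis_fibre[OF q(2) y(1)] q(4) unfolding is_basis_def by blast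
  qed
  note c = good[OF z' q(2)]
  have "0 = (\<Sum>y | y \<in> W x \<and> \<Phi> y = z'. inverse (\<omega> x y) ^ q * (\<Sum>p<m x. C (x, p, k) * \<omega> x y ^ p))"
    using s0 by simp
  also have "\<dots> = (\<Sum>w | w ^ m x = coord B z z'. inverse w ^ q * (\<Sum>p<m x. C (x, p, k) * w ^ p))"
    by (rule model_roots(1)[OF M q(2) z'(1) c, of "\<lambda>w. inverse w ^ q * (\<Sum>p<m x. C (x, p, k) * w ^ p)"])
  also have "\<dots> = (\<Sum>p<m x. C (x, p, k) * (\<Sum>w | w ^ m x = coord B z z'. inverse w ^ q * w ^ p))"
    unfolding sum_distrib_left by (subst sum.swap) (simp add: mult_ac)
  also have "\<dots> = (\<Sum>p<m x. C (x, p, k) * (if q = p then of_nat (m x) else 0))"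
    using sum_roots_power[OF mult_pos c q(3)] by (intro sum.cong) auto
  also have "\<dots> = C (x, q, k) * of_nat (m x)"
    using q(3) by (simp add: if_distrib[of "\<lambda>c. _ * c"] cong: if_cong)
  finally show ?thesis using mult_pos[of x] q(1) by simp
qed

lemma comb_surjective:
  assumes z': "z' \<in> V" "z' \<notin> ppts DI" and v: "v \<in> direct_sum_fibre \<Phi> E z'"
  shows "\<exists>C. v = comb C z'"
proof -
  have "\<exists>c. \<forall>x. \<Phi> x = z \<longrightarrow> y \<in> W x \<longrightarrow> (\<lambda>i. v (y, i)) = lincomb r c (\<lambda>k. e x k y)" if y: "\<Phi> y = z'" for y
  proof -
    obtain x where x: "\<Phi> x = z" "y \<in> W x" using sheet[of y] y z' by blast
    have ny: "y \<notin> ppts E" using not_ppts_DI(2)[of y] y z' by simp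
    have "(\<lambda>i. v (y, i)) \<in> range (\<lambda>c. lincomb r c (\<lambda>k. e x k y))"
      using direct_sum_fibreD(1)[OF v y] basis_fibre[OF x ny] unfolding is_basis_def by simp
    then obtain c where c: "(\<lambda>i. v (y, i)) = lincomb r c (\<lambda>k. e x k y)" by blast
    have "x' = x" if "\<Phi> x' = z" "y \<in> W x'" for x' using modelD(6)[OF M that(1) x(1) that(2) x(2)] .
    then show ?thesis using c by blast
  qed
  then have "\<forall>y\<in>{y. \<Phi> y = z'}. \<exists>c. \<forall>x. \<Phi> x = z \<longrightarrow> y \<in> W x \<longrightarrow> (\<lambda>i. v (y, i)) = lincomb r c (\<lambda>k. e x k y)" by blast
  from bchoice[OF this] obtain c where
    c: "\<forall>y\<in>{y. \<Phi> y = z'}. \<forall>x. \<Phi> x = z \<longrightarrow> y \<in> W x \<longrightarrow> (\<lambda>i. v (y, i)) = lincomb r (c y) (\<lambda>k. e x k y)" by (rule exE)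
  have "v = comb (fourier (\<lambda>k y. c y k) z') z'"
    by (rule comb_fourier[OF z' v]) (use c in simp)
  then show ?thesis by blast
qed

lemma slice_comb_hol:
  assumes y: "\<Phi> y \<in> V" and x: "\<Phi> x = z" "y \<in> W x" and C: "\<forall>j\<in>idx. hol_at B (\<Phi> y) (C j)"
  shows "\<forall>k<r. hol_at A y (\<lambda>y'. \<Sum>p<m x. C (x, p, k) (\<Phi> y') * \<omega> x y' ^ p)"
    "\<forall>\<^sub>F y' in nhds y. slice (\<lambda>z'. comb (\<lambda>j. C j z') z') y' =
       lincomb r (\<lambda>k. \<Sum>p<m x. C (x, p, k) (\<Phi> y') * \<omega> x y' ^ p) (\<lambda>k. e x k y')"
proof -
  show "\<forall>k<r. hol_at A y (\<lambda>y'. \<Sum>p<m x. C (x, p, k) (\<Phi> y') * \<omega> x y' ^ p)"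
  proof (intro allI impI X.hol_at_sum)
    fix k p assume "k < r" "p \<in> {..<m x}"
    then have "hol_at B (\<Phi> y) (C (x, p, k))" using C x(1) by (auto simp: idx_def)
    then show "hol_at A y (\<lambda>y'. C (x, p, k) (\<Phi> y') * \<omega> x y' ^ p)"
      by (rule X.hol_at_mult[OF hol_at_Phi X.hol_at_power[OF model_hol_at[OF M x]]])
  qed
  have "\<forall>\<^sub>F y' in nhds y. y' \<in> W x"
    using local_coordD(1)[OF modelD(7)[OF M x(1)]] x(2) by (intro eventually_nhds_in_open)
  then show "\<forall>\<^sub>F y' in nhds y. slice (\<lambda>z'. comb (\<lambda>j. C j z') z') y' =
       lincomb r (\<lambda>k. \<Sum>p<m x. C (x, p, k) (\<Phi> y') * \<omega> x y' ^ p) (\<lambda>k. e x k y')"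
    by eventually_elim (simp add: comb_eq[OF x(1)] lincomb_def)
qed

text \<open>Over ordinary points the map is unramified, so the Fourier coefficients of a section are
  traces of holomorphic functions and hence holomorphic.\<close>

lemma stalk_comb:
  assumes z': "z' \<in> V" "z' \<notin> ppts DI"
  shows "s \<in> stalk DI z' \<longleftrightarrow> (\<exists>C. (\<forall>j\<in>idx. hol_at B z' (C j)) \<and> (\<forall>\<^sub>F z'' in nhds z'. s z'' = comb (\<lambda>j. C j z'') z''))"
proof
  have eV: "\<forall>\<^sub>F z'' in nhds z'. z'' \<in> V" using modelD(1)[OF M] z' by (intro eventually_nhds_in_open)
  have eg: "\<forall>\<^sub>F z'' in nhds z'. z'' \<notin> ppts DI" by (rule Z.eventually_not_mem_finite(2)[OF finite_ppts_DI z'(2)])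
  {
    assume "\<exists>C. (\<forall>j\<in>idx. hol_at B z' (C j)) \<and> (\<forall>\<^sub>F z'' in nhds z'. s z'' = comb (\<lambda>j. C j z'') z'')"
    then obtain C where C: "\<And>j. j \<in> idx \<Longrightarrow> hol_at B z' (C j)"
      "\<forall>\<^sub>F z'' in nhds z'. s z'' = comb (\<lambda>j. C j z'') z''" by blast
    have "\<forall>\<^sub>F z'' in nhds z'. s z'' \<in> direct_sum_fibre \<Phi> E z''"
      using C(2) eV eg by eventually_elim (simp add: comb_mem)
    moreover have "slice s \<in> stalk E y" if y: "\<Phi> y = z'" for y
    proof -
      obtain x where x: "\<Phi> x = z" "y \<in> W x" using sheet[of y] y z' by blast
      have ny: "y \<notin> ppts E" using not_ppts_DI(2)[of y] y z' by simp
      have yU: "y \<in> U x" using U(1)[OF x(1)] x(2) by blast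
      have yV: "\<Phi> y \<in> V" using y z' by simp
      have Cy: "\<forall>j\<in>idx. hol_at B (\<Phi> y) (C j)" using C(1) y by simp
      note sc = slice_comb_hol[OF yV x Cy]
      have "\<forall>\<^sub>F y' in nhds y. s (\<Phi> y') = comb (\<lambda>j. C j (\<Phi> y')) (\<Phi> y')"
        by (rule eventually_nhds_Phi) (use C(2) y in simp)
      with sc(2) have "\<forall>\<^sub>F y' in nhds y. slice s y' =
          lincomb r (\<lambda>k. \<Sum>p<m x. C (x, p, k) (\<Phi> y') * \<omega> x y' ^ p) (\<lambda>k. e x k y')"
        by eventually_elim simp
      then show ?thesis unfolding E.frameD(3)[OF U(2)[OF x(1)] yU ny]
        using sc(1) by (intro exI[of _ "\<lambda>k y'. \<Sum>p<m x. C (x, p, k) (\<Phi> y') * \<omega> x y' ^ p"]) blast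
    qed
    ultimately show "s \<in> stalk DI z'" unfolding stalk_DI by blast
  }
  assume s: "s \<in> stalk DI z'"
  \<comment> \<open>Coefficients in the frames of \<open>E\<close>, chosen pointwise so that one
    function serves the whole fibre. Uniqueness of coefficients makes it agree near each preimage
    with holomorphic ones.\<close>
  define \<gamma> where "\<gamma> = (\<lambda>k y. (SOME c. \<forall>x. \<Phi> x = z \<longrightarrow> y \<in> W x \<longrightarrow> slice s y = lincomb r c (\<lambda>k. e x k y)) k)"
  have g: "(\<forall>k<r. hol_at A y (\<gamma> k)) \<and>
      (\<forall>\<^sub>F y' in nhds y. \<forall>x. \<Phi> x = z \<longrightarrow> y' \<in> W x \<longrightarrow> slice s y' = lincomb r (\<lambda>k. \<gamma> k y') (\<lambda>k. e x k y'))"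
    if y: "\<Phi> y = z'" for y
  proof -
    obtain x where x: "\<Phi> x = z" "y \<in> W x" using sheet[of y] y z' by blast
    have ny: "y \<notin> ppts E" using not_ppts_DI(2)[of y] y z' by simp
    have yU: "y \<in> U x" using U(1)[OF x(1)] x(2) by blast
    have "slice s \<in> stalk E y" using s y unfolding stalk_DI by blast
    then obtain f where f: "\<forall>k<r. hol_at A y (f k)"
      "\<forall>\<^sub>F y' in nhds y. slice s y' = lincomb r (\<lambda>k. f k y') (\<lambda>k. e x k y')"
      unfolding E.frameD(3)[OF U(2)[OF x(1)] yU ny] by blast
    have "\<forall>\<^sub>F y' in nhds y. y' \<in> W x"
      using local_coordD(1)[OF modelD(7)[OF M x(1)]] x(2) by (intro eventually_nhds_in_open)
    then have ev: "\<forall>\<^sub>F y' in nhds y. (\<forall>k<r. \<gamma> k y' = f k y') \<and>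
        (\<forall>x. \<Phi> x = z \<longrightarrow> y' \<in> W x \<longrightarrow> slice s y' = lincomb r (\<lambda>k. \<gamma> k y') (\<lambda>k. e x k y'))"
      using f(2) E.eventually_nhds_not_ppts[OF ny]
    proof eventually_elim
      case (elim y')
      have un: "x' = x" if "\<Phi> x' = z" "y' \<in> W x'" for x'
        using modelD(6)[OF M that(1) x(1) that(2) elim(1)] .
      let ?P = "\<lambda>c. \<forall>x. \<Phi> x = z \<longrightarrow> y' \<in> W x \<longrightarrow> slice s y' = lincomb r c (\<lambda>k. e x k y')"
      have "?P (\<lambda>k. f k y')" using un elim(2) by metis
      then have P: "?P (SOME c. ?P c)" by (rule someI[of ?P "\<lambda>k. f k y'"])
      have ge: "(SOME c. ?P c) = (\<lambda>k. \<gamma> k y')" by (simp add: \<gamma>_def)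
      have Pg: "?P (\<lambda>k. \<gamma> k y')" using P unfolding ge .
      then have "lincomb r (\<lambda>k. \<gamma> k y') (\<lambda>k. e x k y') = lincomb r (\<lambda>k. f k y') (\<lambda>k. e x k y')"
        using x(1) elim(1,2) by metis
      then have "\<forall>k<r. \<gamma> k y' = f k y'" using is_basis_unique[OF basis_fibre[OF x(1) elim(1,3)]] by blast
      then show ?case using Pg by blast
    qed
    have "hol_at A y (\<gamma> k)" if k: "k < r" for k
    proof -
      have "\<forall>\<^sub>F y' in nhds y. \<gamma> k y' = f k y'" using ev by eventually_elim (use k in blast)
      then show ?thesis using X.hol_at_cong f(1) k by blast
    qed
    moreover have "\<forall>\<^sub>F y' in nhds y. \<forall>x. \<Phi> x = z \<longrightarrow> y' \<in> W x \<longrightarrow> slice s y' = lincomb r (\<lambda>k. \<gamma> k y') (\<lambda>k. e x k y')"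
      using ev by eventually_elim blast
    ultimately show ?thesis by blast
  qed
  have "\<forall>\<^sub>F z'' in nhds z'. \<forall>y. \<Phi> y = z'' \<longrightarrow>
      (\<forall>x. \<Phi> x = z \<longrightarrow> y \<in> W x \<longrightarrow> slice s y = lincomb r (\<lambda>k. \<gamma> k y) (\<lambda>k. e x k y))"
    by (rule eventually_nhds_fibre) (use g in blast)
  moreover have "\<forall>\<^sub>F z'' in nhds z'. s z'' \<in> direct_sum_fibre \<Phi> E z''" using s unfolding stalk_DI by blast
  ultimately have "\<forall>\<^sub>F z'' in nhds z'. s z'' = comb (fourier \<gamma> z'') z''"
    using eV eg
  proof eventually_elim
    case (elim z'')
    show ?case by (rule comb_fourier[OF elim(3,4,2)]) (use elim(1) in auto)
  qed
  moreover have "hol_at B z' (\<lambda>z''. fourier \<gamma> z'' j)" if j: "j \<in> idx" for j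
  proof -
    obtain x p k where q: "j = (x, p, k)" "\<Phi> x = z" "p < m x" "k < r" using j by (auto simp: idx_def)
    \<comment> \<open>Extension by zero from \<open>W x\<close> keeps the function holomorphic,
      since a preimage outside \<open>W x\<close> lies in another, disjoint open disc.\<close>
    have "hol_at A y (\<lambda>y. if y \<in> W x then inverse (\<omega> x y) ^ p * \<gamma> k y else 0)" if y: "\<Phi> y = z'" for y
    proof (cases "y \<in> W x")
      case True
      have "\<forall>\<^sub>F y' in nhds y. y' \<in> W x"
        using local_coordD(1)[OF modelD(7)[OF M q(2)]] True by (intro eventually_nhds_in_open)
      then have "\<forall>\<^sub>F y' in nhds y. (if y' \<in> W x then inverse (\<omega> x y') ^ p * \<gamma> k y' else 0) = inverse (\<omega> x y') ^ p * \<gamma> k y'"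
        by eventually_elim simp
      \<comment> \<open>For multiplicity 1 the exponent is 0; otherwise \<open>\<omega> x y\<close>
        is nonzero because \<open>z'\<close> is ordinary.\<close>
      moreover have "hol_at A y (\<lambda>y. inverse (\<omega> x y) ^ p)"
      proof (cases "m x = 1")
        case True
        then show ?thesis using q(3) by simp
      next
        case False
        then have "\<omega> x y ^ m x \<noteq> 0" using good[OF z' q(2)] modelD(8)[OF M q(2) True] y by simp
        then have "\<omega> x y \<noteq> 0" using mult_pos[of x] by (auto simp: power_0_left)
        then show ?thesis by (intro X.hol_at_power X.hol_at_inverse model_hol_at[OF M q(2) True])
      qed
      then have "hol_at A y (\<lambda>y. inverse (\<omega> x y) ^ p * \<gamma> k y)" using X.hol_at_mult g[OF y] q(4) by blast
      ultimately show ?thesis by (simp add: X.hol_at_cong)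
    next
      case False
      obtain x' where x': "\<Phi> x' = z" "y \<in> W x'" using sheet[of y] y z' by blast
      have "\<forall>\<^sub>F y' in nhds y. y' \<in> W x'"
        using local_coordD(1)[OF modelD(7)[OF M x'(1)]] x'(2) by (intro eventually_nhds_in_open)
      then have "\<forall>\<^sub>F y' in nhds y. (if y' \<in> W x then inverse (\<omega> x y') ^ p * \<gamma> k y' else 0) = 0"
        by eventually_elim (use modelD(6)[OF M q(2) x'(1)] False x'(2) in auto)
      then show ?thesis by (simp add: X.hol_at_cong)
    qed
    then have "hol_at B z' (trace (\<lambda>y. if y \<in> W x then inverse (\<omega> x y) ^ p * \<gamma> k y else 0))"
      using not_ppts_DI(1) z'(2) by (intro hol_at_trace) auto
    from Z.hol_at_mult[OF Z.hol_at_const[of z' "1 / of_nat (m x)"] this]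
    show ?thesis by (simp add: q(1) fourier_def)
  qed
  ultimately show "\<exists>C. (\<forall>j\<in>idx. hol_at B z' (C j)) \<and> (\<forall>\<^sub>F z'' in nhds z'. s z'' = comb (\<lambda>j. C j z'') z'')"
    by (intro exI[of _ "\<lambda>j z''. fourier \<gamma> z'' j"]) simp
qed

text \<open>At the centre, Fourier inversion would divide by \<open>\<omega> x\<close>, which
  vanishes there. The holomorphic coefficients come instead from the power series decomposition at
  each preimage.\<close>

lemma di_germ_comb:
  "s \<in> di_germ z 0 \<longleftrightarrow> (\<exists>C. (\<forall>j\<in>idx. hol_at B z (C j)) \<and> (\<forall>\<^sub>F z' in at z. s z' = comb (\<lambda>j. C j z') z'))"
proof
  have eV: "\<forall>\<^sub>F z' in at z. z' \<in> V"
    using modelD(1,2)[OF M] unfolding eventually_at_topological by blast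
  {
    assume "\<exists>C. (\<forall>j\<in>idx. hol_at B z (C j)) \<and> (\<forall>\<^sub>F z' in at z. s z' = comb (\<lambda>j. C j z') z')"
    then obtain C where C: "\<And>j. j \<in> idx \<Longrightarrow> hol_at B z (C j)"
      "\<forall>\<^sub>F z' in at z. s z' = comb (\<lambda>j. C j z') z'" by blast
    show "s \<in> di_germ z 0"
    proof (rule di_germI)
      show "\<forall>\<^sub>F z' in at z. s z' \<in> direct_sum_fibre \<Phi> E z'"
        using C(2) eV eventually_fibre_good[of z] by eventually_elim (simp add: comb_mem)
      fix x assume x: "\<Phi> x = z"
      have xW: "x \<in> W x" using local_coordD(2)[OF modelD(7)[OF M x]] .
      have xU: "x \<in> U x" using U(1)[OF x] xW by blast
      have xV: "\<Phi> x \<in> V" using x modelD(2)[OF M] by simp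
      have Cx: "\<forall>j\<in>idx. hol_at B (\<Phi> x) (C j)" using C(1) x by simp
      note sc = slice_comb_hol[OF xV x xW Cx]
      have "\<forall>\<^sub>F y in at x. s (\<Phi> y) = comb (\<lambda>j. C j (\<Phi> y)) (\<Phi> y)"
        by (rule eventually_at_Phi) (use C(2) x in simp)
      moreover have "\<forall>\<^sub>F y in at x. slice (\<lambda>z'. comb (\<lambda>j. C j z') z') y =
          lincomb r (\<lambda>k. \<Sum>p<m x. C (x, p, k) (\<Phi> y) * \<omega> x y ^ p) (\<lambda>k. e x k y)"
        using sc(2) by (simp add: eventually_nhds_conv_at)
      ultimately have "\<forall>\<^sub>F y in at x. slice s y =
          lincomb r (\<lambda>k. \<Sum>p<m x. C (x, p, k) (\<Phi> y) * \<omega> x y ^ p) (\<lambda>k. e x k y)"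
        by eventually_elim simp
      then have "slice s \<in> germs A E x 0" unfolding E.germs_0[OF U(2)[OF x] xU]
        using sc(1) by (intro exI[of _ "\<lambda>k y. \<Sum>p<m x. C (x, p, k) (\<Phi> y) * \<omega> x y ^ p"]) blast
      then show "slice s \<in> germs A E x (real (m x) * 0)" by simp
    qed
  }
  assume s: "s \<in> di_germ z 0"
  have "\<exists>a. (\<forall>p<m x. \<forall>k<r. hol_at B z (a p k)) \<and>
      (\<forall>\<^sub>F y in at x. slice s y = lincomb r (\<lambda>k. \<Sum>p<m x. a p k (\<Phi> y) * \<omega> x y ^ p) (\<lambda>k. e x k y))"
    if x: "\<Phi> x = z" for x
  proof -
    have xU: "x \<in> U x" using U(1)[OF x] local_coordD(2)[OF modelD(7)[OF M x]] by blast
    have "slice s \<in> germs A E x 0" using di_germD(2)[OF s x] by simp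
    then obtain f where f: "\<forall>k<r. hol_at A x (f k)"
      "\<forall>\<^sub>F y in at x. slice s y = lincomb r (\<lambda>k. f k y) (\<lambda>k. e x k y)"
      unfolding E.germs_0[OF U(2)[OF x] xU] by blast
    have "\<forall>k\<in>{..<r}. \<exists>a. (\<forall>p<m x. hol_at B z (a p)) \<and> (\<forall>\<^sub>F y in nhds x. f k y = (\<Sum>p<m x. \<omega> x y ^ p * a p (\<Phi> y)))"
    proof
      fix k assume "k \<in> {..<r}"
      then have "hol_at A x (f k)" using f(1) by simp
      then obtain a where "\<And>p. p < m x \<Longrightarrow> hol_at B z (a p)"
        "\<forall>\<^sub>F y in nhds x. f k y = (\<Sum>p<m x. \<omega> x y ^ p * a p (\<Phi> y))"
        by (rule hol_at_decomposition[OF M x]) blast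
      then show "\<exists>a. (\<forall>p<m x. hol_at B z (a p)) \<and> (\<forall>\<^sub>F y in nhds x. f k y = (\<Sum>p<m x. \<omega> x y ^ p * a p (\<Phi> y)))"
        by blast
    qed
    from bchoice[OF this] obtain a where
      a: "\<forall>k\<in>{..<r}. (\<forall>p<m x. hol_at B z (a k p)) \<and> (\<forall>\<^sub>F y in nhds x. f k y = (\<Sum>p<m x. \<omega> x y ^ p * a k p (\<Phi> y)))"
      by (rule exE)
    have "\<forall>k\<in>{..<r}. \<forall>\<^sub>F y in at x. f k y = (\<Sum>p<m x. \<omega> x y ^ p * a k p (\<Phi> y))"
      using a by (simp add: eventually_nhds_conv_at)
    then have "\<forall>\<^sub>F y in at x. \<forall>k\<in>{..<r}. f k y = (\<Sum>p<m x. \<omega> x y ^ p * a k p (\<Phi> y))"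
      by (intro eventually_ball_finite) auto
    with f(2) have "\<forall>\<^sub>F y in at x. slice s y = lincomb r (\<lambda>k. \<Sum>p<m x. a k p (\<Phi> y) * \<omega> x y ^ p) (\<lambda>k. e x k y)"
      by eventually_elim (simp add: lincomb_def mult.commute)
    then show ?thesis using a by (intro exI[of _ "\<lambda>p k. a k p"]) simp
  qed
  then have "\<forall>x\<in>{x. \<Phi> x = z}. \<exists>a. (\<forall>p<m x. \<forall>k<r. hol_at B z (a p k)) \<and>
      (\<forall>\<^sub>F y in at x. slice s y = lincomb r (\<lambda>k. \<Sum>p<m x. a p k (\<Phi> y) * \<omega> x y ^ p) (\<lambda>k. e x k y))" by blast
  from bchoice[OF this] obtain a where a: "\<forall>x\<in>{x. \<Phi> x = z}. (\<forall>p<m x. \<forall>k<r. hol_at B z (a x p k)) \<and>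
      (\<forall>\<^sub>F y in at x. slice s y = lincomb r (\<lambda>k. \<Sum>p<m x. a x p k (\<Phi> y) * \<omega> x y ^ p) (\<lambda>k. e x k y))"
    by (rule exE)
  define C where "C = (\<lambda>(x, p, k). a x p k)"
  have hol: "\<forall>j\<in>idx. hol_at B z (C j)" using a by (auto simp: idx_def C_def)
  have "\<forall>\<^sub>F z' in at z. \<forall>y. \<Phi> y = z' \<longrightarrow> (\<forall>x. \<Phi> x = z \<longrightarrow> y \<in> W x \<longrightarrow>
      slice s y = lincomb r (\<lambda>k. \<Sum>p<m x. a x p k (\<Phi> y) * \<omega> x y ^ p) (\<lambda>k. e x k y))"
  proof (rule eventually_at_fibre)
    fix x assume x: "\<Phi> x = z"
    have "\<forall>\<^sub>F y in at x. y \<in> W x"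
      using local_coordD(1,2)[OF modelD(7)[OF M x]] unfolding eventually_at_topological by blast
    moreover have "\<forall>\<^sub>F y in at x. slice s y = lincomb r (\<lambda>k. \<Sum>p<m x. a x p k (\<Phi> y) * \<omega> x y ^ p) (\<lambda>k. e x k y)"
      using a x by blast
    ultimately show "\<forall>\<^sub>F y in at x. \<forall>x. \<Phi> x = z \<longrightarrow> y \<in> W x \<longrightarrow>
        slice s y = lincomb r (\<lambda>k. \<Sum>p<m x. a x p k (\<Phi> y) * \<omega> x y ^ p) (\<lambda>k. e x k y)"
    proof eventually_elim
      case (elim y)
      show ?case
      proof (intro allI impI)
        fix x' assume "\<Phi> x' = z" "y \<in> W x'"
        then have "x' = x" using modelD(6)[OF M _ x _ elim(1)] by blast
        then show "slice s y = lincomb r (\<lambda>k. \<Sum>p<m x'. a x' p k (\<Phi> y) * \<omega> x' y ^ p) (\<lambda>k. e x' k y)"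
          using elim(2) by simp
      qed
    qed
  qed
  then have "\<forall>\<^sub>F z' in at z. s z' = comb (\<lambda>j. C j z') z'"
    using eV di_germD(1)[OF s]
  proof eventually_elim
    case (elim z')
    show ?case
    proof (rule ext, clarify)
      fix y i
      show "s z' (y, i) = comb (\<lambda>j. C j z') z' (y, i)"
      proof (cases "\<Phi> y = z'")
        case True
        obtain x where x: "\<Phi> x = z" "y \<in> W x" using sheet[of y] True elim(2) by blast
        have "slice s y = lincomb r (\<lambda>k. \<Sum>p<m x. a x p k (\<Phi> y) * \<omega> x y ^ p) (\<lambda>k. e x k y)"
          using elim(1) True x by blast
        from fun_cong[OF this, of i] show ?thesis
          using comb_eq[OF x, of "\<lambda>j. C j z'" i] True by (simp add: lincomb_def C_def)
      qed (simp add: comb_eq_0 direct_sum_fibreD(2)[OF elim(3)])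
    qed
  qed
  then show "\<exists>C. (\<forall>j\<in>idx. hol_at B z (C j)) \<and> (\<forall>\<^sub>F z' in at z. s z' = comb (\<lambda>j. C j z') z')"
    using hol by blast
qed

text \<open>What remains is to number the triples in \<open>idx\<close> by natural numbers.\<close>

lemma local_frame_DI: "\<exists>f. local_frame B DI (sheets z * r) V f"
proof -
  define R where "R = sheets z * r"
  obtain b where b: "bij_betw b {..<R} idx"
    using ex_bij_betw_nat_finite[OF finite_idx] by (auto simp: card_idx R_def lessThan_atLeast0)
  define c where "c = inv_into {..<R} b"
  have cb: "c (b k) = k" if "k < R" for k
    unfolding c_def using b that by (intro inv_into_f_f) (auto simp: bij_betw_def)
  have bc: "b (c j) = j" "c j < R" if "j \<in> idx" for j
    using b that inv_into_into[of j b "{..<R}"] unfolding c_def by (auto simp: bij_betw_def f_inv_into_f)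
  have bi: "b k \<in> idx" if "k < R" for k using b that by (auto simp: bij_betw_def)
  define f where "f = (\<lambda>k. sect (b k))"
  have lc: "lincomb R D (\<lambda>k. f k z') = comb (\<lambda>j. D (c j)) z'" for D z'
  proof
    fix q
    have "lincomb R D (\<lambda>k. f k z') q = (\<Sum>k<R. D (c (b k)) * sect (b k) z' q)"
      by (simp add: lincomb_def f_def cb)
    also have "\<dots> = comb (\<lambda>j. D (c j)) z' q"
      unfolding comb_def by (rule sum.reindex_bij_betw[OF b, of "\<lambda>j. D (c j) * sect j z' q"])
    finally show "lincomb R D (\<lambda>k. f k z') q = comb (\<lambda>j. D (c j)) z' q" .
  qed
  have cl: "comb C z' = lincomb R (\<lambda>k. C (b k)) (\<lambda>k. f k z')" for C z'
    unfolding lc comb_def by (intro ext sum.cong) (auto simp: bc)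
  have "local_frame B DI R V f"
    unfolding local_frame_def
  proof (intro conjI ballI)
    show "open V" by (rule modelD(1)[OF M])
    fix z' assume "z' \<in> V - ppts DI"
    then have z': "z' \<in> V" "z' \<notin> ppts DI" by auto
    show "is_basis R (\<lambda>k. f k z') (fibre DI z')"
      unfolding is_basis_def fibre_DI
    proof (intro conjI allI impI equalityI subsetI)
      fix v assume "v \<in> direct_sum_fibre \<Phi> E z'"
      then obtain C where "v = comb C z'" using comb_surjective[OF z'] by blast
      then show "v \<in> range (\<lambda>c. lincomb R c (\<lambda>k. f k z'))" unfolding cl by blast
    next
      fix v assume "v \<in> range (\<lambda>c. lincomb R c (\<lambda>k. f k z'))"
      then show "v \<in> direct_sum_fibre \<Phi> E z'" unfolding lc using comb_mem[OF z'] by blast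
    next
      fix D k assume "lincomb R D (\<lambda>k. f k z') = (\<lambda>_. 0)" "k < R"
      then show "D k = 0" using comb_injective[OF z', of "\<lambda>j. D (c j)" "b k"] bi[of k] cb[of k] unfolding lc by simp
    qed
    show "stalk DI z' = {s. \<exists>g. (\<forall>k<R. hol_at B z' (g k)) \<and>
        (\<forall>\<^sub>F y in nhds z'. s y = lincomb R (\<lambda>k. g k y) (\<lambda>k. f k y))}"
    proof (rule set_eqI)
      fix s
      have "(\<exists>C. (\<forall>j\<in>idx. hol_at B z' (C j)) \<and> (\<forall>\<^sub>F y in nhds z'. s y = comb (\<lambda>j. C j y) y)) \<longleftrightarrow>
          (\<exists>g. (\<forall>k<R. hol_at B z' (g k)) \<and> (\<forall>\<^sub>F y in nhds z'. s y = lincomb R (\<lambda>k. g k y) (\<lambda>k. f k y)))"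
      proof
        assume "\<exists>C. (\<forall>j\<in>idx. hol_at B z' (C j)) \<and> (\<forall>\<^sub>F y in nhds z'. s y = comb (\<lambda>j. C j y) y)"
        then obtain C where "\<forall>j\<in>idx. hol_at B z' (C j)" "\<forall>\<^sub>F y in nhds z'. s y = comb (\<lambda>j. C j y) y" by blast
        then show "\<exists>g. (\<forall>k<R. hol_at B z' (g k)) \<and> (\<forall>\<^sub>F y in nhds z'. s y = lincomb R (\<lambda>k. g k y) (\<lambda>k. f k y))"
          using bi unfolding cl by (intro exI[of _ "\<lambda>k. C (b k)"]) simp
      next
        assume "\<exists>g. (\<forall>k<R. hol_at B z' (g k)) \<and> (\<forall>\<^sub>F y in nhds z'. s y = lincomb R (\<lambda>k. g k y) (\<lambda>k. f k y))"
        then obtain g where "\<forall>k<R. hol_at B z' (g k)" "\<forall>\<^sub>F y in nhds z'. s y = lincomb R (\<lambda>k. g k y) (\<lambda>k. f k y)" by blast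
        then show "\<exists>C. (\<forall>j\<in>idx. hol_at B z' (C j)) \<and> (\<forall>\<^sub>F y in nhds z'. s y = comb (\<lambda>j. C j y) y)"
          using bc unfolding lc by (intro exI[of _ "\<lambda>j. g (c j)"]) simp
      qed
      then show "s \<in> stalk DI z' \<longleftrightarrow> s \<in> {s. \<exists>g. (\<forall>k<R. hol_at B z' (g k)) \<and>
          (\<forall>\<^sub>F y in nhds z'. s y = lincomb R (\<lambda>k. g k y) (\<lambda>k. f k y))}"
        unfolding stalk_comb[OF z'] by simp
    qed
  next
    fix z' assume "z' \<in> V \<inter> ppts DI"
    then have zz: "z' = z" "z \<in> ppts DI" using V by auto
    have L: "lattice DI z 0 = di_germ z 0" using germs_DI[of z 0] zz(2) by (simp add: germs_def)
    show "lattice DI z' 0 = {s. \<exists>g. (\<forall>k<R. hol_at B z' (g k)) \<and>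
        (\<forall>\<^sub>F y in at z'. s y = lincomb R (\<lambda>k. g k y) (\<lambda>k. f k y))}"
      unfolding zz(1) L
    proof (intro set_eqI)
      fix s
      have "(\<exists>C. (\<forall>j\<in>idx. hol_at B z (C j)) \<and> (\<forall>\<^sub>F y in at z. s y = comb (\<lambda>j. C j y) y)) \<longleftrightarrow>
          (\<exists>g. (\<forall>k<R. hol_at B z (g k)) \<and> (\<forall>\<^sub>F y in at z. s y = lincomb R (\<lambda>k. g k y) (\<lambda>k. f k y)))"
      proof
        assume "\<exists>C. (\<forall>j\<in>idx. hol_at B z (C j)) \<and> (\<forall>\<^sub>F y in at z. s y = comb (\<lambda>j. C j y) y)"
        then obtain C where "\<forall>j\<in>idx. hol_at B z (C j)" "\<forall>\<^sub>F y in at z. s y = comb (\<lambda>j. C j y) y" by blast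
        then show "\<exists>g. (\<forall>k<R. hol_at B z (g k)) \<and> (\<forall>\<^sub>F y in at z. s y = lincomb R (\<lambda>k. g k y) (\<lambda>k. f k y))"
          using bi unfolding cl by (intro exI[of _ "\<lambda>k. C (b k)"]) simp
      next
        assume "\<exists>g. (\<forall>k<R. hol_at B z (g k)) \<and> (\<forall>\<^sub>F y in at z. s y = lincomb R (\<lambda>k. g k y) (\<lambda>k. f k y))"
        then obtain g where "\<forall>k<R. hol_at B z (g k)" "\<forall>\<^sub>F y in at z. s y = lincomb R (\<lambda>k. g k y) (\<lambda>k. f k y)" by blast
        then show "\<exists>C. (\<forall>j\<in>idx. hol_at B z (C j)) \<and> (\<forall>\<^sub>F y in at z. s y = comb (\<lambda>j. C j y) y)"
          using bc unfolding lc by (intro exI[of _ "\<lambda>j. g (c j)"]) simp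
      qed
      then show "s \<in> di_germ z 0 \<longleftrightarrow> s \<in> {s. \<exists>g. (\<forall>k<R. hol_at B z (g k)) \<and>
          (\<forall>\<^sub>F y in at z. s y = lincomb R (\<lambda>k. g k y) (\<lambda>k. f k y))}"
        unfolding di_germ_comb by simp
    qed
  qed
  then show ?thesis unfolding R_def by blast
qed

end

context cover_bundle
begin

text \<open>The base point \<open>z0\<close> is arbitrary because the degree is constant; the rank
  must be a single number for all points.\<close>

lemma DI_rank: "par_bundle_rank B DI (sheets z0 * r)"
  unfolding par_bundle_rank_def
proof (intro conjI allI ballI)
  show "finite (ppts DI)" by (rule finite_ppts_DI)
  show "\<exists>n F \<alpha>. flag_weights B DI z n F \<alpha>" if "z \<in> ppts DI" for z by (rule flags_DI[OF that])
  fix z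
  have "\<forall>x. \<exists>U e. x \<in> U \<and> local_frame A E r U e" using E.rank unfolding par_bundle_rank_def by blast
  then obtain U e where U: "\<And>x. x \<in> U x" "\<And>x. local_frame A E r (U x) (e x)" by metis
  have O: "open (U x) \<and> x \<in> U x" for x using U(1) E.frameD(1)[OF U(2)] by blast
  have "open (- (ppts DI - {z}))" using finite_ppts_DI by (intro open_Compl finite_imp_closed) simp
  then obtain V W \<rho> \<omega> \<theta> where M: "model z V W \<rho> \<omega> \<theta>" "\<And>x. \<Phi> x = z \<Longrightarrow> W x \<subseteq> U x" "V \<subseteq> - (ppts DI - {z})"
    using obtain_model[of z U "- (ppts DI - {z})"] O by blast
  interpret model_frame A B \<Phi> E r z V W \<rho> \<omega> \<theta> U e
    by unfold_locales (use M U in auto)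
  show "\<exists>V f. z \<in> V \<and> local_frame B DI (sheets z0 * r) V f"
    using local_frame_DI modelD(2)[OF M(1)] sheets_constant[of z z0] by auto
qed

end

section \<open>The trace of a section of the pullback\<close>

lemma linear_toD:
  assumes "linear_to V W h"
  shows "\<And>v. v \<in> V \<Longrightarrow> h v \<in> W"
    "\<And>u v a b. u \<in> V \<Longrightarrow> v \<in> V \<Longrightarrow> h (\<lambda>i. a * u i + b * v i) = (\<lambda>j. a * h u j + b * h v j)"
  using assms unfolding linear_to_def by blast+

lemma linear_to_scale:
  assumes "linear_to V W h" "v \<in> V"
  shows "h (\<lambda>i. a * v i) = (\<lambda>j. a * h v j)" "h (\<lambda>_. 0) = (\<lambda>_. 0)"
  using linear_toD(2)[OF assms(1,2,2), of a 0] linear_toD(2)[OF assms(1,2,2), of 0 0] by simp_all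

lemma linear_to_sum:
  assumes h: "linear_to V W h" and V: "(\<lambda>_. 0) \<in> V" "\<And>u v a b. u \<in> V \<Longrightarrow> v \<in> V \<Longrightarrow> (\<lambda>i. a * u i + b * v i) \<in> V"
    and v: "\<And>k. k < (n::nat) \<Longrightarrow> v k \<in> V"
  shows "h (\<lambda>i. \<Sum>k<n. c k * v k i) = (\<lambda>j. \<Sum>k<n. c k * h (v k) j)" "(\<lambda>i. \<Sum>k<n. c k * v k i) \<in> V"
proof -
  have "h (\<lambda>i. \<Sum>k<n. c k * v k i) = (\<lambda>j. \<Sum>k<n. c k * h (v k) j) \<and> (\<lambda>i. \<Sum>k<n. c k * v k i) \<in> V"
    using v
  proof (induction n)
    case 0
    then show ?case using V(1) linear_to_scale(2)[OF h V(1)] by simp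
  next
    case (Suc n)
    then have IH: "h (\<lambda>i. \<Sum>k<n. c k * v k i) = (\<lambda>j. \<Sum>k<n. c k * h (v k) j)" "(\<lambda>i. \<Sum>k<n. c k * v k i) \<in> V"
      and vn: "v n \<in> V" by auto
    show ?case using linear_toD(2)[OF h IH(2) vn, of 1 "c n"] V(2)[OF IH(2) vn, of 1 "c n"] IH(1) by simp
  qed
  then show "h (\<lambda>i. \<Sum>k<n. c k * v k i) = (\<lambda>j. \<Sum>k<n. c k * h (v k) j)" "(\<lambda>i. \<Sum>k<n. c k * v k i) \<in> V"
    by auto
qed

lemma par_homD:
  assumes "par_hom A E E' h"
  shows "\<And>x. x \<notin> ppts E \<Longrightarrow> x \<notin> ppts E' \<Longrightarrow> linear_to (fibre E x) (fibre E' x) (h x)"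
    "\<And>x s. x \<notin> ppts E \<Longrightarrow> x \<notin> ppts E' \<Longrightarrow> s \<in> stalk E x \<Longrightarrow> (\<lambda>y. h y (s y)) \<in> stalk E' x"
    "\<And>x s t. s \<in> germs A E x t \<Longrightarrow> (\<lambda>y. h y (s y)) \<in> germs A E' x t"
  using assms unfolding par_hom_def by blast+

text \<open>Meaningful for multiples of a nonzero \<open>w\<close>. It makes the coefficient of a
  section relative to a frame one function, instead of a separate choice near each preimage.\<close>

definition coef :: "('j \<Rightarrow> complex) \<Rightarrow> ('j \<Rightarrow> complex) \<Rightarrow> complex" where
  "coef v w = (SOME c. v = (\<lambda>j. c * w j))"

lemma coef_mult:
  assumes "w \<noteq> (\<lambda>_. 0)"
  shows "coef (\<lambda>j. c * w j) w = c"
  unfolding coef_def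
proof (rule some_equality)
  fix d assume eq: "(\<lambda>j. c * w j) = (\<lambda>j. d * w j)"
  obtain j where "w j \<noteq> 0" using assms by auto
  then show "d = c" using fun_cong[OF eq, of j] by simp
qed simp

lemma (in parabolic_line) fibre_coef:
  assumes "local_frame A L 1 U e" "x \<in> U" "x \<notin> ppts L" "v \<in> fibre L x"
  shows "v = (\<lambda>j. coef v (e 0 x) * e 0 x j)"
proof -
  obtain c where "v = (\<lambda>j. c * e 0 x j)" using frame_line_nonzero(2)[OF assms(1-3)] assms(4) by auto
  then show ?thesis using coef_mult[OF frame_line_nonzero(1)[OF assms(1-3)], of c] by simp
qed

lemma (in parabolic_line) line_stalk:
  assumes "local_frame A L 1 U e" "x \<in> U" "x \<notin> ppts L"
  shows "s \<in> stalk L x \<longleftrightarrow> (\<exists>f. hol_at A x f \<and> (\<forall>\<^sub>F y in nhds x. s y = (\<lambda>i. f y * e 0 y i)))"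
  unfolding frameD(3)[OF assms] lincomb_def by (auto intro: exI[of _ "\<lambda>_. _"])

lemma (in parabolic_line) eventually_nhds_frame_nonzero:
  assumes U: "local_frame A L 1 U e" "x \<in> U" "x \<notin> ppts L"
  shows "\<forall>\<^sub>F y in nhds x. e 0 y \<noteq> (\<lambda>_. 0)"
  using eventually_frame_nonzero[OF U(1,2)] frame_line_nonzero(1)[OF U] by (simp add: eventually_nhds_conv_at)

section \<open>Sections of the pullback line bundle\<close>

locale cover_line = cover A B \<Phi> + L': parabolic_line B L'
  for A :: "'x::t2_space atlas" and B :: "'z::t2_space atlas" and \<Phi> :: "'x \<Rightarrow> 'z"
    and L' :: "('z, 'j) par_bundle"
begin

abbreviation PB :: "('x, 'j) par_bundle" where
  "PB \<equiv> par_pullback A B \<Phi> L'"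

lemma ppts_PB: "ppts PB = \<Phi> -` ppts L'" and fibre_PB: "fibre PB x = fibre L' (\<Phi> x)"
  by (auto simp: par_pullback_def)

lemma stalk_PB: "s \<in> stalk PB x \<longleftrightarrow> (\<exists>n f u. (\<forall>q<n. hol_at A x (f q) \<and> u q \<in> stalk L' (\<Phi> x)) \<and>
    (\<forall>\<^sub>F y in nhds x. s y = lincomb n (\<lambda>q. f q y) (\<lambda>q. u q (\<Phi> y))))"
  by (simp add: par_pullback_def)

lemma stalk_PBI: "l \<in> stalk L' (\<Phi> x) \<Longrightarrow> hol_at A x h \<Longrightarrow> (\<lambda>y j. h y * l (\<Phi> y) j) \<in> stalk PB x"
  unfolding stalk_PB
  by (intro exI[of _ 1] exI[of _ "\<lambda>_. h"] exI[of _ "\<lambda>_. l"]) (simp add: lincomb_def)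

text \<open>At an ordinary point of \<open>L'\<close>, the coordinate downstairs is a unit times
  \<open>coord A x ^ m\<close>. The surplus of \<open>m * \<lceil>b\<rceil>\<close> over
  \<open>\<lceil>m * b\<rceil>\<close> is a power of \<open>coord A x\<close> and goes into the
  coefficient.\<close>

lemma germs_PBI:
  assumes l: "l \<in> germs B L' (\<Phi> x) b"
  shows "(\<lambda>y. l (\<Phi> y)) \<in> germs A PB x (real (mult A B \<Phi> x) * b)"
proof (cases "\<Phi> x \<in> ppts L'")
  case True
  have "(\<lambda>y. l (\<Phi> y)) \<in> lattice PB x (real (mult A B \<Phi> x) * b)"
    unfolding par_pullback_def using l
    by (auto simp: lincomb_def intro!: exI[of _ "1::nat"] exI[of _ "\<lambda>_ _. 1"] exI[of _ "\<lambda>_. l"] exI[of _ "\<lambda>_. 0"] exI[of _ "\<lambda>_. b"])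
  then show ?thesis using True by (simp add: germs_def ppts_PB)
next
  case False
  let ?m = "mult A B \<Phi> x"
  have "l \<in> zmul B (\<Phi> x) \<lceil>b\<rceil> (stalk L' (\<Phi> x))" using l False by (simp add: germs_def)
  then obtain l' where l': "l' \<in> stalk L' (\<Phi> x)" "\<forall>\<^sub>F z in at (\<Phi> x). l z = (\<lambda>j. coord B (\<Phi> x) z powi \<lceil>b\<rceil> * l' z j)"
    by (rule zmulE)
  obtain u where u: "hol_at A x u" "u x \<noteq> 0" "\<forall>\<^sub>F y in nhds x. coord B (\<Phi> x) (\<Phi> y) = coord A x y ^ ?m * u y"
    by (rule coord_Phi_unit)
  have u3: "\<forall>\<^sub>F y in at x. coord B (\<Phi> x) (\<Phi> y) = coord A x y ^ ?m * u y"
    using u(3) by (simp add: eventually_nhds_conv_at)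
  define q where "q = nat (int ?m * \<lceil>b\<rceil> - \<lceil>real ?m * b\<rceil>)"
  have "\<lceil>real ?m * b\<rceil> \<le> int ?m * \<lceil>b\<rceil>" by (simp add: ceiling_le_iff mult_left_mono)
  then have q: "int ?m * \<lceil>b\<rceil> = \<lceil>real ?m * b\<rceil> + int q" by (simp add: q_def)
  have "hol_at A x (\<lambda>y. coord A x y ^ q * u y powi \<lceil>b\<rceil>)"
    by (rule X.hol_at_mult[OF X.hol_at_power[OF X.hol_at_coord] X.hol_at_powi[OF u(1,2)]])
  from stalk_PBI[OF l'(1) this]
  have "(\<lambda>y j. coord A x y ^ q * u y powi \<lceil>b\<rceil> * l' (\<Phi> y) j) \<in> stalk PB x" .
  moreover have "\<forall>\<^sub>F y in at x. l (\<Phi> y) =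
      (\<lambda>j. coord A x y powi \<lceil>real ?m * b\<rceil> * (coord A x y ^ q * u y powi \<lceil>b\<rceil> * l' (\<Phi> y) j))"
    using eventually_at_Phi[OF l'(2)] u3 X.coord_nonzero[of x]
  proof eventually_elim
    case (elim y)
    have "coord B (\<Phi> x) (\<Phi> y) powi \<lceil>b\<rceil> = coord A x y powi (int ?m * \<lceil>b\<rceil>) * u y powi \<lceil>b\<rceil>"
      unfolding elim(2) by (simp add: power_int_mult_distrib power_int_mult)
    also have "coord A x y powi (int ?m * \<lceil>b\<rceil>) = coord A x y powi \<lceil>real ?m * b\<rceil> * coord A x y ^ q"
      unfolding q using elim(3) by (simp add: power_int_add)
    finally show ?case unfolding elim(1) by (simp add: mult.assoc)
  qed
  ultimately have "(\<lambda>y. l (\<Phi> y)) \<in> zmul A x \<lceil>real ?m * b\<rceil> (stalk PB x)" by (rule zmulI)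
  then show ?thesis using False by (simp add: germs_def ppts_PB)
qed

lemma germs_PB_form:
  assumes s: "s \<in> germs A PB x t"
  obtains n f u k a where "\<And>q. q < (n::nat) \<Longrightarrow> hol_at A x (f q)"
    "\<And>q. q < n \<Longrightarrow> u q \<in> germs B L' (\<Phi> x) (a q)"
    "\<And>q. q < n \<Longrightarrow> real (mult A B \<Phi> x) * a q + real_of_int (k q) \<ge> t"
    "\<forall>\<^sub>F y in at x. s y = lincomb n (\<lambda>q. f q y * coord A x y powi k q) (\<lambda>q. u q (\<Phi> y))"
proof (cases "\<Phi> x \<in> ppts L'")
  case True
  then have "s \<in> lattice PB x t" using s by (simp add: germs_def ppts_PB)
  then obtain n f u k a where
    "\<forall>q<n. hol_at A x (f q) \<and> u q \<in> germs B L' (\<Phi> x) (a q) \<and>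
       real (mult A B \<Phi> x) * a q + real_of_int (k q) \<ge> t"
    "\<forall>\<^sub>F y in at x. s y = lincomb n (\<lambda>q. f q y * coord A x y powi k q) (\<lambda>q. u q (\<Phi> y))"
    unfolding par_pullback_def by auto
  then show thesis using that[of n f u a k] by blast
next
  case False
  then have "s \<in> zmul A x \<lceil>t\<rceil> (stalk PB x)" using s by (simp add: germs_def ppts_PB)
  then obtain s' where s': "s' \<in> stalk PB x" "\<forall>\<^sub>F y in at x. s y = (\<lambda>j. coord A x y powi \<lceil>t\<rceil> * s' y j)" by (rule zmulE)
  obtain n f u where fu: "\<forall>q<n. hol_at A x (f q) \<and> u q \<in> stalk L' (\<Phi> x)"
    "\<forall>\<^sub>F y in nhds x. s' y = lincomb n (\<lambda>q. f q y) (\<lambda>q. u q (\<Phi> y))"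
    using s'(1) unfolding stalk_PB by blast
  show thesis
  proof (rule that[of n f u "\<lambda>_. 0" "\<lambda>_. \<lceil>t\<rceil>"])
    show "u q \<in> germs B L' (\<Phi> x) 0" if "q < n" for q using L'.stalk_germs[OF False] fu(1) that by blast
    have "\<forall>\<^sub>F y in at x. s' y = lincomb n (\<lambda>q. f q y) (\<lambda>q. u q (\<Phi> y))"
      using fu(2) by (simp add: eventually_nhds_conv_at)
    with s'(2) show "\<forall>\<^sub>F y in at x. s y = lincomb n (\<lambda>q. f q y * coord A x y powi \<lceil>t\<rceil>) (\<lambda>q. u q (\<Phi> y))"
      by eventually_elim (simp add: lincomb_def sum_distrib_left mult_ac)
  qed (use fu(1) in auto)
qed

text \<open>A generator with indices \<open>a\<close> and \<open>k\<close> has a coefficient of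
  order at least \<open>k + m * (a - \<alpha>) \<ge> t - m * \<alpha>\<close>: pulling back
  multiplies the weight by the multiplicity.\<close>

lemma germs_PB_coefficient:
  assumes e: "\<And>s t. s \<in> germs B L' (\<Phi> x) t \<longleftrightarrow> (\<exists>f\<in>zO B (\<Phi> x) \<lceil>t - \<alpha>\<rceil>. \<forall>\<^sub>F z in at (\<Phi> x). s z = (\<lambda>i. f z * e 0 z i))"
    and s: "s \<in> germs A PB x t"
  shows "\<exists>h\<in>zO A x \<lceil>t - real (mult A B \<Phi> x) * \<alpha>\<rceil>. \<forall>\<^sub>F y in at x. s y = (\<lambda>j. h y * e 0 (\<Phi> y) j)"
proof -
  let ?m = "mult A B \<Phi> x"
  obtain n f u k a where fu: "\<And>q. q < (n::nat) \<Longrightarrow> hol_at A x (f q)"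
    "\<And>q. q < n \<Longrightarrow> u q \<in> germs B L' (\<Phi> x) (a q)" "\<And>q. q < n \<Longrightarrow> real ?m * a q + real_of_int (k q) \<ge> t"
    "\<forall>\<^sub>F y in at x. s y = lincomb n (\<lambda>q. f q y * coord A x y powi k q) (\<lambda>q. u q (\<Phi> y))"
    by (rule germs_PB_form[OF s]) blast
  have "\<forall>q\<in>{..<n}. \<exists>g. g \<in> zO B (\<Phi> x) \<lceil>a q - \<alpha>\<rceil> \<and> (\<forall>\<^sub>F z in at (\<Phi> x). u q z = (\<lambda>i. g z * e 0 z i))"
    using fu(2) unfolding e by blast
  from bchoice[OF this] obtain g where
    g: "\<forall>q\<in>{..<n}. g q \<in> zO B (\<Phi> x) \<lceil>a q - \<alpha>\<rceil> \<and> (\<forall>\<^sub>F z in at (\<Phi> x). u q z = (\<lambda>i. g q z * e 0 z i))" by (rule exE)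
  define h where "h = (\<lambda>y. \<Sum>q<n. f q y * coord A x y powi k q * g q (\<Phi> y))"
  have "h \<in> zO A x \<lceil>t - real ?m * \<alpha>\<rceil>"
    unfolding h_def
  proof (rule X.zO_sum)
    fix q assume "q \<in> {..<n}"
    then have q: "q < n" "g q \<in> zO B (\<Phi> x) \<lceil>a q - \<alpha>\<rceil>" using g by auto
    have "(\<lambda>y. f q y * coord A x y powi k q * g q (\<Phi> y)) \<in> zO A x (k q + int ?m * \<lceil>a q - \<alpha>\<rceil>)"
      by (rule X.zO_mult[OF X.zO_hol_mult[OF fu(1)[OF q(1)] X.coord_powi_zO] zO_Phi[OF q(2)]])
    moreover have "\<lceil>t - real ?m * \<alpha>\<rceil> \<le> k q + int ?m * \<lceil>a q - \<alpha>\<rceil>"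
    proof -
      have "real ?m * (a q - \<alpha>) \<le> real ?m * of_int \<lceil>a q - \<alpha>\<rceil>" by (rule mult_left_mono) auto
      then show ?thesis using fu(3)[OF q(1)] by (simp add: ceiling_le_iff algebra_simps)
    qed
    ultimately show "(\<lambda>y. f q y * coord A x y powi k q * g q (\<Phi> y)) \<in> zO A x \<lceil>t - real ?m * \<alpha>\<rceil>"
      by (rule X.zO_mono)
  qed
  moreover have "\<forall>\<^sub>F y in at x. s y = (\<lambda>j. h y * e 0 (\<Phi> y) j)"
  proof -
    have "\<forall>q\<in>{..<n}. \<forall>\<^sub>F y in at x. u q (\<Phi> y) = (\<lambda>i. g q (\<Phi> y) * e 0 (\<Phi> y) i)"
      using g eventually_at_Phi by blast
    then have "\<forall>\<^sub>F y in at x. \<forall>q\<in>{..<n}. u q (\<Phi> y) = (\<lambda>i. g q (\<Phi> y) * e 0 (\<Phi> y) i)"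
      by (intro eventually_ball_finite) auto
    with fu(4) show ?thesis
      by eventually_elim (simp add: lincomb_def h_def sum_distrib_right mult.assoc)
  qed
  ultimately show ?thesis by blast
qed

text \<open>All preimages of \<open>z\<close> see the same weight \<open>\<alpha>\<close> of
  \<open>L'\<close>. The coefficient of \<open>s\<close> has order at least
  \<open>m * (t - \<alpha>)\<close> at each of them, so its trace has order at least
  \<open>t - \<alpha>\<close>, rounded up.\<close>

lemma trace_germs:
  assumes s: "\<And>x. \<Phi> x = z \<Longrightarrow> s \<in> germs A PB x (real (mult A B \<Phi> x) * t)"
  shows "(\<lambda>z' j. \<Sum>y | \<Phi> y = z'. s y j) \<in> germs B L' z t"
proof -
  obtain U e \<alpha> where U: "local_frame B L' 1 U e" "z \<in> U" "U \<inter> ppts L' \<subseteq> {z}"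
    and e: "\<And>s t. s \<in> germs B L' z t \<longleftrightarrow> (\<exists>f\<in>zO B z \<lceil>t - \<alpha>\<rceil>. \<forall>\<^sub>F z' in at z. s z' = (\<lambda>i. f z' * e 0 z' i))"
    by (rule L'.line_weight[of z]) blast
  define h where "h = (\<lambda>y. coef (s y) (e 0 (\<Phi> y)))"
  have *: "h \<in> zO A x \<lceil>real (mult A B \<Phi> x) * (t - \<alpha>)\<rceil> \<and> (\<forall>\<^sub>F y in at x. s y = (\<lambda>j. h y * e 0 (\<Phi> y) j))"
    if x: "\<Phi> x = z" for x
  proof -
    have "\<exists>h\<in>zO A x \<lceil>real (mult A B \<Phi> x) * t - real (mult A B \<Phi> x) * \<alpha>\<rceil>. \<forall>\<^sub>F y in at x. s y = (\<lambda>j. h y * e 0 (\<Phi> y) j)"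
      by (rule germs_PB_coefficient[OF _ s[OF x]]) (use e x in simp)
    then obtain h' where h': "h' \<in> zO A x \<lceil>real (mult A B \<Phi> x) * (t - \<alpha>)\<rceil>"
      "\<forall>\<^sub>F y in at x. s y = (\<lambda>j. h' y * e 0 (\<Phi> y) j)"
      by (auto simp: right_diff_distrib)
    have "\<forall>\<^sub>F y in at x. e 0 (\<Phi> y) \<noteq> (\<lambda>_. 0)"
      by (rule eventually_at_Phi) (use L'.eventually_frame_nonzero[OF U(1,2)] x in simp)
    then have eq: "\<forall>\<^sub>F y in at x. h y = h' y" using h'(2)
      by eventually_elim (simp add: h_def coef_mult)
    have "\<forall>\<^sub>F y in at x. s y = (\<lambda>j. h y * e 0 (\<Phi> y) j)" using eq h'(2) by eventually_elim simp
    then show ?thesis using X.zO_cong[OF h'(1) eq] by blast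
  qed
  have "trace h \<in> zO B z \<lceil>t - \<alpha>\<rceil>" by (rule zO_trace) (use * in blast)
  moreover have "\<forall>\<^sub>F z' in at z. \<forall>y. \<Phi> y = z' \<longrightarrow> s y = (\<lambda>j. h y * e 0 (\<Phi> y) j)"
    by (rule eventually_at_fibre) (use * in blast)
  then have "\<forall>\<^sub>F z' in at z. (\<lambda>j. \<Sum>y | \<Phi> y = z'. s y j) = (\<lambda>j. trace h z' * e 0 z' j)"
  proof eventually_elim
    case (elim z')
    have "(\<Sum>y | \<Phi> y = z'. s y j) = (\<Sum>y | \<Phi> y = z'. h y * e 0 z' j)" for j
    proof (rule sum.cong)
      fix y assume "y \<in> {y. \<Phi> y = z'}"
      then have "s y = (\<lambda>j. h y * e 0 z' j)" using elim by auto
      then show "s y j = h y * e 0 z' j" by (rule fun_cong)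
    qed simp
    then show ?case by (simp add: trace_def sum_distrib_right)
  qed
  ultimately show ?thesis unfolding e by blast
qed

text \<open>Germs disregard the value at the point itself, so holomorphic sections at ordinary
  points need an argument of their own: without ramification the trace of the coefficient is
  holomorphic.\<close>

lemma trace_stalk:
  assumes z: "z \<notin> ppts L'" and m: "\<And>x. \<Phi> x = z \<Longrightarrow> mult A B \<Phi> x = 1"
    and s: "\<And>x. \<Phi> x = z \<Longrightarrow> s \<in> stalk PB x"
  shows "(\<lambda>z' j. \<Sum>y | \<Phi> y = z'. s y j) \<in> stalk L' z"
proof -
  obtain U e where U: "z \<in> U" "local_frame B L' 1 U e" by (rule L'.frame[of UNIV z]) auto
  note ls = L'.line_stalk[OF U(2,1) z]
  define h where "h = (\<lambda>y. coef (s y) (e 0 (\<Phi> y)))"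
  have *: "hol_at A x h \<and> (\<forall>\<^sub>F y in nhds x. s y = (\<lambda>j. h y * e 0 (\<Phi> y) j))" if x: "\<Phi> x = z" for x
  proof -
    obtain n f u where fu: "\<forall>q<n. hol_at A x (f q) \<and> u q \<in> stalk L' z"
      "\<forall>\<^sub>F y in nhds x. s y = lincomb n (\<lambda>q. f q y) (\<lambda>q. u q (\<Phi> y))"
      using s[OF x] x unfolding stalk_PB by blast
    have "\<forall>q\<in>{..<n}. \<exists>g. hol_at B z g \<and> (\<forall>\<^sub>F z' in nhds z. u q z' = (\<lambda>i. g z' * e 0 z' i))"
      using fu(1) unfolding ls by blast
    from bchoice[OF this] obtain g where
      g: "\<forall>q\<in>{..<n}. hol_at B z (g q) \<and> (\<forall>\<^sub>F z' in nhds z. u q z' = (\<lambda>i. g q z' * e 0 z' i))" by (rule exE)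
    define h' where "h' = (\<lambda>y. \<Sum>q<n. f q y * g q (\<Phi> y))"
    have hol: "hol_at A x h'" unfolding h'_def
      by (rule X.hol_at_sum, rule X.hol_at_mult) (use fu(1) g x hol_at_Phi in auto)
    have "\<forall>q\<in>{..<n}. \<forall>\<^sub>F y in nhds x. u q (\<Phi> y) = (\<lambda>i. g q (\<Phi> y) * e 0 (\<Phi> y) i)"
      using g eventually_nhds_Phi x by blast
    then have "\<forall>\<^sub>F y in nhds x. \<forall>q\<in>{..<n}. u q (\<Phi> y) = (\<lambda>i. g q (\<Phi> y) * e 0 (\<Phi> y) i)"
      by (intro eventually_ball_finite) auto
    with fu(2) have h': "\<forall>\<^sub>F y in nhds x. s y = (\<lambda>j. h' y * e 0 (\<Phi> y) j)"
      by eventually_elim (simp add: lincomb_def h'_def sum_distrib_right mult.assoc)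
    have "\<forall>\<^sub>F y in nhds x. e 0 (\<Phi> y) \<noteq> (\<lambda>_. 0)"
      by (rule eventually_nhds_Phi) (use L'.eventually_nhds_frame_nonzero[OF U(2,1) z] x in simp)
    then have eq: "\<forall>\<^sub>F y in nhds x. h y = h' y" using h'
      by eventually_elim (simp add: h_def coef_mult)
    have "\<forall>\<^sub>F y in nhds x. s y = (\<lambda>j. h y * e 0 (\<Phi> y) j)" using eq h' by eventually_elim simp
    then show ?thesis using X.hol_at_cong[OF eq] hol by blast
  qed
  have "hol_at B z (trace h)" by (rule hol_at_trace[OF m]) (use * in auto)
  moreover have "\<forall>\<^sub>F z' in nhds z. \<forall>y. \<Phi> y = z' \<longrightarrow> s y = (\<lambda>j. h y * e 0 (\<Phi> y) j)"
    by (rule eventually_nhds_fibre) (use * in blast)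
  then have "\<forall>\<^sub>F z' in nhds z. (\<lambda>j. \<Sum>y | \<Phi> y = z'. s y j) = (\<lambda>j. trace h z' * e 0 z' j)"
  proof eventually_elim
    case (elim z')
    have "(\<Sum>y | \<Phi> y = z'. s y j) = (\<Sum>y | \<Phi> y = z'. h y * e 0 z' j)" for j
    proof (rule sum.cong)
      fix y assume "y \<in> {y. \<Phi> y = z'}"
      then have "s y = (\<lambda>j. h y * e 0 z' j)" using elim by auto
      then show "s y j = h y * e 0 z' j" by (rule fun_cong)
    qed simp
    then show ?case by (simp add: trace_def sum_distrib_right)
  qed
  ultimately show ?thesis unfolding ls by blast
qed

end

section \<open>Restriction of functionals on the direct image\<close>

context cover_bundle
begin

definition emb :: "'x \<Rightarrow> ('i \<Rightarrow> complex) \<Rightarrow> 'x \<times> 'i \<Rightarrow> complex" where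
  "emb y v = (\<lambda>(y', i). if y' = y then v i else 0)"

text \<open>Composition with the inclusion of the summand \<open>y\<close>, set to 0 outside the
  fibre as \<open>dual_space\<close> demands.\<close>

definition restr :: "('z \<Rightarrow> ('x \<times> 'i \<Rightarrow> complex) \<Rightarrow> complex) \<Rightarrow> 'x \<Rightarrow> ('i \<Rightarrow> complex) \<Rightarrow> complex" where
  "restr \<xi> = (\<lambda>y v. if v \<in> fibre E y then \<xi> (\<Phi> y) (emb y v) else 0)"

lemma emb_lin: "emb y (\<lambda>i. a * u i + b * v i) = (\<lambda>p. a * emb y u p + b * emb y v p)"
  by (auto simp: emb_def)

lemma emb_slice: "(\<lambda>i. emb y v (y', i)) = (if y' = y then v else (\<lambda>_. 0))"
  by (auto simp: emb_def)

lemma emb_mem: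
  assumes "\<Phi> y \<notin> ppts DI" "v \<in> fibre E y"
  shows "emb y v \<in> direct_sum_fibre \<Phi> E (\<Phi> y)"
proof (rule direct_sum_fibreI)
  fix x assume x: "\<Phi> x = \<Phi> y"
  then have "x \<notin> ppts E" using not_ppts_DI(2)[of x] assms(1) by simp
  then show "(\<lambda>i. emb y v (x, i)) \<in> fibre E x" using E.fibre_closed(1) assms(2) by (simp add: emb_slice)
qed (auto simp: emb_def)

lemma restr_dual:
  assumes z: "\<Phi> y \<notin> ppts DI" and xi: "\<xi> (\<Phi> y) \<in> dual_space (direct_sum_fibre \<Phi> E (\<Phi> y))"
  shows "restr \<xi> y \<in> dual_space (fibre E y)"
  unfolding dual_space_def
proof (intro CollectI conjI ballI allI impI)
  have y: "y \<notin> ppts E" using not_ppts_DI(2) z by blast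
  fix u v a b assume uv: "u \<in> fibre E y" "v \<in> fibre E y"
  show "restr \<xi> y (\<lambda>i. a * u i + b * v i) = a * restr \<xi> y u + b * restr \<xi> y v"
    using dual_spaceD(1)[OF xi emb_mem[OF z uv(1)] emb_mem[OF z uv(2)]] uv E.fibre_closed(3)[OF y uv]
    by (simp add: restr_def emb_lin)
qed (simp add: restr_def)

lemma emb_sum:
  assumes fin: "finite S" and z: "z \<notin> ppts DI" and xi: "\<xi> \<in> dual_space (direct_sum_fibre \<Phi> E z)"
    and v: "\<And>y. y \<in> S \<Longrightarrow> \<Phi> y = z \<and> v y \<in> fibre E y"
  shows "\<xi> (\<lambda>q. \<Sum>y\<in>S. c y * emb y (v y) q) = (\<Sum>y\<in>S. c y * \<xi> (emb y (v y)))"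
    "(\<lambda>q. \<Sum>y\<in>S. c y * emb y (v y) q) \<in> direct_sum_fibre \<Phi> E z"
proof -
  have "\<xi> (\<lambda>q. \<Sum>y\<in>S. c y * emb y (v y) q) = (\<Sum>y\<in>S. c y * \<xi> (emb y (v y))) \<and>
    (\<lambda>q. \<Sum>y\<in>S. c y * emb y (v y) q) \<in> direct_sum_fibre \<Phi> E z"
    using fin v
  proof (induction S)
    case empty
    have 0: "(\<lambda>_. 0) \<in> direct_sum_fibre \<Phi> E z"
      by (rule direct_sum_fibreI) (use not_ppts_DI(2) z E.fibre_closed(1) in auto)
    then show ?case using dual_spaceD(1)[OF xi 0 0, of 0 0] by simp
  next
    case (insert y S)
    have y: "emb y (v y) \<in> direct_sum_fibre \<Phi> E z" using emb_mem[of y "v y"] insert.prems z by simp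
    have IH: "\<xi> (\<lambda>q. \<Sum>y\<in>S. c y * emb y (v y) q) = (\<Sum>y\<in>S. c y * \<xi> (emb y (v y)))"
      "(\<lambda>q. \<Sum>y\<in>S. c y * emb y (v y) q) \<in> direct_sum_fibre \<Phi> E z"
      using insert.IH insert.prems by auto
    show ?case
      using dual_spaceD(1)[OF xi y IH(2), of "c y" 1] dsf_lin[OF z y IH(2), of "c y" 1] IH(1) insert.hyps by simp
  qed
  then show "\<xi> (\<lambda>q. \<Sum>y\<in>S. c y * emb y (v y) q) = (\<Sum>y\<in>S. c y * \<xi> (emb y (v y)))"
    "(\<lambda>q. \<Sum>y\<in>S. c y * emb y (v y) q) \<in> direct_sum_fibre \<Phi> E z" by auto
qed

definition ext0 :: "'x set \<Rightarrow> ('x \<Rightarrow> 'i \<Rightarrow> complex) \<Rightarrow> 'z \<Rightarrow> 'x \<times> 'i \<Rightarrow> complex" where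
  "ext0 W s = (\<lambda>z' (y, i). if y \<in> W \<and> \<Phi> y = z' then s y i else 0)"

lemma ext0_emb: "ext0 W s z' = (\<lambda>q. \<Sum>y | y \<in> W \<and> \<Phi> y = z'. 1 * emb y (s y) q)"
proof (rule ext, clarify)
  fix y i
  have fin: "finite {y. y \<in> W \<and> \<Phi> y = z'}" using finite_fibre[of z'] by (rule rev_finite_subset) auto
  have "(\<Sum>y' | y' \<in> W \<and> \<Phi> y' = z'. 1 * emb y' (s y') (y, i)) = (\<Sum>y' | y' \<in> W \<and> \<Phi> y' = z'. if y' = y then s y i else 0)"
    by (intro sum.cong) (auto simp: emb_def)
  also have "\<dots> = ext0 W s z' (y, i)" using fin by (simp add: ext0_def)
  finally show "ext0 W s z' (y, i) = (\<Sum>y' | y' \<in> W \<and> \<Phi> y' = z'. 1 * emb y' (s y') (y, i))" by simp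
qed

lemma ext0_slice:
  assumes M: "model z V W \<rho> \<omega> \<theta>" and x: "\<Phi> x = z" and x': "\<Phi> x' = z"
  shows "\<forall>\<^sub>F y in nhds x'. slice (ext0 (W x) s) y = (if x' = x then s y else (\<lambda>_. 0))"
proof -
  have "\<forall>\<^sub>F y in nhds x'. y \<in> W x'"
    using local_coordD(1,2)[OF modelD(7)[OF M x']] by (intro eventually_nhds_in_open)
  then show ?thesis
    by eventually_elim (use modelD(6)[OF M x x'] in \<open>auto simp: ext0_def fun_eq_iff\<close>)
qed

lemma ext0_mem:
  assumes "z \<notin> ppts DI" "\<And>y. y \<in> W \<Longrightarrow> \<Phi> y = z \<Longrightarrow> s y \<in> fibre E y"
  shows "ext0 W s z \<in> direct_sum_fibre \<Phi> E z"
proof (rule direct_sum_fibreI)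
  fix y assume y: "\<Phi> y = z"
  then have "y \<notin> ppts E" using not_ppts_DI(2)[of y] assms(1) by simp
  then show "(\<lambda>i. ext0 W s z (y, i)) \<in> fibre E y"
    using y assms(2)[of y] E.fibre_closed(1) by (cases "y \<in> W") (auto simp: ext0_def)
qed (simp add: ext0_def)

text \<open>The discs of the other preimages of \<open>z\<close> are disjoint from
  \<open>W x\<close>, so near those preimages the extension is the zero section.\<close>

lemma ext0_stalk:
  assumes M: "model z V W \<rho> \<omega> \<theta>" and x: "\<Phi> x = z" and z: "z \<notin> ppts DI" and s: "s \<in> stalk E x"
  shows "ext0 (W x) s \<in> stalk DI z"
  unfolding stalk_DI
proof (intro conjI allI impI)
  have nx: "x' \<notin> ppts E" if "\<Phi> x' = z" for x' using not_ppts_DI(2)[of x'] z that by simp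
  have "\<forall>\<^sub>F z' in nhds z. \<forall>y. \<Phi> y = z' \<longrightarrow> y \<in> W x \<longrightarrow> s y \<in> fibre E y"
  proof (rule eventually_nhds_fibre)
    fix x' assume x': "\<Phi> x' = z"
    have ev: "\<forall>\<^sub>F y in nhds x'. y \<in> W x'"
      using local_coordD(1,2)[OF modelD(7)[OF M x']] by (intro eventually_nhds_in_open)
    show "\<forall>\<^sub>F y in nhds x'. y \<in> W x \<longrightarrow> s y \<in> fibre E y"
    proof (cases "x' = x")
      case True
      then show ?thesis using E.stalk_fibre[OF nx[OF x] s] by (auto elim: eventually_mono)
    next
      case False
      from ev show ?thesis by eventually_elim (use modelD(6)[OF M x x'] False in blast)
    qed
  qed
  then show "\<forall>\<^sub>F z' in nhds z. ext0 (W x) s z' \<in> direct_sum_fibre \<Phi> E z'"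
    using Z.eventually_not_mem_finite(2)[OF finite_ppts_DI z] by eventually_elim (auto intro!: ext0_mem)
  fix x' assume x': "\<Phi> x' = z"
  have mem: "(if x' = x then s else (\<lambda>_ _. 0)) \<in> stalk E x'" using s E.zero_stalk[OF nx[OF x']] by simp
  have "\<forall>\<^sub>F y in nhds x'. slice (ext0 (W x) s) y = (if x' = x then s else (\<lambda>_ _. 0)) y"
    using ext0_slice[OF M x x', of s] by (simp add: if_distrib[of "\<lambda>f. f _"] cong: if_cong)
  then show "slice (ext0 (W x) s) \<in> stalk E x'" by (rule E.stalk_cong[OF nx[OF x'] mem])
qed

text \<open>At the other preimages the zero section lies in every module, so only \<open>x\<close>
  restricts the index, which is divided by the multiplicity there.\<close>

lemma ext0_germ:
  assumes M: "model z V W \<rho> \<omega> \<theta>" and x: "\<Phi> x = z" and s: "s \<in> germs A E x t"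
  shows "ext0 (W x) s \<in> di_germ z (t / real (mult A B \<Phi> x))"
    "\<forall>\<^sub>F z' in at z. \<forall>y. \<Phi> y = z' \<longrightarrow> y \<in> W x \<longrightarrow> s y \<in> fibre E y"
proof -
  show mem: "\<forall>\<^sub>F z' in at z. \<forall>y. \<Phi> y = z' \<longrightarrow> y \<in> W x \<longrightarrow> s y \<in> fibre E y"
  proof (rule eventually_at_fibre)
    fix x' assume x': "\<Phi> x' = z"
    have ev: "\<forall>\<^sub>F y in at x'. y \<in> W x'"
      using local_coordD(1,2)[OF modelD(7)[OF M x']] unfolding eventually_at_topological by blast
    show "\<forall>\<^sub>F y in at x'. y \<in> W x \<longrightarrow> s y \<in> fibre E y"
    proof (cases "x' = x")
      case True
      then show ?thesis using E.germs_fibre[OF s] by (auto elim: eventually_mono)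
    next
      case False
      from ev show ?thesis by eventually_elim (use modelD(6)[OF M x x'] False in blast)
    qed
  qed
  show "ext0 (W x) s \<in> di_germ z (t / real (mult A B \<Phi> x))"
  proof (rule di_germI)
    show "\<forall>\<^sub>F z' in at z. ext0 (W x) s z' \<in> direct_sum_fibre \<Phi> E z'"
      using mem eventually_fibre_good[of z] by eventually_elim (auto intro!: ext0_mem)
    fix x' assume x': "\<Phi> x' = z"
    let ?t = "real (mult A B \<Phi> x') * (t / real (mult A B \<Phi> x))"
    have "(if x' = x then s else (\<lambda>_ _. 0)) \<in> germs A E x' ?t"
      using s hol_moduleD(1)[OF E.hol_module_germs] mult_pos[of x] by auto
    moreover have "\<forall>\<^sub>F y in at x'. slice (ext0 (W x) s) y = (if x' = x then s else (\<lambda>_ _. 0)) y"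
      using ext0_slice[OF M x x', of s]
      by (simp add: eventually_nhds_conv_at if_distrib[of "\<lambda>f. f _"] cong: if_cong)
    ultimately show "slice (ext0 (W x) s) \<in> germs A E x' ?t"
      by (rule hol_moduleD(4)[OF E.hol_module_germs])
  qed
qed

lemma restr_stalk:
  assumes z: "\<Phi> x \<notin> ppts DI" and xi: "\<xi> \<in> dual_stalk B DI (\<Phi> x)"
  shows "restr \<xi> \<in> dual_stalk A E x"
  unfolding dual_stalk_def
proof (intro CollectI conjI ballI)
  have x: "x \<notin> ppts E" and m: "mult A B \<Phi> x = 1" using not_ppts_DI[of x] z by auto
  have "\<forall>\<^sub>F z' in nhds (\<Phi> x). \<xi> z' \<in> dual_space (direct_sum_fibre \<Phi> E z')"
    using xi unfolding dual_stalk_def fibre_DI by blast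
  then have ev: "\<forall>\<^sub>F y in nhds x. \<Phi> y \<notin> ppts DI \<and> \<xi> (\<Phi> y) \<in> dual_space (direct_sum_fibre \<Phi> E (\<Phi> y))"
    using Z.eventually_not_mem_finite(2)[OF finite_ppts_DI z]
    by (intro eventually_nhds_Phi eventually_conj)
  then show "\<forall>\<^sub>F y in nhds x. restr \<xi> y \<in> dual_space (fibre E y)"
    by eventually_elim (use restr_dual in blast)
  fix s assume s: "s \<in> stalk E x"
  obtain V W \<rho> \<omega> \<theta> where M: "model (\<Phi> x) V W \<rho> \<omega> \<theta>"
    by (rule obtain_model[of "\<Phi> x" "\<lambda>_. UNIV" UNIV]) auto
  have "hol_at B (\<Phi> x) (\<lambda>z'. \<xi> z' (ext0 (W x) s z'))"
    using xi ext0_stalk[OF M refl z s] unfolding dual_stalk_def by blast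
  then have "hol_at A x (\<lambda>y. \<xi> (\<Phi> y) (ext0 (W x) s (\<Phi> y)))" by (rule hol_at_Phi)
  moreover have "\<forall>\<^sub>F y in nhds x. y \<in> W x"
    using local_coordD(1,2)[OF modelD(7)[OF M refl]] by (intro eventually_nhds_in_open)
  then have "\<forall>\<^sub>F y in nhds x. restr \<xi> y (s y) = \<xi> (\<Phi> y) (ext0 (W x) s (\<Phi> y))"
    using E.stalk_fibre[OF x s]
  proof eventually_elim
    case (elim y)
    \<comment> \<open>Multiplicity 1 makes \<open>\<Phi>\<close> injective on \<open>W x\<close>, so
      over \<open>\<Phi> y\<close> the extension by zero has the single summand
      \<open>y\<close>.\<close>
    have "{y'. y' \<in> W x \<and> \<Phi> y' = \<Phi> y} = {y}"
      using local_coordD(11)[OF modelD(7)[OF M refl]] modelD(8)[OF M refl] m elim(1)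
      by (auto simp: inj_on_def) metis
    then have "ext0 (W x) s (\<Phi> y) = emb y (s y)" unfolding ext0_emb by simp
    then show ?case using elim(2) by (simp add: restr_def)
  qed
  ultimately show "hol_at A x (\<lambda>y. restr \<xi> y (s y))" by (simp add: X.hol_at_cong)
qed

text \<open>A function on \<open>W x\<close> is recovered from the traces of its products with the powers of
  \<open>\<omega> x\<close>, by which the pole order of a restricted functional is bounded.\<close>

lemma restr_germ:
  assumes xi: "dual_germ B DI (\<Phi> x) a \<xi>"
  shows "dual_germ A E x (real (mult A B \<Phi> x) * a) (restr \<xi>)"
  unfolding dual_germ_def
proof (intro conjI allI ballI)
  let ?m = "mult A B \<Phi> x"
  have ev: "\<forall>\<^sub>F z' in at (\<Phi> x). z' \<notin> ppts DI \<and> \<xi> \<in> dual_stalk B DI z'"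
    using xi eventually_fibre_good[of "\<Phi> x"] unfolding dual_germ_def by (simp add: eventually_conj_iff)
  have "\<forall>\<^sub>F y in at x. \<Phi> y \<notin> ppts DI \<and> \<xi> \<in> dual_stalk B DI (\<Phi> y)" by (rule eventually_at_Phi[OF ev])
  then show "\<forall>\<^sub>F y in at x. restr \<xi> \<in> dual_stalk A E y" by eventually_elim (use restr_stalk in blast)
  have dual: "\<forall>\<^sub>F z' in at (\<Phi> x). z' \<notin> ppts DI \<and> \<xi> z' \<in> dual_space (direct_sum_fibre \<Phi> E z')"
    using ev
  proof eventually_elim
    case (elim z')
    then have "\<forall>\<^sub>F z'' in nhds z'. \<xi> z'' \<in> dual_space (direct_sum_fibre \<Phi> E z'')"
      unfolding dual_stalk_def fibre_DI by blast
    then show ?case using elim eventually_nhds_x_imp_x by blast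
  qed
  fix c s assume s: "s \<in> germs A E x c"
  obtain V W \<rho> \<omega> \<theta> where M: "model (\<Phi> x) V W \<rho> \<omega> \<theta>"
    by (rule obtain_model[of "\<Phi> x" "\<lambda>_. UNIV" UNIV]) auto
  note D = local_coordD[OF modelD(7)[OF M refl]]
  have wz: "(\<lambda>y. \<omega> x y powi n) \<in> zO A x n" for n
    unfolding zO_model[OF M refl] by (intro exI[of _ "\<lambda>_. 1"]) simp
  \<comment> \<open>The test sections \<open>\<omega> x ^ p\<close> times \<open>s\<close>, extended
    by zero; the factor raises the index downstairs to \<open>(c + p) / m\<close>.\<close>
  define S where "S = (\<lambda>p::nat. ext0 (W x) (\<lambda>y i. \<omega> x y powi int p * s y i))"
  define T where "T = (\<lambda>p z'. \<xi> z' (S p z'))"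
  have T: "T p \<in> zO B (\<Phi> x) \<lceil>(c + real p) / real ?m + a\<rceil>" for p
  proof -
    have "(\<lambda>y i. \<omega> x y powi int p * s y i) \<in> germs A E x (c + real p)"
      using E.germs_zO[OF wz[of "int p"] s] by simp
    from ext0_germ(1)[OF M refl this] have "S p \<in> germs B DI (\<Phi> x) ((c + real p) / real ?m)"
      by (simp add: germs_DI S_def)
    then show ?thesis using xi unfolding dual_germ_def T_def by blast
  qed
  define h where "h = (\<lambda>y. restr \<xi> y (s y))"
  \<comment> \<open>The Fourier inversion of the values \<open>T p\<close>, to be identified with
    \<open>h\<close> on \<open>W x\<close>.\<close>
  define h' where "h' = (\<lambda>y. (\<Sum>p<?m. \<omega> x y powi (- int p) * T p (\<Phi> y)) / of_nat ?m)"
  have "\<forall>\<^sub>F z' in at (\<Phi> x). \<forall>y. \<Phi> y = z' \<longrightarrow> y \<in> W x \<longrightarrow> h y = h' y"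
  proof -
    have "\<forall>\<^sub>F z' in at (\<Phi> x). z' \<in> V \<and> z' \<noteq> \<Phi> x"
      using modelD(1,2)[OF M] unfolding eventually_at_topological by blast
    then show ?thesis using dual ext0_germ(2)[OF M refl s]
    proof eventually_elim
      case (elim z')
      have nz: "coord B (\<Phi> x) z' \<noteq> 0" using model_nonzero[OF M] elim(1) by blast
      have fin: "finite {y. y \<in> W x \<and> \<Phi> y = z'}" using finite_fibre[of z'] by (rule rev_finite_subset) auto
      have Sp: "S p z' = (\<lambda>q. \<Sum>y | y \<in> W x \<and> \<Phi> y = z'. \<omega> x y ^ p * emb y (s y) q)" for p
        unfolding S_def ext0_emb by (auto simp: emb_def fun_eq_iff intro!: sum.cong)
      have Tp: "T p z' = (\<Sum>y | y \<in> W x \<and> \<Phi> y = z'. \<omega> x y ^ p * h y)" for p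
      proof -
        have "T p z' = (\<Sum>y | y \<in> W x \<and> \<Phi> y = z'. \<omega> x y ^ p * \<xi> z' (emb y (s y)))"
          unfolding T_def Sp using elim(2,3) fin by (intro emb_sum(1)) auto
        also have "\<dots> = (\<Sum>y | y \<in> W x \<and> \<Phi> y = z'. \<omega> x y ^ p * h y)"
          using elim(3) by (intro sum.cong) (auto simp: h_def restr_def)
        finally show ?thesis .
      qed
      show ?case
      proof (intro allI impI)
        fix y assume y: "\<Phi> y = z'" "y \<in> W x"
        have "(\<Sum>p<?m. \<omega> x y powi (- int p) * T p (\<Phi> y)) =
            (\<Sum>p<?m. \<Sum>y' | y' \<in> W x \<and> \<Phi> y' = z'. inverse (\<omega> x y) ^ p * (\<omega> x y' ^ p * h y'))"
          by (simp add: y(1) Tp sum_distrib_left power_int_minus power_inverse)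
        also have "\<dots> = (\<Sum>y' | y' \<in> W x \<and> \<Phi> y' = z'. (\<Sum>p<?m. inverse (\<omega> x y) ^ p * \<omega> x y' ^ p) * h y')"
          by (subst sum.swap) (simp add: sum_distrib_right mult.assoc)
        also have "\<dots> = (\<Sum>y' | y' \<in> W x \<and> \<Phi> y' = z'. if y' = y then of_nat ?m * h y else 0)"
        proof (intro sum.cong refl)
          fix y' assume y': "y' \<in> {y'. y' \<in> W x \<and> \<Phi> y' = z'}"
          have "\<omega> x y ^ ?m = coord B (\<Phi> x) z'" "\<omega> x y' ^ ?m = coord B (\<Phi> x) z'"
            using modelD(8)[OF M refl, of y'] modelD(8)[OF M refl, of y] y y' by simp_all
          from sum_quotient_roots[OF mult_pos disjI1[OF nz] this]
          have "(\<Sum>p<?m. inverse (\<omega> x y) ^ p * \<omega> x y' ^ p) = (if \<omega> x y' = \<omega> x y then of_nat ?m else 0)" .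
          moreover have "\<omega> x y' = \<omega> x y \<longleftrightarrow> y' = y" using D(11) y y' by (auto simp: inj_on_def)
          ultimately show "(\<Sum>p<?m. inverse (\<omega> x y) ^ p * \<omega> x y' ^ p) * h y' = (if y' = y then of_nat ?m * h y else 0)"
            by simp
        qed
        also have "\<dots> = of_nat ?m * h y" using fin y by simp
        finally show "h y = h' y" using mult_pos[of x] by (simp add: h'_def)
      qed
    qed
  qed
  from eventually_at_Phi[OF this] have "\<forall>\<^sub>F y in at x. y \<in> W x \<longrightarrow> h y = h' y" 
    by (rule eventually_mono) (elim allE, blast)
  moreover have "\<forall>\<^sub>F y in at x. y \<in> W x" using D(1,2) unfolding eventually_at_topological by blast
  ultimately have eq: "\<forall>\<^sub>F y in at x. h y = h' y" by eventually_elim simp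
  have "h' \<in> zO A x \<lceil>c + real ?m * a\<rceil>"
  proof -
    have "(\<lambda>y. \<omega> x y powi (- int p) * T p (\<Phi> y)) \<in> zO A x \<lceil>c + real ?m * a\<rceil>" for p
    proof -
      have "(\<lambda>y. \<omega> x y powi (- int p) * T p (\<Phi> y)) \<in>
          zO A x (- int p + int ?m * \<lceil>(c + real p) / real ?m + a\<rceil>)"
        by (rule X.zO_mult[OF wz zO_Phi[OF T]])
      \<comment> \<open>The \<open>p\<close> gained from the factor in \<open>S p\<close> is given
        back by the power \<open>- p\<close> of \<open>\<omega> x\<close>, and rounding up
        downstairs can only raise the order.\<close>
      moreover have "\<lceil>c + real ?m * a\<rceil> \<le> - int p + int ?m * \<lceil>(c + real p) / real ?m + a\<rceil>"
      proof -
        have "real ?m * ((c + real p) / real ?m + a) \<le> real ?m * of_int \<lceil>(c + real p) / real ?m + a\<rceil>"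
          by (rule mult_left_mono) auto
        moreover have "real ?m * ((c + real p) / real ?m + a) = c + real p + real ?m * a"
          using mult_pos[of x] by (simp add: field_simps)
        ultimately show ?thesis by (simp add: ceiling_le_iff)
      qed
      ultimately show ?thesis by (rule X.zO_mono)
    qed
    then have "(\<lambda>y. \<Sum>p<?m. \<omega> x y powi (- int p) * T p (\<Phi> y)) \<in> zO A x \<lceil>c + real ?m * a\<rceil>"
      by (intro X.zO_sum) blast
    from X.zO_hol_mult[OF X.hol_at_const[of x "1 / of_nat ?m"] this] show ?thesis by (simp add: h'_def)
  qed
  then have "h \<in> zO A x \<lceil>c + real ?m * a\<rceil>" using eq by (rule X.zO_cong)
  then show "(\<lambda>y. restr \<xi> y (s y)) \<in> zO A x \<lceil>c + real ?m * a\<rceil>" by (simp add: h_def)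
qed

end

section \<open>The induced pairing\<close>

text \<open>\<open>\<epsilon>\<close> will be 1 in the orthogonal and -1 in the symplectic case.
  \<open>\<iota>'\<close> and \<open>g\<close> are the inverses of \<open>\<iota>\<close> and
  \<open>hat E \<phi>\<close>; the inverse laws concern fibres at ordinary points, where
  homomorphisms are defined.\<close>

locale pairing = cover_bundle A B \<Phi> E r + cover_line A B \<Phi> L' + L: parabolic_line A L
  for A :: "'x::t2_space atlas" and B :: "'z::t2_space atlas" and \<Phi> :: "'x \<Rightarrow> 'z"
    and E :: "('x, 'i) par_bundle" and r :: nat and L' :: "('z, 'j) par_bundle"
    and L :: "('x, 'l) par_bundle" +
  fixes \<iota> :: "'x \<Rightarrow> ('l \<Rightarrow> complex) \<Rightarrow> 'j \<Rightarrow> complex" and \<iota>' :: "'x \<Rightarrow> ('j \<Rightarrow> complex) \<Rightarrow> 'l \<Rightarrow> complex"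
    and \<phi> :: "'x \<Rightarrow> ('i \<times> 'i \<Rightarrow> complex) \<Rightarrow> 'l \<Rightarrow> complex"
    and g :: "'x \<Rightarrow> (('i \<Rightarrow> complex) \<times> 'l \<Rightarrow> complex) \<Rightarrow> 'i \<Rightarrow> complex"
    and \<epsilon> :: complex
  assumes ppts_L: "ppts L = ppts E"
    and \<iota>: "par_hom A L PB \<iota>" and \<iota>': "par_hom A PB L \<iota>'"
    and \<iota>'\<iota>: "\<And>x v. x \<notin> ppts E \<Longrightarrow> \<Phi> x \<notin> ppts L' \<Longrightarrow> v \<in> fibre L x \<Longrightarrow> \<iota>' x (\<iota> x v) = v"
    and \<iota>\<iota>': "\<And>x w. x \<notin> ppts E \<Longrightarrow> \<Phi> x \<notin> ppts L' \<Longrightarrow> w \<in> fibre L' (\<Phi> x) \<Longrightarrow> \<iota> x (\<iota>' x w) = w"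
    and \<phi>: "par_hom A (par_tensor A E E) L \<phi>"
    and g: "par_hom A (par_tensor A (par_dual A E) L) E g"
    and hat: "par_hom A E (par_tensor A (par_dual A E) L) (hat E \<phi>)"
    and g_hat: "\<And>x v. x \<notin> ppts E \<Longrightarrow> v \<in> fibre E x \<Longrightarrow> g x (hat E \<phi> x v) = v"
    and hat_g: "\<And>x w. x \<notin> ppts E \<Longrightarrow> w \<in> fibre (par_tensor A (par_dual A E) L) x \<Longrightarrow> hat E \<phi> x (g x w) = w"
    and sym: "\<And>x u v. x \<notin> ppts E \<Longrightarrow> u \<in> fibre E x \<Longrightarrow> v \<in> fibre E x \<Longrightarrow>
      \<phi> x (tens u v) = (\<lambda>l. \<epsilon> * \<phi> x (tens v u) l)"

lemma tensor_fibreI: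
  "u \<in> fibre E x \<Longrightarrow> v \<in> fibre E' x \<Longrightarrow> tens u v \<in> fibre (par_tensor A E E') x"
  unfolding par_tensor_def by (auto intro!: exI[of _ "1::nat"] exI[of _ "\<lambda>_. u"] exI[of _ "\<lambda>_. v"])

lemma tensor_fibre:
  "w \<in> fibre (par_tensor A E E') x \<longleftrightarrow>
     (\<exists>n u v. (\<forall>k<n. u k \<in> fibre E x \<and> v k \<in> fibre E' x) \<and> w = (\<lambda>p. \<Sum>k<(n::nat). tens (u k) (v k) p))"
  by (simp add: par_tensor_def)

lemma tensor_stalk:
  "s \<in> stalk (par_tensor A E E') x \<longleftrightarrow> (\<exists>n u v. (\<forall>k<n. u k \<in> stalk E x \<and> v k \<in> stalk E' x) \<and>
     (\<forall>\<^sub>F y in nhds x. s y = (\<lambda>p. \<Sum>k<(n::nat). tens (u k y) (v k y) p)))"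
  by (simp add: par_tensor_def)

lemma tensor_stalkE:
  assumes "s \<in> stalk (par_tensor A E E') x"
  obtains n u v where "\<forall>k<n. u k \<in> stalk E x \<and> v k \<in> stalk E' x"
    "\<forall>\<^sub>F y in nhds x. s y = (\<lambda>p. \<Sum>k<(n::nat). tens (u k y) (v k y) p)"
  using assms unfolding tensor_stalk by (elim exE conjE) (rule that)

lemma tensor_stalkI:
  "u \<in> stalk E x \<Longrightarrow> v \<in> stalk E' x \<Longrightarrow> \<forall>\<^sub>F y in nhds x. s y = tens (u y) (v y) \<Longrightarrow>
     s \<in> stalk (par_tensor A E E') x"
  unfolding tensor_stalk by (intro exI[of _ "1::nat"] exI[of _ "\<lambda>_. u"] exI[of _ "\<lambda>_. v"]) simp

lemma ppts_tensor: "ppts (par_tensor A E E') = ppts E \<union> ppts E'"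
  and ppts_dual: "ppts (par_dual A E) = ppts E"
  and fibre_dual: "fibre (par_dual A E) x = dual_space (fibre E x)"
  and stalk_dual: "stalk (par_dual A E) x = dual_stalk A E x"
  by (simp_all add: par_tensor_def par_dual_def)

lemma tensor_fibreE:
  assumes "w \<in> fibre (par_tensor A E E') x"
  obtains n u v where "\<forall>k<n. u k \<in> fibre E x \<and> v k \<in> fibre E' x"
    "w = (\<lambda>p. \<Sum>k<(n::nat). tens (u k) (v k) p)"
  using assms unfolding tensor_fibre by (elim exE conjE) (rule that)

lemma tensor_dual_fibreE:
  assumes "w \<in> fibre (par_tensor A (par_dual A E) E') x"
  obtains n \<xi> v where "\<forall>k<n. \<xi> k \<in> dual_space (fibre E x) \<and> v k \<in> fibre E' x"
    "w = (\<lambda>p. \<Sum>k<(n::nat). tens (\<xi> k) (v k) p)"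
  using assms unfolding tensor_fibre fibre_dual by (elim exE conjE) (rule that)

lemma tensor_dual_fibreI:
  assumes "\<forall>k<n. \<xi> k \<in> dual_space (fibre E x) \<and> v k \<in> fibre E' x"
    and "w = (\<lambda>p. \<Sum>k<(n::nat). tens (\<xi> k) (v k) p)"
  shows "w \<in> fibre (par_tensor A (par_dual A E) E') x"
  unfolding tensor_fibre using assms
  by (intro exI[of _ n] exI[of _ \<xi>] exI[of _ v]) (simp add: par_dual_def)

lemma tens_lin:
  "tens u (\<lambda>i. a * v i + b * w i) = (\<lambda>p. a * tens u v p + b * tens u w p)"
  "tens (\<lambda>i. a * v i + b * w i) u = (\<lambda>p. a * tens v u p + b * tens w u p)"
  by (auto simp: tens_def algebra_simps)

section \<open>The pairing on the direct image\<close>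

context pairing
begin

text \<open>The diagonal block at \<open>y\<close>. The pairing uses these blocks alone, so
  different summands of a fibre are orthogonal to each other.\<close>

definition slice2 :: "'x \<Rightarrow> (('x \<times> 'i) \<times> ('x \<times> 'i) \<Rightarrow> complex) \<Rightarrow> 'i \<times> 'i \<Rightarrow> complex" where
  "slice2 y w = (\<lambda>(i, i'). w ((y, i), (y, i')))"

definition \<psi> :: "'z \<Rightarrow> (('x \<times> 'i) \<times> ('x \<times> 'i) \<Rightarrow> complex) \<Rightarrow> 'j \<Rightarrow> complex" where
  "\<psi> z w = (\<lambda>j. \<Sum>y | \<Phi> y = z. \<iota> y (\<phi> y (slice2 y w)) j)"

lemma slice2_tens: "slice2 y (tens u v) = tens (\<lambda>i. u (y, i)) (\<lambda>i. v (y, i))"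
  by (auto simp: slice2_def tens_def)

lemma slice2_sum:
  "slice2 y (\<lambda>p. \<Sum>k<(n::nat). tens (u k) (v k) p) = (\<lambda>p. \<Sum>k<n. tens (\<lambda>i. u k (y, i)) (\<lambda>i. v k (y, i)) p)"
  by (auto simp: slice2_def tens_def)

lemma good_point:
  assumes "z \<notin> ppts DI" "z \<notin> ppts L'" "\<Phi> y = z"
  shows "y \<notin> ppts E" "y \<notin> ppts L" "y \<notin> ppts PB" "y \<notin> ppts (par_tensor A E E)"
    "y \<notin> ppts (par_tensor A (par_dual A E) L)"
  using not_ppts_DI(2)[of y] assms ppts_L by (auto simp: ppts_PB ppts_tensor ppts_dual)

lemma linear_\<phi>: "y \<notin> ppts E \<Longrightarrow> linear_to (fibre (par_tensor A E E) y) (fibre L y) (\<phi> y)"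
  using par_homD(1)[OF \<phi>, of y] ppts_L by (simp add: ppts_tensor)

lemma linear_\<iota>: "y \<notin> ppts E \<Longrightarrow> \<Phi> y \<notin> ppts L' \<Longrightarrow> linear_to (fibre L y) (fibre L' (\<Phi> y)) (\<iota> y)"
  using par_homD(1)[OF \<iota>, of y] ppts_L by (simp add: ppts_PB fibre_PB)

lemma linear_\<iota>': "y \<notin> ppts E \<Longrightarrow> \<Phi> y \<notin> ppts L' \<Longrightarrow> linear_to (fibre L' (\<Phi> y)) (fibre L y) (\<iota>' y)"
  using par_homD(1)[OF \<iota>', of y] ppts_L by (simp add: ppts_PB fibre_PB)

lemma linear_g: "y \<notin> ppts E \<Longrightarrow> linear_to (fibre (par_tensor A (par_dual A E) L) y) (fibre E y) (g y)"
  using par_homD(1)[OF g, of y] ppts_L by (simp add: ppts_tensor ppts_dual)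

lemma slice2_mem:
  assumes w: "w \<in> fibre (par_tensor B DI DI) z" and y: "\<Phi> y = z"
  shows "slice2 y w \<in> fibre (par_tensor A E E) y"
proof -
  obtain n u v where uv: "\<forall>k<n. u k \<in> fibre DI z \<and> v k \<in> fibre DI z" "w = (\<lambda>p. \<Sum>k<(n::nat). tens (u k) (v k) p)"
    by (rule tensor_fibreE[OF w])
  show ?thesis unfolding tensor_fibre uv(2) slice2_sum
    using uv(1) y direct_sum_fibreD(1) unfolding fibre_DI
    by (intro exI[of _ n] exI[of _ "\<lambda>k i. u k (y, i)"] exI[of _ "\<lambda>k i. v k (y, i)"]) blast
qed

lemma linear_\<psi>:
  assumes z: "z \<notin> ppts DI" "z \<notin> ppts L'"
  shows "linear_to (fibre (par_tensor B DI DI) z) (fibre L' z) (\<psi> z)"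
  unfolding linear_to_def
proof (intro conjI ballI allI)
  fix w assume w: "w \<in> fibre (par_tensor B DI DI) z"
  have in_L: "\<phi> y (slice2 y w) \<in> fibre L y" if w: "w \<in> fibre (par_tensor B DI DI) z" and y: "\<Phi> y = z" for w y
    by (rule linear_toD(1)[OF linear_\<phi> slice2_mem[OF w y]]) (rule good_point(1)[OF z y])
  have "\<iota> y (\<phi> y (slice2 y w)) \<in> fibre L' z" if y: "\<Phi> y = z" for y
    using linear_toD(1)[OF linear_\<iota>[OF good_point(1)[OF z y]] in_L[OF w y]] z(2) y by simp
  then show "\<psi> z w \<in> fibre L' z" unfolding \<psi>_def by (intro L'.fibre_sum[OF z(2)]) simp
  fix w' a b assume w': "w' \<in> fibre (par_tensor B DI DI) z"
  have "\<iota> y (\<phi> y (slice2 y (\<lambda>p. a * w p + b * w' p))) j =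
      a * \<iota> y (\<phi> y (slice2 y w)) j + b * \<iota> y (\<phi> y (slice2 y w')) j" if y: "\<Phi> y = z" for y j
  proof -
    have "slice2 y (\<lambda>p. a * w p + b * w' p) = (\<lambda>p. a * slice2 y w p + b * slice2 y w' p)"
      by (auto simp: slice2_def)
    then have "\<phi> y (slice2 y (\<lambda>p. a * w p + b * w' p)) = (\<lambda>l. a * \<phi> y (slice2 y w) l + b * \<phi> y (slice2 y w') l)"
      using linear_toD(2)[OF linear_\<phi>[OF good_point(1)[OF z y]] slice2_mem[OF w y] slice2_mem[OF w' y]] by simp
    then show ?thesis
      using linear_toD(2)[OF linear_\<iota>[OF good_point(1)[OF z y]] in_L[OF w y] in_L[OF w' y]] z(2) y by simp
  qed
  then show "\<psi> z (\<lambda>p. a * w p + b * w' p) = (\<lambda>j. a * \<psi> z w j + b * \<psi> z w' j)"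
    by (simp add: \<psi>_def sum.distrib sum_distrib_left)
qed

lemma \<psi>_stalk:
  assumes z: "z \<notin> ppts DI" "z \<notin> ppts L'" and s: "s \<in> stalk (par_tensor B DI DI) z"
  shows "(\<lambda>z'. \<psi> z' (s z')) \<in> stalk L' z"
proof -
  obtain n u v where uv: "\<forall>k<n. u k \<in> stalk DI z \<and> v k \<in> stalk DI z"
    "\<forall>\<^sub>F z' in nhds z. s z' = (\<lambda>p. \<Sum>k<(n::nat). tens (u k z') (v k z') p)"
    by (rule tensor_stalkE[OF s])
  have "(\<lambda>y. \<iota> y (\<phi> y (slice2 y (s (\<Phi> y))))) \<in> stalk PB x" if x: "\<Phi> x = z" for x
  proof -
    have "\<forall>\<^sub>F y in nhds x. s (\<Phi> y) = (\<lambda>p. \<Sum>k<n. tens (u k (\<Phi> y)) (v k (\<Phi> y)) p)"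
      by (rule eventually_nhds_Phi) (use uv(2) x in simp)
    then have "\<forall>\<^sub>F y in nhds x. slice2 y (s (\<Phi> y)) = (\<lambda>p. \<Sum>k<n. tens (slice (u k) y) (slice (v k) y) p)"
      by eventually_elim (simp add: slice2_sum)
    moreover have "\<forall>k<n. slice (u k) \<in> stalk E x \<and> slice (v k) \<in> stalk E x"
      using uv(1) x unfolding stalk_DI by blast
    ultimately have "(\<lambda>y. slice2 y (s (\<Phi> y))) \<in> stalk (par_tensor A E E) x"
      unfolding tensor_stalk
      by (intro exI[of _ n] exI[of _ "\<lambda>k. slice (u k)"] exI[of _ "\<lambda>k. slice (v k)"] conjI)
    from par_homD(2)[OF \<phi> good_point(4,2)[OF z x] this]
    have "(\<lambda>y. \<phi> y (slice2 y (s (\<Phi> y)))) \<in> stalk L x" .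
    from par_homD(2)[OF \<iota> good_point(2,3)[OF z x] this] show ?thesis .
  qed
  from trace_stalk[OF z(2) _ this]
  have "(\<lambda>z' j. \<Sum>y | \<Phi> y = z'. \<iota> y (\<phi> y (slice2 y (s (\<Phi> y)))) j) \<in> stalk L' z"
    using not_ppts_DI(1) z(1) by blast
  moreover have "(\<lambda>z' j. \<Sum>y | \<Phi> y = z'. \<iota> y (\<phi> y (slice2 y (s (\<Phi> y)))) j) = (\<lambda>z'. \<psi> z' (s z'))"
    unfolding \<psi>_def by (intro ext sum.cong) auto
  ultimately show ?thesis by simp
qed

text \<open>Passing to slices multiplies the indices by the multiplicity, \<open>\<phi>\<close> and
  \<open>\<iota>\<close> preserve them, and the trace divides by the multiplicity again.\<close>

lemma \<psi>_germs:
  assumes s: "s \<in> germs B (par_tensor B DI DI) z t"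
  shows "(\<lambda>z'. \<psi> z' (s z')) \<in> germs B L' z t"
proof -
  obtain n u v a b where uv: "\<And>k. k < (n::nat) \<Longrightarrow> a k + b k = t"
    "\<And>k. k < n \<Longrightarrow> u k \<in> germs B DI z (a k)" "\<And>k. k < n \<Longrightarrow> v k \<in> germs B DI z (b k)"
    "\<forall>\<^sub>F z' in at z. s z' = (\<lambda>p. \<Sum>k<n. tens (u k z') (v k z') p)"
    by (rule Z.tensor_germsD[OF s]) blast
  have "(\<lambda>y. \<iota> y (\<phi> y (slice2 y (s (\<Phi> y))))) \<in> germs A PB x (real (mult A B \<Phi> x) * t)" if x: "\<Phi> x = z" for x
  proof -
    let ?m = "real (mult A B \<Phi> x)"
    have "\<forall>\<^sub>F y in at x. s (\<Phi> y) = (\<lambda>p. \<Sum>k<n. tens (u k (\<Phi> y)) (v k (\<Phi> y)) p)"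
      by (rule eventually_at_Phi) (use uv(4) x in simp)
    then have ev: "\<forall>\<^sub>F y in at x. slice2 y (s (\<Phi> y)) = (\<lambda>p. \<Sum>k<n. tens (slice (u k) y) (slice (v k) y) p)"
      by eventually_elim (simp add: slice2_sum)
    have "(\<lambda>y. slice2 y (s (\<Phi> y))) \<in> germs A (par_tensor A E E) x (?m * t)"
    proof (rule X.tensor_germsI[OF _ _ _ _ ev])
      show "?m * a k + ?m * b k = ?m * t" if "k < n" for k
        using uv(1)[OF that] by (simp flip: distrib_left)
      show "slice (u k) \<in> germs A E x (?m * a k)" if "k < n" for k
        using uv(2)[OF that] x unfolding germs_DI di_germ_def by blast
      show "slice (v k) \<in> germs A E x (?m * b k)" if "k < n" for k
        using uv(3)[OF that] x unfolding germs_DI di_germ_def by blast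
    qed (use E.stalk_mult in simp)
    from par_homD(3)[OF \<iota> par_homD(3)[OF \<phi> this]] show ?thesis .
  qed
  from trace_germs[OF this]
  have "(\<lambda>z' j. \<Sum>y | \<Phi> y = z'. \<iota> y (\<phi> y (slice2 y (s (\<Phi> y)))) j) \<in> germs B L' z t" .
  moreover have "(\<lambda>z' j. \<Sum>y | \<Phi> y = z'. \<iota> y (\<phi> y (slice2 y (s (\<Phi> y)))) j) = (\<lambda>z'. \<psi> z' (s z'))"
    unfolding \<psi>_def by (intro ext sum.cong) auto
  ultimately show ?thesis by simp
qed

lemma hom_\<psi>: "par_hom B (par_tensor B DI DI) L' \<psi>"
  unfolding par_hom_def
proof (intro conjI allI impI ballI)
  show "linear_to (fibre (par_tensor B DI DI) z) (fibre L' z) (\<psi> z)"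
    "\<And>s. s \<in> stalk (par_tensor B DI DI) z \<Longrightarrow> (\<lambda>y. \<psi> y (s y)) \<in> stalk L' z"
    if "z \<notin> ppts (par_tensor B DI DI) \<union> ppts L'" for z
    using linear_\<psi> \<psi>_stalk that by (auto simp: ppts_tensor)
qed (rule \<psi>_germs)

lemma sym_\<psi>:
  assumes z: "z \<notin> ppts DI" "z \<notin> ppts L'" and uv: "u \<in> fibre DI z" "v \<in> fibre DI z"
  shows "\<psi> z (tens u v) = (\<lambda>j. \<epsilon> * \<psi> z (tens v u) j)"
proof -
  have "\<iota> y (\<phi> y (slice2 y (tens u v))) j = \<epsilon> * \<iota> y (\<phi> y (slice2 y (tens v u))) j" if y: "\<Phi> y = z" for y j
  proof -
    have f: "(\<lambda>i. u (y, i)) \<in> fibre E y" "(\<lambda>i. v (y, i)) \<in> fibre E y"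
      using uv direct_sum_fibreD(1) y unfolding fibre_DI by blast+
    note gp = good_point(1)[OF z y]
    have "\<phi> y (slice2 y (tens v u)) \<in> fibre L y"
      unfolding slice2_tens by (rule linear_toD(1)[OF linear_\<phi>[OF gp] tensor_fibreI[OF f(2,1)]])
    moreover have "\<phi> y (slice2 y (tens u v)) = (\<lambda>l. \<epsilon> * \<phi> y (slice2 y (tens v u)) l)"
      unfolding slice2_tens by (rule sym[OF gp f])
    ultimately show ?thesis using linear_to_scale(1)[OF linear_\<iota>[OF gp]] z(2) y by simp
  qed
  then show ?thesis by (simp add: \<psi>_def sum_distrib_left)
qed

text \<open>On vectors of the fibre the trace pairing sums, over the preimages,
  \<open>hat E \<phi>\<close> followed by \<open>\<iota>\<close>, which is the sum in
  \<open>\<psi>\<close>; on all other vectors both sides vanish.\<close>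

lemma induced:
  assumes u: "u \<in> fibre DI z"
  shows "induced_hom \<Phi> \<iota> E \<phi> z u = hat DI \<psi> z u"
proof (rule ext, clarify)
  fix v j
  show "induced_hom \<Phi> \<iota> E \<phi> z u (v, j) = hat DI \<psi> z u (v, j)"
  proof (cases "v \<in> direct_sum_fibre \<Phi> E z")
    case True
    have "(\<Sum>x | \<Phi> x = z. projection_formula \<Phi> \<iota> z (direct_image_hom \<Phi> (hat E \<phi>) z u) ((x, \<lambda>i. v (x, i)), j)) =
        \<psi> z (tens u v) j"
      unfolding \<psi>_def
    proof (rule sum.cong)
      fix x assume "x \<in> {x. \<Phi> x = z}"
      then have x: "\<Phi> x = z" by simp
      then have "(\<lambda>i. v (x, i)) \<in> fibre E x" using direct_sum_fibreD(1)[OF True] by blast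
      then show "projection_formula \<Phi> \<iota> z (direct_image_hom \<Phi> (hat E \<phi>) z u) ((x, \<lambda>i. v (x, i)), j) =
          \<iota> x (\<phi> x (slice2 x (tens u v))) j"
        using x by (simp add: projection_formula_def direct_image_hom_def hat_def slice2_tens)
    qed simp
    then show ?thesis using True
      by (simp add: induced_hom_def tensor_id_def trace_pairing_def hat_def fibre_DI)
  next
    case False
    then show ?thesis by (simp add: induced_hom_def tensor_id_def trace_pairing_def hat_def fibre_DI)
  qed
qed

text \<open>The base point \<open>undefined\<close> stands for any point, since the degree is
  constant.\<close>

definition rk :: nat where "rk = sheets undefined * r"

sublocale D: parabolic B DI rk
  by unfold_locales (simp add: rk_def DI_rank)

section \<open>The homomorphism from the direct image to its twisted dual\<close>

definition functional :: "(nat \<Rightarrow> 'z \<Rightarrow> 'j \<Rightarrow> complex) \<Rightarrow> ('z \<Rightarrow> 'x \<times> 'i \<Rightarrow> complex) \<Rightarrow>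
    'z \<Rightarrow> ('x \<times> 'i \<Rightarrow> complex) \<Rightarrow> complex" where
  "functional e u = (\<lambda>z v. if v \<in> fibre DI z then coef (\<psi> z (tens (u z) v)) (e 0 z) else 0)"

text \<open>Since \<open>L'\<close> has rank one, pairing with \<open>u\<close> is a single pure
  tensor: the frame \<open>e 0\<close> of \<open>L'\<close> times the functional that reads off the
  coefficient.\<close>

lemma functional_point:
  assumes U: "local_frame B L' 1 U e" "z \<in> U" and z: "z \<notin> ppts DI" "z \<notin> ppts L'" and u: "u z \<in> fibre DI z"
  shows "functional e u z \<in> dual_space (fibre DI z)"
    "hat DI \<psi> z (u z) = tens (functional e u z) (e 0 z)"
proof -
  note e = L'.frame_line_nonzero(1)[OF U z(2)]
  have mem: "\<psi> z (tens (u z) v) \<in> fibre L' z" if "v \<in> fibre DI z" for v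
    by (rule linear_toD(1)[OF linear_\<psi>[OF z] tensor_fibreI[OF u that]])
  have eq: "\<psi> z (tens (u z) v) = (\<lambda>j. coef (\<psi> z (tens (u z) v)) (e 0 z) * e 0 z j)" if "v \<in> fibre DI z" for v
    by (rule L'.fibre_coef[OF U z(2) mem[OF that]])
  show "functional e u z \<in> dual_space (fibre DI z)"
    unfolding dual_space_def
  proof (intro CollectI conjI ballI allI impI)
    fix v w a b assume vw: "v \<in> fibre DI z" "w \<in> fibre DI z"
    have "\<psi> z (tens (u z) (\<lambda>i. a * v i + b * w i)) = (\<lambda>j. a * \<psi> z (tens (u z) v) j + b * \<psi> z (tens (u z) w) j)"
      unfolding tens_lin by (rule linear_toD(2)[OF linear_\<psi>[OF z] tensor_fibreI[OF u vw(1)] tensor_fibreI[OF u vw(2)]])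
    also have "\<dots> = (\<lambda>j. (a * coef (\<psi> z (tens (u z) v)) (e 0 z) + b * coef (\<psi> z (tens (u z) w)) (e 0 z)) * e 0 z j)"
      using fun_cong[OF eq[OF vw(1)]] fun_cong[OF eq[OF vw(2)]] by (auto simp: fun_eq_iff algebra_simps)
    finally have "coef (\<psi> z (tens (u z) (\<lambda>i. a * v i + b * w i))) (e 0 z) =
        a * coef (\<psi> z (tens (u z) v)) (e 0 z) + b * coef (\<psi> z (tens (u z) w)) (e 0 z)"
      by (simp only: coef_mult[OF e])
    then show "functional e u z (\<lambda>i. a * v i + b * w i) = a * functional e u z v + b * functional e u z w"
      using vw D.fibre_closed(3)[OF z(1) vw] by (simp add: functional_def)
  qed (simp add: functional_def)
  show "hat DI \<psi> z (u z) = tens (functional e u z) (e 0 z)"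
  proof (rule ext, clarify)
    fix v j
    show "hat DI \<psi> z (u z) (v, j) = tens (functional e u z) (e 0 z) (v, j)"
      using fun_cong[OF eq[of v], of j] by (simp add: hat_def tens_def functional_def)
  qed
qed

lemma functional_stalk:
  assumes U: "local_frame B L' 1 U e" "z \<in> U" and z: "z \<notin> ppts DI" "z \<notin> ppts L'" and u: "u \<in> stalk DI z"
  shows "functional e u \<in> dual_stalk B DI z"
    "\<forall>\<^sub>F z' in nhds z. hat DI \<psi> z' (u z') = tens (functional e u z') (e 0 z')"
proof -
  have "\<forall>\<^sub>F z' in nhds z. z' \<in> U" using L'.frameD(1)[OF U(1)] U(2) by (intro eventually_nhds_in_open)
  then have ev: "\<forall>\<^sub>F z' in nhds z. z' \<in> U \<and> z' \<notin> ppts DI \<and> z' \<notin> ppts L' \<and> u z' \<in> fibre DI z'"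
    using D.eventually_nhds_not_ppts[OF z(1)] L'.eventually_nhds_not_ppts[OF z(2)] D.stalk_fibre[OF z(1) u]
    by eventually_elim simp
  then show "\<forall>\<^sub>F z' in nhds z. hat DI \<psi> z' (u z') = tens (functional e u z') (e 0 z')"
    by eventually_elim (use functional_point(2)[OF U(1)] in blast)
  have "\<forall>\<^sub>F z' in nhds z. functional e u z' \<in> dual_space (fibre DI z')"
    using ev by eventually_elim (use functional_point(1)[OF U(1)] in blast)
  moreover have "hol_at B z (\<lambda>z'. functional e u z' (s z'))" if s: "s \<in> stalk DI z" for s
  proof -
    have "(\<lambda>z'. tens (u z') (s z')) \<in> stalk (par_tensor B DI DI) z" by (rule tensor_stalkI[OF u s]) simp
    from \<psi>_stalk[OF z this] obtain f where f: "hol_at B z f"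
      "\<forall>\<^sub>F z' in nhds z. \<psi> z' (tens (u z') (s z')) = (\<lambda>i. f z' * e 0 z' i)"
      unfolding L'.line_stalk[OF U z(2)] by blast
    have "\<forall>\<^sub>F z' in nhds z. functional e u z' (s z') = f z'"
      using f(2) L'.eventually_nhds_frame_nonzero[OF U z(2)] D.stalk_fibre[OF z(1) s]
      by eventually_elim (simp add: functional_def coef_mult)
    then show ?thesis using f(1) by (simp add: Z.hol_at_cong)
  qed
  ultimately show "functional e u \<in> dual_stalk B DI z" unfolding dual_stalk_def by blast
qed

text \<open>The index splits as \<open>(t - \<alpha>) + \<alpha>\<close>: the frame of
  \<open>L'\<close> has index \<open>\<alpha>\<close>, and the functional has index
  \<open>t - \<alpha>\<close> by the estimate for \<open>\<psi>\<close> on pure tensors.\<close>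

lemma hat_\<psi>_germs:
  assumes u: "u \<in> germs B DI z t"
  shows "(\<lambda>z'. hat DI \<psi> z' (u z')) \<in> germs B (par_tensor B (par_dual B DI) L') z t"
proof -
  obtain U e \<alpha> where U: "local_frame B L' 1 U e" "z \<in> U" "U \<inter> ppts L' \<subseteq> {z}"
    and e: "\<And>s t. s \<in> germs B L' z t \<longleftrightarrow> (\<exists>f\<in>zO B z \<lceil>t - \<alpha>\<rceil>. \<forall>\<^sub>F z' in at z. s z' = (\<lambda>i. f z' * e 0 z' i))"
    by (rule L'.line_weight[of z]) blast
  have "\<forall>\<^sub>F z' in nhds z. z' \<in> U" using L'.frameD(1)[OF U(1)] U(2) by (intro eventually_nhds_in_open)
  then have "\<forall>\<^sub>F z' in at z. z' \<in> U" by (simp add: eventually_nhds_conv_at)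
  then have ev: "\<forall>\<^sub>F z' in at z. z' \<in> U \<and> z' \<notin> ppts DI \<and> z' \<notin> ppts L' \<and> u z' \<in> fibre DI z' \<and> u \<in> stalk DI z'"
    using L'.eventually_at_not_ppts[of z] D.germs_fibre[OF u] D.germs_nearby[OF u]
    by eventually_elim simp
  have "dual_germ B DI z (t - \<alpha>) (functional e u)"
    unfolding dual_germ_def
  proof (intro conjI allI ballI)
    show "\<forall>\<^sub>F z' in at z. functional e u \<in> dual_stalk B DI z'"
      using ev by eventually_elim (use functional_stalk(1)[OF U(1)] in blast)
    fix a s assume s: "s \<in> germs B DI z a"
    have "(\<lambda>z'. tens (u z') (s z')) \<in> germs B (par_tensor B DI DI) z (t + a)"
      by (rule Z.tensor_germsI[of z DI DI 1 "\<lambda>_. t" "\<lambda>_. a" _ "\<lambda>_. u" "\<lambda>_. s"])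
        (use D.stalk_mult u s in \<open>auto simp: fun_eq_iff\<close>)
    from \<psi>_germs[OF this] obtain f where f: "f \<in> zO B z \<lceil>t + a - \<alpha>\<rceil>"
      "\<forall>\<^sub>F z' in at z. \<psi> z' (tens (u z') (s z')) = (\<lambda>i. f z' * e 0 z' i)"
      unfolding e by blast
    have "\<forall>\<^sub>F z' in at z. functional e u z' (s z') = f z'"
      using f(2) L'.eventually_frame_nonzero[OF U(1,2)] D.germs_fibre[OF s]
      by eventually_elim (simp add: functional_def coef_mult)
    from Z.zO_cong[OF f(1) this] show "(\<lambda>z'. functional e u z' (s z')) \<in> zO B z \<lceil>a + (t - \<alpha>)\<rceil>"
      by (simp add: algebra_simps)
  qed
  then have xi: "functional e u \<in> germs B (par_dual B DI) z (t - \<alpha>)" by (rule D.dual_germsI)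
  have l: "e 0 \<in> germs B L' z \<alpha>"
    unfolding e by (rule bexI[of _ "\<lambda>_. 1"]) (auto intro: Z.hol_imp_zO_0)
  have "\<forall>\<^sub>F z' in at z. hat DI \<psi> z' (u z') = tens (functional e u z') (e 0 z')"
    using ev by eventually_elim (use functional_point(2)[OF U(1)] in blast)
  then show ?thesis
    by (intro Z.tensor_germsI[of z "par_dual B DI" L' 1 "\<lambda>_. t - \<alpha>" "\<lambda>_. \<alpha>" _ "\<lambda>_. functional e u" "\<lambda>_. e 0"])
      (use Z.dual_stalk_mult xi l in \<open>auto simp: stalk_dual\<close>)
qed

lemma hom_hat_\<psi>: "par_hom B DI (par_tensor B (par_dual B DI) L') (hat DI \<psi>)"
  unfolding par_hom_def
proof (intro conjI allI impI ballI)
  fix z assume "z \<notin> ppts DI \<union> ppts (par_tensor B (par_dual B DI) L')"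
  then have z: "z \<notin> ppts DI" "z \<notin> ppts L'" by (auto simp: ppts_tensor)
  obtain U e where U: "z \<in> U" "local_frame B L' 1 U e" by (rule L'.frame[of UNIV z]) auto
  have e: "e 0 \<in> stalk L' z" by (rule L'.frame_stalk[OF U(2,1) z(2)]) simp
  then have e0: "e 0 z \<in> fibre L' z" using eventually_nhds_x_imp_x[OF L'.stalk_fibre[OF z(2)]] by blast
  show "linear_to (fibre DI z) (fibre (par_tensor B (par_dual B DI) L') z) (hat DI \<psi> z)"
    unfolding linear_to_def
  proof (intro conjI ballI allI)
    fix u assume u: "u \<in> fibre DI z"
    show "hat DI \<psi> z u \<in> fibre (par_tensor B (par_dual B DI) L') z"
      using functional_point[OF U(2,1) z, of "\<lambda>_. u"] u e0 by (auto simp: fibre_dual intro!: tensor_fibreI)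
    fix v a b assume v: "v \<in> fibre DI z"
    show "hat DI \<psi> z (\<lambda>i. a * u i + b * v i) = (\<lambda>p. a * hat DI \<psi> z u p + b * hat DI \<psi> z v p)"
    proof (rule ext, clarify)
      fix w j
      show "hat DI \<psi> z (\<lambda>i. a * u i + b * v i) (w, j) = a * hat DI \<psi> z u (w, j) + b * hat DI \<psi> z v (w, j)"
      proof (cases "w \<in> fibre DI z")
        case True
        have "\<psi> z (tens (\<lambda>i. a * u i + b * v i) w) = (\<lambda>j. a * \<psi> z (tens u w) j + b * \<psi> z (tens v w) j)"
          unfolding tens_lin by (rule linear_toD(2)[OF linear_\<psi>[OF z] tensor_fibreI[OF u True] tensor_fibreI[OF v True]])
        then show ?thesis by (simp add: hat_def)
      qed (simp add: hat_def)
    qed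
  qed
  fix u assume u: "u \<in> stalk DI z"
  show "(\<lambda>y. hat DI \<psi> y (u y)) \<in> stalk (par_tensor B (par_dual B DI) L') z"
    by (rule tensor_stalkI[OF _ e functional_stalk(2)[OF U(2,1) z u]])
      (use functional_stalk(1)[OF U(2,1) z u] in \<open>simp add: stalk_dual\<close>)
qed (rule hat_\<psi>_germs)

section \<open>The inverse homomorphism\<close>

definition pull :: "'x \<Rightarrow> (('x \<times> 'i \<Rightarrow> complex) \<times> 'j \<Rightarrow> complex) \<Rightarrow> ('i \<Rightarrow> complex) \<times> 'l \<Rightarrow> complex" where
  "pull y \<tau> = (\<lambda>(v, l). if v \<in> fibre E y then \<iota>' y (\<lambda>j. \<tau> (emb y v, j)) l else 0)"

definition inv_hat :: "'z \<Rightarrow> (('x \<times> 'i \<Rightarrow> complex) \<times> 'j \<Rightarrow> complex) \<Rightarrow> 'x \<times> 'i \<Rightarrow> complex" where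
  "inv_hat z \<tau> = (\<lambda>(y, i). if \<Phi> y = z then g y (pull y \<tau>) i else 0)"

lemma tensor_slice:
  assumes z: "z \<notin> ppts L'" and \<tau>: "\<tau> = (\<lambda>p. \<Sum>k<(n::nat). tens (\<xi> k) (l k) p)" and l: "\<forall>k<n. l k \<in> fibre L' z"
  shows "(\<lambda>j. \<tau> (v, j)) = (\<lambda>j. \<Sum>k<n. \<xi> k v * l k j)" "(\<lambda>j. \<tau> (v, j)) \<in> fibre L' z"
proof -
  show eq: "(\<lambda>j. \<tau> (v, j)) = (\<lambda>j. \<Sum>k<n. \<xi> k v * l k j)" by (simp add: \<tau> tens_def)
  show "(\<lambda>j. \<tau> (v, j)) \<in> fibre L' z"
    unfolding eq by (rule L'.fibre_sum[OF z]) (use l L'.fibre_closed(2)[OF z] in auto)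
qed

text \<open>\<open>pull\<close> evaluates \<open>\<tau>\<close> directly and so does not depend on a
  decomposition into pure tensors. On a given decomposition it restricts the functionals and applies
  \<open>\<iota>'\<close> to the other factors, which is how its holomorphy and index are
  controlled.\<close>

lemma pull_tensor:
  assumes z: "\<Phi> y \<notin> ppts DI" "\<Phi> y \<notin> ppts L'"
    and \<tau>: "\<tau> = (\<lambda>p. \<Sum>k<(n::nat). tens (\<xi> k (\<Phi> y)) (l k) p)" and l: "\<forall>k<n. l k \<in> fibre L' (\<Phi> y)"
  shows "pull y \<tau> = (\<lambda>p. \<Sum>k<n. tens (restr (\<xi> k) y) (\<iota>' y (l k)) p)"
proof (rule ext, clarify)
  fix v i
  note y = good_point(1)[OF z refl]
  have "\<iota>' y (\<lambda>j. \<Sum>k<n. \<xi> k (\<Phi> y) (emb y v) * l k j) = (\<lambda>i. \<Sum>k<n. \<xi> k (\<Phi> y) (emb y v) * \<iota>' y (l k) i)"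
    by (rule linear_to_sum(1)[OF linear_\<iota>'[OF y z(2)]])
      (use L'.fibre_closed(1,3)[OF z(2)] l in auto)
  then show "pull y \<tau> (v, i) = (\<Sum>k<n. tens (restr (\<xi> k) y) (\<iota>' y (l k)) (v, i))"
    using tensor_slice(1)[OF z(2) \<tau> l, of "emb y v"] by (simp add: pull_def restr_def tens_def)
qed

lemma pull_mem:
  assumes z: "\<Phi> y \<notin> ppts DI" "\<Phi> y \<notin> ppts L'" and \<tau>: "\<tau> \<in> fibre (par_tensor B (par_dual B DI) L') (\<Phi> y)"
  shows "pull y \<tau> \<in> fibre (par_tensor A (par_dual A E) L) y"
proof -
  obtain n \<xi> l where xl: "\<forall>k<n. \<xi> k \<in> dual_space (fibre DI (\<Phi> y)) \<and> l k \<in> fibre L' (\<Phi> y)"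
    "\<tau> = (\<lambda>p. \<Sum>k<(n::nat). tens (\<xi> k) (l k) p)"
    by (rule tensor_dual_fibreE[OF \<tau>])
  have "pull y \<tau> = (\<lambda>p. \<Sum>k<n. tens (restr (\<lambda>_. \<xi> k) y) (\<iota>' y (l k)) p)"
    by (rule pull_tensor[OF z]) (use xl in auto)
  moreover have "restr (\<lambda>_. \<xi> k) y \<in> dual_space (fibre E y) \<and> \<iota>' y (l k) \<in> fibre L y" if "k < n" for k
    using restr_dual[OF z(1), of "\<lambda>_. \<xi> k"] linear_toD(1)[OF linear_\<iota>'[OF good_point(1)[OF z refl] z(2)]] xl(1) that by (simp add: fibre_DI)
  ultimately show ?thesis by (intro tensor_dual_fibreI[of n "\<lambda>k. restr (\<lambda>_. \<xi> k) y" _ _ "\<lambda>k. \<iota>' y (l k)"]) simp_all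
qed

lemma inv_hat_mem:
  assumes z: "z \<notin> ppts DI" "z \<notin> ppts L'" and \<tau>: "\<tau> \<in> fibre (par_tensor B (par_dual B DI) L') z"
  shows "inv_hat z \<tau> \<in> direct_sum_fibre \<Phi> E z"
proof (rule direct_sum_fibreI)
  fix y assume y: "\<Phi> y = z"
  have "g y (pull y \<tau>) \<in> fibre E y"
    by (rule linear_toD(1)[OF linear_g[OF good_point(1)[OF z y]] pull_mem]) (use z y \<tau> in auto)
  then show "(\<lambda>i. inv_hat z \<tau> (y, i)) \<in> fibre E y" using y by (simp add: inv_hat_def)
qed (simp add: inv_hat_def)

lemma inv_hat_slice: "slice (\<lambda>z. inv_hat z (\<tau> z)) y = g y (pull y (\<tau> (\<Phi> y)))"
  by (simp add: inv_hat_def)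

lemma inv_hat_stalk:
  assumes z: "z \<notin> ppts DI" "z \<notin> ppts L'" and \<tau>: "\<tau> \<in> stalk (par_tensor B (par_dual B DI) L') z"
  shows "(\<lambda>z'. inv_hat z' (\<tau> z')) \<in> stalk DI z"
proof -
  obtain n \<xi> l where xl0: "\<forall>k<n. \<xi> k \<in> stalk (par_dual B DI) z \<and> l k \<in> stalk L' z"
    and xl2: "\<forall>\<^sub>F z' in nhds z. \<tau> z' = (\<lambda>p. \<Sum>k<(n::nat). tens (\<xi> k z') (l k z') p)"
    by (rule tensor_stalkE[OF \<tau>])
  have xl1: "\<forall>k<n. \<xi> k \<in> dual_stalk B DI z \<and> l k \<in> stalk L' z" using xl0 by (simp add: stalk_dual)
  note xl = xl1 xl2
  have "\<forall>k\<in>{..<n}. \<forall>\<^sub>F z' in nhds z. \<xi> k z' \<in> dual_space (fibre DI z') \<and> l k z' \<in> fibre L' z'"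
  proof
    fix k assume "k \<in> {..<n}"
    then have k: "\<xi> k \<in> dual_stalk B DI z" "l k \<in> stalk L' z" using xl(1) by auto
    then have "\<forall>\<^sub>F z' in nhds z. \<xi> k z' \<in> dual_space (fibre DI z')" unfolding dual_stalk_def by simp
    then show "\<forall>\<^sub>F z' in nhds z. \<xi> k z' \<in> dual_space (fibre DI z') \<and> l k z' \<in> fibre L' z'"
      using L'.stalk_fibre[OF z(2) k(2)] by (rule eventually_conj)
  qed
  then have "\<forall>\<^sub>F z' in nhds z. \<forall>k\<in>{..<n}. \<xi> k z' \<in> dual_space (fibre DI z') \<and> l k z' \<in> fibre L' z'"
    by (intro eventually_ball_finite finite_lessThan ballI) simp
  then have ev: "\<forall>\<^sub>F z' in nhds z. z' \<notin> ppts DI \<and> z' \<notin> ppts L' \<and>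
      (\<forall>k<n. \<xi> k z' \<in> dual_space (fibre DI z') \<and> l k z' \<in> fibre L' z') \<and>
      \<tau> z' = (\<lambda>p. \<Sum>k<n. tens (\<xi> k z') (l k z') p)"
    using D.eventually_nhds_not_ppts[OF z(1)] L'.eventually_nhds_not_ppts[OF z(2)] xl(2)
    by eventually_elim simp
  have "\<forall>\<^sub>F z' in nhds z. inv_hat z' (\<tau> z') \<in> direct_sum_fibre \<Phi> E z'"
    using ev
  proof eventually_elim
    case (elim z')
    then have "\<tau> z' \<in> fibre (par_tensor B (par_dual B DI) L') z'"
      by (intro tensor_dual_fibreI[of n "\<lambda>k. \<xi> k z'" _ _ "\<lambda>k. l k z'"]) simp_all
    with elim show ?case by (intro inv_hat_mem) simp_all
  qed
  moreover have "slice (\<lambda>z'. inv_hat z' (\<tau> z')) \<in> stalk E x" if x: "\<Phi> x = z" for x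
  proof -
    have "\<forall>\<^sub>F y in nhds x. \<Phi> y \<notin> ppts DI \<and> \<Phi> y \<notin> ppts L' \<and>
      (\<forall>k<n. \<xi> k (\<Phi> y) \<in> dual_space (fibre DI (\<Phi> y)) \<and> l k (\<Phi> y) \<in> fibre L' (\<Phi> y)) \<and>
      \<tau> (\<Phi> y) = (\<lambda>p. \<Sum>k<n. tens (\<xi> k (\<Phi> y)) (l k (\<Phi> y)) p)"
      by (rule eventually_nhds_Phi) (use ev x in simp)
    then have "\<forall>\<^sub>F y in nhds x. pull y (\<tau> (\<Phi> y)) = (\<lambda>p. \<Sum>k<n. tens (restr (\<xi> k) y) (\<iota>' y (l k (\<Phi> y))) p)"
      by eventually_elim (rule pull_tensor[where \<xi>=\<xi> and l="\<lambda>k. l k (\<Phi> _)"], simp_all)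
    moreover have "restr (\<xi> k) \<in> dual_stalk A E x \<and> (\<lambda>y. \<iota>' y (l k (\<Phi> y))) \<in> stalk L x" if k: "k < n" for k
    proof
      show "restr (\<xi> k) \<in> dual_stalk A E x" by (rule restr_stalk) (use xl(1) k z x in auto)
      have "(\<lambda>y. l k (\<Phi> y)) \<in> stalk PB x"
        using stalk_PBI[of "l k" x "\<lambda>_. 1"] xl(1) k x by simp
      then show "(\<lambda>y. \<iota>' y (l k (\<Phi> y))) \<in> stalk L x"
        by (rule par_homD(2)[OF \<iota>' good_point(3,2)[OF z x]])
    qed
    ultimately have "(\<lambda>y. pull y (\<tau> (\<Phi> y))) \<in> stalk (par_tensor A (par_dual A E) L) x"
      unfolding tensor_stalk stalk_dual
      by (intro exI[of _ n] exI[of _ "\<lambda>k. restr (\<xi> k)"] exI[of _ "\<lambda>k y. \<iota>' y (l k (\<Phi> y))"] conjI allI impI)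
        simp_all
    from par_homD(2)[OF g good_point(5,1)[OF z x] this] show ?thesis unfolding inv_hat_slice .
  qed
  ultimately show ?thesis unfolding stalk_DI by blast
qed

text \<open>The restricted functionals have index \<open>?m * a k\<close> and the pulled-back
  sections of \<open>L'\<close> have index \<open>?m * b k\<close>; these add up to
  \<open>?m * t\<close>, which \<open>\<iota>'\<close> and \<open>g\<close> preserve.\<close>

lemma inv_hat_germs:
  assumes \<tau>: "\<tau> \<in> germs B (par_tensor B (par_dual B DI) L') z t"
  shows "(\<lambda>z'. inv_hat z' (\<tau> z')) \<in> germs B DI z t"
proof -
  obtain n \<xi> l a b where xl: "\<And>k. k < (n::nat) \<Longrightarrow> a k + b k = t"
    "\<And>k. k < n \<Longrightarrow> \<xi> k \<in> germs B (par_dual B DI) z (a k)" "\<And>k. k < n \<Longrightarrow> l k \<in> germs B L' z (b k)"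
    "\<forall>\<^sub>F z' in at z. \<tau> z' = (\<lambda>p. \<Sum>k<n. tens (\<xi> k z') (l k z') p)"
    by (rule Z.tensor_germsD[OF \<tau>]) blast
  have dg: "dual_germ B DI z (a k) (\<xi> k)" if "k < n" for k by (rule D.dual_germsD[OF xl(2)[OF that]])
  have "\<forall>\<^sub>F z' in at z. \<xi> k z' \<in> dual_space (fibre DI z') \<and> l k z' \<in> fibre L' z'" if k: "k < n" for k
  proof -
    have "\<forall>\<^sub>F z' in at z. \<xi> k \<in> dual_stalk B DI z'" using dg[OF k] unfolding dual_germ_def by blast
    then show ?thesis using L'.germs_fibre[OF xl(3)[OF k]]
    proof eventually_elim
      case (elim z')
      then have "\<forall>\<^sub>F z'' in nhds z'. \<xi> k z'' \<in> dual_space (fibre DI z'')" unfolding dual_stalk_def by blast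
      then show ?case using elim eventually_nhds_x_imp_x by blast
    qed
  qed
  then have "\<forall>\<^sub>F z' in at z. \<forall>k\<in>{..<n}. \<xi> k z' \<in> dual_space (fibre DI z') \<and> l k z' \<in> fibre L' z'"
    by (intro eventually_ball_finite finite_lessThan ballI) simp
  then have ev: "\<forall>\<^sub>F z' in at z. z' \<notin> ppts DI \<and> z' \<notin> ppts L' \<and>
      (\<forall>k<n. \<xi> k z' \<in> dual_space (fibre DI z') \<and> l k z' \<in> fibre L' z') \<and>
      \<tau> z' = (\<lambda>p. \<Sum>k<n. tens (\<xi> k z') (l k z') p)"
    using D.eventually_at_not_ppts[of z] L'.eventually_at_not_ppts[of z] xl(4)
    by eventually_elim simp
  show ?thesis unfolding germs_DI
  proof (rule di_germI)
    show "\<forall>\<^sub>F z' in at z. inv_hat z' (\<tau> z') \<in> direct_sum_fibre \<Phi> E z'"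
      using ev
    proof eventually_elim
      case (elim z')
      then have "\<tau> z' \<in> fibre (par_tensor B (par_dual B DI) L') z'"
        by (intro tensor_dual_fibreI[of n "\<lambda>k. \<xi> k z'" _ _ "\<lambda>k. l k z'"]) simp_all
      with elim show ?case by (intro inv_hat_mem) simp_all
    qed
    fix x assume x: "\<Phi> x = z"
    let ?m = "real (mult A B \<Phi> x)"
    have "\<forall>\<^sub>F y in at x. \<Phi> y \<notin> ppts DI \<and> \<Phi> y \<notin> ppts L' \<and>
      (\<forall>k<n. \<xi> k (\<Phi> y) \<in> dual_space (fibre DI (\<Phi> y)) \<and> l k (\<Phi> y) \<in> fibre L' (\<Phi> y)) \<and>
      \<tau> (\<Phi> y) = (\<lambda>p. \<Sum>k<n. tens (\<xi> k (\<Phi> y)) (l k (\<Phi> y)) p)"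
      by (rule eventually_at_Phi) (use ev x in simp)
    then have evx: "\<forall>\<^sub>F y in at x. pull y (\<tau> (\<Phi> y)) = (\<lambda>p. \<Sum>k<n. tens (restr (\<xi> k) y) (\<iota>' y (l k (\<Phi> y))) p)"
      by eventually_elim (rule pull_tensor[where \<xi>=\<xi> and l="\<lambda>k. l k (\<Phi> _)"], simp_all)
    have "(\<lambda>y. pull y (\<tau> (\<Phi> y))) \<in> germs A (par_tensor A (par_dual A E) L) x (?m * t)"
    proof (rule X.tensor_germsI[OF _ _ _ _ evx])
      show "?m * a k + ?m * b k = ?m * t" if "k < n" for k
        using xl(1)[OF that] by (simp flip: distrib_left)
      show "restr (\<xi> k) \<in> germs A (par_dual A E) x (?m * a k)" if "k < n" for k
        by (rule E.dual_germsI[OF restr_germ]) (use dg[OF that] x in simp)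
      show "(\<lambda>y. \<iota>' y (l k (\<Phi> y))) \<in> germs A L x (?m * b k)" if "k < n" for k
        by (rule par_homD(3)[OF \<iota>' germs_PBI]) (use xl(3)[OF that] x in simp)
    qed (simp add: stalk_dual X.dual_stalk_mult)
    from par_homD(3)[OF g this] show "slice (\<lambda>z'. inv_hat z' (\<tau> z')) \<in> germs A E x (?m * t)"
      unfolding inv_hat_slice .
  qed
qed

lemma hom_inv_hat: "par_hom B (par_tensor B (par_dual B DI) L') DI inv_hat"
  unfolding par_hom_def
proof (intro conjI allI impI ballI)
  fix z assume "z \<notin> ppts (par_tensor B (par_dual B DI) L') \<union> ppts DI"
  then have z: "z \<notin> ppts DI" "z \<notin> ppts L'" by (auto simp: ppts_tensor)
  let ?T = "fibre (par_tensor B (par_dual B DI) L') z"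
  show "linear_to ?T (fibre DI z) (inv_hat z)"
    unfolding linear_to_def
  proof (intro conjI ballI allI)
    fix \<tau> assume \<tau>: "\<tau> \<in> ?T"
    show "inv_hat z \<tau> \<in> fibre DI z" using inv_hat_mem[OF z \<tau>] by (simp add: fibre_DI)
    fix \<tau>' a b assume \<tau>': "\<tau>' \<in> ?T"
    have "g y (pull y (\<lambda>p. a * \<tau> p + b * \<tau>' p)) i = a * g y (pull y \<tau>) i + b * g y (pull y \<tau>') i" if y: "\<Phi> y = z" for y i
    proof -
      note gp = good_point(1)[OF z y]
      have sl: "(\<lambda>j. \<tau> (v, j)) \<in> fibre L' z" if \<tau>: "\<tau> \<in> ?T" for v \<tau>
      proof -
        obtain n \<xi> l where "\<forall>k<n. \<xi> k \<in> dual_space (fibre DI z) \<and> l k \<in> fibre L' z"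
          "\<tau> = (\<lambda>p. \<Sum>k<(n::nat). tens (\<xi> k) (l k) p)"
          by (rule tensor_dual_fibreE[OF \<tau>])
        then show ?thesis by (intro tensor_slice(2)[OF z(2), of \<tau> \<xi> l n]) simp_all
      qed
      have "\<iota>' y (\<lambda>j. a * \<tau> (v, j) + b * \<tau>' (v, j)) = (\<lambda>l. a * \<iota>' y (\<lambda>j. \<tau> (v, j)) l + b * \<iota>' y (\<lambda>j. \<tau>' (v, j)) l)" for v
        using linear_toD(2)[OF linear_\<iota>'[OF gp]] sl[OF \<tau>] sl[OF \<tau>'] z(2) y by simp
      then have "pull y (\<lambda>p. a * \<tau> p + b * \<tau>' p) = (\<lambda>p. a * pull y \<tau> p + b * pull y \<tau>' p)"
        by (auto simp: pull_def fun_eq_iff)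
      then show ?thesis
        using linear_toD(2)[OF linear_g[OF gp] pull_mem pull_mem] z y \<tau> \<tau>' by simp
    qed
    then show "inv_hat z (\<lambda>p. a * \<tau> p + b * \<tau>' p) = (\<lambda>p. a * inv_hat z \<tau> p + b * inv_hat z \<tau>' p)"
      by (auto simp: inv_hat_def fun_eq_iff)
  qed
  show "(\<lambda>y. inv_hat y (s y)) \<in> stalk DI z" if "s \<in> stalk (par_tensor B (par_dual B DI) L') z" for s
    by (rule inv_hat_stalk[OF z that])
qed (rule inv_hat_germs)

text \<open>Pairing \<open>u\<close> with a vector of a single summand leaves one term of the sum.
  Hence \<open>pull\<close> returns \<open>hat E \<phi>\<close> of the slice of \<open>u\<close>,
  and \<open>g\<close> inverts it.\<close>

lemma inv_hat_hat:
  assumes z: "z \<notin> ppts DI" "z \<notin> ppts L'" and u: "u \<in> fibre DI z"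
  shows "inv_hat z (hat DI \<psi> z u) = u"
proof (rule ext, clarify)
  fix y i
  show "inv_hat z (hat DI \<psi> z u) (y, i) = u (y, i)"
  proof (cases "\<Phi> y = z")
    case True
    note gp = good_point(1)[OF z True]
    have uy: "(\<lambda>i. u (y, i)) \<in> fibre E y" using direct_sum_fibreD(1) u True unfolding fibre_DI by blast
    have "pull y (hat DI \<psi> z u) = hat E \<phi> y (\<lambda>i. u (y, i))"
    proof (rule ext, clarify)
      fix v l
      show "pull y (hat DI \<psi> z u) (v, l) = hat E \<phi> y (\<lambda>i. u (y, i)) (v, l)"
      proof (cases "v \<in> fibre E y")
        case v: True
        have "\<psi> z (tens u (emb y v)) = \<iota> y (\<phi> y (tens (\<lambda>i. u (y, i)) v))"
        proof
          fix j
          have "\<psi> z (tens u (emb y v)) j = (\<Sum>y' | \<Phi> y' = z. if y' = y then \<iota> y (\<phi> y (tens (\<lambda>i. u (y, i)) v)) j else 0)"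
            unfolding \<psi>_def
          proof (rule sum.cong)
            fix y' assume "y' \<in> {y'. \<Phi> y' = z}"
            then have y': "\<Phi> y' = z" by simp
            note gp' = good_point(1)[OF z y']
            have uy': "(\<lambda>i. u (y', i)) \<in> fibre E y'" using direct_sum_fibreD(1) u y' unfolding fibre_DI by blast
            have "\<phi> y' (tens (\<lambda>i. u (y', i)) (\<lambda>_. 0)) = (\<lambda>_. 0)"
              using linear_to_scale(2)[OF linear_\<phi>[OF gp'] tensor_fibreI[OF uy' E.fibre_closed(1)[OF gp']]]
              by (simp add: tens_def case_prod_unfold)
            moreover have "\<iota> y' (\<lambda>_. 0) = (\<lambda>_. 0)"
              using linear_to_scale(2)[OF linear_\<iota>[OF gp'] L.fibre_closed(1)] z(2) y' gp' ppts_L by simp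
            ultimately show "\<iota> y' (\<phi> y' (slice2 y' (tens u (emb y v)))) j =
                (if y' = y then \<iota> y (\<phi> y (tens (\<lambda>i. u (y, i)) v)) j else 0)"
              by (simp add: slice2_tens emb_slice)
          qed simp
          also have "\<dots> = \<iota> y (\<phi> y (tens (\<lambda>i. u (y, i)) v)) j" using finite_fibre[of z] True by simp
          finally show "\<psi> z (tens u (emb y v)) j = \<iota> y (\<phi> y (tens (\<lambda>i. u (y, i)) v)) j" .
        qed
        moreover have "emb y v \<in> fibre DI z" using emb_mem[of y v] z(1) True v by (simp add: fibre_DI)
        moreover have "\<phi> y (tens (\<lambda>i. u (y, i)) v) \<in> fibre L y"
          by (rule linear_toD(1)[OF linear_\<phi>[OF gp] tensor_fibreI[OF uy v]])
        ultimately show ?thesis using v \<iota>'\<iota>[OF gp] z(2) True by (simp add: pull_def hat_def)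
      qed (simp add: pull_def hat_def)
    qed
    then show ?thesis using g_hat[OF gp uy] True by (simp add: inv_hat_def)
  next
    case False
    then show ?thesis using direct_sum_fibreD(2)[of u z y i] u by (simp add: inv_hat_def fibre_DI)
  qed
qed

text \<open>A vector of the fibre is the sum of the inclusions of its slices, so a functional is
  determined by its restrictions to the summands.\<close>

lemma hat_inv_hat:
  assumes z: "z \<notin> ppts DI" "z \<notin> ppts L'" and \<tau>: "\<tau> \<in> fibre (par_tensor B (par_dual B DI) L') z"
  shows "hat DI \<psi> z (inv_hat z \<tau>) = \<tau>"
proof (rule ext, clarify)
  fix v j
  obtain n \<xi> l where xl: "\<forall>k<n. \<xi> k \<in> dual_space (fibre DI z) \<and> l k \<in> fibre L' z"
    "\<tau> = (\<lambda>p. \<Sum>k<(n::nat). tens (\<xi> k) (l k) p)"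
    by (rule tensor_dual_fibreE[OF \<tau>])
  show "hat DI \<psi> z (inv_hat z \<tau>) (v, j) = \<tau> (v, j)"
  proof (cases "v \<in> fibre DI z")
    case False
    have "\<xi> k v = 0" if "k < n" for k
      by (rule dual_spaceD(2)[OF _ False]) (use xl(1) that in simp)
    then have "\<tau> (v, j) = 0" by (simp add: xl(2) tens_def)
    then show ?thesis using False by (simp add: hat_def)
  next
    case True
    have vy: "(\<lambda>i. v (y, i)) \<in> fibre E y" if "\<Phi> y = z" for y
      using direct_sum_fibreD(1) True that unfolding fibre_DI by blast
    have "\<psi> z (tens (inv_hat z \<tau>) v) j = (\<Sum>y | \<Phi> y = z. \<tau> (emb y (\<lambda>i. v (y, i)), j))"
      unfolding \<psi>_def
    proof (rule sum.cong)
      fix y assume "y \<in> {y. \<Phi> y = z}"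
      then have y: "\<Phi> y = z" by simp
      note gp = good_point(1)[OF z y]
      have pm: "pull y \<tau> \<in> fibre (par_tensor A (par_dual A E) L) y" using pull_mem[of y \<tau>] z y \<tau> by simp
      have "slice2 y (tens (inv_hat z \<tau>) v) = tens (g y (pull y \<tau>)) (\<lambda>i. v (y, i))"
        using y by (simp add: slice2_tens inv_hat_def)
      moreover have "\<phi> y (tens (g y (pull y \<tau>)) (\<lambda>i. v (y, i))) = (\<lambda>l. pull y \<tau> (\<lambda>i. v (y, i), l))"
      proof
        fix l
        have "hat E \<phi> y (g y (pull y \<tau>)) (\<lambda>i. v (y, i), l) = pull y \<tau> (\<lambda>i. v (y, i), l)"
          by (simp only: hat_g[OF gp pm])
        then show "\<phi> y (tens (g y (pull y \<tau>)) (\<lambda>i. v (y, i))) l = pull y \<tau> (\<lambda>i. v (y, i), l)"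
          using vy[OF y] by (simp add: hat_def)
      qed
      moreover have "(\<lambda>l. pull y \<tau> (\<lambda>i. v (y, i), l)) = \<iota>' y (\<lambda>j. \<tau> (emb y (\<lambda>i. v (y, i)), j))"
        using vy[OF y] by (simp add: pull_def)
      moreover have "(\<lambda>j. \<tau> (emb y (\<lambda>i. v (y, i)), j)) \<in> fibre L' (\<Phi> y)"
        unfolding y by (rule tensor_slice(2)[OF z(2) xl(2)]) (use xl(1) in simp)
      ultimately show "\<iota> y (\<phi> y (slice2 y (tens (inv_hat z \<tau>) v))) j = \<tau> (emb y (\<lambda>i. v (y, i)), j)"
        using \<iota>\<iota>'[OF gp] z(2) y by simp
    qed simp
    also have "\<dots> = (\<Sum>k<n. (\<Sum>y | \<Phi> y = z. 1 * \<xi> k (emb y (\<lambda>i. v (y, i)))) * l k j)"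
      unfolding xl(2) by (simp add: tens_def sum_distrib_right) (rule sum.swap)
    also have "\<dots> = (\<Sum>k<n. \<xi> k v * l k j)"
    proof (rule sum.cong)
      fix k assume "k \<in> {..<n}"
      then have xi: "\<xi> k \<in> dual_space (direct_sum_fibre \<Phi> E z)" using xl(1) by (simp add: fibre_DI)
      have "(\<lambda>q. \<Sum>y | \<Phi> y = z. 1 * emb y (\<lambda>i. v (y, i)) q) = v"
      proof (rule ext, clarify)
        fix y i
        have "(\<Sum>y' | \<Phi> y' = z. 1 * emb y' (\<lambda>i. v (y', i)) (y, i)) = (\<Sum>y' | \<Phi> y' = z. if y' = y then v (y, i) else 0)"
          by (intro sum.cong) (auto simp: emb_def)
        also have "\<dots> = v (y, i)"
          using finite_fibre[of z] direct_sum_fibreD(2)[of v z y i] True by (simp add: fibre_DI)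
        finally show "(\<Sum>y' | \<Phi> y' = z. 1 * emb y' (\<lambda>i. v (y', i)) (y, i)) = v (y, i)" .
      qed
      moreover have "\<xi> k (\<lambda>q. \<Sum>y | \<Phi> y = z. 1 * emb y (\<lambda>i. v (y, i)) q) = (\<Sum>y | \<Phi> y = z. 1 * \<xi> k (emb y (\<lambda>i. v (y, i))))"
        by (rule emb_sum(1)[where v="\<lambda>y i. v (y, i)" and c="\<lambda>_. 1", OF finite_fibre z(1) xi])
          (use vy in simp)
      ultimately show "(\<Sum>y | \<Phi> y = z. 1 * \<xi> k (emb y (\<lambda>i. v (y, i)))) * l k j = \<xi> k v * l k j" by simp
    qed simp
    also have "\<dots> = \<tau> (v, j)" by (simp add: xl(2) tens_def)
    finally show ?thesis using True by (simp add: hat_def)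
  qed
qed

lemma iso_hat_\<psi>: "par_iso B DI (par_tensor B (par_dual B DI) L') (hat DI \<psi>)"
  unfolding par_iso_def using hom_hat_\<psi> hom_inv_hat inv_hat_hat hat_inv_hat
  by (auto simp: ppts_tensor intro!: exI[of _ inv_hat])

lemma gives_pairing_\<psi>: "gives_pairing L' DI (induced_hom \<Phi> \<iota> E \<phi>) \<psi>"
  unfolding gives_pairing_def using induced by blast

lemma par_vector_bundle_DI: "par_vector_bundle B DI"
  unfolding par_vector_bundle_def using DI_rank by blast

end

section \<open>Symplectic and orthogonal structures on the direct image\<close>

lemma induced_pairing:
  fixes A :: "'x::t2_space atlas" and B :: "'z::t2_space atlas" and \<Phi> :: "'x \<Rightarrow> 'z"
    and L' :: "('z, 'j) par_bundle" and L :: "('x, 'l) par_bundle" and E :: "('x, 'i) par_bundle"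
    and \<iota> :: "'x \<Rightarrow> ('l \<Rightarrow> complex) \<Rightarrow> 'j \<Rightarrow> complex"
    and \<phi> :: "'x \<Rightarrow> ('i \<times> 'i \<Rightarrow> complex) \<Rightarrow> 'l \<Rightarrow> complex"
  assumes X: "compact_riemann_surface A" and Z: "compact_riemann_surface B"
    and Phi: "hol_map A B \<Phi>" "\<not> (\<exists>c. \<forall>x. \<Phi> x = c)"
    and L': "par_line_bundle B L'" and L: "par_line_bundle A L" "ppts L = ppts E"
    and iota: "par_iso A L (par_pullback A B \<Phi> L') \<iota>"
    and E: "par_vector_bundle A E" and phi: "par_hom A (par_tensor A E E) L \<phi>"
    and iso: "par_iso A E (par_tensor A (par_dual A E) L) (hat E \<phi>)"
    and sym: "\<forall>x. x \<notin> ppts E \<longrightarrow>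
      (\<forall>u\<in>fibre E x. \<forall>v\<in>fibre E x. \<phi> x (tens u v) = (\<lambda>l. \<epsilon> * \<phi> x (tens v u) l))"
  shows "\<exists>\<psi>. gives_pairing L' (par_direct_image A B \<Phi> E) (induced_hom \<Phi> \<iota> E \<phi>) \<psi> \<and>
    par_vector_bundle B (par_direct_image A B \<Phi> E) \<and>
    par_hom B (par_tensor B (par_direct_image A B \<Phi> E) (par_direct_image A B \<Phi> E)) L' \<psi> \<and>
    (\<forall>z. z \<notin> ppts (par_direct_image A B \<Phi> E) \<union> ppts L' \<longrightarrow>
       (\<forall>u\<in>fibre (par_direct_image A B \<Phi> E) z. \<forall>v\<in>fibre (par_direct_image A B \<Phi> E) z.
          \<psi> z (tens u v) = (\<lambda>j. \<epsilon> * \<psi> z (tens v u) j))) \<and>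
    par_iso B (par_direct_image A B \<Phi> E) (par_tensor B (par_dual B (par_direct_image A B \<Phi> E)) L')
      (hat (par_direct_image A B \<Phi> E) \<psi>)"
proof -
  obtain r where r: "par_bundle_rank A E r" using E unfolding par_vector_bundle_def by blast
  obtain \<iota>' where i: "par_hom A L (par_pullback A B \<Phi> L') \<iota>" "par_hom A (par_pullback A B \<Phi> L') L \<iota>'"
    "\<And>x. x \<notin> ppts L \<union> ppts (par_pullback A B \<Phi> L') \<Longrightarrow> (\<forall>v\<in>fibre L x. \<iota>' x (\<iota> x v) = v) \<and>
       (\<forall>w\<in>fibre (par_pullback A B \<Phi> L') x. \<iota> x (\<iota>' x w) = w)"
    using iota unfolding par_iso_def by blast
  obtain g where g: "par_hom A E (par_tensor A (par_dual A E) L) (hat E \<phi>)"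
    "par_hom A (par_tensor A (par_dual A E) L) E g"
    "\<And>x. x \<notin> ppts E \<union> ppts (par_tensor A (par_dual A E) L) \<Longrightarrow> (\<forall>v\<in>fibre E x. g x (hat E \<phi> x v) = v) \<and>
       (\<forall>w\<in>fibre (par_tensor A (par_dual A E) L) x. hat E \<phi> x (g x w) = w)"
    using iso unfolding par_iso_def by blast
  interpret pairing A B \<Phi> E r L' L \<iota> \<iota>' \<phi> g \<epsilon>
  proof unfold_locales
    show "riemann_surface A" "riemann_surface B" "compact (UNIV :: 'x set)" "compact (UNIV :: 'z set)"
      using X Z unfolding compact_riemann_surface_def by auto
    show "par_bundle_rank B L' 1" "par_bundle_rank A L 1" using L' L(1) unfolding par_line_bundle_def by auto
    show "\<iota>' x (\<iota> x v) = v" if "x \<notin> ppts E" "\<Phi> x \<notin> ppts L'" "v \<in> fibre L x" for x v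
      using i(3)[of x] that L(2) by (simp add: par_pullback_def)
    show "\<iota> x (\<iota>' x w) = w" if "x \<notin> ppts E" "\<Phi> x \<notin> ppts L'" "w \<in> fibre L' (\<Phi> x)" for x w
      using i(3)[of x] that L(2) by (simp add: par_pullback_def)
    show "g x (hat E \<phi> x v) = v" if "x \<notin> ppts E" "v \<in> fibre E x" for x v
      using g(3)[of x] that L(2) by (simp add: ppts_tensor ppts_dual)
    show "hat E \<phi> x (g x w) = w" if "x \<notin> ppts E" "w \<in> fibre (par_tensor A (par_dual A E) L) x" for x w
      using g(3)[of x] that L(2) by (simp add: ppts_tensor ppts_dual)
  qed (fact Phi r L(2) i(1,2) phi g(1,2) sym[rule_format])+
  show ?thesis
  proof (intro exI[of _ \<psi>] conjI allI impI ballI)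
    fix z u v
    assume "z \<notin> ppts DI \<union> ppts L'" and uv: "u \<in> fibre DI z" "v \<in> fibre DI z"
    then have z: "z \<notin> ppts DI" "z \<notin> ppts L'" by simp_all
    show "\<psi> z (tens u v) = (\<lambda>j. \<epsilon> * \<psi> z (tens v u) j)" by (rule sym_\<psi>[OF z uv])
  qed (fact gives_pairing_\<psi> par_vector_bundle_DI hom_\<psi> iso_hat_\<psi>)+
qed

theorem lemma5p1:
  fixes A :: "'x::t2_space atlas" and B :: "'z::t2_space atlas" and \<Phi> :: "'x \<Rightarrow> 'z"
    and L' :: "('z, 'j) par_bundle" and L :: "('x, 'l) par_bundle" and E :: "('x, 'i) par_bundle"
    and \<iota> :: "'x \<Rightarrow> ('l \<Rightarrow> complex) \<Rightarrow> 'j \<Rightarrow> complex"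
    and \<phi> :: "'x \<Rightarrow> ('i \<times> 'i \<Rightarrow> complex) \<Rightarrow> 'l \<Rightarrow> complex"
    and D :: "'x set"
  assumes X: "compact_riemann_surface A" and Z: "compact_riemann_surface B"
    and Phi: "hol_map A B \<Phi>" "\<not> (\<exists>c. \<forall>x. \<Phi> x = c)"
    and L': "par_line_bundle B L'" "par_degree_line B L' = 0"
    and L: "par_line_bundle A L" "ppts L = D" "par_iso A L (par_pullback A B \<Phi> L') \<iota>"
    and E: "par_vector_bundle A E" "ppts E = D"
  shows "(par_symplectic A L E \<phi> \<longrightarrow>
            (\<exists>\<psi>. gives_pairing L' (par_direct_image A B \<Phi> E) (induced_hom \<Phi> \<iota> E \<phi>) \<psi> \<and>
                 par_symplectic B L' (par_direct_image A B \<Phi> E) \<psi>)) \<and>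
         (par_orthogonal A L E \<phi> \<longrightarrow>
            (\<exists>\<psi>. gives_pairing L' (par_direct_image A B \<Phi> E) (induced_hom \<Phi> \<iota> E \<phi>) \<psi> \<and>
                 par_orthogonal B L' (par_direct_image A B \<Phi> E) \<psi>))"
proof (intro conjI impI)
  let ?F = "par_direct_image A B \<Phi> E"
  have LE: "ppts L = ppts E" using L(2) E(2) by simp
  note main = induced_pairing[OF X Z Phi L'(1) L(1) LE L(3) E(1)]
  show "\<exists>\<psi>. gives_pairing L' ?F (induced_hom \<Phi> \<iota> E \<phi>) \<psi> \<and> par_symplectic B L' ?F \<psi>"
    if s: "par_symplectic A L E \<phi>"
  proof -
    have hom: "par_hom A (par_tensor A E E) L \<phi>" and iso: "par_iso A E (par_tensor A (par_dual A E) L) (hat E \<phi>)"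
      using s unfolding par_symplectic_def by blast+
    have "\<forall>x. x \<notin> ppts E \<union> ppts L \<longrightarrow>
        (\<forall>u\<in>fibre E x. \<forall>v\<in>fibre E x. \<phi> x (tens u v) = (\<lambda>j. - \<phi> x (tens v u) j))"
      using s unfolding par_symplectic_def by (elim conjE)
    then have sym: "\<forall>x. x \<notin> ppts E \<longrightarrow>
        (\<forall>u\<in>fibre E x. \<forall>v\<in>fibre E x. \<phi> x (tens u v) = (\<lambda>l. (- 1) * \<phi> x (tens v u) l))"
      unfolding LE Un_absorb mult_minus1 .
    \<comment> \<open>Here \<open>sym\<close> instantiates the sign \<open>\<epsilon>\<close> with
      -1.\<close>
    from main[OF hom iso sym] show ?thesis
      using L' unfolding par_symplectic_def mult_minus1 by (elim exE conjE) (intro exI conjI; assumption)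
  qed
  show "\<exists>\<psi>. gives_pairing L' ?F (induced_hom \<Phi> \<iota> E \<phi>) \<psi> \<and> par_orthogonal B L' ?F \<psi>"
    if s: "par_orthogonal A L E \<phi>"
  proof -
    have hom: "par_hom A (par_tensor A E E) L \<phi>" and iso: "par_iso A E (par_tensor A (par_dual A E) L) (hat E \<phi>)"
      using s unfolding par_orthogonal_def by blast+
    have "\<forall>x. x \<notin> ppts E \<union> ppts L \<longrightarrow>
        (\<forall>u\<in>fibre E x. \<forall>v\<in>fibre E x. \<phi> x (tens u v) = \<phi> x (tens v u))"
      using s unfolding par_orthogonal_def by (elim conjE)
    then have sym: "\<forall>x. x \<notin> ppts E \<longrightarrow>
        (\<forall>u\<in>fibre E x. \<forall>v\<in>fibre E x. \<phi> x (tens u v) = (\<lambda>l. 1 * \<phi> x (tens v u) l))"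
      unfolding LE Un_absorb mult_1 .
    \<comment> \<open>Here \<open>sym\<close> instantiates the sign \<open>\<epsilon>\<close> with
      1.\<close>
    from main[OF hom iso sym] show ?thesis
      using L' unfolding par_orthogonal_def mult_1 by (elim exE conjE) (intro exI conjI; assumption)
  qed
qed

end
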